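(* Let $T>0$ and let $\rho,k,\gamma$ satisfy the standing assumptions given in the context. If a state $W^0\in\widehat{\mathbb H}^1$ is controllable to $0$ in the time $T$ with respect to the system $$W_t=\mathbb D_{\rho k}^2W-qW-2\sqrt{(\rho k)(0)}\,u\,\delta\ \text{ on }\mathbb R\times(0,T),\qquad W(\cdot,0)=W^0\ \text{ on }\mathbb R,$$ with controls $u\in L^\infty(0,T)$, then $W^0=0$.
   Context: Standing assumptions. $\rho,k\in C^1[0,+\infty)$ are positive on $[0,+\infty)$, $\rho k\in C^2[0,+\infty)$, $(\rho k)'(0)=0$, and $\gamma$ is a given function on $[0,+\infty)$. The even extensions of $\rho,k,\gamma$ to $\mathbb R$ are denoted by the same symbols. Put $\sigma(x)=\int_0^x\sqrt{\rho(|\xi|)/k(|\xi|)}\,d\xi$, $x\in\mathbb R$, and assume $\sigma(x)\to+\infty$ as $x\to+\infty$. Put $Q_1(\rho,k)=\sqrt{k/\rho}\,\frac{(k\rho)'}{4k\rho}$, $Q_2(\rho,k)=\sqrt{k/\rho}\,(Q_1(\rho,k))'+(Q_1(\rho,k))^2$, and $q=Q_2(\rho,k)-\gamma$ (an even function on $\mathbb R$). Assume $q\in L^\infty(0,+\infty)\cap C^1[0,+\infty)$ and $\sqrt{\rho/k}\;q\,\sigma\in L^1(0,+\infty)$. Spaces. $L^2_\rho(\mathbb R)=\{f\in L^2_{\rm loc}(\mathbb R): \sqrt\rho f\in L^2(\mathbb R)\}$ with norm $\|\sqrt\rho f\|_{L^2(\mathbb R)}$. For $\varphi\in L^2_{\rm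 loc}(\mathbb R)$ put $\mathbb D_{\rho k}\varphi=\sqrt{k/\rho}\,\varphi'+Q_1(\rho,k)\varphi$ (with $\varphi'$ the distributional derivative). $\mathbb H^0=L^2_\rho(\mathbb R)$; $\mathbb H^1=\{\varphi\in L^2_\rho(\mathbb R):\mathbb D_{\rho k}\varphi\in L^2_\rho(\mathbb R)\}$ with norm $\big(\|\varphi\|_{L^2_\rho}^2+\|\mathbb D_{\rho k}\varphi\|_{L^2_\rho}^2\big)^{1/2}$; $\mathbb H^{-1}=(\mathbb H^1)^*$ with the dual norm and pairing $\langle\langle f,\varphi\rangle\rangle$, which for $f\in\mathbb H^0$ equals $\int_{\mathbb R}f\varphi\rho\,dx$. For $f\in\mathbb H^0$, $\mathbb D_{\rho k}f\in\mathbb H^{-1}$ is defined by $\langle\langle\mathbb D_{\rho k}f,\varphi\rangle\rangle=-\langle\langle f,\mathbb D_{\rho k}\varphi\rangle\rangle$, $\varphi\in\mathbb H^1$; thus $\mathbb D_{\rho k}^2f\in\mathbb H^{-1}$ for $f\in\mathbb H^1$. $\widehat{\mathbb H}^s$ is the (closed) subspace of even elements of $\mathbb H^s$, $s=-1,0,1$. $\delta$ is the Dirac distribution with respect to $x$: $\langle\langle\delta,\varphi\rangle\rangle=\varphi(0)$. Solutions and controllability. A solution $W$ of the system is understood with $\left(\frac{d}{dt}\right)^lW:[0,T]\to\widehat{\mathbb H}^{1-2l}$, $l=0,1$ (the equation being one in $\widehat{\mathbb H}^{-1}$ on $(0,T)$), $W^0\in\widehat{\mathbb H}^1$. $\mathcal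 R_T^{\rho k\gamma}(W^0)$ is the set of all $W^T\in\widehat{\mathbb H}^1$ for which there exists a control $u\in L^\infty(0,T)$ such that the system has a unique solution $W$ with this $u$, and $W(\cdot,T)=W^T$. A state $W^0$ is controllable to $W^T$ in the time $T$ if $W^T\in\mathcal R_T^{\rho k\gamma}(W^0)$. *)

theory Defs
  imports "HOL-Analysis.Analysis"
begin

text \<open>
  All functions are real-valued. Elements of Lebesgue spaces are represented by Lebesgue measurable
  functions, so that equality of elements means equality almost everywhere.
\<close>

section \<open>Function classes\<close>

definition even_ext :: "(real \<Rightarrow> real) \<Rightarrow> real \<Rightarrow> real" where
  "even_ext f x = f \<bar>x\<bar>"

text \<open>\<open>C\<^sup>n\<close> on a set, with derivatives relative to the set; thus one-sided at \<open>0\<close> for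
  \<open>C\<^sup>n[0,\<infinity>)\<close>.\<close>

primrec Ck_on :: "nat \<Rightarrow> real set \<Rightarrow> (real \<Rightarrow> real) \<Rightarrow> bool" where
  "Ck_on 0 S f \<longleftrightarrow> continuous_on S f"
| "Ck_on (Suc n) S f \<longleftrightarrow>
     (\<exists>f'. (\<forall>x\<in>S. (f has_real_derivative f' x) (at x within S)) \<and> Ck_on n S f')"

definition L2_on :: "real set \<Rightarrow> (real \<Rightarrow> real) \<Rightarrow> bool" where
  "L2_on S f \<longleftrightarrow> set_borel_measurable lebesgue S f \<and> set_integrable lebesgue S (\<lambda>x. (f x)\<^sup>2)"

definition Linf_on :: "real set \<Rightarrow> (real \<Rightarrow> real) \<Rightarrow> bool" where
  "Linf_on S f \<longleftrightarrow> set_borel_measurable lebesgue S f \<and>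
     (\<exists>C. AE x in lebesgue. x \<in> S \<longrightarrow> \<bar>f x\<bar> \<le> C)"

definition L1_loc :: "real set \<Rightarrow> (real \<Rightarrow> real) \<Rightarrow> bool" where
  "L1_loc S f \<longleftrightarrow> (\<forall>K. compact K \<and> K \<subseteq> S \<longrightarrow> set_integrable lebesgue K f)"

definition L2_loc :: "(real \<Rightarrow> real) \<Rightarrow> bool" where
  "L2_loc f \<longleftrightarrow> (\<forall>K. compact K \<longrightarrow> L2_on K f)"

definition test_functions :: "real set \<Rightarrow> (real \<Rightarrow> real) set" where
  "test_functions S = {\<theta>. (\<forall>n x. (deriv ^^ n) \<theta> field_differentiable (at x)) \<and>
     compact (closure {x. \<theta> x \<noteq> 0}) \<and> closure {x. \<theta> x \<noteq> 0} \<subseteq> S}"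

text \<open>\<open>f' = g\<close> in the sense of distributions on the open set \<open>S\<close>.\<close>

definition has_weak_deriv :: "real set \<Rightarrow> (real \<Rightarrow> real) \<Rightarrow> (real \<Rightarrow> real) \<Rightarrow> bool" where
  "has_weak_deriv S f g \<longleftrightarrow> L1_loc S f \<and> L1_loc S g \<and>
     (\<forall>\<theta>\<in>test_functions S.
        (LINT x:S|lebesgue. f x * deriv \<theta> x) = - (LINT x:S|lebesgue. g x * \<theta> x))"

text \<open>Unique up to null sets, if it exists.\<close>

definition weak_deriv :: "(real \<Rightarrow> real) \<Rightarrow> real \<Rightarrow> real" where
  "weak_deriv f = (SOME g. has_weak_deriv UNIV f g)"

section \<open>Coefficients\<close>

text \<open>From here on, \<open>\<rho>\<close>, \<open>k\<close>, \<open>\<gamma>\<close> are functions on the whole line (the even extensions).\<close>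

definition sigma :: "(real \<Rightarrow> real) \<Rightarrow> (real \<Rightarrow> real) \<Rightarrow> real \<Rightarrow> real" where
  "sigma \<rho> k x = (LBINT \<xi>=ereal 0..ereal x. sqrt (\<rho> \<xi> / k \<xi>))"

text \<open>If \<open>\<rho> k\<close> is \<open>C\<^sup>2\<close> on \<open>[0,\<infinity>)\<close> with \<open>(\<rho> k)'(0) = 0\<close>, its even extension is \<open>C\<^sup>2\<close> on the line and
  \<open>Q1\<close> is odd and differentiable everywhere, including at \<open>0\<close>, so that both uses of \<open>deriv\<close>
  are two-sided derivatives that exist.\<close>

definition Q1 :: "(real \<Rightarrow> real) \<Rightarrow> (real \<Rightarrow> real) \<Rightarrow> real \<Rightarrow> real" where
  "Q1 \<rho> k x = sqrt (k x / \<rho> x) * (deriv (\<lambda>y. k y * \<rho> y) x / (4 * k x * \<rho> x))"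

definition Q2 :: "(real \<Rightarrow> real) \<Rightarrow> (real \<Rightarrow> real) \<Rightarrow> real \<Rightarrow> real" where
  "Q2 \<rho> k x = sqrt (k x / \<rho> x) * deriv (Q1 \<rho> k) x + (Q1 \<rho> k x)\<^sup>2"

definition qpot :: "(real \<Rightarrow> real) \<Rightarrow> (real \<Rightarrow> real) \<Rightarrow> (real \<Rightarrow> real) \<Rightarrow> real \<Rightarrow> real" where
  "qpot \<rho> k \<gamma> x = Q2 \<rho> k x - \<gamma> x"

section \<open>Spaces\<close>

definition H0 :: "(real \<Rightarrow> real) \<Rightarrow> (real \<Rightarrow> real) set" where
  "H0 \<rho> = {f. L2_loc f \<and> L2_on UNIV (\<lambda>x. sqrt (\<rho> x) * f x)}"

definition norm_H0 :: "(real \<Rightarrow> real) \<Rightarrow> (real \<Rightarrow> real) \<Rightarrow> real" where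
  "norm_H0 \<rho> f = sqrt (LINT x|lebesgue. (sqrt (\<rho> x) * f x)\<^sup>2)"

definition DD :: "(real \<Rightarrow> real) \<Rightarrow> (real \<Rightarrow> real) \<Rightarrow> (real \<Rightarrow> real) \<Rightarrow> real \<Rightarrow> real" where
  "DD \<rho> k \<phi> x = sqrt (k x / \<rho> x) * weak_deriv \<phi> x + Q1 \<rho> k x * \<phi> x"

text \<open>\<open>\<rho>\<close>, \<open>k\<close> are positive and continuous, hence \<open>DD \<rho> k \<phi> \<in> H0 \<rho>\<close> forces the distribution \<open>\<phi>'\<close>
  to be a locally integrable function; it is therefore no restriction to require this of \<open>\<phi>'\<close>.\<close>

definition H1 :: "(real \<Rightarrow> real) \<Rightarrow> (real \<Rightarrow> real) \<Rightarrow> (real \<Rightarrow> real) set" where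
  "H1 \<rho> k = {\<phi> \<in> H0 \<rho>. (\<exists>g. has_weak_deriv UNIV \<phi> g) \<and> DD \<rho> k \<phi> \<in> H0 \<rho>}"

definition norm_H1 :: "(real \<Rightarrow> real) \<Rightarrow> (real \<Rightarrow> real) \<Rightarrow> (real \<Rightarrow> real) \<Rightarrow> real" where
  "norm_H1 \<rho> k \<phi> = sqrt ((norm_H0 \<rho> \<phi>)\<^sup>2 + (norm_H0 \<rho> (DD \<rho> k \<phi>))\<^sup>2)"

text \<open>Elements of the dual are functionals of which only the values on \<open>H1 \<rho> k\<close> matter. Boundedness
  with respect to the seminorm \<open>norm_H1\<close> makes them respect equality almost everywhere. The
  pairing is function application.\<close>

type_synonym functional = "(real \<Rightarrow> real) \<Rightarrow> real"

definition Hm1 :: "(real \<Rightarrow> real) \<Rightarrow> (real \<Rightarrow> real) \<Rightarrow> functional set" where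
  "Hm1 \<rho> k = {F.
     (\<forall>\<phi>\<in>H1 \<rho> k. \<forall>\<psi>\<in>H1 \<rho> k. \<forall>a b. F (\<lambda>x. a * \<phi> x + b * \<psi> x) = a * F \<phi> + b * F \<psi>) \<and>
     (\<exists>C. \<forall>\<phi>\<in>H1 \<rho> k. \<bar>F \<phi>\<bar> \<le> C * norm_H1 \<rho> k \<phi>)}"

definition norm_Hm1 :: "(real \<Rightarrow> real) \<Rightarrow> (real \<Rightarrow> real) \<Rightarrow> functional \<Rightarrow> real" where
  "norm_Hm1 \<rho> k F = (SUP \<phi>\<in>{\<phi> \<in> H1 \<rho> k. norm_H1 \<rho> k \<phi> \<le> 1}. \<bar>F \<phi>\<bar>)"

definition even_H1 :: "(real \<Rightarrow> real) \<Rightarrow> (real \<Rightarrow> real) \<Rightarrow> (real \<Rightarrow> real) set" where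
  "even_H1 \<rho> k = {f \<in> H1 \<rho> k. AE x in lebesgue. f (- x) = f x}"

definition even_Hm1 :: "(real \<Rightarrow> real) \<Rightarrow> (real \<Rightarrow> real) \<Rightarrow> functional set" where
  "even_Hm1 \<rho> k = {F \<in> Hm1 \<rho> k. \<forall>\<phi>\<in>H1 \<rho> k. F (\<lambda>x. \<phi> (- x)) = F \<phi>}"

text \<open>The embedding of \<open>H0\<close> into the dual of \<open>H1\<close>.\<close>

definition emb :: "(real \<Rightarrow> real) \<Rightarrow> (real \<Rightarrow> real) \<Rightarrow> functional" where
  "emb \<rho> f \<phi> = (LINT x|lebesgue. f x * \<phi> x * \<rho> x)"

text \<open>The operator \<open>DD\<close> extended to a map from \<open>H0\<close> into the dual of \<open>H1\<close>.\<close>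

definition DD_dual :: "(real \<Rightarrow> real) \<Rightarrow> (real \<Rightarrow> real) \<Rightarrow> (real \<Rightarrow> real) \<Rightarrow> functional" where
  "DD_dual \<rho> k f \<phi> = - emb \<rho> f (DD \<rho> k \<phi>)"

text \<open>Elements of \<open>H1\<close> are classes of functions; their value at \<open>0\<close> is that of the
  continuous representative.\<close>

definition delta :: functional where
  "delta \<phi> = (THE g. continuous_on UNIV g \<and> (AE x in lebesgue. g x = \<phi> x)) 0"

section \<open>Solutions and controllability\<close>

text \<open>\<open>dF/dt = Z\<close> for maps from \<open>[0,T]\<close> into the dual of \<open>H1\<close>: as controls are only defined almost
  everywhere, the derivative is that of vector-valued distributions on \<open>(0,T)\<close>. Continuity of
  \<open>F\<close> in the dual norm gives a meaning to the values at the end points.\<close>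

definition has_time_deriv ::
  "(real \<Rightarrow> real) \<Rightarrow> (real \<Rightarrow> real) \<Rightarrow> real \<Rightarrow> (real \<Rightarrow> functional) \<Rightarrow> (real \<Rightarrow> functional) \<Rightarrow> bool" where
  "has_time_deriv \<rho> k T F Z \<longleftrightarrow>
     (\<forall>s\<in>{0..T}. ((\<lambda>t. norm_Hm1 \<rho> k (\<lambda>\<phi>. F t \<phi> - F s \<phi>)) \<longlongrightarrow> 0) (at s within {0..T})) \<and>
     (\<forall>\<phi>\<in>H1 \<rho> k. has_weak_deriv {0<..<T} (\<lambda>t. F t \<phi>) (\<lambda>t. Z t \<phi>))"

text \<open>\<open>W t\<close> is the state \<open>W(\<cdot>,t)\<close>.\<close>

definition is_solution ::
  "(real \<Rightarrow> real) \<Rightarrow> (real \<Rightarrow> real) \<Rightarrow> (real \<Rightarrow> real) \<Rightarrow> real \<Rightarrow> (real \<Rightarrow> real) \<Rightarrow> (real \<Rightarrow> real) \<Rightarrow>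
   (real \<Rightarrow> real \<Rightarrow> real) \<Rightarrow> bool" where
  "is_solution \<rho> k \<gamma> T W0 u W \<longleftrightarrow>
     (\<forall>t\<in>{0..T}. W t \<in> even_H1 \<rho> k) \<and>
     (\<exists>Wt. (\<forall>t\<in>{0..T}. Wt t \<in> even_Hm1 \<rho> k) \<and>
        has_time_deriv \<rho> k T (\<lambda>t. emb \<rho> (W t)) Wt \<and>
        (AE t in lebesgue. t \<in> {0<..<T} \<longrightarrow>
          (\<forall>\<phi>\<in>H1 \<rho> k. Wt t \<phi> =
             DD_dual \<rho> k (DD \<rho> k (W t)) \<phi> - emb \<rho> (\<lambda>x. qpot \<rho> k \<gamma> x * W t x) \<phi>
             - 2 * sqrt (\<rho> 0 * k 0) * u t * delta \<phi>))) \<and>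
     (AE x in lebesgue. W 0 x = W0 x)"

definition reachable ::
  "(real \<Rightarrow> real) \<Rightarrow> (real \<Rightarrow> real) \<Rightarrow> (real \<Rightarrow> real) \<Rightarrow> real \<Rightarrow> (real \<Rightarrow> real) \<Rightarrow> (real \<Rightarrow> real) set" where
  "reachable \<rho> k \<gamma> T W0 = {WT \<in> even_H1 \<rho> k. \<exists>u. Linf_on {0<..<T} u \<and>
     (\<exists>W. is_solution \<rho> k \<gamma> T W0 u W \<and>
        (\<forall>V. is_solution \<rho> k \<gamma> T W0 u V \<longrightarrow> (\<forall>t\<in>{0..T}. AE x in lebesgue. V t x = W t x)) \<and>
        (AE x in lebesgue. W T x = WT x))}"

definition controllable ::
  "(real \<Rightarrow> real) \<Rightarrow> (real \<Rightarrow> real) \<Rightarrow> (real \<Rightarrow> real) \<Rightarrow> real \<Rightarrow> (real \<Rightarrow> real) \<Rightarrow> (real \<Rightarrow> real) \<Rightarrow> bool" where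
  "controllable \<rho> k \<gamma> T W0 WT \<longleftrightarrow> WT \<in> reachable \<rho> k \<gamma> T W0"

end

theory Submission
  imports Defs
begin

text \<open>
  With \<open>\<sigma>\<close> as new variable and \<open>m = (\<rho> k)\<^bsup>1/4\<^esup>\<close>, the functions \<open>m W\<close> solve a heat equation with potential \<open>q\<close> on
  the line, driven by \<open>u \<delta>\<close>. For \<open>\<kappa> \<ge> 1\<close> let \<open>v\<^sub>\<kappa>\<close> be the even solution of \<open>v'' = (q - \<kappa>\<^sup>2) v\<close>, \<open>v(0) = 1\<close>. As
  \<open>(1 + \<sigma>) q\<close> is integrable, averages of \<open>v\<^sub>\<kappa>\<close> over \<open>\<kappa>\<^sup>2 \<in> [l, l + 1]\<close> decay like \<open>1 / (1 + \<sigma>)\<close>, with bounds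
  polynomial in \<open>l\<close>. Testing the equation with them, a null control satisfies
  \<open>\<integral>\<^sub>0\<^sup>T exp (l t) B(t) u(t) dt = O(l\<^sup>2)\<close> for a fixed positive function \<open>B\<close>, and Mikusinski's moment argument gives
  \<open>u = 0\<close>. For \<open>u = 0\<close> let \<open>R\<close> be a resolvent of the (symmetric) generator: the function \<open>\<langle>R W(a), R W(b)\<rangle>\<close> depends
  on \<open>a + b\<close> only, so \<open>W(\<tau>) = 0\<close> implies \<open>W(\<tau>/2) = 0\<close>, and by iteration and continuity \<open>W(0) = 0\<close>.
\<close>

section \<open>Smooth functions\<close>

text \<open>A single solution \<open>v\<close> oscillates and in general does not decay, so it is no
  admissible test function in \<open>H1\<close>. Averaging over \<kappa> creates decay because
  \<sigma> then plays the role of a frequency; each difference in \<kappa> of the phase costs a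
  factor \<sigma>, and this is why q is weighted by 1 + \<sigma>. The averaging window has length
  one in the square of \<kappa>: shifting it by l multiplies the average of exp (\<kappa>^2 t) by
  exp (l t) exactly and leaves a factor B that does not depend on l. Moving backwards from the zero
  state at time T, the tested equation carries exponentially large weights on the control, whereas
  the initial state contributes only a polynomial bound in l. This imbalance makes the moments of u
  subexponential. States are continuous in time only in the dual norm, and their \<open>H1\<close>
  norms need not be bounded in time. Two resolvents are therefore inserted in the uniqueness
  argument: they supply test functions with uniformly bounded \<open>H1\<close> norms, so that
  scalar products of states at two different times depend continuously on both times and can be
  differentiated.\<close>

inductive_set smooth_class :: "(real \<Rightarrow> real) set" where
  const: "(\<lambda>x. c) \<in> smooth_class"
| ident: "(\<lambda>x. x) \<in> smooth_class"
| flat: "(\<lambda>x. if x > 0 then exp (- (1 / x)) / x ^ n else 0) \<in> smooth_class"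
| add: "f \<in> smooth_class \<Longrightarrow> g \<in> smooth_class \<Longrightarrow> (\<lambda>x. f x + g x) \<in> smooth_class"
| mult: "f \<in> smooth_class \<Longrightarrow> g \<in> smooth_class \<Longrightarrow> (\<lambda>x. f x * g x) \<in> smooth_class"
| affine: "f \<in> smooth_class \<Longrightarrow> (\<lambda>x. f (a * x + b)) \<in> smooth_class"
| primitive: "f \<in> smooth_class \<Longrightarrow> (\<And>x. (F has_real_derivative f x) (at x)) \<Longrightarrow> F \<in> smooth_class"

text \<open>The powers of 1/x are carried along so that the family is closed under differentiation.
  At 0 the difference quotient is exp (-1/x) / x^(n+1), which tends to 0 from the right after the
  substitution y = 1/x.\<close>

lemma flat_deriv:
  fixes x :: real
  defines "e \<equiv> \<lambda>n x. if x > 0 then exp (- (1 / x)) / x ^ n else (0::real)"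
  shows "(e n has_real_derivative e (n + 2) x + (- real n) * e (n + 1) x) (at x)"
proof -
  consider "x > 0" | "x < 0" | "x = 0" by linarith
  then show ?thesis
  proof cases
    case 1
    have "((\<lambda>x. exp (- (1 / x)) / x ^ n) has_real_derivative
        (exp (- (1 / x)) * (1 / x\<^sup>2) * x ^ n - exp (- (1 / x)) * (real n * x ^ (n - 1))) / (x ^ n)\<^sup>2) (at x)"
      using 1 by (auto intro!: derivative_eq_intros simp: power2_eq_square field_simps)
    moreover have "(exp (- (1 / x)) * (1 / x\<^sup>2) * x ^ n - exp (- (1 / x)) * (real n * x ^ (n - 1))) / (x ^ n)\<^sup>2
        = e (n + 2) x + (- real n) * e (n + 1) x"
      using 1 unfolding e_def by (cases n) (auto simp: field_simps power2_eq_square power_add)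
    ultimately have "((\<lambda>x. exp (- (1 / x)) / x ^ n) has_real_derivative
        e (n + 2) x + (- real n) * e (n + 1) x) (at x)" by simp
    then show ?thesis
      by (rule has_field_derivative_transform_within_open[of _ _ _ "{0<..}"]) (use 1 in \<open>auto simp: e_def\<close>)
  next
    case 2
    have "((\<lambda>x. 0) has_real_derivative e (n + 2) x + (- real n) * e (n + 1) x) (at x)"
      using 2 by (auto simp: e_def)
    then show ?thesis
      by (rule has_field_derivative_transform_within_open[of _ _ _ "{..<0}"]) (use 2 in \<open>auto simp: e_def\<close>)
  next
    case 3
    have "((\<lambda>x::real. inverse x ^ Suc n / exp (inverse x)) \<longlongrightarrow> 0) (at_right 0)"
      using filterlim_compose[OF tendsto_power_div_exp_0[of "Suc n"] filterlim_inverse_at_top_right] .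
    then have "((\<lambda>x. e n x / x) \<longlongrightarrow> 0) (at_right 0)"
      by (rule Lim_transform_eventually)
        (auto simp: eventually_at_filter e_def field_simps exp_minus)
    moreover have "((\<lambda>x. e n x / x) \<longlongrightarrow> 0) (at_left 0)"
      by (rule Lim_transform_eventually[of "\<lambda>x. 0"]) (auto simp: eventually_at_filter e_def)
    ultimately have "((\<lambda>x. e n x / x) \<longlongrightarrow> 0) (at 0)"
      by (simp add: filterlim_split_at)
    then have "(e n has_real_derivative 0) (at 0)"
      by (simp add: has_field_derivative_iff e_def)
    then show ?thesis using 3 by (simp add: e_def)
  qed
qed

text \<open>Test functions must have every iterate of \<open>deriv\<close> differentiable. Each
  generating rule of the class produces a derivative that is again in the class, so one rule
  induction yields derivatives of all orders; for \<open>primitive\<close> the derivative is a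
  member by assumption.\<close>

lemma smooth_class_deriv:
  assumes "f \<in> smooth_class"
  shows "\<exists>f'\<in>smooth_class. \<forall>x. (f has_real_derivative f' x) (at x)"
  using assms
proof induction
  case (const c)
  show ?case by (rule bexI[of _ "\<lambda>x. 0"]) (auto intro: smooth_class.const)
next
  case ident
  show ?case by (rule bexI[of _ "\<lambda>x. 1"]) (auto intro: smooth_class.const)
next
  case (flat n)
  show ?case
    by (rule bexI, rule allI, rule flat_deriv)
      (intro smooth_class.add smooth_class.mult smooth_class.flat smooth_class.const)
next
  case (add f g)
  then obtain f' g' where "f' \<in> smooth_class" "g' \<in> smooth_class"
    "\<And>x. (f has_real_derivative f' x) (at x)" "\<And>x. (g has_real_derivative g' x) (at x)" by auto
  then show ?case
    by (intro bexI[of _ "\<lambda>x. f' x + g' x"]) (auto intro: smooth_class.add DERIV_add)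
next
  case (mult f g)
  then obtain f' g' where "f' \<in> smooth_class" "g' \<in> smooth_class"
    "\<And>x. (f has_real_derivative f' x) (at x)" "\<And>x. (g has_real_derivative g' x) (at x)" by auto
  then show ?case using mult.hyps
    by (intro bexI[of _ "\<lambda>x. f' x * g x + g' x * f x"])
      (auto intro!: smooth_class.add smooth_class.mult DERIV_mult)
next
  case (affine f a b)
  then obtain f' where f': "f' \<in> smooth_class" "\<And>x. (f has_real_derivative f' x) (at x)" by auto
  have "((\<lambda>x. f (a * x + b)) has_real_derivative a * f' (a * x + b)) (at x)" for x
    by (rule DERIV_chain2[OF f'(2), THEN DERIV_cong]) (auto intro!: derivative_eq_intros)
  then show ?case using f'
    by (intro bexI[of _ "\<lambda>x. a * f' (a * x + b)"])
      (auto intro: smooth_class.mult smooth_class.const smooth_class.affine)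
next
  case (primitive f F)
  then show ?case by auto
qed

lemma smooth_class_deriv_funpow: "f \<in> smooth_class \<Longrightarrow> (deriv ^^ n) f \<in> smooth_class"
proof (induction n)
  case (Suc n)
  then obtain f' where f': "f' \<in> smooth_class" "\<And>x. ((deriv ^^ n) f has_real_derivative f' x) (at x)"
    using smooth_class_deriv by blast
  then have "deriv ((deriv ^^ n) f) = f'" by (auto intro!: ext DERIV_imp_deriv)
  then show ?case using f' by simp
qed auto

lemma smooth_class_test_function:
  assumes "f \<in> smooth_class" "\<And>x. x \<notin> {a..b} \<Longrightarrow> f x = 0" "{a..b} \<subseteq> S"
  shows "f \<in> test_functions S"
proof -
  have "{x. f x \<noteq> 0} \<subseteq> {a..b}" using assms(2) by blast
  then have "closure {x. f x \<noteq> 0} \<subseteq> {a..b}" by (rule closure_minimal) simp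
  then have "compact (closure {x. f x \<noteq> 0})"
    by (metis closed_closure compact_Icc compact_Int_closed inf.absorb2)
  moreover note \<open>closure {x. f x \<noteq> 0} \<subseteq> {a..b}\<close>
  moreover have "(deriv ^^ n) f field_differentiable (at x)" for n x
    using smooth_class_deriv[OF smooth_class_deriv_funpow[OF assms(1)], of n]
    by (auto simp: field_differentiable_def)
  ultimately show ?thesis
    using assms(3) unfolding test_functions_def by blast
qed

lemma smooth_class_continuous: "f \<in> smooth_class \<Longrightarrow> continuous_on A f"
  using smooth_class_deriv[of f] by (auto intro!: continuous_at_imp_continuous_on intro: DERIV_isCont)

text \<open>The integral is oriented, so x may lie on either side of \<open>a\<close>; the proof
  works on an interval with x in its interior in order to obtain a two-sided derivative.\<close>

lemma has_real_derivative_primitive: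
  fixes f :: "real \<Rightarrow> real"
  assumes "continuous_on UNIV f"
  shows "((\<lambda>x. LBINT t=ereal a..ereal x. f t) has_real_derivative f x) (at x)"
proof -
  define l u where "l = min a x - 1" and "u = max a x + 1"
  have "((\<lambda>u. LBINT y=a..u. f y) has_vector_derivative (f x)) (at x within {l..u})"
    using interval_integral_FTC2[of l a u f x] continuous_on_subset[OF assms subset_UNIV]
    unfolding l_def u_def by (auto simp: min_def max_def)
  moreover have "at x within {l..u} = at x"
    by (rule at_within_interior) (auto simp: l_def u_def)
  ultimately show ?thesis by (simp add: has_real_derivative_iff_has_vector_derivative)
qed

text \<open>Normalised primitive of exp (-1/x) exp (-1/(1-x)), extended by 0 outside (0,1). It is
  constant on either side of that interval and increases across it, so the normalising factor is
  positive.\<close>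

lemma smooth_step:
  obtains S where "S \<in> smooth_class" "\<And>x. x \<le> 0 \<Longrightarrow> S x = (0::real)" "\<And>x. x \<ge> 1 \<Longrightarrow> S x = 1"
proof -
  define h where "h = (\<lambda>x::real. if x > 0 then exp (- (1 / x)) / x ^ 0 else 0)"
  define w where "w x = h x * h ((-1) * x + 1)" for x
  have wC: "w \<in> smooth_class"
    unfolding w_def h_def by (intro smooth_class.mult smooth_class.flat smooth_class.affine[OF smooth_class.flat])
  define F where "F x = (LBINT t=ereal 0..ereal x. w t)" for x
  have F: "(F has_real_derivative w x) (at x)" for x
    unfolding F_def by (rule has_real_derivative_primitive[OF smooth_class_continuous[OF wC]])
  have F0: "F 0 = 0" by (simp add: F_def)
  have Fneg: "F x = 0" if "x \<le> 0" for x
  proof -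
    have "F 0 = F x" if "x < 0"
    proof (rule DERIV_isconst2[of x 0 F 0])
      show "continuous_on {x..0} F"
        by (auto intro!: continuous_at_imp_continuous_on DERIV_isCont[OF F])
    next
      fix y assume "x < y" "y < 0"
      then show "(F has_real_derivative 0) (at y)" using F[of y] by (simp add: w_def h_def)
    qed (use that in auto)
    then show ?thesis using F0 that by (cases "x = 0") auto
  qed
  have F1: "F x = F 1" if "x \<ge> 1" for x
  proof (cases "x = 1")
    case False
    show ?thesis
    proof (rule DERIV_isconst2[of 1 x F x])
      show "continuous_on {1..x} F"
        by (auto intro!: continuous_at_imp_continuous_on DERIV_isCont[OF F])
    next
      fix y assume "1 < y" "y < x"
      then show "(F has_real_derivative 0) (at y)" using F[of y] by (simp add: w_def h_def)
    qed (use that False in auto)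
  qed simp
  have "F 0 < F 1"
  proof (rule DERIV_pos_imp_increasing_open[of 0 1 F])
    show "continuous_on {0..1} F"
      by (auto intro!: continuous_at_imp_continuous_on DERIV_isCont[OF F])
    show "\<exists>y. (F has_real_derivative y) (at x) \<and> 0 < y" if "0 < x" "x < 1" for x
      using F[of x] that by (intro exI[of _ "w x"]) (auto simp: w_def h_def)
  qed auto
  then have pos: "F 1 > 0" using F0 by simp
  have "F \<in> smooth_class" by (rule smooth_class.primitive[OF wC F])
  then have "(\<lambda>x. inverse (F 1) * F x) \<in> smooth_class"
    by (intro smooth_class.mult smooth_class.const)
  moreover have "inverse (F 1) * F x = 1" if "x \<ge> 1" for x
    using pos by (simp only: F1[OF that]) simp
  ultimately show ?thesis by (intro that[of "\<lambda>x. inverse (F 1) * F x"]) (auto simp: Fneg)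
qed

lemma smooth_cutoff:
  fixes a b e :: real
  assumes "e > 0"
  obtains X where "X \<in> smooth_class" "\<And>x. x \<in> {a..b} \<Longrightarrow> X x = 1" "\<And>x. x \<notin> {a-e..b+e} \<Longrightarrow> X x = 0"
proof -
  obtain S where S: "S \<in> smooth_class" "\<And>x. x \<le> 0 \<Longrightarrow> S x = (0::real)" "\<And>x. x \<ge> 1 \<Longrightarrow> S x = 1"
    using smooth_step by blast
  \<comment> \<open>A step rising from \<open>a - e\<close> to \<open>a\<close>, multiplied by one
    falling from \<open>b\<close> to \<open>b + e\<close>.\<close>
  define X where "X x = S ((1/e) * x + (e - a) / e) * S ((-1/e) * x + (e + b) / e)" for x
  have "X \<in> smooth_class"
    unfolding X_def by (intro smooth_class.mult smooth_class.affine S)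
  moreover have "X x = 1" if "x \<in> {a..b}" for x
  proof -
    have "(1/e) * x + (e - a) / e = (x - a) / e + 1" "(-1/e) * x + (e + b) / e = (b - x) / e + 1"
      using assms by (auto simp: field_simps)
    then have "(1/e) * x + (e - a) / e \<ge> 1" "(-1/e) * x + (e + b) / e \<ge> 1"
      using assms that by auto
    then show ?thesis unfolding X_def by (simp add: S(3))
  qed
  moreover have "X x = 0" if "x \<notin> {a-e..b+e}" for x
  proof -
    have "(1/e) * x + (e - a) / e = (x - (a - e)) / e" "(-1/e) * x + (e + b) / e = (b + e - x) / e"
      using assms by (auto simp: field_simps)
    moreover have "x - (a - e) \<le> 0 \<or> b + e - x \<le> 0" using that by auto
    ultimately have "(1/e) * x + (e - a) / e \<le> 0 \<or> (-1/e) * x + (e + b) / e \<le> 0"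
      using assms by (auto simp: divide_le_0_iff)
    then show ?thesis unfolding X_def using S(2) by auto
  qed
  ultimately show ?thesis by (rule that)
qed

text \<open>Makes Weierstrass approximants available as building blocks of test functions.\<close>

lemma real_polynomial_smooth_class:
  "real_polynomial_function p \<Longrightarrow> p \<in> smooth_class"
proof (induction rule: real_polynomial_function.induct)
  case (linear f)
  interpret bounded_linear f by fact
  define c where "c = f 1"
  have "f x = c * x" for x using scaleR[of x 1] by (simp add: c_def mult.commute)
  then have f: "f = (\<lambda>x. c * x)" by auto
  show ?case unfolding f by (intro smooth_class.mult smooth_class.const smooth_class.ident)
qed (auto intro: smooth_class.const smooth_class.add smooth_class.mult)

section \<open>Weak derivatives: C1 test functions, calculus rules, fundamental theorem,
  uniqueness\<close>

lemma DERIV_imp_continuous_on: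
  "(\<And>x. (f has_real_derivative f' x) (at x)) \<Longrightarrow> continuous_on A f"
  by (auto intro!: continuous_at_imp_continuous_on intro: DERIV_isCont)

lemma set_integrable_mult_continuous:
  fixes f h :: "real \<Rightarrow> real"
  assumes "set_integrable lebesgue {a..b} f" "continuous_on {a..b} h"
  shows "set_integrable lebesgue {a..b} (\<lambda>x. f x * h x)"
  using absolutely_integrable_bounded_measurable_product_real[of h "{a..b}" f] assms
    continuous_imp_measurable_on_sets_lebesgue[of "{a..b}" h]
    compact_imp_bounded[OF compact_continuous_image[OF assms(2)]]
  by (simp add: mult.commute)

lemma integrable_mult_continuous_support:
  fixes f h :: "real \<Rightarrow> real"
  assumes "set_integrable lebesgue {a..b} f" "continuous_on {a..b} h" "\<And>x. x \<notin> {a..b} \<Longrightarrow> h x = 0"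
  shows "integrable lebesgue (\<lambda>x. f x * h x)"
  using set_integrable_mult_continuous[OF assms(1,2)] unfolding set_integrable_def
  by (rule Bochner_Integration.integrable_cong[THEN iffD1, OF refl, rotated])
    (use assms(3) in \<open>auto simp: indicator_def\<close>)

lemma set_integral_support:
  fixes h :: "real \<Rightarrow> real"
  assumes "\<And>x. x \<notin> S \<Longrightarrow> h x = 0"
  shows "(LINT x:S|lebesgue. h x) = (LINT x|lebesgue. h x)"
  unfolding set_lebesgue_integral_def
  by (rule Bochner_Integration.integral_cong) (use assms in \<open>auto simp: indicator_def\<close>)

lemma open_interval_enlarge:
  fixes a b :: real
  assumes "open S" "{a..b} \<subseteq> S" "a \<le> b"
  obtains e where "e > 0" "{a-e..b+e} \<subseteq> S"
proof -
  obtain e1 where e1: "e1 > 0" "cball a e1 \<subseteq> S"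
    using assms by (meson atLeastAtMost_iff open_contains_cball order_refl subsetD)
  obtain e2 where e2: "e2 > 0" "cball b e2 \<subseteq> S"
    using assms by (meson atLeastAtMost_iff open_contains_cball order_refl subsetD)
  show ?thesis
  proof (rule that[of "min e1 e2"])
    show "{a - min e1 e2..b + min e1 e2} \<subseteq> S"
    proof
      fix x assume x: "x \<in> {a - min e1 e2..b + min e1 e2}"
      then consider "x \<in> cball a e1" | "x \<in> {a..b}" | "x \<in> cball b e2"
        by (force simp: dist_real_def)
      then show "x \<in> S" using e1 e2 assms by cases auto
    qed
  qed (use e1 e2 in auto)
qed

lemma L1_loc_Icc: "L1_loc S f \<Longrightarrow> {a..b} \<subseteq> S \<Longrightarrow> set_integrable lebesgue {a..b} f"
  unfolding L1_loc_def by (meson compact_Icc)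

text \<open>By Weierstrass, a \<open>C\<^sup>1\<close> function of compact support is a limit of smooth ones (polynomials times
  one fixed cutoff), so weak derivatives may be tested against it.\<close>

lemma has_weak_deriv_C1_test:
  fixes \<theta> \<theta>' :: "real \<Rightarrow> real"
  assumes wd: "has_weak_deriv S f g" and S: "open S" "{a..b} \<subseteq> S"
    and d: "\<And>x. (\<theta> has_real_derivative \<theta>' x) (at x)" and c: "continuous_on UNIV \<theta>'"
    and z: "\<And>x. x \<notin> {a..b} \<Longrightarrow> \<theta> x = 0"
  shows "(LINT x|lebesgue. f x * \<theta>' x) = - (LINT x|lebesgue. g x * \<theta> x)"
proof (cases "a \<le> b")
  case False
  then have "\<theta> = (\<lambda>x. 0)" using z by auto
  then have "\<theta>' = (\<lambda>x. 0)" using d by (auto intro!: ext DERIV_unique[OF _ DERIV_const])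
  then show ?thesis using \<open>\<theta> = _\<close> by simp
next
  case ab: True
  obtain e where e: "e > 0" "{a-e..b+e} \<subseteq> S" using open_interval_enlarge[OF S ab] .
  define K where "K = {a-e..b+e}"
  have KS: "K \<subseteq> S" and Kc: "compact K" using e by (auto simp: K_def)
  \<comment> \<open>\<open>X\<close> is 1 on the support of \<theta>, so multiplying \<theta> by it
    changes nothing: approximants can be cut off afterwards without disturbing the limit.\<close>
  obtain X where X: "X \<in> smooth_class" "\<And>x. x \<in> {a..b} \<Longrightarrow> X x = 1" "\<And>x. x \<notin> K \<Longrightarrow> X x = 0"
    unfolding K_def using smooth_cutoff[OF e(1), of a b] by blast
  obtain X' where X': "X' \<in> smooth_class" "\<And>x. (X has_real_derivative X' x) (at x)"
    using smooth_class_deriv[OF X(1)] by blast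
  have X'z: "X' x = 0" if "x \<notin> K" for x
  proof (rule DERIV_unique[OF X'(2)])
    show "(X has_real_derivative 0) (at x)"
      by (rule has_field_derivative_transform_within_open[of "\<lambda>x. 0" _ _ "- K"])
        (use that X(3) in \<open>auto simp: K_def open_Compl\<close>)
  qed
  have \<theta>'z: "\<theta>' x = 0" if "x \<notin> {a..b}" for x
  proof (rule DERIV_unique[OF d])
    show "(\<theta> has_real_derivative 0) (at x)"
      by (rule has_field_derivative_transform_within_open[of "\<lambda>x. 0" _ _ "- {a..b}"])
        (use that z in \<open>auto simp: open_Compl\<close>)
  qed
  have X\<theta>: "X x * \<theta> x = \<theta> x" for x using X(2) z by (cases "x \<in> {a..b}") auto
  have X\<theta>': "X' x * \<theta> x + X x * \<theta>' x = \<theta>' x" for x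
  proof (rule DERIV_unique[OF _ d])
    have "((\<lambda>x. X x * \<theta> x) has_real_derivative X' x * \<theta> x + X x * \<theta>' x) (at x)"
      by (rule DERIV_mult[OF X'(2) d, THEN DERIV_cong]) (simp add: mult.commute)
    then show "(\<theta> has_real_derivative X' x * \<theta> x + X x * \<theta>' x) (at x)" by (simp add: X\<theta>)
  qed
  have "bounded (X ` K)" "bounded (X' ` K)"
    by (auto intro!: compact_imp_bounded compact_continuous_image Kc smooth_class_continuous X X')
  then obtain M1 M2 where M: "\<And>x. x \<in> K \<Longrightarrow> \<bar>X x\<bar> \<le> M1" "\<And>x. x \<in> K \<Longrightarrow> \<bar>X' x\<bar> \<le> M2"
    unfolding bounded_iff by (metis imageI real_norm_def)
  have aK: "a \<in> K" using ab e by (auto simp: K_def)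
  have M0: "0 \<le> M1" "0 \<le> M2" using M[OF aK] by auto
  \<comment> \<open>Weierstrass is applied to the derivative of \<theta>. Primitives that start at
    \<open>a - e\<close>, where \<theta> vanishes, then approximate \<theta> as well; approximating
    \<theta> itself would not control the derivatives.\<close>
  have "\<exists>p. p \<in> smooth_class \<and> (\<forall>x\<in>K. \<bar>\<theta>' x - p x\<bar> < 1 / (real n + 1))" for n
  proof -
    obtain p where "real_polynomial_function p" "\<And>x. x \<in> K \<Longrightarrow> \<bar>\<theta>' x - p x\<bar> < 1 / (real n + 1)"
      by (rule Stone_Weierstrass_real_polynomial_function[OF Kc continuous_on_subset[OF c subset_UNIV],
            of "1 / (real n + 1)"]) auto
    then show ?thesis using real_polynomial_smooth_class by blast
  qed
  then obtain p where p: "\<And>n. p n \<in> smooth_class" "\<And>n x. x \<in> K \<Longrightarrow> \<bar>\<theta>' x - p n x\<bar> < 1 / (real n + 1)"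
    by metis
  define P where "P n x = (LBINT t=ereal (a-e)..ereal x. p n t)" for n x
  have P: "(P n has_real_derivative p n x) (at x)" for n x
    unfolding P_def by (rule has_real_derivative_primitive[OF smooth_class_continuous[OF p(1)]])
  have P0: "P n (a-e) = 0" for n by (simp add: P_def)
  define L where "L = b - a + 2 * e"
  have L0: "L \<ge> 0" using ab e by (simp add: L_def)
  have Pb: "\<bar>P n x - \<theta> x\<bar> \<le> L * (1 / (real n + 1))" if "x \<in> K" for n x
  proof -
    have "norm ((P n x - \<theta> x) - (P n (a-e) - \<theta> (a-e))) \<le> 1 / (real n + 1) * norm (x - (a-e))"
    proof (rule field_differentiable_bound[of K _ "\<lambda>x. p n x - \<theta>' x"])
      fix y assume "y \<in> K"
      show "((\<lambda>x. P n x - \<theta> x) has_real_derivative p n y - \<theta>' y) (at y within K)"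
        by (intro DERIV_diff has_field_derivative_at_within[OF P] has_field_derivative_at_within[OF d])
      show "norm (p n y - \<theta>' y) \<le> 1 / (real n + 1)"
        using p(2)[OF \<open>y \<in> K\<close>, of n] by (simp add: abs_minus_commute)
    qed (use that e ab in \<open>auto simp: K_def\<close>)
    moreover have "\<theta> (a-e) = 0" using z e by auto
    moreover have "norm (x - (a-e)) \<le> L" using that by (auto simp: K_def L_def)
    then have "1 / (real n + 1) * norm (x - (a-e)) \<le> 1 / (real n + 1) * L"
      by (intro mult_left_mono) auto
    ultimately show ?thesis by (simp add: P0 mult.commute)
  qed
  define \<phi> \<phi>' where "\<phi> n x = X x * P n x" and "\<phi>' n x = X' x * P n x + X x * p n x" for n x
  have \<phi>d: "(\<phi> n has_real_derivative \<phi>' n x) (at x)" for n x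
    unfolding \<phi>_def \<phi>'_def
    by (rule DERIV_mult[OF X'(2) P, THEN DERIV_cong]) (simp add: mult.commute)
  have \<phi>S: "\<phi> n \<in> smooth_class" for n
    unfolding \<phi>_def by (intro smooth_class.mult X smooth_class.primitive[OF p(1) P])
  have \<phi>z: "\<phi> n x = 0" "\<phi>' n x = 0" if "x \<notin> K" for n x
    using X(3)[OF that] X'z[OF that] by (auto simp: \<phi>_def \<phi>'_def)
  have \<phi>T: "\<phi> n \<in> test_functions S" for n
    by (rule smooth_class_test_function[OF \<phi>S, of "a-e" "b+e"]) (use \<phi>z e in \<open>auto simp: K_def\<close>)
  have d\<phi>: "deriv (\<phi> n) = \<phi>' n" for n by (auto intro!: DERIV_imp_deriv \<phi>d)
  have \<phi>b: "\<bar>\<phi> n x - \<theta> x\<bar> \<le> M1 * L * (1 / (real n + 1))" for n x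
  proof (cases "x \<in> K")
    case True
    have "\<phi> n x - \<theta> x = X x * (P n x - \<theta> x)" by (simp add: \<phi>_def X\<theta> right_diff_distrib)
    then have "\<bar>\<phi> n x - \<theta> x\<bar> \<le> M1 * (L * (1 / (real n + 1)))"
      unfolding abs_mult using M(1)[OF True] Pb[OF True, of n] M0 by (simp only: abs_mult) (intro mult_mono; simp)
    then show ?thesis by simp
  next
    case False
    then have "x \<notin> {a..b}" using e by (auto simp: K_def)
    then show ?thesis using \<phi>z[OF False] z M0 L0 by simp
  qed
  have \<phi>'b: "\<bar>\<phi>' n x - \<theta>' x\<bar> \<le> (M2 * L + M1) * (1 / (real n + 1))" for n x
  proof (cases "x \<in> K")
    case True
    have "\<phi>' n x - \<theta>' x = X' x * (P n x - \<theta> x) + X x * (p n x - \<theta>' x)"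
      using X\<theta>'[of x] by (simp add: \<phi>'_def algebra_simps)
    also have "\<bar>\<dots>\<bar> \<le> M2 * (L * (1 / (real n + 1))) + M1 * (1 / (real n + 1))"
    proof (rule order_trans[OF abs_triangle_ineq], rule add_mono; unfold abs_mult; rule mult_mono)
      show "\<bar>p n x - \<theta>' x\<bar> \<le> 1 / (real n + 1)"
        using p(2)[OF True, of n] by (simp add: abs_minus_commute)
    qed (use M(1,2)[OF True] Pb[OF True, of n] M0 in auto)
    finally show ?thesis by (simp add: algebra_simps add_divide_distrib)
  next
    case False
    then have "x \<notin> {a..b}" using e by (auto simp: K_def)
    then show ?thesis using \<phi>z[OF False] \<theta>'z M0 L0 by simp
  qed
  have fK: "set_integrable lebesgue K f" "set_integrable lebesgue K g"
    using wd KS Kc unfolding has_weak_deriv_def L1_loc_def by auto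
  have lim0: "(\<lambda>n. C * (1 / (real n + 1))) \<longlonglongrightarrow> 0" for C
    using tendsto_mult[OF tendsto_const LIMSEQ_inverse_real_of_nat, of C] by (simp add: inverse_eq_divide add.commute)
  \<comment> \<open>Uniform convergence of functions supported in \<open>K\<close> passes to the
    limit against a merely integrable factor, by dominated convergence.\<close>
  have gen: "(\<lambda>n. LINT x|lebesgue. F x * h n x) \<longlonglongrightarrow> (LINT x|lebesgue. F x * h0 x)"
    if F: "set_integrable lebesgue K F" and hz: "\<And>n x. x \<notin> K \<Longrightarrow> h n x = 0" "\<And>x. x \<notin> K \<Longrightarrow> h0 x = 0"
      and hc: "\<And>n. continuous_on K (h n)" "continuous_on K h0"
      and hb: "\<And>n x. \<bar>h n x - h0 x\<bar> \<le> C * (1 / (real n + 1))" for F h h0 C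
  proof -
    obtain B where B: "\<And>x. x \<in> K \<Longrightarrow> \<bar>h0 x\<bar> \<le> B"
      using compact_imp_bounded[OF compact_continuous_image[OF hc(2) Kc]] unfolding bounded_iff by auto
    have C0: "C \<ge> 0" using hb[of 0 a] by (smt (verit) divide_self mult_cancel_left1 of_nat_0)
    show ?thesis
    proof (rule integral_dominated_convergence)
    show "integrable lebesgue (\<lambda>x. \<bar>indicator K x * F x\<bar> * (B + C))"
      using F unfolding set_integrable_def by auto
    show "AE x in lebesgue. norm (F x * h n x) \<le> \<bar>indicator K x * F x\<bar> * (B + C)" for n
    proof (rule AE_I2)
      fix x
      show "norm (F x * h n x) \<le> \<bar>indicator K x * F x\<bar> * (B + C)"
      proof (cases "x \<in> K")
        case True
        have "C * (1 / (real n + 1)) \<le> C" using C0 by (simp add: divide_le_eq mult_le_cancel_left1)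
        then have "\<bar>h n x\<bar> \<le> B + C" using hb[of n x] B[OF True] by linarith
        then show ?thesis using True by (simp add: abs_mult mult_left_mono)
      qed (simp add: hz)
    qed
    show "AE x in lebesgue. (\<lambda>n. F x * h n x) \<longlonglongrightarrow> F x * h0 x"
    proof (rule AE_I2, rule tendsto_mult[OF tendsto_const])
      fix x
      have "(\<lambda>n. h n x - h0 x) \<longlonglongrightarrow> 0"
      proof (rule tendsto_0_le[OF lim0[of C], of _ 1], rule always_eventually, rule allI)
        fix n
        show "norm (h n x - h0 x) \<le> norm (C * (1 / (real n + 1))) * 1"
          using hb[of n x] abs_ge_self[of "C * (1 / (real n + 1))"] unfolding real_norm_def mult_1_right by linarith
      qed
      then show "(\<lambda>n. h n x) \<longlonglongrightarrow> h0 x" by (simp add: LIM_zero_iff)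
    qed
    show "(\<lambda>x. F x * h0 x) \<in> borel_measurable lebesgue"
      by (rule borel_measurable_integrable,
          rule integrable_mult_continuous_support[of "a-e" "b+e"])
        (use F hc hz in \<open>auto simp: K_def\<close>)
    show "(\<lambda>x. F x * h n x) \<in> borel_measurable lebesgue" for n
      by (rule borel_measurable_integrable,
          rule integrable_mult_continuous_support[of "a-e" "b+e"])
        (use F hc hz in \<open>auto simp: K_def\<close>)
    qed
  qed
  have eq: "(LINT x|lebesgue. f x * \<phi>' n x) = - (LINT x|lebesgue. g x * \<phi> n x)" for n
  proof -
    have "(LINT x:S|lebesgue. f x * deriv (\<phi> n) x) = - (LINT x:S|lebesgue. g x * \<phi> n x)"
      using wd \<phi>T unfolding has_weak_deriv_def by blast
    moreover have "x \<notin> S \<Longrightarrow> x \<notin> K" for x using KS by auto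
    ultimately show ?thesis by (subst (asm) (1 2) set_integral_support) (auto simp: d\<phi> \<phi>z)
  qed
  have abK: "x \<notin> K \<Longrightarrow> x \<notin> {a..b}" for x using e by (auto simp: K_def)
  have "(\<lambda>n. LINT x|lebesgue. f x * \<phi>' n x) \<longlonglongrightarrow> (LINT x|lebesgue. f x * \<theta>' x)"
  proof (rule gen[OF fK(1) _ _ _ _ \<phi>'b])
    show "continuous_on K (\<phi>' n)" for n
      unfolding \<phi>'_def
      by (intro continuous_intros smooth_class_continuous X' X p DERIV_imp_continuous_on[OF P])
    show "continuous_on K \<theta>'" by (rule continuous_on_subset[OF c]) simp
  qed (use abK in \<open>auto simp: \<phi>z \<theta>'z\<close>)
  moreover have "(\<lambda>n. LINT x|lebesgue. g x * \<phi> n x) \<longlonglongrightarrow> (LINT x|lebesgue. g x * \<theta> x)"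
  proof (rule gen[OF fK(2) _ _ _ _ \<phi>b])
    show "continuous_on K (\<phi> n)" for n by (rule smooth_class_continuous[OF \<phi>S])
    show "continuous_on K \<theta>" by (rule DERIV_imp_continuous_on[OF d])
  qed (use abK z in \<open>auto simp: \<phi>z\<close>)
  ultimately show ?thesis
    unfolding eq using LIMSEQ_unique tendsto_minus by blast
qed


text \<open>Completeness of \<open>lebesgue\<close> transfers measurability between functions that
  agree almost everywhere; if neither is measurable, both integrals have the default value
  0.\<close>

lemma integrable_lebesgue_cong_AE:
  fixes f g :: "real \<Rightarrow> real"
  assumes "AE x in lebesgue. f x = g x"
  shows "integrable lebesgue f \<longleftrightarrow> integrable lebesgue g"
    and "integral\<^sup>L lebesgue f = integral\<^sup>L lebesgue g"
proof -
  have assms': "AE x in lebesgue. g x = f x" using assms by eventually_elim simp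
  show "integrable lebesgue f \<longleftrightarrow> integrable lebesgue g"
    using integrable_cong_AE_imp[OF _ borel_measurable_AE[OF borel_measurable_integrable assms] assms]
      integrable_cong_AE_imp[OF _ borel_measurable_AE[OF borel_measurable_integrable assms'] assms'] by blast
  show "integral\<^sup>L lebesgue f = integral\<^sup>L lebesgue g"
  proof (cases "f \<in> borel_measurable lebesgue")
    case True
    then show ?thesis using borel_measurable_AE[OF True assms] assms by (intro integral_cong_AE)
  next
    case False
    then have "g \<notin> borel_measurable lebesgue" using borel_measurable_AE[OF _ assms'] by blast
    then have "\<not> integrable lebesgue f" "\<not> integrable lebesgue g"
      using False by (auto dest: borel_measurable_integrable)
    then show ?thesis by (simp add: not_integrable_integral_eq)
  qed
qed

lemma has_weak_deriv_AE:
  assumes "has_weak_deriv S f g" "AE x in lebesgue. x \<in> S \<longrightarrow> f x = f' x"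
    "AE x in lebesgue. x \<in> S \<longrightarrow> g x = g' x"
  shows "has_weak_deriv S f' g'"
proof -
  have int: "set_integrable lebesgue K h'"
    if "set_integrable lebesgue K h" "AE x in lebesgue. x \<in> S \<longrightarrow> h x = h' x" "K \<subseteq> S"
    for K and h h' :: "real \<Rightarrow> real"
  proof -
    have "AE x in lebesgue. indicator K x * h x = indicator K x * h' x"
      using that(2) by eventually_elim (use that(3) in \<open>auto simp: indicator_def\<close>)
    from integrable_lebesgue_cong_AE(1)[OF this] show ?thesis
      using that(1) unfolding set_integrable_def by simp
  qed
  have eq: "(LINT x:S|lebesgue. h x * \<theta> x) = (LINT x:S|lebesgue. h' x * \<theta> x)"
    if "AE x in lebesgue. x \<in> S \<longrightarrow> h x = h' x" for h h' \<theta> :: "real \<Rightarrow> real"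
    unfolding set_lebesgue_integral_def
    by (rule integrable_lebesgue_cong_AE(2)) (use that in \<open>eventually_elim, auto simp: indicator_def\<close>)
  have L1: "L1_loc S h'" if "L1_loc S h" "AE x in lebesgue. x \<in> S \<longrightarrow> h x = h' x"
    for h h' :: "real \<Rightarrow> real"
    using that(1) int[OF _ that(2)] unfolding L1_loc_def by blast
  have "L1_loc S f'" "L1_loc S g'"
    using assms(1) L1[OF _ assms(2)] L1[OF _ assms(3)] unfolding has_weak_deriv_def by auto
  then show ?thesis
    using assms(1) eq[OF assms(2)] eq[OF assms(3)] unfolding has_weak_deriv_def by simp
qed

text \<open>The support is enclosed between its extreme points, and the interval so obtained stays
  in \<open>S\<close> because \<open>S\<close> is an interval. An empty support is represented by
  {1..0}.\<close>

lemma test_function_C1: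
  assumes "\<theta> \<in> test_functions S" "is_interval S"
  obtains a b where "{a..b} \<subseteq> S" "\<And>x. (\<theta> has_real_derivative deriv \<theta> x) (at x)"
    "continuous_on UNIV (deriv \<theta>)" "\<And>x. x \<notin> {a..b} \<Longrightarrow> \<theta> x = 0" "\<And>x. x \<notin> {a..b} \<Longrightarrow> deriv \<theta> x = 0"
proof -
  have d: "(deriv ^^ n) \<theta> field_differentiable (at x)" for n x
    using assms(1) unfolding test_functions_def by blast
  have d0: "(\<theta> has_real_derivative deriv \<theta> x) (at x)" for x
    using d[of 0 x] by (simp add: DERIV_deriv_iff_field_differentiable)
  have "deriv \<theta> field_differentiable (at x)" for x using d[of 1 x] by simp
  then have c: "continuous_on UNIV (deriv \<theta>)"
    by (auto intro!: continuous_at_imp_continuous_on field_differentiable_imp_continuous_at)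
  define C where "C = closure {x. \<theta> x \<noteq> 0}"
  have C: "compact C" "C \<subseteq> S" using assms(1) unfolding test_functions_def C_def by auto
  have z: "\<theta> x = 0" if "x \<notin> C" for x using that closure_subset[of "{x. \<theta> x \<noteq> 0}"] by (auto simp: C_def)
  have dz: "deriv \<theta> x = 0" if "x \<notin> C" for x
  proof (rule DERIV_unique[OF d0])
    show "(\<theta> has_real_derivative 0) (at x)"
      by (rule has_field_derivative_transform_within_open[of "\<lambda>x. 0" _ _ "- C"])
        (use that z compact_imp_closed[OF C(1)] in \<open>auto simp: open_Compl\<close>)
  qed
  show ?thesis
  proof (cases "C = {}")
    case True
    show ?thesis by (rule that[of 1 0, OF _ d0 c]) (use z dz True in auto)
  next
    case False
    obtain a b where ab: "a \<in> C" "b \<in> C" "\<And>x. x \<in> C \<Longrightarrow> a \<le> x" "\<And>x. x \<in> C \<Longrightarrow> x \<le> b"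
      using compact_attains_inf[OF C(1) False] compact_attains_sup[OF C(1) False] by metis
    have "x \<in> S" if "x \<in> {a..b}" for x
    proof (rule mem_is_interval_1_I[OF assms(2), of a b])
      show "a \<in> S" "b \<in> S" using ab C by blast+
    qed (use that in auto)
    then have "{a..b} \<subseteq> S" by blast
    moreover have "\<And>x. x \<notin> {a..b} \<Longrightarrow> x \<notin> C" using ab by auto
    ultimately show ?thesis by (intro that[of a b, OF _ d0 c]) (use z dz in blast)+
  qed
qed

text \<open>Together with \<open>has_weak_deriv_C1_test\<close> this replaces smooth test functions
  by C1 functions vanishing outside an interval. That class is stable under multiplication by C1
  weights such as \<open>m\<close>, which smooth test functions are not.\<close>

lemma has_weak_deriv_I:
  assumes L1: "L1_loc S f" "L1_loc S g" and S: "is_interval S"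
    and test: "\<And>\<theta> \<theta>' a b. {a..b} \<subseteq> S \<Longrightarrow> (\<And>x. (\<theta> has_real_derivative \<theta>' x) (at x)) \<Longrightarrow>
      continuous_on UNIV \<theta>' \<Longrightarrow> (\<And>x. x \<notin> {a..b} \<Longrightarrow> \<theta> x = 0) \<Longrightarrow> (\<And>x. x \<notin> {a..b} \<Longrightarrow> \<theta>' x = 0) \<Longrightarrow>
      (LINT x|lebesgue. f x * \<theta>' x) = - (LINT x|lebesgue. g x * \<theta> x)"
  shows "has_weak_deriv S f g"
  unfolding has_weak_deriv_def
proof (intro conjI ballI L1)
  fix \<theta> assume "\<theta> \<in> test_functions S"
  then obtain a b where ab: "{a..b} \<subseteq> S" "\<And>x. (\<theta> has_real_derivative deriv \<theta> x) (at x)"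
    "continuous_on UNIV (deriv \<theta>)" "\<And>x. x \<notin> {a..b} \<Longrightarrow> \<theta> x = 0" "\<And>x. x \<notin> {a..b} \<Longrightarrow> deriv \<theta> x = 0"
    using S by (rule test_function_C1) blast
  have "x \<notin> S \<Longrightarrow> x \<notin> {a..b}" for x using ab(1) by blast
  then show "(LINT x:S|lebesgue. f x * deriv \<theta> x) = - (LINT x:S|lebesgue. g x * \<theta> x)"
    by (subst (1 2) set_integral_support) (use ab test[OF ab] in auto)
qed

lemma L1_loc_continuous:
  fixes f :: "real \<Rightarrow> real"
  assumes "continuous_on S f"
  shows "L1_loc S f"
  unfolding L1_loc_def
proof safe
  fix K assume K: "compact K" "K \<subseteq> S"
  have "integrable lborel (\<lambda>x. indicator K x *\<^sub>R f x)"
    by (rule borel_integrable_compact[OF K(1) continuous_on_subset[OF assms K(2)]])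
  then show "set_integrable lebesgue K f"
    unfolding set_integrable_def using integrable_completion borel_measurable_integrable by blast
qed

lemma L1_loc_Icc_I:
  assumes S: "is_interval S" and f: "\<And>a b. {a..b} \<subseteq> S \<Longrightarrow> set_integrable lebesgue {a..b} f"
  shows "L1_loc S f"
  unfolding L1_loc_def
proof safe
  fix K :: "real set" assume K: "compact K" "K \<subseteq> S"
  show "set_integrable lebesgue K f"
  proof (cases "K = {}")
    case False
    obtain a b where ab: "a \<in> K" "b \<in> K" "\<And>x. x \<in> K \<Longrightarrow> a \<le> x" "\<And>x. x \<in> K \<Longrightarrow> x \<le> b"
      using compact_attains_inf[OF K(1) False] compact_attains_sup[OF K(1) False] by metis
    have "x \<in> S" if "x \<in> {a..b}" for x
    proof (rule mem_is_interval_1_I[OF S, of a b])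
      show "a \<in> S" "b \<in> S" using ab K by blast+
    qed (use that in auto)
    then have "set_integrable lebesgue {a..b} f" using f by blast
    then show ?thesis by (rule set_integrable_subset) (use ab K in \<open>auto intro: lmeasurable_compact fmeasurableD\<close>)
  qed (simp add: set_integrable_def)
qed

lemma L1_loc_mult_continuous:
  assumes "L1_loc S f" "is_interval S" "continuous_on S h"
  shows "L1_loc S (\<lambda>x. f x * h x)"
  by (intro L1_loc_Icc_I set_integrable_mult_continuous)
    (use assms in \<open>auto intro: L1_loc_Icc continuous_on_subset\<close>)

lemma L1_loc_add:
  "L1_loc S f \<Longrightarrow> L1_loc S g \<Longrightarrow> L1_loc S (\<lambda>x. f x + g x)"
  unfolding L1_loc_def by auto

lemma has_weak_deriv_L1_loc:
  assumes "has_weak_deriv S f g" shows "L1_loc S f" "L1_loc S g"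
  using assms unfolding has_weak_deriv_def by auto

lemma has_weak_deriv_add:
  assumes S: "open S" "is_interval S" and fg: "has_weak_deriv S f1 g1" "has_weak_deriv S f2 g2"
  shows "has_weak_deriv S (\<lambda>x. f1 x + f2 x) (\<lambda>x. g1 x + g2 x)"
proof (rule has_weak_deriv_I[OF _ _ S(2)])
  note L = has_weak_deriv_L1_loc[OF fg(1)] has_weak_deriv_L1_loc[OF fg(2)]
  show "L1_loc S (\<lambda>x. f1 x + f2 x)" "L1_loc S (\<lambda>x. g1 x + g2 x)" by (intro L1_loc_add L)+
  fix \<theta> \<theta>' :: "real \<Rightarrow> real" and a b
  assume \<theta>: "{a..b} \<subseteq> S" "\<And>x. (\<theta> has_real_derivative \<theta>' x) (at x)" "continuous_on UNIV \<theta>'"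
    "\<And>x. x \<notin> {a..b} \<Longrightarrow> \<theta> x = 0" "\<And>x. x \<notin> {a..b} \<Longrightarrow> \<theta>' x = 0"
  have c: "continuous_on {a..b} \<theta>" "continuous_on {a..b} \<theta>'"
    by (rule DERIV_imp_continuous_on[OF \<theta>(2)], rule continuous_on_subset[OF \<theta>(3)]) simp
  have i: "integrable lebesgue (\<lambda>x. f x * \<theta> x)" "integrable lebesgue (\<lambda>x. f x * \<theta>' x)" if "L1_loc S f" for f
    using L1_loc_Icc[OF that \<theta>(1)] c \<theta>(4,5) by (auto intro: integrable_mult_continuous_support)
  show "(LINT x|lebesgue. (f1 x + f2 x) * \<theta>' x) = - (LINT x|lebesgue. (g1 x + g2 x) * \<theta> x)"
    using has_weak_deriv_C1_test[OF fg(1) S(1) \<theta>(1-4)] has_weak_deriv_C1_test[OF fg(2) S(1) \<theta>(1-4)]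
    by (simp add: distrib_right i L)
qed

text \<open>The weight is moved to the test function: the definition for f is tested with m
  \<theta>, which is only of class C1.\<close>

lemma has_weak_deriv_mult_C1:
  assumes S: "open S" "is_interval S" and fg: "has_weak_deriv S f g"
    and m: "\<And>x. (m has_real_derivative m' x) (at x)" "continuous_on UNIV m'"
  shows "has_weak_deriv S (\<lambda>x. m x * f x) (\<lambda>x. m x * g x + m' x * f x)"
proof (rule has_weak_deriv_I[OF _ _ S(2)])
  note L = has_weak_deriv_L1_loc[OF fg]
  have mc: "continuous_on A m" for A
    by (rule DERIV_imp_continuous_on[OF m(1)])
  have m'c: "continuous_on A m'" for A by (rule continuous_on_subset[OF m(2)]) auto
  show "L1_loc S (\<lambda>x. m x * f x)" "L1_loc S (\<lambda>x. m x * g x + m' x * f x)"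
    using L1_loc_mult_continuous[OF L(1) S(2) mc] L1_loc_mult_continuous[OF L(2) S(2) mc]
      L1_loc_mult_continuous[OF L(1) S(2) m'c] by (auto simp: mult.commute intro!: L1_loc_add)
  fix \<theta> \<theta>' :: "real \<Rightarrow> real" and a b
  assume \<theta>: "{a..b} \<subseteq> S" "\<And>x. (\<theta> has_real_derivative \<theta>' x) (at x)" "continuous_on UNIV \<theta>'"
    "\<And>x. x \<notin> {a..b} \<Longrightarrow> \<theta> x = 0" "\<And>x. x \<notin> {a..b} \<Longrightarrow> \<theta>' x = 0"
  have tc: "continuous_on A \<theta>" "continuous_on A \<theta>'" for A
    by (rule DERIV_imp_continuous_on[OF \<theta>(2)], rule continuous_on_subset[OF \<theta>(3)]) simp
  have i: "integrable lebesgue (\<lambda>x. F x * h x)"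
    if "L1_loc S F" "continuous_on UNIV h" "\<And>x. x \<notin> {a..b} \<Longrightarrow> h x = 0" for F h
    by (rule integrable_mult_continuous_support[OF L1_loc_Icc[OF that(1) \<theta>(1)] continuous_on_subset[OF that(2)]])
      (use that in auto)
  have "((\<lambda>x. m x * \<theta> x) has_real_derivative m' x * \<theta> x + m x * \<theta>' x) (at x)" for x
    by (rule DERIV_mult[OF m(1) \<theta>(2), THEN DERIV_cong]) (simp add: mult.commute)
  note t = has_weak_deriv_C1_test[OF fg S(1) \<theta>(1) this]
  have *: "(LINT x|lebesgue. f x * (m' x * \<theta> x + m x * \<theta>' x)) = - (LINT x|lebesgue. g x * (m x * \<theta> x))"
    by (rule t, intro continuous_intros tc mc m'c) (simp add: \<theta>(4))
  have ints: "integrable lebesgue (\<lambda>x. f x * (m' x * \<theta> x))" "integrable lebesgue (\<lambda>x. f x * (m x * \<theta>' x))"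
     "integrable lebesgue (\<lambda>x. g x * (m x * \<theta> x))"
    by (rule i, rule L, intro continuous_intros tc mc m'c, simp add: \<theta>(4,5))+
  have "(LINT x|lebesgue. f x * (m' x * \<theta> x + m x * \<theta>' x)) =
      (LINT x|lebesgue. f x * (m' x * \<theta> x)) + (LINT x|lebesgue. f x * (m x * \<theta>' x))"
    unfolding distrib_left by (rule Bochner_Integration.integral_add[OF ints(1,2)])
  moreover have "(m x * g x + m' x * f x) * \<theta> x = g x * (m x * \<theta> x) + f x * (m' x * \<theta> x)" for x
    by (simp add: algebra_simps)
  then have "(LINT x|lebesgue. (m x * g x + m' x * f x) * \<theta> x)
      = (LINT x|lebesgue. g x * (m x * \<theta> x)) + (LINT x|lebesgue. f x * (m' x * \<theta> x))"
    using Bochner_Integration.integral_add[OF ints(3,1)] by simp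
  moreover have "(LINT x|lebesgue. m x * f x * \<theta>' x) = (LINT x|lebesgue. f x * (m x * \<theta>' x))"
    by (simp only: mult.assoc mult.left_commute[of "m _"])
  ultimately show "(LINT x|lebesgue. m x * f x * \<theta>' x) = - (LINT x|lebesgue. (m x * g x + m' x * f x) * \<theta> x)"
    using * by simp
qed

lemma has_weak_deriv_cmult:
  assumes "open S" "is_interval S" "has_weak_deriv S f g"
  shows "has_weak_deriv S (\<lambda>x. c * f x) (\<lambda>x. c * g x)"
  using has_weak_deriv_mult_C1[OF assms, of "\<lambda>x. c" "\<lambda>x. 0"] by simp

lemma integral_deriv_compact_support:
  fixes F F' :: "real \<Rightarrow> real"
  assumes "\<And>x. (F has_real_derivative F' x) (at x)" "continuous_on UNIV F'" "a \<le> b"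
    and "\<And>x. x \<notin> {a..b} \<Longrightarrow> F' x = 0"
  shows "integrable lebesgue F'" "(LINT x|lebesgue. F' x) = F b - F a"
proof -
  have i: "set_integrable lebesgue {a..b} F'"
    by (auto intro!: absolutely_integrable_continuous_real continuous_on_subset[OF assms(2)])
  then show "integrable lebesgue F'"
    using integrable_mult_continuous_support[of a b "\<lambda>x. 1" F'] assms(4) continuous_on_subset[OF assms(2), of "{a..b}"]
    by (simp add: absolutely_integrable_continuous_real)
  have "(LINT x|lebesgue. F' x) = (LINT x:{a..b}|lebesgue. F' x)"
    by (rule set_integral_support[symmetric]) (use assms in auto)
  also have "\<dots> = integral {a..b} F'" by (rule set_lebesgue_integral_eq_integral[OF i])
  also have "\<dots> = F b - F a"
    by (intro integral_unique fundamental_theorem_of_calculus assms(3))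
      (auto intro!: has_field_derivative_at_within assms(1) simp flip: has_real_derivative_iff_has_vector_derivative)
  finally show "(LINT x|lebesgue. F' x) = F b - F a" .
qed

lemma has_weak_deriv_C1:
  assumes S: "is_interval S"
    and f: "\<And>x. (f has_real_derivative f' x) (at x)" "continuous_on UNIV f'"
  shows "has_weak_deriv S f f'"
proof (rule has_weak_deriv_I[OF _ _ S])
  have fc: "continuous_on A f" "continuous_on A f'" for A
    by (rule DERIV_imp_continuous_on[OF f(1)], rule continuous_on_subset[OF f(2)]) simp
  show "L1_loc S f" "L1_loc S f'" by (intro L1_loc_continuous fc)+
  fix \<theta> \<theta>' :: "real \<Rightarrow> real" and a b
  assume \<theta>: "{a..b} \<subseteq> S" "\<And>x. (\<theta> has_real_derivative \<theta>' x) (at x)" "continuous_on UNIV \<theta>'"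
    "\<And>x. x \<notin> {a..b} \<Longrightarrow> \<theta> x = 0" "\<And>x. x \<notin> {a..b} \<Longrightarrow> \<theta>' x = 0"
  have tc: "continuous_on A \<theta>" "continuous_on A \<theta>'" for A
    by (rule DERIV_imp_continuous_on[OF \<theta>(2)], rule continuous_on_subset[OF \<theta>(3)]) simp
  \<comment> \<open>Both points lie outside {a..b}, also when that interval is empty, so the
    boundary terms vanish.\<close>
  define l u where "l = a - 1" and "u = max a b + 1"
  have lu: "l \<le> u" "x \<notin> {l..u} \<Longrightarrow> x \<notin> {a..b}" "l \<notin> {a..b}" "u \<notin> {a..b}" for x by (auto simp: l_def u_def)
  have i: "integrable lebesgue (\<lambda>x. F x * h x)"
    if "continuous_on UNIV F" "continuous_on UNIV h" "\<And>x. x \<notin> {a..b} \<Longrightarrow> h x = 0" for F h :: "real \<Rightarrow> real"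
    by (rule integrable_mult_continuous_support[OF L1_loc_Icc[OF L1_loc_continuous[OF that(1)]]
          continuous_on_subset[OF that(2)]]) (use that in auto)
  have "((\<lambda>x. f x * \<theta> x) has_real_derivative f x * \<theta>' x + f' x * \<theta> x) (at x)" for x
    by (rule DERIV_mult[OF f(1) \<theta>(2), THEN DERIV_cong]) (simp add: mult.commute)
  then have "(LINT x|lebesgue. f x * \<theta>' x + f' x * \<theta> x) = f u * \<theta> u - f l * \<theta> l"
    by (rule integral_deriv_compact_support(2)) (use \<theta> lu in \<open>auto intro!: continuous_intros fc tc\<close>)
  also have "\<dots> = 0" using \<theta>(4)[OF lu(3)] \<theta>(4)[OF lu(4)] by simp
  finally show "(LINT x|lebesgue. f x * \<theta>' x) = - (LINT x|lebesgue. f' x * \<theta> x)"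
    by (subst (asm) Bochner_Integration.integral_add) (use \<theta> in \<open>auto intro!: i fc tc\<close>)
qed

lemma integral_lebesgue_eq_lborel_continuous:
  fixes f :: "real \<Rightarrow> real"
  assumes "continuous_on UNIV f"
  shows "(LINT x|lebesgue. f x) = (LINT x|lborel. f x)"
  by (rule integral_completion) (use assms in \<open>simp add: borel_measurable_continuous_onI\<close>)

text \<open>The substitution x = c + r / (n + 1) moves the scaling from \<eta> to \<open>F\<close>,
  where continuity gives pointwise convergence and the bound on \<open>F\<close> gives
  domination.\<close>

lemma approximate_identity:
  fixes F \<eta> :: "real \<Rightarrow> real"
  assumes F: "continuous_on UNIV F" "\<And>x. \<bar>F x\<bar> \<le> B" and \<eta>: "continuous_on UNIV \<eta>" "integrable lebesgue \<eta>"
  shows "(\<lambda>n. LINT x|lebesgue. F x * (real (Suc n) * \<eta> (real (Suc n) * (x - c)))) \<longlonglongrightarrow> F c * (LINT r|lebesgue. \<eta> r)"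
proof -
  have eq: "(LINT x|lebesgue. F x * (real (Suc n) * \<eta> (real (Suc n) * (x - c))))
      = (LINT r|lebesgue. F (c + inverse (real (Suc n)) * r) * \<eta> r)" for n
  proof -
    have "(LINT x|lebesgue. F x * (real (Suc n) * \<eta> (real (Suc n) * (x - c))))
      = (LINT x|lborel. F x * (real (Suc n) * \<eta> (real (Suc n) * (x - c))))"
      by (intro integral_lebesgue_eq_lborel_continuous continuous_intros F continuous_on_compose2[OF \<eta>(1)]) auto
    also have "\<dots> = \<bar>inverse (real (Suc n))\<bar> *\<^sub>R (LINT x|lborel. F (c + inverse (real (Suc n)) * x) *
        (real (Suc n) * \<eta> (real (Suc n) * (c + inverse (real (Suc n)) * x - c))))"
      by (rule lborel_integral_real_affine) simp
    also have "\<dots> = (LINT r|lborel. F (c + inverse (real (Suc n)) * r) * \<eta> r)"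
      by (subst integral_scaleR_right[symmetric], rule Bochner_Integration.integral_cong)
        (auto simp del: of_nat_Suc simp flip: mult.assoc)
    also have "\<dots> = (LINT r|lebesgue. F (c + inverse (real (Suc n)) * r) * \<eta> r)"
      by (rule integral_lebesgue_eq_lborel_continuous[symmetric])
        (intro continuous_intros \<eta>(1) continuous_on_compose2[OF F(1)]; simp)
    finally show ?thesis .
  qed
  have lim: "(\<lambda>n. LINT r|lebesgue. F (c + inverse (real (Suc n)) * r) * \<eta> r) \<longlonglongrightarrow> (LINT r|lebesgue. F c * \<eta> r)"
  proof (rule integral_dominated_convergence[where w = "\<lambda>r. B * \<bar>\<eta> r\<bar>"])
    have "continuous_on UNIV (\<lambda>r. F (c + inverse (real (Suc n)) * r) * \<eta> r)" for n
      by (intro continuous_intros \<eta>(1) continuous_on_compose2[OF F(1)]; simp)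
    then show "(\<lambda>r. F (c + inverse (real (Suc n)) * r) * \<eta> r) \<in> borel_measurable lebesgue" for n
      by (intro measurable_completion) (simp add: borel_measurable_continuous_onI)
    show "AE r in lebesgue. (\<lambda>n. F (c + inverse (real (Suc n)) * r) * \<eta> r) \<longlonglongrightarrow> F c * \<eta> r"
    proof (rule AE_I2, rule tendsto_mult_right)
      fix r
      have "(\<lambda>n. c + inverse (real (Suc n)) * r) \<longlonglongrightarrow> c + 0 * r"
        by (intro tendsto_intros LIMSEQ_inverse_real_of_nat)
      moreover have "isCont F c" using F(1) by (simp add: continuous_on_eq_continuous_at)
      ultimately show "(\<lambda>n. F (c + inverse (real (Suc n)) * r)) \<longlonglongrightarrow> F c"
        by (auto intro: isCont_tendsto_compose)
    qed
    show "AE r in lebesgue. norm (F (c + inverse (real (Suc n)) * r) * \<eta> r) \<le> B * \<bar>\<eta> r\<bar>" for n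
      by (rule AE_I2) (auto simp: abs_mult intro!: mult_right_mono F(2))
  qed (use \<eta> in auto)
  then show ?thesis unfolding eq by simp
qed

text \<open>Testing against smooth approximations of the indicator of \<open>(a, b]\<close>.\<close>

lemma has_weak_deriv_FTC:
  fixes f g :: "real \<Rightarrow> real"
  assumes wd: "has_weak_deriv S f g" and S: "open S" "{a..b} \<subseteq> S" and ab: "a \<le> b" and f: "continuous_on S f"
  shows "f b - f a = (LINT x:{a..b}|lebesgue. g x)"
proof -
  obtain e where e: "e > 0" "{a-e..b+e} \<subseteq> S" using open_interval_enlarge[OF S ab] .
  obtain Z where Z: "Z \<in> smooth_class" "\<And>x. x \<le> 0 \<Longrightarrow> Z x = (0::real)" "\<And>x. x \<ge> 1 \<Longrightarrow> Z x = 1"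
    using smooth_step by blast
  obtain \<eta> where \<eta>: "\<eta> \<in> smooth_class" "\<And>x. (Z has_real_derivative \<eta> x) (at x)"
    using smooth_class_deriv[OF Z(1)] by blast
  have \<eta>z: "\<eta> x = 0" if "x \<notin> {0..1}" for x
  proof (rule DERIV_unique[OF \<eta>(2)])
    have "x < 0 \<or> x > 1" using that by auto
    then consider "x < 0" | "x > 1" by blast
    then show "(Z has_real_derivative 0) (at x)"
    proof cases
      case 1 show ?thesis
        by (rule has_field_derivative_transform_within_open[of "\<lambda>x. 0" _ _ "{..<0}"]) (use 1 Z in auto)
    next
      case 2 show ?thesis
        by (rule has_field_derivative_transform_within_open[of "\<lambda>x. 1" _ _ "{1<..}"]) (use 2 Z in auto)
    qed
  qed
  have \<eta>c: "continuous_on A \<eta>" for A by (rule smooth_class_continuous[OF \<eta>(1)])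
  have \<eta>i: "integrable lebesgue \<eta>" "(LINT r|lebesgue. \<eta> r) = 1"
    using integral_deriv_compact_support[OF \<eta>(2) \<eta>c, of 0 1] \<eta>z Z by auto
  obtain B where B: "\<And>x. \<bar>Z x\<bar> \<le> B"
  proof -
    have "bounded (Z ` {0..1})"
      by (intro compact_imp_bounded compact_continuous_image smooth_class_continuous Z) simp
    then obtain B where B: "\<forall>x\<in>{0..1}. \<bar>Z x\<bar> \<le> B" unfolding bounded_iff by auto
    have "\<bar>Z x\<bar> \<le> max B 1" for x
      using bspec[OF B, of x] Z(2,3)[of x] by (cases "x \<le> 0"; cases "x \<ge> 1") auto
    then show ?thesis using that by blast
  qed
  define l u where "l = a - e" and "u = b + e"
  have lu: "l < a" "b < u" "{l..u} \<subseteq> S" using e by (auto simp: l_def u_def)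
  \<comment> \<open>Clamping extends f from the enlarged interval to a bounded continuous function
    on the line, as \<open>approximate_identity\<close> requires; nothing changes on the interval
    where the smoothed steps vary.\<close>
  define F where "F x = f (max l (min u x))" for x
  have Fc: "continuous_on UNIV F"
    unfolding F_def
    by (rule continuous_on_compose2[OF continuous_on_subset[OF f lu(3)]])
      (use lu ab in \<open>auto intro!: continuous_intros\<close>)
  have "bounded (f ` {l..u})"
    by (intro compact_imp_bounded compact_continuous_image continuous_on_subset[OF f] lu) simp
  then obtain M where M: "\<forall>x\<in>{l..u}. \<bar>f x\<bar> \<le> M" unfolding bounded_iff by auto
  have Fb: "\<bar>F x\<bar> \<le> M" for x unfolding F_def by (rule M[rule_format]) (use lu ab in auto)
  have Feq: "F x = f x" if "x \<in> {l..u}" for x using that by (auto simp: F_def)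
  \<comment> \<open>Both steps rise to the right of their base points \<open>a\<close> and
    \<open>b\<close>, hence for large n the support stays in {a..u} with
    \<open>u = b + e\<close>.\<close>
  define \<theta> where "\<theta> n x = Z (real (Suc n) * (x - a)) - Z (real (Suc n) * (x - b))" for n x
  define \<theta>' where "\<theta>' n x = real (Suc n) * \<eta> (real (Suc n) * (x - a)) - real (Suc n) * \<eta> (real (Suc n) * (x - b))" for n x
  have \<theta>d: "(\<theta> n has_real_derivative \<theta>' n x) (at x)" for n x
  proof -
    have "((\<lambda>x. Z (real (Suc n) * (x - c))) has_real_derivative \<eta> (real (Suc n) * (x - c)) * real (Suc n)) (at x)" for c
      by (rule DERIV_chain2[OF \<eta>(2)]) (auto intro!: derivative_eq_intros)
    from DERIV_diff[OF this[of a] this[of b]] show ?thesis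
      unfolding \<theta>_def \<theta>'_def by (simp add: mult.commute)
  qed
  have \<theta>'c: "continuous_on UNIV (\<theta>' n)" for n
    unfolding \<theta>'_def by (intro continuous_intros continuous_on_compose2[OF \<eta>c]) auto
  obtain N where N: "inverse (real (Suc N)) < e" using reals_Archimedean[OF e(1)] by blast
  have \<theta>z: "\<theta> n x = 0" "\<theta>' n x = 0" if n: "n \<ge> N" and x: "x \<notin> {a..u}" for n x
  proof -
    have "inverse (real (Suc n)) \<le> inverse (real (Suc N))" using n by (simp add: field_simps)
    then have "inverse (real (Suc n)) < e" using N by linarith
    then have n1: "1 < real (Suc n) * e" by (simp add: field_simps del: of_nat_Suc)
    have *: "real (Suc n) * (x - a) < 0 \<and> real (Suc n) * (x - b) < 0 \<or>
        real (Suc n) * (x - a) > 1 \<and> real (Suc n) * (x - b) > 1"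
    proof (cases "x < a")
      case True
      then show ?thesis using ab by (auto simp del: of_nat_Suc simp: mult_less_0_iff)
    next
      case False
      then have "x - b > e" "x - a > e" using x ab by (auto simp: u_def)
      then have "real (Suc n) * (x - b) > real (Suc n) * e" "real (Suc n) * (x - a) > real (Suc n) * e"
        by (auto simp del: of_nat_Suc)
      then show ?thesis using n1 by linarith
    qed
    show "\<theta> n x = 0" using * Z(2,3) unfolding \<theta>_def by auto
    show "\<theta>' n x = 0" using * \<eta>z unfolding \<theta>'_def by auto
  qed
  have aS: "{a..u} \<subseteq> S" using lu by auto
  have ibp: "(LINT x|lebesgue. F x * \<theta>' n x) = - (LINT x|lebesgue. g x * \<theta> n x)" if n: "n \<ge> N" for n
  proof -
    have "F x * \<theta>' n x = f x * \<theta>' n x" for x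
      using \<theta>z(2)[OF n, of x] Feq[of x] lu by (cases "x \<in> {a..u}") auto
    then have "(LINT x|lebesgue. F x * \<theta>' n x) = (LINT x|lebesgue. f x * \<theta>' n x)" by (simp only:)
    also have "\<dots> = - (LINT x|lebesgue. g x * \<theta> n x)"
      by (rule has_weak_deriv_C1_test[OF wd S(1) aS \<theta>d \<theta>'c]) (rule \<theta>z(1)[OF n])
    finally show ?thesis .
  qed
  have ints: "integrable lebesgue (\<lambda>x. F x * (real (Suc n) * \<eta> (real (Suc n) * (x - c))))" for n c
  proof (rule integrable_mult_continuous_support[of "c" "c + inverse (real (Suc n))"])
    show "set_integrable lebesgue {c..c + inverse (real (Suc n))} F"
      by (intro absolutely_integrable_continuous_real continuous_on_subset[OF Fc]) auto
    show "continuous_on {c..c + inverse (real (Suc n))} (\<lambda>x. real (Suc n) * \<eta> (real (Suc n) * (x - c)))"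
      by (intro continuous_intros continuous_on_compose2[OF \<eta>c]) auto
    fix x assume "x \<notin> {c..c + inverse (real (Suc n))}"
    then have "real (Suc n) * (x - c) \<notin> {0..1}"
      by (auto simp: field_simps zero_le_mult_iff simp del: of_nat_Suc)
    then show "real (Suc n) * \<eta> (real (Suc n) * (x - c)) = 0" using \<eta>z by simp
  qed
  have "(LINT x|lebesgue. F x * \<theta>' n x) = (LINT x|lebesgue. F x * (real (Suc n) * \<eta> (real (Suc n) * (x - a))))
      - (LINT x|lebesgue. F x * (real (Suc n) * \<eta> (real (Suc n) * (x - b))))" for n
  proof -
    have "F x * \<theta>' n x = F x * (real (Suc n) * \<eta> (real (Suc n) * (x - a))) - F x * (real (Suc n) * \<eta> (real (Suc n) * (x - b)))" for x
      unfolding \<theta>'_def by (rule right_diff_distrib)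
    then show ?thesis by (simp only: Bochner_Integration.integral_diff[OF ints ints])
  qed
  then have lim1: "(\<lambda>n. LINT x|lebesgue. F x * \<theta>' n x) \<longlonglongrightarrow> F a - F b"
    using tendsto_diff[OF approximate_identity[OF Fc Fb \<eta>c \<eta>i(1), of a] approximate_identity[OF Fc Fb \<eta>c \<eta>i(1), of b]] \<eta>i(2)
    by simp
  have gi: "set_integrable lebesgue {a..u} g" by (rule L1_loc_Icc[OF has_weak_deriv_L1_loc(2)[OF wd] aS])
  have lim2: "(\<lambda>n. LINT x|lebesgue. (indicator {a..u} x * g x) * \<theta> n x) \<longlonglongrightarrow> (LINT x|lebesgue. (indicator {a..u} x * g x) * indicator {a<..b} x)"
  proof (rule integral_dominated_convergence[where w = "\<lambda>x. \<bar>indicator {a..u} x * g x\<bar> * (2 * B)"])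
    have gm: "(\<lambda>x. indicator {a..u} x * g x) \<in> borel_measurable lebesgue"
      using gi unfolding set_integrable_def by (auto dest: borel_measurable_integrable)
    have "\<theta> n \<in> borel_measurable lebesgue" for n
      by (intro measurable_completion)
        (auto intro!: borel_measurable_continuous_onI DERIV_imp_continuous_on[OF \<theta>d])
    then show "(\<lambda>x. indicator {a..u} x * g x * \<theta> n x) \<in> borel_measurable lebesgue" for n
      by (intro borel_measurable_times gm) auto
    show "(\<lambda>x. indicator {a..u} x * g x * indicator {a<..b} x) \<in> borel_measurable lebesgue"
      by (intro borel_measurable_times gm) (auto intro: borel_measurable_indicator)
    show "integrable lebesgue (\<lambda>x. \<bar>indicator {a..u} x * g x\<bar> * (2 * B))"
      using gi unfolding set_integrable_def by auto
    have "\<bar>\<theta> n x\<bar> \<le> 2 * B" for n x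
      unfolding \<theta>_def using B[of "real (Suc n) * (x - a)"] B[of "real (Suc n) * (x - b)"] by linarith
    then show "AE x in lebesgue. norm (indicator {a..u} x * g x * \<theta> n x) \<le> \<bar>indicator {a..u} x * g x\<bar> * (2 * B)" for n
      by (intro AE_I2) (simp add: abs_mult mult_left_mono)
    have Zlim: "(\<lambda>n. Z (real (Suc n) * (x - c))) \<longlonglongrightarrow> (if x > c then 1 else 0)" for x c
    proof (cases "x > c")
      case True
      obtain N where N: "inverse (real (Suc N)) < x - c" using reals_Archimedean[of "x - c"] True by auto
      have "Z (real (Suc n) * (x - c)) = 1" if "n \<ge> N" for n
      proof (rule Z(3))
        have "inverse (real (Suc n)) \<le> inverse (real (Suc N))" using that by (simp add: field_simps)
        then have "inverse (real (Suc n)) \<le> x - c" using N by linarith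
        then show "1 \<le> real (Suc n) * (x - c)" by (simp add: field_simps del: of_nat_Suc)
      qed
      then show ?thesis using True by (auto intro!: tendsto_eventually eventually_sequentiallyI)
    next
      case False
      then have "Z (real (Suc n) * (x - c)) = 0" for n
        by (intro Z(2)) (auto simp: mult_le_0_iff simp del: of_nat_Suc)
      then show ?thesis using False by simp
    qed
    show "AE x in lebesgue. (\<lambda>n. indicator {a..u} x * g x * \<theta> n x) \<longlonglongrightarrow> indicator {a..u} x * g x * indicator {a<..b} x"
    proof (rule AE_I2, rule tendsto_mult_left)
      fix x
      show "(\<lambda>n. \<theta> n x) \<longlonglongrightarrow> indicator {a<..b} x"
        unfolding \<theta>_def using tendsto_diff[OF Zlim[of x a] Zlim[of x b]] ab
        by (auto simp: indicator_def split: if_splits)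
    qed
  qed
  have "(LINT x|lebesgue. (indicator {a..u} x * g x) * \<theta> n x) = (LINT x|lebesgue. g x * \<theta> n x)" if "n \<ge> N" for n
    by (rule Bochner_Integration.integral_cong) (use \<theta>z(1)[OF that] in \<open>auto simp: indicator_def\<close>)
  then have "(LINT x|lebesgue. F x * \<theta>' n x) = - (LINT x|lebesgue. (indicator {a..u} x * g x) * \<theta> n x)" if "n \<ge> N" for n
    using ibp[OF that] that by simp
  then have "(\<lambda>n. - (LINT x|lebesgue. (indicator {a..u} x * g x) * \<theta> n x)) \<longlonglongrightarrow> F a - F b"
    by (intro Lim_transform_eventually[OF lim1]) (auto intro: eventually_sequentiallyI)
  from LIMSEQ_unique[OF this tendsto_minus[OF lim2]]
  have "F b - F a = (LINT x|lebesgue. (indicator {a..u} x * g x) * indicator {a<..b} x)" by simp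
  also have "\<dots> = (LINT x:{a..b}|lebesgue. g x)"
    unfolding set_lebesgue_integral_def
  proof (rule integrable_lebesgue_cong_AE(2))
    have "AE x in lebesgue. x \<noteq> a" by (rule AE_completion[OF AE_lborel_singleton])
    then show "AE x in lebesgue. indicator {a..u} x * g x * indicator {a<..b} x = indicat_real {a..b} x *\<^sub>R g x"
      by eventually_elim (use lu in \<open>auto simp: indicator_def\<close>)
  qed
  finally show ?thesis using Feq[of a] Feq[of b] lu ab by simp
qed

text \<open>The half-lines {..x} are stable under intersection and generate the Borel sets, so by
  Dynkin's argument the integral vanishes over every Borel set. Since they generate no more than the
  Borel sets, h is first replaced by a Borel measurable representative.\<close>

lemma AE_0_if_primitive_0:
  fixes h :: "real \<Rightarrow> real"
  assumes h: "integrable lebesgue h" and z: "\<And>x. (LINT y:{..x}|lebesgue. h y) = 0"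
  shows "AE x in lebesgue. h x = 0"
proof -
  obtain h' where h': "h' \<in> borel_measurable lborel" "AE x in lborel. h x = h' x"
    using completion_ex_borel_measurable_real[OF borel_measurable_integrable[OF h]] by blast
  have hh': "AE x in lebesgue. h x = h' x" using AE_completion[OF h'(2)] .
  have "integrable lebesgue h'" using integrable_lebesgue_cong_AE(1)[OF hh'] h by simp
  then have i': "integrable lborel h'" using integrable_completion[OF h'(1)] by simp
  have iA: "set_integrable lborel A h'" if "A \<in> sets borel" for A
    using i' that unfolding set_integrable_def by (intro integrable_mult_indicator) auto
  have eq: "(LINT y:A|lebesgue. h y) = (LINT y:A|lborel. h' y)" if "A \<in> sets borel" for A
  proof -
    have "(LINT y:A|lebesgue. h y) = (LINT y:A|lebesgue. h' y)"
      unfolding set_lebesgue_integral_def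
      by (rule integrable_lebesgue_cong_AE(2)) (use hh' in \<open>eventually_elim, simp\<close>)
    also have "\<dots> = (LINT y:A|lborel. h' y)"
      unfolding set_lebesgue_integral_def
      by (rule integral_completion) (use h' that in \<open>auto intro!: borel_measurable_scaleR borel_measurable_indicator\<close>)
    finally show ?thesis .
  qed
  have z': "(LINT y:{..x}|lborel. h' y) = 0" for x using eq[of "{..x}"] z by simp
  \<comment> \<open>Complements in the Dynkin induction require that the total integral vanishes
    too.\<close>
  have ztot: "(LINT y|lborel. h' y) = 0"
  proof -
    have "(\<lambda>n. LINT y:{..real n}|lborel. h' y) \<longlonglongrightarrow> (LINT y:(\<Union>n. {..real n})|lborel. h' y)"
      by (rule set_integral_cont_up) (auto intro!: iA simp: incseq_def)
    moreover have "(\<Union>n. {..real n}) = UNIV" by (auto intro: real_arch_simple)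
    ultimately have "(\<lambda>n. 0::real) \<longlonglongrightarrow> (LINT y:UNIV|lborel. h' y)" using z' by simp
    then have "(LINT y:UNIV|lborel. h' y) = 0" by (rule LIMSEQ_unique) (rule tendsto_const)
    then show ?thesis by (simp add: set_lebesgue_integral_def)
  qed
  have "(LINT y:A|lborel. h' y) = 0" if "A \<in> sets lborel" for A
  proof -
    have A: "A \<in> sigma_sets UNIV (range (\<lambda>a::real. {..a}))"
      using that by (simp add: borel_eq_atMost)
    show ?thesis
    proof (rule sigma_sets_induct_disjoint[OF _ _ A, where P="\<lambda>A. A \<in> sets borel \<and> (LINT y:A|lborel. h' y) = 0", THEN conjunct2])
      show "Int_stable (range (\<lambda>a::real. {..a}))" by (auto simp: Int_stable_def)
    next
      fix A assume "A \<in> sigma_sets UNIV (range (\<lambda>a::real. {..a}))" and P: "A \<in> sets borel \<and> (LINT y:A|lborel. h' y) = 0"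
      have "(LINT y:A \<union> (UNIV - A)|lborel. h' y) = (LINT y:A|lborel. h' y) + (LINT y:UNIV - A|lborel. h' y)"
        by (rule set_integral_Un) (use P iA in auto)
      then show "UNIV - A \<in> sets borel \<and> (LINT y:UNIV - A|lborel. h' y) = 0"
        using P ztot sets.compl_sets[of A borel] by (simp add: set_lebesgue_integral_def Un_Diff_cancel)
    next
      fix A :: "nat \<Rightarrow> real set"
      assume A: "disjoint_family A" "\<And>i. A i \<in> sets borel \<and> (LINT y:A i|lborel. h' y) = 0"
      have U: "(\<Union>i. A i) \<in> sets borel" using A(2) by blast
      have "(LINT y:(\<Union>i. A i)|lborel. h' y) = (\<Sum>i. (LINT y:A i|lborel. h' y))"
        by (rule lebesgue_integral_countable_add) (use A iA[OF U] in \<open>auto simp: disjoint_family_on_def\<close>)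
      then show "(\<Union>i. A i) \<in> sets borel \<and> (LINT y:(\<Union>i. A i)|lborel. h' y) = 0" using A U by simp
    qed (use z' in \<open>auto simp: set_lebesgue_integral_def\<close>)
  qed
  then have "AE x in lborel. h' x = 0" by (intro sigma_finite_measure.density_zero[OF sigma_finite_lborel] i')
  then have "AE x in lebesgue. h' x = 0" by (rule AE_completion)
  then show ?thesis using hh' by eventually_elim simp
qed

text \<open>Stated for countably many intervals, because the applications exhaust the line by
  bounded intervals, and (0,T] by intervals that stay away from 0.\<close>

lemma AE_0_if_interval_integrals_0:
  fixes h :: "real \<Rightarrow> real"
  assumes h: "\<And>n::nat. set_integrable lebesgue {l n..u n} h"
    and z: "\<And>n x. x \<in> {l n..u n} \<Longrightarrow> (LINT y:{l n..x}|lebesgue. h y) = 0"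
  shows "AE x in lebesgue. x \<in> (\<Union>n. {l n..u n}) \<longrightarrow> h x = 0"
proof -
  have "AE x in lebesgue. indicator {l n..u n} x * h x = 0" for n
  proof (rule AE_0_if_primitive_0)
    show "integrable lebesgue (\<lambda>x. indicator {l n..u n} x * h x)" using h[of n] by (simp add: set_integrable_def)
    fix x
    have "(LINT y:{..x}|lebesgue. indicator {l n..u n} y * h y) = (LINT y:{l n..min x (u n)}|lebesgue. h y)"
      unfolding set_lebesgue_integral_def by (rule Bochner_Integration.integral_cong) (auto simp: indicator_def)
    also have "\<dots> = 0"
    proof (cases "l n \<le> min x (u n)")
      case True then show ?thesis by (intro z) auto
    qed (simp add: set_lebesgue_integral_def)
    finally show "(LINT y:{..x}|lebesgue. indicator {l n..u n} y * h y) = 0" .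
  qed
  then have "AE x in lebesgue. \<forall>n. indicator {l n..u n} x * h x = 0" unfolding AE_all_countable by blast
  then show ?thesis
  proof eventually_elim
    fix x assume *: "\<forall>n. indicator {l n..u n} x * h x = 0"
    show "x \<in> (\<Union>n. {l n..u n}) \<longrightarrow> h x = 0"
    proof
      assume "x \<in> (\<Union>n. {l n..u n})"
      then obtain n where "x \<in> {l n..u n}" by blast
      with *[rule_format, of n] show "h x = 0" by simp
    qed
  qed
qed

text \<open>The difference of the two candidates is a weak derivative of the zero function, so its
  integrals over all bounded intervals vanish by \<open>has_weak_deriv_FTC\<close>.\<close>

lemma has_weak_deriv_unique:
  assumes "has_weak_deriv UNIV f g1" "has_weak_deriv UNIV f g2"
  shows "AE x in lebesgue. g1 x = g2 x"
proof -
  have wd: "has_weak_deriv UNIV (\<lambda>x. f x + (-1) * f x) (\<lambda>x. g1 x + (-1) * g2 x)"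
    by (intro has_weak_deriv_add has_weak_deriv_cmult assms) auto
  have 0: "(LINT y:{a..b}|lebesgue. g1 y + (-1) * g2 y) = 0" if "a \<le> b" for a b
    using has_weak_deriv_FTC[OF wd _ _ that] by simp
  have "AE x in lebesgue. x \<in> (\<Union>n. {- real n..real n}) \<longrightarrow> g1 x + (-1) * g2 x = 0"
  proof (rule AE_0_if_interval_integrals_0)
    show "set_integrable lebesgue {- real n..real n} (\<lambda>x. g1 x + (-1) * g2 x)" for n
      using has_weak_deriv_L1_loc(2)[OF wd] by (rule L1_loc_Icc) simp
    show "(LINT y:{- real n..x}|lebesgue. g1 y + (-1) * g2 y) = 0" if "x \<in> {- real n..real n}" for n x
      using 0 that by simp
  qed
  moreover have "x \<in> (\<Union>n. {- real n..real n})" for x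
  proof -
    obtain n where "\<bar>x\<bar> \<le> real n" using real_arch_simple by blast
    then show ?thesis by (auto intro!: exI[of _ n])
  qed
  ultimately show ?thesis by (auto elim: eventually_mono)
qed

section \<open>Exponential moments\<close>

lemma sum_le_sums_nonneg:
  fixes f :: "nat \<Rightarrow> real"
  assumes "f sums s" "\<And>k. 0 \<le> f k"
  shows "(\<Sum>k<N. f k) \<le> s"
  using sum_le_suminf[OF sums_summable[OF assms(1)], of "{..<N}"] assms by (simp add: sums_iff)

text \<open>Mikusinski's trick: \<open>1 - exp (- exp (n (t - x)))\<close> is a series in \<open>exp (k n (t - x))\<close>, \<open>k \<ge> 1\<close>,
  and tends to the indicator of \<open>t > x\<close> as \<open>n\<close> grows.\<close>

lemma exponential_moments_subexponential_imp_0: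
  fixes h :: "real \<Rightarrow> real"
  assumes h: "set_integrable lebesgue {0..T} h"
    and bd: "\<And>e. e > 0 \<Longrightarrow> \<exists>C. \<forall>s\<ge>1. \<bar>LINT t:{0..T}|lebesgue. exp (s * t) * h t\<bar> \<le> C * exp (e * s)"
  shows "AE t in lebesgue. t \<in> {0<..T} \<longrightarrow> h t = 0"
proof -
  define H where "H t = indicator {0..T} t * h t" for t
  have Hi: "integrable lebesgue H" using h by (simp add: set_integrable_def H_def[abs_def])
  have Hm: "H \<in> borel_measurable lebesgue" using Hi by (rule borel_measurable_integrable)
  define f where "f s = (LINT t|lebesgue. exp (s * t) * H t)" for s
  have f_eq: "f s = (LINT t:{0..T}|lebesgue. exp (s * t) * h t)" for s
    unfolding f_def set_lebesgue_integral_def H_def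
    by (rule Bochner_Integration.integral_cong) auto
  have expm: "(\<lambda>t. g t * H t) \<in> borel_measurable lebesgue" if "continuous_on UNIV g" for g :: "real \<Rightarrow> real"
    using that by (intro borel_measurable_times Hm measurable_completion) (simp add: borel_measurable_continuous_onI)
  have fi: "integrable lebesgue (\<lambda>t. g t * H t)" if g: "continuous_on UNIV g" for g :: "real \<Rightarrow> real"
    using integrable_mult_continuous_support[of 0 T "\<lambda>t. h t" "\<lambda>t. g t"]
      set_integrable_mult_continuous[OF h continuous_on_subset[OF g subset_UNIV]]
    unfolding set_integrable_def H_def
    by (rule_tac Bochner_Integration.integrable_cong[THEN iffD1, OF refl, rotated]) (auto simp: algebra_simps)
  have key: "(LINT t:{x<..T}|lebesgue. h t) = 0" if x: "x > 0" for x
  proof -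
    \<comment> \<open>With growth rate x/2 the k-th term of the series below keeps a net factor exp
      (- k n x / 2); hence the whole series is at most C (exp z - 1) with z = exp (- n x / 2), which
      tends to 0.\<close>
    obtain C where C: "\<And>s. s \<ge> 1 \<Longrightarrow> \<bar>f s\<bar> \<le> C * exp (x / 2 * s)"
      using bd[of "x / 2"] x unfolding f_eq by auto
    have C0: "C \<ge> 0" using C[of 1] by (smt (verit) exp_gt_zero mult_neg_pos)
    define G where "G n t = 1 - exp (- exp (real n * (t - x)))" for n t
    have Gc: "continuous_on UNIV (G n)" for n unfolding G_def by (intro continuous_intros)
    have bnd: "\<bar>LINT t|lebesgue. G n t * H t\<bar> \<le> C * (exp (exp (- (real n * x / 2))) - 1)" if n: "n \<ge> 1" for n
    proof -
      define y where "y t = exp (real n * (t - x))" for t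
      \<comment> \<open>The constant term of the exponential series cancels against the 1 in
        \<open>G\<close>. This matters, because the moments are controlled only for s \<ge> 1 and
        the term k = 0 would involve s = 0.\<close>
      define c where "c k t = (if k = 0 then 0 else - ((- y t) ^ k / fact k))" for k t
      have yc: "continuous_on UNIV y" unfolding y_def by (intro continuous_intros)
      have cc: "continuous_on UNIV (c k)" for k
        unfolding c_def using yc by (cases "k = 0") (auto intro!: continuous_intros)
      have sums: "(\<lambda>k. c k t) sums G n t" for t
      proof -
        have "(\<lambda>k. (- y t) ^ k /\<^sub>R fact k) sums exp (- y t)" by (rule exp_converges)
        then have "(\<lambda>k. - ((- y t) ^ k / fact k)) sums (- exp (- y t))"
          by (intro sums_minus) (simp add: divide_inverse mult.commute)
        from sums_add[OF this sums_single[of 0 "\<lambda>_. 1"]]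
        have "(\<lambda>k. - ((- y t) ^ k / fact k) + (if k = 0 then 1 else 0)) sums G n t"
          by (simp add: G_def y_def)
        moreover have "- ((- y t) ^ k / fact k) + (if k = 0 then 1 else 0) = c k t" for k
          by (simp add: c_def)
        ultimately show ?thesis by simp
      qed
      have cint: "(LINT t|lebesgue. c k t * H t) =
          (if k = 0 then 0 else - ((-1) ^ k / fact k * exp (- (real k * real n * x)) * f (real k * real n)))" for k
      proof (cases "k = 0")
        case False
        have "c k t * H t = - ((-1) ^ k / fact k * exp (- (real k * real n * x))) * (exp (real k * real n * t) * H t)" for t
        proof -
          have "(- y t) ^ k = (-1) ^ k * exp (real k * (real n * (t - x)))"
            unfolding y_def by (subst power_minus) (simp add: exp_of_nat_mult)
          moreover have "exp (real k * (real n * (t - x))) = exp (- (real k * real n * x)) * exp (real k * real n * t)"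
            by (simp add: algebra_simps flip: exp_add)
          ultimately show ?thesis using False by (simp add: c_def)
        qed
        then show ?thesis using False by (simp add: f_def)
      qed (simp add: c_def)
      have part: "\<bar>\<Sum>k<N. LINT t|lebesgue. c k t * H t\<bar> \<le> C * (exp (exp (- (real n * x / 2))) - 1)" for N
      proof -
        define z where "z = exp (- (real n * x / 2))"
        have "\<bar>LINT t|lebesgue. c k t * H t\<bar> \<le> C * (z ^ k / fact k - (if k = 0 then 1 else 0))" for k
        proof (cases "k = 0")
          case False
          then have "real k * real n \<ge> 1" using n by (metis One_nat_def Suc_leI mult_le_mono nat_mult_1 neq0_conv of_nat_1 of_nat_le_iff of_nat_mult)
          from C[OF this] have "\<bar>f (real k * real n)\<bar> \<le> C * exp (x / 2 * (real k * real n))" .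
          then have "exp (- (real k * real n * x)) * \<bar>f (real k * real n)\<bar> \<le>
              exp (- (real k * real n * x)) * (C * exp (x / 2 * (real k * real n)))"
            by (rule mult_left_mono) simp
          also have "\<dots> = C * exp (- (real k * real n * x) + x / 2 * (real k * real n))"
            by (simp only: exp_add mult_ac)
          also have "- (real k * real n * x) + x / 2 * (real k * real n) = real k * (- (real n * x / 2))"
            by (simp add: field_simps)
          also have "exp \<dots> = z ^ k" unfolding z_def by (rule exp_of_nat_mult)
          finally have "exp (- (real k * real n * x)) * \<bar>f (real k * real n)\<bar> / fact k \<le> C * z ^ k / fact k"
            by (rule divide_right_mono) simp
          then show ?thesis using False unfolding cint by (simp add: abs_mult power_abs)
        qed (simp add: cint)
        then have "\<bar>\<Sum>k<N. LINT t|lebesgue. c k t * H t\<bar> \<le> (\<Sum>k<N. C * (z ^ k / fact k - (if k = 0 then 1 else 0)))"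
          by (intro order_trans[OF sum_abs] sum_mono)
        also have "\<dots> \<le> C * (exp z - 1)"
        proof (rule sum_le_sums_nonneg)
          show "(\<lambda>k. C * (z ^ k / fact k - (if k = 0 then 1 else 0))) sums (C * (exp z - 1))"
            using sums_diff[OF exp_converges[of z] sums_single[of 0 "\<lambda>_. 1"]]
            by (intro sums_mult) (simp add: divide_inverse mult.commute)
          show "0 \<le> C * (z ^ k / fact k - (if k = 0 then 1 else 0))" for k
            using C0 by (auto simp: z_def)
        qed
        finally show ?thesis unfolding z_def .
      qed
      have lim: "(\<lambda>N. LINT t|lebesgue. (\<Sum>k<N. c k t) * H t) \<longlonglongrightarrow> (LINT t|lebesgue. G n t * H t)"
      proof (rule integral_dominated_convergence[where w = "\<lambda>t. exp (y t) * \<bar>H t\<bar>"])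
        show "(\<lambda>t. G n t * H t) \<in> borel_measurable lebesgue" by (rule expm[OF Gc])
        show "(\<lambda>t. (\<Sum>k<N. c k t) * H t) \<in> borel_measurable lebesgue" for N
          by (rule expm) (intro continuous_intros cc)
        have "integrable lebesgue (\<lambda>t. exp (y t) * H t)" by (rule fi) (intro continuous_intros yc)
        from integrable_abs[OF this] show "integrable lebesgue (\<lambda>t. exp (y t) * \<bar>H t\<bar>)" by (simp add: abs_mult)
        show "AE t in lebesgue. (\<lambda>N. (\<Sum>k<N. c k t) * H t) \<longlonglongrightarrow> G n t * H t"
          using sums by (intro AE_I2 tendsto_mult_right) (simp add: sums_def)
        show "AE t in lebesgue. norm ((\<Sum>k<N. c k t) * H t) \<le> exp (y t) * \<bar>H t\<bar>" for N
        proof (rule AE_I2)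
          fix t
          have "\<bar>\<Sum>k<N. c k t\<bar> \<le> (\<Sum>k<N. y t ^ k / fact k)"
            by (intro order_trans[OF sum_abs] sum_mono) (auto simp: c_def y_def power_abs)
          also have "\<dots> \<le> exp (y t)"
          proof (rule sum_le_sums_nonneg)
            show "(\<lambda>k. y t ^ k / fact k) sums exp (y t)"
              using exp_converges[of "y t"] by (simp add: divide_inverse mult.commute)
          qed (simp add: y_def)
          finally show "norm ((\<Sum>k<N. c k t) * H t) \<le> exp (y t) * \<bar>H t\<bar>"
            by (simp add: abs_mult mult_right_mono)
        qed
      qed
      have "(LINT t|lebesgue. (\<Sum>k<N. c k t) * H t) = (\<Sum>k<N. LINT t|lebesgue. c k t * H t)" for N
        unfolding sum_distrib_right by (rule Bochner_Integration.integral_sum) (rule fi[OF cc])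
      with lim part show ?thesis
        by (intro tendsto_upperbound[OF tendsto_rabs[OF lim]]) (auto intro!: always_eventually)
    qed
    have l1: "(\<lambda>n. LINT t|lebesgue. G n t * H t) \<longlonglongrightarrow> 0"
    proof (rule tendsto_0_le[where K = 1])
      have *: "filterlim (\<lambda>n. real n * (x / 2)) at_top sequentially"
        using x by (intro filterlim_at_top_mult_tendsto_pos[OF tendsto_const] filterlim_real_sequentially | simp add: mult.commute)+
      have "(\<lambda>n. exp (- (real n * x / 2))) \<longlonglongrightarrow> 0"
        using filterlim_compose[OF exp_at_bot filterlim_compose[OF filterlim_uminus_at_bot_at_top *]] by simp
      then have "(\<lambda>n. C * (exp (exp (- (real n * x / 2))) - 1)) \<longlonglongrightarrow> C * (exp 0 - 1)"
        by (intro tendsto_intros)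
      then show "(\<lambda>n. C * (exp (exp (- (real n * x / 2))) - 1)) \<longlonglongrightarrow> 0" by simp
      show "\<forall>\<^sub>F n in sequentially. norm (LINT t|lebesgue. G n t * H t) \<le> norm (C * (exp (exp (- (real n * x / 2))) - 1)) * 1"
        using bnd by (intro eventually_sequentiallyI[of 1]) (auto intro: order_trans[OF _ abs_ge_self])
    qed
    have l2: "(\<lambda>n. LINT t|lebesgue. G n t * H t) \<longlonglongrightarrow> (LINT t|lebesgue. indicator {x<..} t * H t)"
    proof (rule integral_dominated_convergence[where w = "\<lambda>t. \<bar>H t\<bar>"])
      show "(\<lambda>t. G n t * H t) \<in> borel_measurable lebesgue" for n by (rule expm[OF Gc])
      show "(\<lambda>t. indicator {x<..} t * H t) \<in> borel_measurable lebesgue"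
        by (intro borel_measurable_times Hm borel_measurable_indicator) simp
      show "integrable lebesgue (\<lambda>t. \<bar>H t\<bar>)" using Hi by simp
      have "\<bar>G n t\<bar> \<le> 1" for n t by (simp add: G_def)
      then show "AE t in lebesgue. norm (G n t * H t) \<le> \<bar>H t\<bar>" for n
        by (intro AE_I2) (simp add: abs_mult mult_left_le_one_le)
      \<comment> \<open>At t = x every \<open>G n\<close> has the value 1 - exp (-1), so this null
        set is left out.\<close>
      have "AE t in lebesgue. t \<noteq> x" by (rule AE_completion[OF AE_lborel_singleton])
      then show "AE t in lebesgue. (\<lambda>n. G n t * H t) \<longlonglongrightarrow> indicator {x<..} t * H t"
      proof eventually_elim
        fix t assume t: "t \<noteq> x"
        have "(\<lambda>n. G n t) \<longlonglongrightarrow> indicator {x<..} t"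
        proof (cases "t > x")
          case True
          have *: "filterlim (\<lambda>n. real n * (t - x)) at_top sequentially"
            using True by (intro filterlim_at_top_mult_tendsto_pos[OF tendsto_const] filterlim_real_sequentially | simp add: mult.commute)+
          have "(\<lambda>n. exp (- exp (real n * (t - x)))) \<longlonglongrightarrow> 0"
            using filterlim_compose[OF exp_at_bot filterlim_compose[OF filterlim_uminus_at_bot_at_top filterlim_compose[OF exp_at_top *]]] .
          from tendsto_diff[OF tendsto_const[of 1] this] show ?thesis using True by (simp add: G_def)
        next
          case False
          then have "t < x" using t by simp
          then have *: "filterlim (\<lambda>n. real n * (x - t)) at_top sequentially"
            by (intro filterlim_at_top_mult_tendsto_pos[OF tendsto_const] filterlim_real_sequentially | simp add: mult.commute)+
          have eq: "- (real n * (x - t)) = real n * (t - x)" for n by (simp add: algebra_simps)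
          have "(\<lambda>n. exp (real n * (t - x))) \<longlonglongrightarrow> 0"
            using filterlim_compose[OF exp_at_bot filterlim_compose[OF filterlim_uminus_at_bot_at_top *]] unfolding eq .
          then have "(\<lambda>n. 1 - exp (- exp (real n * (t - x)))) \<longlonglongrightarrow> 1 - exp (- 0)"
            by (intro tendsto_intros)
          then show ?thesis using False by (simp add: G_def)
        qed
        then show "(\<lambda>n. G n t * H t) \<longlonglongrightarrow> indicator {x<..} t * H t" by (rule tendsto_mult_right)
      qed
    qed
    have "(LINT t|lebesgue. indicator {x<..} t * H t) = 0" by (rule LIMSEQ_unique[OF l2 l1])
    moreover have "(LINT t:{x<..T}|lebesgue. h t) = (LINT t|lebesgue. indicator {x<..} t * H t)"
      unfolding set_lebesgue_integral_def H_def
      by (rule Bochner_Integration.integral_cong) (use x in \<open>auto simp: indicator_def\<close>)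
    ultimately show ?thesis by simp
  qed
  have hs: "set_integrable lebesgue A h" if "A \<subseteq> {0..T}" "A \<in> sets lebesgue" for A
    by (rule set_integrable_subset[OF h]) (use that in auto)
  \<comment> \<open>\<open>key\<close> is available for x > 0 only; therefore (0,T] is exhausted by
    intervals bounded away from 0.\<close>
  have "AE t in lebesgue. t \<in> (\<Union>n. {inverse (real (Suc n))..T}) \<longrightarrow> h t = 0"
  proof (rule AE_0_if_interval_integrals_0)
    show "set_integrable lebesgue {inverse (real (Suc n))..T} h" for n
    proof (rule hs)
      have "0 \<le> inverse (real (Suc n))" by simp
      then show "{inverse (real (Suc n))..T} \<subseteq> {0..T}" unfolding atLeastatMost_subset_iff by simp
    qed simp
    fix n x assume x: "x \<in> {inverse (real (Suc n))..T}"
    define l where "l = inverse (real (Suc n))"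
    have l: "0 < l" "l \<le> x" "x \<le> T" using x by (auto simp: l_def)
    have "(LINT y:{l<..x} \<union> {x<..T}|lebesgue. h y) = (LINT y:{l<..x}|lebesgue. h y) + (LINT y:{x<..T}|lebesgue. h y)"
      by (rule set_integral_Un) (use l in \<open>auto intro!: hs\<close>)
    moreover have "{l<..x} \<union> {x<..T} = {l<..T}" using l by auto
    ultimately have "(LINT y:{l<..x}|lebesgue. h y) = 0" using key[of l] key[of x] l by simp
    moreover have "(LINT y:{l..x}|lebesgue. h y) = (LINT y:{l<..x}|lebesgue. h y)"
      unfolding set_lebesgue_integral_def
    proof (rule integrable_lebesgue_cong_AE(2))
      have "AE y in lebesgue. y \<noteq> l" by (rule AE_completion[OF AE_lborel_singleton])
      then show "AE y in lebesgue. indicat_real {l..x} y *\<^sub>R h y = indicat_real {l<..x} y *\<^sub>R h y"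
        by eventually_elim (auto simp: indicator_def)
    qed
    ultimately show "(LINT y:{inverse (real (Suc n))..x}|lebesgue. h y) = 0" by (simp add: l_def)
  qed
  then show ?thesis
  proof eventually_elim
    fix t assume *: "t \<in> (\<Union>n. {inverse (real (Suc n))..T}) \<longrightarrow> h t = 0"
    show "t \<in> {0<..T} \<longrightarrow> h t = 0"
    proof
      assume t: "t \<in> {0<..T}"
      then obtain n where "inverse (real (Suc n)) < t" using reals_Archimedean[of t] by auto
      then have "t \<in> {inverse (real (Suc n))..T}" using t by auto
      then show "h t = 0" using * by blast
    qed
  qed
qed

section \<open>Semi-inner products and square integrable functions\<close>

lemma tendsto_0_if_square_tendsto_0:
  fixes f :: "nat \<Rightarrow> real"
  assumes "(\<lambda>n. (f n)\<^sup>2) \<longlonglongrightarrow> 0"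
  shows "f \<longlonglongrightarrow> 0"
  using tendsto_real_sqrt[OF assms] by (simp add: tendsto_rabs_zero_iff)

text \<open>The form is only semidefinite: elements are functions and not classes, so a vanishing
  square does not mean a vanishing function. Keeping \<open>V\<close> and \<open>B\<close> abstract
  serves both the plain scalar products and the energy form on \<open>H1\<close>.\<close>

locale form_space =
  fixes V :: "('a \<Rightarrow> real) set" and B :: "('a \<Rightarrow> real) \<Rightarrow> ('a \<Rightarrow> real) \<Rightarrow> real"
  assumes lin: "v \<in> V \<Longrightarrow> w \<in> V \<Longrightarrow> (\<lambda>x. a * v x + b * w x) \<in> V"
    and sym: "v \<in> V \<Longrightarrow> w \<in> V \<Longrightarrow> B v w = B w v"
    and Blin: "u \<in> V \<Longrightarrow> v \<in> V \<Longrightarrow> w \<in> V \<Longrightarrow> B (\<lambda>x. a * u x + b * v x) w = a * B u w + b * B v w"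
    and pos: "v \<in> V \<Longrightarrow> 0 \<le> B v v"
begin

lemma Blin2: "u \<in> V \<Longrightarrow> v \<in> V \<Longrightarrow> w \<in> V \<Longrightarrow> B w (\<lambda>x. a * u x + b * v x) = a * B w u + b * B w v"
  using Blin[of u v w a b] sym[OF _ lin[of u v a b], of w] sym[of u w] sym[of v w] by simp

lemma square_expand:
  assumes "u \<in> V" "w \<in> V"
  shows "B (\<lambda>x. a * u x + b * w x) (\<lambda>x. a * u x + b * w x) = a\<^sup>2 * B u u + 2 * a * b * B u w + b\<^sup>2 * B w w"
proof -
  have "B (\<lambda>x. a * u x + b * w x) (\<lambda>x. a * u x + b * w x) = a * (a * B u u + b * B u w) + b * (a * B w u + b * B w w)"
    using assms by (simp add: Blin Blin2 lin)
  then show ?thesis using sym[OF assms] by (simp add: power2_eq_square algebra_simps)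
qed

lemma diff_in: "u \<in> V \<Longrightarrow> w \<in> V \<Longrightarrow> (\<lambda>x. u x - w x) \<in> V"
  using lin[of u w 1 "-1"] by simp

lemma B_diff: "u \<in> V \<Longrightarrow> v \<in> V \<Longrightarrow> w \<in> V \<Longrightarrow> B (\<lambda>x. u x - v x) w = B u w - B v w"
  using Blin[of u v w 1 "-1"] by simp

lemma square_diff:
  "u \<in> V \<Longrightarrow> w \<in> V \<Longrightarrow> B (\<lambda>x. u x - w x) (\<lambda>x. u x - w x) = B u u - 2 * B u w + B w w"
  using square_expand[of u w 1 "-1"] by simp

lemma Cauchy_Schwarz_sq:
  assumes "u \<in> V" "w \<in> V"
  shows "(B u w)\<^sup>2 \<le> B u u * B w w"
proof (cases "B w w = 0")
  case True
  have "B u w = 0"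
  proof (rule ccontr)
    assume nz: "B u w \<noteq> 0"
    \<comment> \<open>The value at which the affine function \<open>B u u + 2 * t * B u w\<close> of
      t equals -1, in contradiction with positivity.\<close>
    define t where "t = - (B u u + 1) / (2 * B u w)"
    have "0 \<le> B (\<lambda>x. 1 * u x + t * w x) (\<lambda>x. 1 * u x + t * w x)" by (intro pos lin assms)
    also have "\<dots> = B u u + 2 * t * B u w" using square_expand[OF assms, of 1 t] True by simp
    also have "\<dots> = -1" using nz by (simp add: t_def field_simps)
    finally show False by simp
  qed
  then show ?thesis using True by simp
next
  case False
  then have p: "B w w > 0" using pos[OF assms(2)] by simp
  have "0 \<le> B (\<lambda>x. B w w * u x + (- B u w) * w x) (\<lambda>x. B w w * u x + (- B u w) * w x)"
    by (intro pos lin assms)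
  also have "\<dots> = (B w w)\<^sup>2 * B u u + 2 * B w w * (- B u w) * B u w + (- B u w)\<^sup>2 * B w w"
    by (rule square_expand[OF assms])
  also have "\<dots> = B w w * (B u u * B w w - (B u w)\<^sup>2)" by (simp add: power2_eq_square algebra_simps)
  finally show ?thesis using p by (simp add: zero_le_mult_iff)
qed

lemma Cauchy_Schwarz:
  assumes "u \<in> V" "w \<in> V"
  shows "\<bar>B u w\<bar> \<le> sqrt (B u u) * sqrt (B w w)"
  using real_sqrt_le_mono[OF Cauchy_Schwarz_sq[OF assms]] by (simp add: real_sqrt_mult)

text \<open>The representative is the limit of a minimising sequence of \<open>B v v - 2 l v\<close>.\<close>

lemma Riesz:
  assumes ne: "V \<noteq> {}"
    and llin: "\<And>u v a b. u \<in> V \<Longrightarrow> v \<in> V \<Longrightarrow> l (\<lambda>x. a * u x + b * v x) = a * l u + b * l v"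
    and lbd: "\<And>u. u \<in> V \<Longrightarrow> \<bar>l u\<bar> \<le> C * sqrt (B u u)"
    and complete: "\<And>F. (\<And>n::nat. F n \<in> V) \<Longrightarrow>
      (\<And>e. e > 0 \<Longrightarrow> \<exists>N. \<forall>m\<ge>N. \<forall>n\<ge>N. B (\<lambda>x. F m x - F n x) (\<lambda>x. F m x - F n x) < e) \<Longrightarrow>
      \<exists>v\<in>V. (\<lambda>n. B (\<lambda>x. F n x - v x) (\<lambda>x. F n x - v x)) \<longlonglongrightarrow> 0"
  shows "\<exists>v\<in>V. \<forall>w\<in>V. B w v = l w"
proof -
  define J where "J v = B v v - 2 * l v" for v
  have Jlow: "J v \<ge> - (C\<^sup>2)" if "v \<in> V" for v
  proof -
    have "0 \<le> (sqrt (B v v) - C)\<^sup>2" by simp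
    also have "\<dots> = B v v - 2 * C * sqrt (B v v) + C\<^sup>2" using pos[OF that] by (simp add: power2_diff)
    finally show ?thesis using lbd[OF that] unfolding J_def by linarith
  qed
  define j where "j = Inf (J ` V)"
  have bb: "bdd_below (J ` V)" by (rule bdd_belowI[of _ "- (C\<^sup>2)"]) (use Jlow in auto)
  have jle: "j \<le> J v" if "v \<in> V" for v unfolding j_def using bb that by (auto intro: cInf_lower)
  have "\<exists>v\<in>V. J v < j + inverse (real (Suc n))" for n
  proof -
    have "Inf (J ` V) < j + inverse (real (Suc n))" unfolding j_def by simp
    then show ?thesis using cInf_lessD[of "J ` V"] ne by blast
  qed
  then obtain F where F: "\<And>n. F n \<in> V" "\<And>n. J (F n) < j + inverse (real (Suc n))" by metis
  \<comment> \<open>Parallelogram identity: 2 J(u) + 2 J(w) - 4 J((u + w) / 2) is the square of u -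
    w, and the value at the midpoint is at least \<open>j\<close>. Minimising sequences are
    therefore Cauchy.\<close>
  have par: "B (\<lambda>x. F m x - F n x) (\<lambda>x. F m x - F n x) \<le> 2 * inverse (real (Suc m)) + 2 * inverse (real (Suc n))" for m n
  proof -
    have "j \<le> J (\<lambda>x. (1/2) * F m x + (1/2) * F n x)" by (intro jle lin F)
    also have "\<dots> = (1/4) * B (F m) (F m) + (1/2) * B (F m) (F n) + (1/4) * B (F n) (F n) - l (F m) - l (F n)"
      unfolding J_def square_expand[OF F(1) F(1)] llin[OF F(1) F(1)] by (simp add: power2_eq_square)
    finally show ?thesis
      using F(2)[of m] F(2)[of n] unfolding square_diff[OF F(1) F(1)] J_def by linarith
  qed
  have "\<exists>v\<in>V. (\<lambda>n. B (\<lambda>x. F n x - v x) (\<lambda>x. F n x - v x)) \<longlonglongrightarrow> 0"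
  proof (rule complete[OF F(1)])
    fix e :: real assume "e > 0"
    then obtain N where N: "inverse (real (Suc N)) < e / 4" using reals_Archimedean[of "e / 4"] by auto
    have "B (\<lambda>x. F m x - F n x) (\<lambda>x. F m x - F n x) < e" if "m \<ge> N" "n \<ge> N" for m n
    proof -
      have "inverse (real (Suc m)) \<le> inverse (real (Suc N))" "inverse (real (Suc n)) \<le> inverse (real (Suc N))"
        using that by (auto intro!: le_imp_inverse_le)
      then show ?thesis using par[of m n] N by linarith
    qed
    then show "\<exists>N. \<forall>m\<ge>N. \<forall>n\<ge>N. B (\<lambda>x. F m x - F n x) (\<lambda>x. F m x - F n x) < e" by blast
  qed
  then obtain v where v: "v \<in> V" "(\<lambda>n. B (\<lambda>x. F n x - v x) (\<lambda>x. F n x - v x)) \<longlonglongrightarrow> 0" by blast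
  have "B w v = l w" if w: "w \<in> V" for w
  proof -
    \<comment> \<open>Adding 1 keeps the divisor positive when w is degenerate. Below,
      \<open>t = - a / c\<close> minimises 2 t a + t^2 c with minimum - a^2 / c, and near-minimality
      of \<open>F n\<close> forces a^2 / c to be small.\<close>
    define c where "c = B w w + 1"
    have c: "c \<ge> 1" using pos[OF w] by (simp add: c_def)
    have sq: "(B (F n) w - l w)\<^sup>2 \<le> inverse (real (Suc n)) * c" for n
    proof -
      define a where "a = B (F n) w - l w"
      define t where "t = - a / c"
      have "j \<le> J (\<lambda>x. 1 * F n x + t * w x)" by (intro jle lin F w)
      also have "\<dots> = J (F n) + 2 * t * a + t\<^sup>2 * B w w"
        unfolding J_def square_expand[OF F(1) w] llin[OF F(1) w] a_def by (simp add: algebra_simps)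
      finally have "0 \<le> inverse (real (Suc n)) + 2 * t * a + t\<^sup>2 * B w w" using F(2)[of n] by linarith
      also have "\<dots> \<le> inverse (real (Suc n)) + 2 * t * a + t\<^sup>2 * c" by (simp add: c_def mult_left_mono)
      also have "2 * t * a = - 2 * a\<^sup>2 / c" by (simp add: t_def power2_eq_square)
      also have "t\<^sup>2 * c = a\<^sup>2 / c" using c by (simp add: t_def power2_eq_square)
      finally have "0 \<le> inverse (real (Suc n)) - a\<^sup>2 / c" by simp
      then have "a\<^sup>2 / c \<le> inverse (real (Suc n))" by simp
      then have "a\<^sup>2 \<le> inverse (real (Suc n)) * c" using c by (simp add: pos_divide_le_eq del: of_nat_Suc)
      then show ?thesis by (simp add: a_def)
    qed
    have "(\<lambda>n. (B (F n) w - l w)\<^sup>2) \<longlonglongrightarrow> 0"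
    proof (rule tendsto_sandwich[of "\<lambda>_. 0"])
      show "(\<lambda>n. inverse (real (Suc n)) * c) \<longlonglongrightarrow> 0"
        using tendsto_mult_right[OF LIMSEQ_inverse_real_of_nat, of c] by simp
    qed (use sq in auto)
    then have "(\<lambda>n. B (F n) w - l w) \<longlonglongrightarrow> 0" by (rule tendsto_0_if_square_tendsto_0) 
    moreover have "(\<lambda>n. (B (F n) w - B v w)\<^sup>2) \<longlonglongrightarrow> 0"
    proof (rule tendsto_sandwich[of "\<lambda>_. 0"])
      show "(\<lambda>n. B (\<lambda>x. F n x - v x) (\<lambda>x. F n x - v x) * B w w) \<longlonglongrightarrow> 0"
        using tendsto_mult_right[OF v(2), of "B w w"] by simp
      show "\<forall>\<^sub>F n in sequentially. (B (F n) w - B v w)\<^sup>2 \<le> B (\<lambda>x. F n x - v x) (\<lambda>x. F n x - v x) * B w w"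
        using Cauchy_Schwarz_sq[OF diff_in[OF F(1) v(1)] w] by (simp add: B_diff F v w)
    qed auto
    then have "(\<lambda>n. B (F n) w - B v w) \<longlonglongrightarrow> 0" by (rule tendsto_0_if_square_tendsto_0) 
    ultimately have "(\<lambda>n. (B (F n) w - l w) - (B (F n) w - B v w)) \<longlonglongrightarrow> 0 - 0" by (rule tendsto_diff)
    then have "(\<lambda>n::nat. B v w - l w) \<longlonglongrightarrow> 0" by simp
    then have "B v w = l w" by (simp add: LIMSEQ_const_iff)
    then show ?thesis using sym[OF v(1) w] by simp
  qed
  then show ?thesis using v by blast
qed

end

section \<open>Square integrable functions over an arbitrary measure\<close>

definition square_integrable :: "'a measure \<Rightarrow> ('a \<Rightarrow> real) set" where
  "square_integrable M = {f \<in> borel_measurable M. integrable M (\<lambda>x. (f x)\<^sup>2)}"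

lemma square_integrableD:
  assumes "f \<in> square_integrable M"
  shows "f \<in> borel_measurable M" "integrable M (\<lambda>x. (f x)\<^sup>2)"
  using assms by (auto simp: square_integrable_def)

lemma square_integrable_mult:
  assumes "f \<in> square_integrable M" "g \<in> square_integrable M"
  shows "integrable M (\<lambda>x. f x * g x)"
proof (rule Bochner_Integration.integrable_bound)
  note fg = square_integrableD[OF assms(1)] square_integrableD[OF assms(2)]
  show "integrable M (\<lambda>x. (f x)\<^sup>2 + (g x)\<^sup>2)" using fg by auto
  show "(\<lambda>x. f x * g x) \<in> borel_measurable M" using fg by auto
  have "\<bar>a * b\<bar> \<le> a\<^sup>2 + b\<^sup>2" for a b :: real
    using sum_squares_bound[of "\<bar>a\<bar>" "\<bar>b\<bar>"] mult_nonneg_nonneg[of "\<bar>a\<bar>" "\<bar>b\<bar>"]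
    by (simp add: abs_mult del: mult_nonneg_nonneg zero_le_mult_iff)
  then show "AE x in M. norm (f x * g x) \<le> norm ((f x)\<^sup>2 + (g x)\<^sup>2)" by (intro AE_I2) simp
qed

lemma square_integrable_lin:
  assumes "f \<in> square_integrable M" "g \<in> square_integrable M"
  shows "(\<lambda>x. a * f x + b * g x) \<in> square_integrable M"
proof -
  have "integrable M (\<lambda>x. a\<^sup>2 * (f x)\<^sup>2 + (2 * a * b) * (f x * g x) + b\<^sup>2 * (g x)\<^sup>2)"
    using square_integrable_mult[OF assms] square_integrableD[OF assms(1)] square_integrableD[OF assms(2)]
    by (intro Bochner_Integration.integrable_add integrable_mult_right) auto
  moreover have "(a * f x + b * g x)\<^sup>2 = a\<^sup>2 * (f x)\<^sup>2 + (2 * a * b) * (f x * g x) + b\<^sup>2 * (g x)\<^sup>2" for x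
    by (simp add: power2_eq_square algebra_simps)
  ultimately show ?thesis
    using square_integrableD[OF assms(1)] square_integrableD[OF assms(2)] by (auto simp: square_integrable_def)
qed

lemma square_integrable_bounded_mult:
  assumes f: "f \<in> square_integrable M" and g: "g \<in> borel_measurable M" "\<And>x. \<bar>g x\<bar> \<le> C"
  shows "(\<lambda>x. g x * f x) \<in> square_integrable M"
proof -
  note fD = square_integrableD[OF f]
  have "integrable M (\<lambda>x. (g x * f x)\<^sup>2)"
  proof (rule Bochner_Integration.integrable_bound)
    show "integrable M (\<lambda>x. C\<^sup>2 * (f x)\<^sup>2)" using fD by auto
    show "(\<lambda>x. (g x * f x)\<^sup>2) \<in> borel_measurable M" using fD g by auto
    have "(g x)\<^sup>2 \<le> C\<^sup>2" for x using power_mono[OF g(2)[of x], of 2] by simp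
    then show "AE x in M. norm ((g x * f x)\<^sup>2) \<le> norm (C\<^sup>2 * (f x)\<^sup>2)"
      by (intro AE_I2) (simp add: power_mult_distrib mult_right_mono)
  qed
  then show ?thesis using fD g by (auto simp: square_integrable_def)
qed

interpretation L2: form_space "square_integrable M" "\<lambda>f g. integral\<^sup>L M (\<lambda>x. f x * g x)" for M :: "'a measure"
proof
  fix u v w :: "'a \<Rightarrow> real" and a b :: real
  assume uvw: "u \<in> square_integrable M" "v \<in> square_integrable M" "w \<in> square_integrable M"
  have "integral\<^sup>L M (\<lambda>x. (a * u x + b * v x) * w x) = integral\<^sup>L M (\<lambda>x. a * (u x * w x) + b * (v x * w x))"
    by (simp add: algebra_simps)
  then show "integral\<^sup>L M (\<lambda>x. (a * u x + b * v x) * w x) = a * integral\<^sup>L M (\<lambda>x. u x * w x) + b * integral\<^sup>L M (\<lambda>x. v x * w x)"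
    using square_integrable_mult[OF uvw(1,3)] square_integrable_mult[OF uvw(2,3)] by simp
qed (auto intro: square_integrable_lin simp: mult.commute)

text \<open>Riesz-Fischer. Along indices with squared distances below 8^(-k), the weighted sum of
  4^k d_k^2 has finite integral; hence almost everywhere the increments d_k are eventually at most
  2^(-k), and the sequence converges. Fatou's lemma turns the pointwise limit into a limit in mean,
  along the full sequence.\<close>

lemma square_integrable_complete:
  assumes F: "\<And>n::nat. F n \<in> square_integrable M"
    and C: "\<And>e. e > 0 \<Longrightarrow> \<exists>N. \<forall>m\<ge>N. \<forall>n\<ge>N. integral\<^sup>L M (\<lambda>x. (F m x - F n x)\<^sup>2) < e"
  shows "\<exists>f\<in>square_integrable M. (\<lambda>n. integral\<^sup>L M (\<lambda>x. (F n x - f x)\<^sup>2)) \<longlonglongrightarrow> 0"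
proof -
  have Fm[measurable]: "F n \<in> borel_measurable M" for n using square_integrableD[OF F] by blast
  have Fi: "integrable M (\<lambda>x. (F m x - F n x)\<^sup>2)" for m n
    using L2.diff_in[OF F F] by (simp add: square_integrable_def)
  have nnF: "(\<integral>\<^sup>+x. ennreal ((F m x - F n x)\<^sup>2) \<partial>M) = ennreal (integral\<^sup>L M (\<lambda>x. (F m x - F n x)\<^sup>2))" for m n
    by (rule nn_integral_eq_integral[OF Fi]) simp
  have "\<forall>k. \<exists>N. \<forall>m\<ge>N. \<forall>n\<ge>N. integral\<^sup>L M (\<lambda>x. (F m x - F n x)\<^sup>2) < (1/8) ^ k" using C by simp
  then obtain N where N: "\<And>k m n. m \<ge> N k \<Longrightarrow> n \<ge> N k \<Longrightarrow> integral\<^sup>L M (\<lambda>x. (F m x - F n x)\<^sup>2) < (1/8) ^ k" by metis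
  \<comment> \<open>Partial sums are monotone and dominate each \<open>N k\<close>; repeated indices
    do no harm.\<close>
  define r where "r k = (\<Sum>i\<le>k. N i)" for k
  have rN: "r k \<ge> N k" for k unfolding r_def by (rule member_le_sum) auto
  have rS: "r (Suc k) \<ge> N k" for k using rN[of k] by (simp add: r_def)
  define d where "d k x = F (r (Suc k)) x - F (r k) x" for k x
  have dm[measurable]: "d k \<in> borel_measurable M" for k unfolding d_def by measurable
  have "(\<integral>\<^sup>+x. (\<Sum>k. ennreal (4 ^ k * (d k x)\<^sup>2)) \<partial>M) = (\<Sum>k. \<integral>\<^sup>+x. ennreal (4 ^ k * (d k x)\<^sup>2) \<partial>M)"
    by (rule nn_integral_suminf) measurable
  also have "\<dots> \<le> (\<Sum>k. ennreal ((1/2) ^ k))"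
  proof (rule suminf_le)
    fix k
    have "(\<integral>\<^sup>+x. ennreal (4 ^ k * (d k x)\<^sup>2) \<partial>M) = ennreal (4 ^ k) * ennreal (integral\<^sup>L M (\<lambda>x. (d k x)\<^sup>2))"
      unfolding d_def nnF[symmetric] by (subst nn_integral_cmult[symmetric]) (auto simp: ennreal_mult)
    also have "\<dots> \<le> ennreal (4 ^ k) * ennreal ((1/8) ^ k)"
      unfolding d_def using N[OF rS rN, of k] by (intro mult_left_mono ennreal_leI) auto
    also have "\<dots> = ennreal ((1/2) ^ k)" by (simp flip: ennreal_mult power_mult_distrib)
    finally show "(\<integral>\<^sup>+x. ennreal (4 ^ k * (d k x)\<^sup>2) \<partial>M) \<le> ennreal ((1/2) ^ k)" .
  qed auto
  also have "\<dots> = ennreal (\<Sum>k. (1/2) ^ k)" by (rule suminf_ennreal2) (auto simp: summable_geometric)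
  also have "\<dots> < \<infinity>" by simp
  finally have "(\<integral>\<^sup>+x. (\<Sum>k. ennreal (4 ^ k * (d k x)\<^sup>2)) \<partial>M) \<noteq> \<infinity>" by simp
  then have fin: "AE x in M. (\<Sum>k. ennreal (4 ^ k * (d k x)\<^sup>2)) \<noteq> \<infinity>"
    by (intro nn_integral_noteq_infinite) measurable
  define f where "f x = lim (\<lambda>k. F (r k) x)" for x
  have fm[measurable]: "f \<in> borel_measurable M" unfolding f_def by measurable
  have conv: "AE x in M. (\<lambda>k. F (r k) x) \<longlonglongrightarrow> f x"
    using fin
  proof eventually_elim
    fix x assume "(\<Sum>k. ennreal (4 ^ k * (d k x)\<^sup>2)) \<noteq> \<infinity>"
    then have "summable (\<lambda>k. 4 ^ k * (d k x)\<^sup>2)" by (intro summable_suminf_not_top) auto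
    then have "(\<lambda>k. 4 ^ k * (d k x)\<^sup>2) \<longlonglongrightarrow> 0" by (rule summable_LIMSEQ_zero)
    then have "\<forall>\<^sub>F k in sequentially. 4 ^ k * (d k x)\<^sup>2 < 1" by (rule order_tendstoD) simp
    then have ev: "\<forall>\<^sub>F k in sequentially. norm (d k x) \<le> (1/2) ^ k"
    proof eventually_elim
      fix k assume k: "4 ^ k * (d k x)\<^sup>2 < 1"
      have "(d k x)\<^sup>2 \<le> ((1/2) ^ k)\<^sup>2"
      proof -
        have "((1/2) ^ k)\<^sup>2 = 1 / (4::real) ^ k"
          by (simp add: power2_eq_square power_one_over flip: power_mult_distrib)
        then show ?thesis using k by (simp add: field_simps)
      qed
      then show "norm (d k x) \<le> (1/2) ^ k" by (simp add: abs_le_square_iff[symmetric] power_abs)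
    qed
    have "summable (\<lambda>k. d k x)" by (rule summable_comparison_test_ev[OF ev]) (simp add: summable_geometric)
    then have "convergent (\<lambda>n. \<Sum>k<n. d k x)" by (simp add: summable_iff_convergent)
    moreover have "(\<Sum>k<n. d k x) = F (r n) x - F (r 0) x" for n
      unfolding d_def by (rule sum_lessThan_telescope)
    ultimately have "convergent (\<lambda>n. F (r n) x - F (r 0) x)" by simp
    then have "convergent (\<lambda>n. F (r n) x)" by (simp add: convergent_diff_const_right_iff)
    then show "(\<lambda>k. F (r k) x) \<longlonglongrightarrow> f x" unfolding f_def by (simp add: convergent_LIMSEQ_iff)
  qed
  have key: "(\<integral>\<^sup>+x. ennreal ((F n x - f x)\<^sup>2) \<partial>M) \<le> ennreal ((1/8) ^ k)" if n: "n \<ge> N k" for n k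
  proof -
    have "(\<integral>\<^sup>+x. ennreal ((F n x - f x)\<^sup>2) \<partial>M) = (\<integral>\<^sup>+x. liminf (\<lambda>i. ennreal ((F n x - F (r i) x)\<^sup>2)) \<partial>M)"
    proof (rule nn_integral_cong_AE)
      show "AE x in M. ennreal ((F n x - f x)\<^sup>2) = liminf (\<lambda>i. ennreal ((F n x - F (r i) x)\<^sup>2))"
        using conv
      proof eventually_elim
        fix x assume "(\<lambda>k. F (r k) x) \<longlonglongrightarrow> f x"
        then have "(\<lambda>i. ennreal ((F n x - F (r i) x)\<^sup>2)) \<longlonglongrightarrow> ennreal ((F n x - f x)\<^sup>2)"
          by (intro tendsto_intros)
        then show "ennreal ((F n x - f x)\<^sup>2) = liminf (\<lambda>i. ennreal ((F n x - F (r i) x)\<^sup>2))"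
          by (rule lim_imp_Liminf[OF trivial_limit_sequentially, symmetric])
      qed
    qed
    also have "\<dots> \<le> liminf (\<lambda>i. \<integral>\<^sup>+x. ennreal ((F n x - F (r i) x)\<^sup>2) \<partial>M)"
      by (rule nn_integral_liminf) measurable
    also have "\<dots> \<le> ennreal ((1/8) ^ k)"
    proof -
      have "\<forall>\<^sub>F i in sequentially. (\<integral>\<^sup>+x. ennreal ((F n x - F (r i) x)\<^sup>2) \<partial>M) \<le> ennreal ((1/8) ^ k)"
      proof (rule eventually_sequentiallyI[of k])
        fix i assume "k \<le> i"
        then have "r i \<ge> r k" unfolding r_def by (intro sum_mono2) auto
        then have "r i \<ge> N k" using rN[of k] by simp
        from N[OF n this] show "(\<integral>\<^sup>+x. ennreal ((F n x - F (r i) x)\<^sup>2) \<partial>M) \<le> ennreal ((1/8) ^ k)"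
          unfolding nnF by (intro ennreal_leI) simp
      qed
      then have "Limsup sequentially (\<lambda>i. \<integral>\<^sup>+x. ennreal ((F n x - F (r i) x)\<^sup>2) \<partial>M) \<le> ennreal ((1/8) ^ k)"
        by (rule Limsup_bounded)
      then show ?thesis using Liminf_le_Limsup[OF trivial_limit_sequentially] order_trans by blast
    qed
    finally show ?thesis .
  qed
  have int: "integrable M (\<lambda>x. (F n x - f x)\<^sup>2)" if "n \<ge> N k" for n k
  proof (rule integrableI_bounded)
    have "(\<integral>\<^sup>+x. ennreal (norm ((F n x - f x)\<^sup>2)) \<partial>M) \<le> ennreal ((1/8) ^ k)" using key[OF that] by simp
    also have "\<dots> < \<infinity>" by simp
    finally show "(\<integral>\<^sup>+x. ennreal (norm ((F n x - f x)\<^sup>2)) \<partial>M) < \<infinity>" .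
  qed measurable
  have intle: "integral\<^sup>L M (\<lambda>x. (F n x - f x)\<^sup>2) \<le> (1/8) ^ k" if "n \<ge> N k" for n k
    using key[OF that] nn_integral_eq_integral[OF int[OF that]] by simp
  have "(\<lambda>x. F (N 0) x - f x) \<in> square_integrable M"
    using int[of 0 "N 0"] by (simp add: square_integrable_def)
  from L2.diff_in[OF F[of "N 0"] this] have fS: "f \<in> square_integrable M" by simp
  have "(\<lambda>n. integral\<^sup>L M (\<lambda>x. (F n x - f x)\<^sup>2)) \<longlonglongrightarrow> 0"
  proof (rule LIMSEQ_I)
    fix e :: real assume "e > 0"
    then obtain k where k: "(1/8) ^ k < e" using real_arch_pow_inv[of e "1/8"] by auto
    have "norm (integral\<^sup>L M (\<lambda>x. (F n x - f x)\<^sup>2) - 0) < e" if "n \<ge> N k" for n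
      using intle[OF that] k by (simp add: abs_of_nonneg)
    then show "\<exists>no. \<forall>n\<ge>no. norm (integral\<^sup>L M (\<lambda>x. (F n x - f x)\<^sup>2) - 0) < e" by blast
  qed
  then show ?thesis using fS by blast
qed

lemma square_integral_0_AE:
  assumes "f \<in> square_integrable M" "integral\<^sup>L M (\<lambda>x. f x * f x) = 0"
  shows "AE x in M. f x = 0"
  using integral_nonneg_eq_0_iff_AE[of M "\<lambda>x. (f x)\<^sup>2"] assms
  by (auto simp: square_integrable_def power2_eq_square)

section \<open>Linear differential equations on the half-line\<close>

lemma continuous_on_Ici_Icc:
  fixes f :: "real \<Rightarrow> 'a::topological_space"
  shows "continuous_on {0..} f \<Longrightarrow> continuous_on {0..x} f"
  by (erule continuous_on_subset) auto

lemma integral_has_vector_derivative_Ici: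
  fixes f :: "real \<Rightarrow> 'a::banach"
  assumes f: "continuous_on {0..} f" and x: "x \<ge> 0"
  shows "((\<lambda>u. integral {0..u} f) has_vector_derivative f x) (at x within {0..})"
proof -
  have "((\<lambda>u. integral {0..u} f) has_vector_derivative f x) (at x within {0..x + 1})"
    by (rule integral_has_vector_derivative[OF continuous_on_Ici_Icc[OF f]]) (use x in auto)
  moreover have "at x within {0..x + 1} = at x within {0..}"
    by (rule at_within_nhd[of x "{..<x + 1}"]) auto
  ultimately show ?thesis by simp
qed

lemma continuous_on_integral_Ici:
  fixes f :: "real \<Rightarrow> 'a::banach"
  assumes f: "continuous_on {0..} f"
  shows "continuous_on {0..} (\<lambda>x. integral {0..x} f)"
  unfolding continuous_on_eq_continuous_within
  using integral_has_vector_derivative_Ici[OF f] has_vector_derivative_continuous by fastforce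

lemma DERIV_nonneg_Ici_imp_mono:
  fixes h :: "real \<Rightarrow> real"
  assumes "\<And>x. x \<ge> 0 \<Longrightarrow> (h has_real_derivative h' x) (at x within {0..})" "\<And>x. x \<ge> 0 \<Longrightarrow> h' x \<ge> 0"
    and "0 \<le> a" "a \<le> b"
  shows "h a \<le> h b"
proof (rule DERIV_nonneg_imp_increasing_open[OF assms(4)])
  fix x assume "a < x" "x < b"
  then have "(h has_real_derivative h' x) (at x)"
    using assms(1)[of x] assms(3) at_within_interior[of x "{0..}"] by auto
  then show "\<exists>y. (h has_real_derivative y) (at x) \<and> 0 \<le> y"
    using assms(2)[of x] \<open>a < x\<close> assms(3) by auto
next
  have "continuous_on {0..} h"
    by (rule DERIV_continuous_on) (use assms(1) in auto)
  then show "continuous_on {a..b} h" by (rule continuous_on_subset) (use assms(3) in auto)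
qed

text \<open>With g the right-hand side of the hypothesis, g exp (- \<integral> b) has derivative b
  (f - g) exp (- \<integral> b), which is nonpositive; \<open>h\<close> is the negative of this
  product. The sign of f does not enter.\<close>

lemma gronwall:
  fixes f b :: "real \<Rightarrow> real"
  assumes f: "continuous_on {0..} f" and b: "continuous_on {0..} b" "\<And>x. x \<ge> 0 \<Longrightarrow> b x \<ge> 0"
    and le: "\<And>x. x \<ge> 0 \<Longrightarrow> f x \<le> C + integral {0..x} (\<lambda>t. b t * f t)" and x: "x \<ge> 0"
  shows "f x \<le> C * exp (integral {0..x} b)"
proof -
  define g where "g x = C + integral {0..x} (\<lambda>t. b t * f t)" for x
  define h where "h x = - (g x * exp (- integral {0..x} b))" for x
  have g': "(g has_real_derivative b x * f x) (at x within {0..})" if "x \<ge> 0" for x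
  proof -
    have "((\<lambda>u. integral {0..u} (\<lambda>t. b t * f t)) has_real_derivative b x * f x) (at x within {0..})"
      unfolding has_real_derivative_iff_has_vector_derivative
      by (rule integral_has_vector_derivative_Ici[OF _ that]) (intro continuous_intros f b)
    from DERIV_add[OF DERIV_const this] show ?thesis unfolding g_def by simp
  qed
  have b': "((\<lambda>x. integral {0..x} b) has_real_derivative b x) (at x within {0..})" if "x \<ge> 0" for x
    unfolding has_real_derivative_iff_has_vector_derivative
    by (rule integral_has_vector_derivative_Ici[OF b(1) that])
  have h': "(h has_real_derivative b x * (g x - f x) * exp (- integral {0..x} b)) (at x within {0..})" if "x \<ge> 0" for x
    unfolding h_def by (auto intro!: derivative_eq_intros g' b' that simp: algebra_simps)
  have "h 0 \<le> h x"
    by (rule DERIV_nonneg_Ici_imp_mono[OF h']) (use le b x in \<open>auto simp: g_def\<close>)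
  then have "g x * exp (- integral {0..x} b) \<le> C" by (simp add: h_def g_def)
  then have "g x \<le> C * exp (integral {0..x} b)" by (simp add: exp_minus field_simps)
  then show ?thesis using le[OF x] by (simp add: g_def)
qed

text \<open>The Picard map is a contraction for the supremum norm weighted by \<open>exp (- 2 \<integral> b)\<close>.\<close>

lemma linear_ode_exists:
  fixes L :: "real \<Rightarrow> complex \<Rightarrow> complex" and b :: "real \<Rightarrow> real"
  assumes b: "continuous_on {0..} b" "\<And>x. x \<ge> 0 \<Longrightarrow> b x \<ge> 0"
    and lip: "\<And>x z w. x \<ge> 0 \<Longrightarrow> norm (L x z - L x w) \<le> b x * norm (z - w)"
    and L0: "\<And>x. L x 0 = 0"
    and cont: "\<And>A. continuous_on {0..} A \<Longrightarrow> continuous_on {0..} (\<lambda>x. L x (A x))"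
  shows "\<exists>A. continuous_on {0..} A \<and> (\<forall>x\<ge>0. A x = a0 + integral {0..x} (\<lambda>t. L t (A t)))"
proof -
  define \<beta> where "\<beta> x = integral {0..x} b" for x
  have \<beta>': "(\<beta> has_real_derivative b x) (at x within {0..})" if "x \<ge> 0" for x
    unfolding \<beta>_def has_real_derivative_iff_has_vector_derivative
    by (rule integral_has_vector_derivative_Ici[OF b(1) that])
  have \<beta>c: "continuous_on {0..} \<beta>" by (rule DERIV_continuous_on) (use \<beta>' in auto)
  have \<beta>0: "\<beta> x \<ge> 0" if "x \<ge> 0" for x
    unfolding \<beta>_def using b that by (intro integral_nonneg integrable_continuous_real continuous_on_Ici_Icc) auto
  \<comment> \<open>Source of the contraction factor 1/2: integrating b against the weight exp (2
    \<beta>) returns at most half of the weight.\<close>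
  have ibe: "integral {0..x} (\<lambda>t. b t * exp (2 * \<beta> t)) = (exp (2 * \<beta> x) - 1) / 2" if "x \<ge> 0" for x
  proof -
    have "((\<lambda>t. b t * exp (2 * \<beta> t)) has_integral exp (2 * \<beta> x) / 2 - exp (2 * \<beta> 0) / 2) {0..x}"
    proof (rule fundamental_theorem_of_calculus[OF that])
      fix y assume "y \<in> {0..x}"
      then have "((\<lambda>t. exp (2 * \<beta> t) / 2) has_real_derivative b y * exp (2 * \<beta> y)) (at y within {0..})"
        by (auto intro!: derivative_eq_intros \<beta>')
      then show "((\<lambda>t. exp (2 * \<beta> t) / 2) has_vector_derivative b y * exp (2 * \<beta> y)) (at y within {0..x})"
        unfolding has_real_derivative_iff_has_vector_derivative[symmetric] by (rule DERIV_subset) auto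
    qed
    then show ?thesis by (simp add: integral_unique \<beta>_def diff_divide_distrib)
  qed
  \<comment> \<open>The unknown is y with A = exp (2 \<beta>) y. Evaluation at
    \<open>max 0 x\<close> in \<open>Tf\<close> extends the map to the whole line, so that the fixed
    point can be sought in the complete space of bounded continuous functions.\<close>
  define U where "U y x = a0 + integral {0..x} (\<lambda>t. L t (of_real (exp (2 * \<beta> t)) * y t))" for y :: "real \<Rightarrow> complex" and x
  define Tf where "Tf y x = of_real (exp (- (2 * \<beta> (max 0 x)))) * U y (max 0 x)" for y :: "real \<Rightarrow> complex" and x
  have Lc: "continuous_on {0..} (\<lambda>t. L t (of_real (exp (2 * \<beta> t)) * y t))" if "continuous_on UNIV y" for y
    by (intro cont continuous_intros \<beta>c continuous_on_subset[OF that]) auto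
  have Uc: "continuous_on {0..} (U y)" if "continuous_on UNIV y" for y
    unfolding U_def by (intro continuous_intros continuous_on_integral_Ici Lc that)
  have Tc: "continuous_on UNIV (Tf y)" if "continuous_on UNIV y" for y
    unfolding Tf_def
    by (intro continuous_intros continuous_on_compose2[OF \<beta>c] continuous_on_compose2[OF Uc[OF that]]) auto
  have Udiff: "norm (U y x - U z x) \<le> (exp (2 * \<beta> x) - 1) / 2 * D"
    if yz: "continuous_on UNIV y" "continuous_on UNIV z" "\<And>t. norm (y t - z t) \<le> D" and x: "x \<ge> 0" for y z x D
  proof -
    have i: "(\<lambda>t. L t (of_real (exp (2 * \<beta> t)) * y t)) integrable_on {0..x}"
      "(\<lambda>t. L t (of_real (exp (2 * \<beta> t)) * z t)) integrable_on {0..x}"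
      by (intro integrable_continuous_real continuous_on_Ici_Icc Lc yz)+
    have i2: "(\<lambda>t. b t * exp (2 * \<beta> t) * D) integrable_on {0..x}"
      by (intro integrable_continuous_real continuous_on_Ici_Icc continuous_intros b \<beta>c)
    have "U y x - U z x = integral {0..x} (\<lambda>t. L t (of_real (exp (2 * \<beta> t)) * y t) - L t (of_real (exp (2 * \<beta> t)) * z t))"
      unfolding U_def using integral_diff[OF i] by simp
    also have "norm \<dots> \<le> integral {0..x} (\<lambda>t. b t * exp (2 * \<beta> t) * D)"
    proof (rule integral_norm_bound_integral[OF integrable_diff[OF i] i2])
      fix t assume t: "t \<in> {0..x}"
      have "norm (L t (of_real (exp (2 * \<beta> t)) * y t) - L t (of_real (exp (2 * \<beta> t)) * z t)) \<le>
          b t * norm (of_real (exp (2 * \<beta> t)) * y t - of_real (exp (2 * \<beta> t)) * z t)"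
        using t by (intro lip) auto
      also have "norm (of_real (exp (2 * \<beta> t)) * y t - of_real (exp (2 * \<beta> t)) * z t) = exp (2 * \<beta> t) * norm (y t - z t)"
        by (simp add: norm_mult flip: right_diff_distrib)
      also have "b t * (exp (2 * \<beta> t) * norm (y t - z t)) \<le> b t * (exp (2 * \<beta> t) * D)"
        using t b yz(3) by (intro mult_left_mono) auto
      finally show "norm (L t (of_real (exp (2 * \<beta> t)) * y t) - L t (of_real (exp (2 * \<beta> t)) * z t))
          \<le> b t * exp (2 * \<beta> t) * D" by (simp add: mult.assoc)
    qed
    also have "\<dots> = (exp (2 * \<beta> x) - 1) / 2 * D" using ibe[OF x] by simp
    finally show ?thesis .
  qed
  have Tdiff: "norm (Tf y x - Tf z x) \<le> 1/2 * D"
    if yz: "continuous_on UNIV y" "continuous_on UNIV z" "\<And>t. norm (y t - z t) \<le> D" for y z x D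
  proof -
    define x' where "x' = max 0 x"
    have x': "x' \<ge> 0" by (simp add: x'_def)
    have D: "D \<ge> 0" using yz(3)[of 0] norm_ge_zero order_trans by blast
    have "norm (Tf y x - Tf z x) = exp (- (2 * \<beta> x')) * norm (U y x' - U z x')"
      unfolding Tf_def x'_def[symmetric] by (simp add: norm_mult flip: right_diff_distrib)
    also have "\<dots> \<le> exp (- (2 * \<beta> x')) * ((exp (2 * \<beta> x') - 1) / 2 * D)"
      by (intro mult_left_mono Udiff yz x') auto
    also have "\<dots> = (1 - exp (- (2 * \<beta> x'))) / 2 * D"
      by (simp add: field_simps flip: exp_add)
    also have "\<dots> \<le> 1/2 * D" using D by (intro mult_right_mono) auto
    finally show ?thesis .
  qed
  have Tb: "Tf y \<in> bcontfun" if y: "y \<in> bcontfun" for y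
  proof -
    have yc: "continuous_on UNIV y" using y by (simp add: bcontfun_def)
    obtain D where D: "\<And>t. norm (y t) \<le> D"
      using y unfolding bcontfun_def bounded_iff by auto
    \<comment> \<open>By \<open>Tdiff\<close> it suffices to bound one image; that of 0 is explicit
      because L vanishes at 0.\<close>
    have "norm (Tf (\<lambda>_. 0) x) \<le> norm a0" for x
    proof -
      have "norm (Tf (\<lambda>_. 0) x) = exp (- (2 * \<beta> (max 0 x))) * norm a0"
        unfolding Tf_def U_def by (simp add: L0 norm_mult)
      also have "\<dots> \<le> 1 * norm a0" using \<beta>0[of "max 0 x"] by (intro mult_right_mono) auto
      finally show ?thesis by simp
    qed
    moreover have "norm (Tf y x - Tf (\<lambda>_. 0) x) \<le> 1/2 * D" for x
      by (rule Tdiff) (use yc D in auto)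
    ultimately have "norm (Tf y x) \<le> norm a0 + 1/2 * D" for x
      by (smt (verit) norm_triangle_sub)
    then show ?thesis by (intro bcontfun_normI[OF Tc[OF yc]])
  qed
  define T where "T y = Bcontfun (Tf (apply_bcontfun y))" for y :: "real \<Rightarrow>\<^sub>C complex"
  have Tapp: "apply_bcontfun (T y) = Tf (apply_bcontfun y)" for y
    unfolding T_def by (rule Bcontfun_inverse[OF Tb[OF apply_bcontfun]])
  have "\<exists>!y. T y = y"
  proof (rule banach_fix_type[of "1/2"])
    show "\<forall>y z. dist (T y) (T z) \<le> 1/2 * dist y z"
    proof (intro allI dist_bound)
      fix y z :: "real \<Rightarrow>\<^sub>C complex" and x
      show "dist (apply_bcontfun (T y) x) (apply_bcontfun (T z) x) \<le> 1/2 * dist y z"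
        unfolding Tapp dist_norm[of "Tf _ _"]
        by (rule Tdiff) (auto intro: dist_bounded simp flip: dist_norm)
    qed
  qed auto
  then obtain y where y: "T y = y" by blast
  define A where "A x = of_real (exp (2 * \<beta> x)) * apply_bcontfun y x" for x
  have "A x = a0 + integral {0..x} (\<lambda>t. L t (A t))" if "x \<ge> 0" for x
  proof -
    have "apply_bcontfun y x = Tf (apply_bcontfun y) x" using Tapp[of y] y by simp
    also have "\<dots> = of_real (exp (- (2 * \<beta> x))) * (a0 + integral {0..x} (\<lambda>t. L t (A t)))"
      using that by (simp add: Tf_def U_def A_def)
    finally show ?thesis
      unfolding A_def[of x] by (simp only: mult.assoc[symmetric] of_real_mult[symmetric] exp_add[symmetric]) simp
  qed
  moreover have "continuous_on {0..} A"
    unfolding A_def by (intro continuous_intros \<beta>c) auto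
  ultimately show ?thesis by blast
qed

text \<open>Cancellation is exhibited by translating by half a period.\<close>

lemma oscillatory_integral_bound:
  fixes F :: "real \<Rightarrow> complex"
  assumes ab: "a < b" "b \<le> a + 1" and z: "F a = 0" "F b = 0" and y: "y \<ge> 0"
    and M: "\<And>t. t \<in> {a..b} \<Longrightarrow> norm (F t) \<le> M"
    and L: "\<And>t u. t \<in> {a..b} \<Longrightarrow> u \<in> {a..b} \<Longrightarrow> norm (F t - F u) \<le> L * \<bar>t - u\<bar>"
  shows "norm (integral {a..b} (\<lambda>t. cis (t * y) * F t)) \<le> 20 * (M + L) / (1 + y)"
proof -
  have M0: "M \<ge> 0" using M[of a] ab by (auto intro: order_trans[OF norm_ge_zero])
  have L0: "L \<ge> 0"
  proof (rule ccontr)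
    assume "\<not> L \<ge> 0"
    then have "L * \<bar>a - b\<bar> < 0" using ab by (intro mult_neg_pos) auto
    then show False using L[of a b] ab norm_ge_zero[of "F a - F b"] by auto
  qed
  have Fc: "continuous_on {a..b} F"
    by (rule lipschitz_on_continuous_on[of L]) (use L L0 in \<open>auto intro!: lipschitz_onI simp: dist_norm\<close>)
    show ?thesis
  proof (cases "y \<le> 1")
    case True
    have "norm (integral {a..b} (\<lambda>t. cis (t * y) * F t)) \<le> M * (b - a)"
      by (rule integral_bound) (use ab M in \<open>auto intro!: continuous_intros Fc simp: norm_mult\<close>)
    also have "\<dots> \<le> M * 1" using M0 ab by (intro mult_left_mono) auto
    also have "M * 1 \<le> 20 * (M + L) / (1 + y)"
    proof -
      have "M * (1 + y) \<le> M * 20" using M0 True by (intro mult_left_mono) auto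
      then show ?thesis using y L0 by (simp add: pos_le_divide_eq)
    qed
    finally show ?thesis .
  next
    case y1: False
    \<comment> \<open>Clamping to [a,b] extends \<open>F\<close> by zero, since \<open>F\<close>
      vanishes at both ends, and it preserves the Lipschitz constant. The extension can be
      translated freely on the line.\<close>
    define c where "c t = max a (min b t)" for t
    define G where "G t = F (c t)" for t
    have cab: "c t \<in> {a..b}" for t using ab by (auto simp: c_def)
    have cl: "\<bar>c t - c u\<bar> \<le> \<bar>t - u\<bar>" for t u unfolding c_def by (auto simp: max_def min_def)
    have Gc: "continuous_on UNIV G" unfolding G_def
      by (rule continuous_on_compose2[OF Fc]) (use cab in \<open>auto simp: c_def intro!: continuous_intros\<close>)
    have Gz: "G t = 0" if "t \<notin> {a..b}" for t using that z ab by (auto simp: G_def c_def max_def min_def)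
    have Gl: "norm (G t - G u) \<le> L * \<bar>t - u\<bar>" for t u
      unfolding G_def using L[OF cab cab] mult_left_mono[OF cl L0] order_trans by blast
    define h where "h = pi / y"
    have h: "0 < h" "h \<le> pi" "h * y = pi" using y1 by (auto simp: h_def field_simps)
    define f where "f t = cis (t * y) * G t" for t
    have fc: "continuous_on UNIV f" unfolding f_def by (intro continuous_intros Gc)
    have fb: "integrable lborel f"
    proof -
      have "integrable lborel (\<lambda>t. indicator {a..b} t *\<^sub>R f t)"
        by (rule borel_integrable_compact) (auto intro: continuous_on_subset[OF fc])
      moreover have "indicator {a..b} t *\<^sub>R f t = f t" for t using Gz by (auto simp: f_def indicator_def)
      ultimately show ?thesis by simp
    qed
    have I: "integral {a..b} (\<lambda>t. cis (t * y) * F t) = (LINT t|lborel. f t)"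
    proof -
      have "integral {a..b} (\<lambda>t. cis (t * y) * F t) = integral {a..b} f"
        by (rule integral_cong) (auto simp: f_def G_def c_def)
      also have "\<dots> = integral UNIV f"
        by (subst integral_restrict_UNIV[symmetric], rule integral_cong) (auto simp: f_def Gz)
      also have "\<dots> = (LINT t|lborel. f t)" using integral_lborel[OF fb] by simp
      finally show ?thesis .
    qed
    have fh: "integrable lborel (\<lambda>t. f (h + 1 * t))" by (rule lborel_integrable_real_affine[OF fb]) simp
    have "(LINT t|lborel. f t) = (LINT t|lborel. f (h + 1 * t))"
      using lborel_integral_real_affine[of 1 f h] by simp
    then have "2 * (LINT t|lborel. f t) = (LINT t|lborel. f t + f (h + 1 * t))"
      using fb fh by simp
    also have "norm \<dots> \<le> (LINT t|lborel. indicator {a - h..b} t * (L * h))"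
    proof (rule Bochner_Integration.integral_norm_bound_integral)
      show "integrable lborel (\<lambda>t. f t + f (h + 1 * t))" using fb fh by simp
      show "integrable lborel (\<lambda>t. indicator {a - h..b} t * (L * h))"
        by (intro integrable_mult_left integrable_real_indicator) (auto simp: emeasure_lborel_Icc_eq)
      fix t
      have "cis ((h + 1 * t) * y) = - cis (t * y)"
        using h(3) by (simp add: distrib_right cis_mult[symmetric])
      then have "f t + f (h + 1 * t) = cis (t * y) * (G t - G (t + h))"
        by (simp add: f_def algebra_simps)
      then have n: "norm (f t + f (h + 1 * t)) = norm (G t - G (t + h))" by (simp add: norm_mult)
      show "norm (f t + f (h + 1 * t)) \<le> indicator {a - h..b} t * (L * h)"
      proof (cases "t \<in> {a - h..b}")
        case True
        then show ?thesis using Gl[of t "t + h"] h(1) n by simp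
      next
        case False
        then have "t \<notin> {a..b}" "t + h \<notin> {a..b}" using h(1) by auto
        then show ?thesis using n False Gz by simp
      qed
    qed
    \<comment> \<open>The length is at most 1 + \<pi> \<le> 5 and \<open>h \<le> 4 / y\<close>.
      Halving, because twice the integral was estimated, gives 10 L / y; then 1 + y \<le> 2 y
      accounts for the constant 20.\<close>
    also have "\<dots> = (b - (a - h)) * (L * h)" using ab h by simp
    also have "\<dots> \<le> 5 * (L * (4 / y))"
    proof (rule mult_mono)
      show "b - (a - h) \<le> 5" using ab h pi_less_4 by simp
      show "L * h \<le> L * (4 / y)" unfolding h_def using L0 y1 pi_less_4 by (intro mult_left_mono divide_right_mono) auto
    qed (use L0 h in auto)
    finally have "norm (LINT t|lborel. f t) \<le> 10 * L / y" by (simp add: norm_mult)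
    also have "\<dots> \<le> 20 * (M + L) / (1 + y)"
      proof -
        have "L \<le> L * y" using L0 y1 by (simp add: mult_le_cancel_left1)
        then have "10 * L * (1 + y) \<le> 20 * L * y" by (simp add: algebra_simps)
        also have "\<dots> \<le> 20 * (M + L) * y" using M0 y by (intro mult_right_mono) auto
        finally show ?thesis using y1 by (simp add: divide_simps)
      qed
      finally show ?thesis unfolding I .
    qed
qed

text \<open>The equation is kept in the variable x, with d/d\<sigma> written as d/dx divided by s,
  so that no inverse of \<sigma> is required. K bounds the integral of (1 + \<sigma>) times the
  modulus of q with respect to d\<sigma>: the summand 1 controls the size of solutions, the summand
  \<sigma> their dependence on \<kappa>.\<close>

locale half_line =
  fixes s \<sigma> q :: "real \<Rightarrow> real" and K :: real
  assumes s_cont: "continuous_on {0..} s" and s_pos: "x \<ge> 0 \<Longrightarrow> s x > 0"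
    and \<sigma>0: "\<sigma> 0 = 0" and \<sigma>': "x \<ge> 0 \<Longrightarrow> (\<sigma> has_real_derivative s x) (at x within {0..})"
    and q_cont: "continuous_on {0..} q"
    and K: "x \<ge> 0 \<Longrightarrow> integral {0..x} (\<lambda>t. \<bar>q t\<bar> * s t * (1 + \<sigma> t)) \<le> K"
begin

lemma \<sigma>_cont: "continuous_on {0..} \<sigma>"
  by (rule DERIV_continuous_on) (use \<sigma>' in auto)

lemma \<sigma>_nonneg: "x \<ge> 0 \<Longrightarrow> \<sigma> x \<ge> 0"
  using DERIV_nonneg_Ici_imp_mono[OF \<sigma>', of 0 x] s_pos \<sigma>0 by (force intro: less_imp_le)

lemma K_nonneg: "K \<ge> 0"
  using K[of 0] by simp

lemma integral_qs_le: "x \<ge> 0 \<Longrightarrow> integral {0..x} (\<lambda>t. \<bar>q t\<bar> * s t) \<le> K"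
proof -
  assume x: "x \<ge> 0"
  have "integral {0..x} (\<lambda>t. \<bar>q t\<bar> * s t) \<le> integral {0..x} (\<lambda>t. \<bar>q t\<bar> * s t * (1 + \<sigma> t))"
  proof (rule integral_le)
    fix t assume "t \<in> {0..x}"
    then have "\<bar>q t\<bar> * s t * 1 \<le> \<bar>q t\<bar> * s t * (1 + \<sigma> t)"
      using \<sigma>_nonneg[of t] s_pos[of t] by (intro mult_left_mono) auto
    then show "\<bar>q t\<bar> * s t \<le> \<bar>q t\<bar> * s t * (1 + \<sigma> t)" by simp
  qed (intro integrable_continuous_real continuous_on_Ici_Icc continuous_intros q_cont s_cont \<sigma>_cont)+
  with K[OF x] show ?thesis by simp
qed

text \<open>Variation of constants. If A = exp (- \<i> \<kappa> \<sigma>) (v' + \<i> \<kappa> v),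
  then dA/d\<sigma> = exp (- \<i> \<kappa> \<sigma>) q v and v = Im (exp (\<i> \<kappa> \<sigma>) A)
  / \<kappa>. With the oscillation factored out, only the integrable coefficient q drives A. The map
  is merely real-linear in z because of \<open>Im\<close>.\<close>

definition rhs :: "real \<Rightarrow> real \<Rightarrow> complex \<Rightarrow> complex" where
  "rhs \<kappa> x z = of_real (q x * s x / \<kappa>) * cis (- \<kappa> * \<sigma> x) * of_real (Im (cis (\<kappa> * \<sigma> x) * z))"

lemma norm_rhs_diff:
  assumes "\<kappa> \<ge> 1" "x \<ge> 0"
  shows "norm (rhs \<kappa> x z - rhs \<kappa> x w) \<le> \<bar>q x\<bar> * s x * norm (z - w)"
proof -
  have "rhs \<kappa> x z - rhs \<kappa> x w = of_real (q x * s x / \<kappa>) * cis (- \<kappa> * \<sigma> x) * of_real (Im (cis (\<kappa> * \<sigma> x) * (z - w)))"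
    by (simp add: rhs_def algebra_simps)
  also have "norm \<dots> = \<bar>q x\<bar> * s x / \<kappa> * \<bar>Im (cis (\<kappa> * \<sigma> x) * (z - w))\<bar>"
    using assms s_pos[of x] by (simp only: norm_mult norm_of_real norm_cis abs_mult abs_divide abs_of_pos mult_1_right)
  also have "\<dots> \<le> \<bar>q x\<bar> * s x / 1 * norm (z - w)"
  proof (rule mult_mono)
    show "\<bar>q x\<bar> * s x / \<kappa> \<le> \<bar>q x\<bar> * s x / 1"
      using assms s_pos[of x] by (intro divide_left_mono) auto
    show "\<bar>Im (cis (\<kappa> * \<sigma> x) * (z - w))\<bar> \<le> norm (z - w)"
      using abs_Im_le_cmod[of "cis (\<kappa> * \<sigma> x) * (z - w)"] by (simp add: norm_mult)
  qed (use s_pos[of x] assms in auto)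
  finally show ?thesis by simp
qed

lemma norm_cis_diff: "norm (cis a - cis b) \<le> \<bar>a - b\<bar>"
proof -
  have "norm (cis a - cis b) \<le> 1 * norm (a - b)"
  proof (rule differentiable_bound[of UNIV cis "\<lambda>x h. h *\<^sub>R (\<i> * cis x)"])
    fix x
    show "(cis has_derivative (\<lambda>h. h *\<^sub>R (\<i> * cis x))) (at x within UNIV)"
      by (rule has_derivative_cis) (rule has_derivative_ident)
    show "onorm (\<lambda>h::real. h *\<^sub>R (\<i> * cis x)) \<le> 1"
      by (rule onorm_le) (simp add: norm_mult)
  qed auto
  then show ?thesis by simp
qed

text \<open>Changing \<kappa> changes each of the two phases by at most \<sigma> times the
  difference, and the factor 1/\<kappa> by at most the difference itself. This is the origin of the
  weight 1 + \<sigma>.\<close>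

lemma norm_rhs_param_diff:
  assumes k: "\<kappa> \<ge> 1" "\<mu> \<ge> 1" and x: "x \<ge> 0"
  shows "norm (rhs \<kappa> x z - rhs \<mu> x z) \<le> 2 * (\<bar>q x\<bar> * s x * (1 + \<sigma> x)) * \<bar>\<kappa> - \<mu>\<bar> * norm z"
proof -
  define c where "c k = cis (k * \<sigma> x)" for k
  define d where "d k = cis (- k * \<sigma> x)" for k
  have nc: "norm (c k) = 1" "norm (d k) = 1" for k by (auto simp: c_def d_def)
  have sx: "\<sigma> x \<ge> 0" "s x > 0" using x \<sigma>_nonneg s_pos by auto
  have cd: "norm (c \<kappa> - c \<mu>) \<le> \<bar>\<kappa> - \<mu>\<bar> * \<sigma> x" "norm (d \<kappa> - d \<mu>) \<le> \<bar>\<kappa> - \<mu>\<bar> * \<sigma> x"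
  proof -
    have "\<bar>\<kappa> * \<sigma> x - \<mu> * \<sigma> x\<bar> = \<bar>\<kappa> - \<mu>\<bar> * \<sigma> x"
      using sx by (simp add: abs_mult flip: left_diff_distrib)
    moreover have "- \<kappa> * \<sigma> x - - \<mu> * \<sigma> x = - (\<kappa> * \<sigma> x - \<mu> * \<sigma> x)" by simp
    ultimately show "norm (c \<kappa> - c \<mu>) \<le> \<bar>\<kappa> - \<mu>\<bar> * \<sigma> x" "norm (d \<kappa> - d \<mu>) \<le> \<bar>\<kappa> - \<mu>\<bar> * \<sigma> x"
      using norm_cis_diff[of "\<kappa> * \<sigma> x" "\<mu> * \<sigma> x"] norm_cis_diff[of "- \<kappa> * \<sigma> x" "- \<mu> * \<sigma> x"]
      unfolding c_def d_def by (simp_all only: abs_minus_cancel)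
  qed
  have inv: "\<bar>1 / \<kappa> - 1 / \<mu>\<bar> \<le> \<bar>\<kappa> - \<mu>\<bar>"
  proof -
    have "1 / \<kappa> - 1 / \<mu> = (\<mu> - \<kappa>) / (\<kappa> * \<mu>)" using k by (simp add: field_simps)
    then have "\<bar>1 / \<kappa> - 1 / \<mu>\<bar> = \<bar>\<kappa> - \<mu>\<bar> / (\<kappa> * \<mu>)" using k by (simp add: abs_mult abs_minus_commute)
    also have "\<dots> \<le> \<bar>\<kappa> - \<mu>\<bar> / 1"
      using k mult_mono[of 1 \<kappa> 1 \<mu>] by (intro divide_left_mono) auto
    finally show ?thesis by simp
  qed
  define a where "a k = of_real (1 / k) * d k * of_real (Im (c k * z))" for k
  have r: "rhs k x z = of_real (q x * s x) * a k" for k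
    by (simp add: rhs_def a_def c_def d_def)
  \<comment> \<open>The three factors are exchanged one at a time; the contributions 1, \<sigma> and
    \<sigma> add up to 1 + 2 \<sigma>.\<close>
  have "a \<kappa> - a \<mu> = of_real (1 / \<kappa> - 1 / \<mu>) * d \<kappa> * of_real (Im (c \<kappa> * z))
      + of_real (1 / \<mu>) * (d \<kappa> - d \<mu>) * of_real (Im (c \<kappa> * z))
      + of_real (1 / \<mu>) * d \<mu> * of_real (Im ((c \<kappa> - c \<mu>) * z))"
    by (simp add: a_def algebra_simps)
  also have "norm \<dots> \<le> \<bar>\<kappa> - \<mu>\<bar> * 1 * norm z + 1 * (\<bar>\<kappa> - \<mu>\<bar> * \<sigma> x) * norm z + 1 * 1 * (\<bar>\<kappa> - \<mu>\<bar> * \<sigma> x * norm z)"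
  proof (intro norm_triangle_mono; unfold norm_mult norm_of_real; intro mult_mono)
    show "\<bar>Im (c \<kappa> * z)\<bar> \<le> norm z" using abs_Im_le_cmod[of "c \<kappa> * z"] by (simp add: norm_mult nc)
    then show "\<bar>Im (c \<kappa> * z)\<bar> \<le> norm z" .
    have "\<bar>Im ((c \<kappa> - c \<mu>) * z)\<bar> \<le> norm (c \<kappa> - c \<mu>) * norm z"
      using abs_Im_le_cmod[of "(c \<kappa> - c \<mu>) * z"] by (simp add: norm_mult)
    also have "\<dots> \<le> \<bar>\<kappa> - \<mu>\<bar> * \<sigma> x * norm z" by (intro mult_right_mono cd) auto
    finally show "\<bar>Im ((c \<kappa> - c \<mu>) * z)\<bar> \<le> \<bar>\<kappa> - \<mu>\<bar> * \<sigma> x * norm z" .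
  qed (use cd inv k nc sx in \<open>auto simp: divide_le_eq\<close>)
  also have "\<dots> = (1 + 2 * \<sigma> x) * \<bar>\<kappa> - \<mu>\<bar> * norm z" by (simp add: algebra_simps)
  also have "\<dots> \<le> (2 * (1 + \<sigma> x)) * \<bar>\<kappa> - \<mu>\<bar> * norm z" using sx by (intro mult_right_mono) auto
  finally have "norm (a \<kappa> - a \<mu>) \<le> (2 * (1 + \<sigma> x)) * \<bar>\<kappa> - \<mu>\<bar> * norm z" .
  then have "\<bar>q x * s x\<bar> * norm (a \<kappa> - a \<mu>) \<le> \<bar>q x * s x\<bar> * ((2 * (1 + \<sigma> x)) * \<bar>\<kappa> - \<mu>\<bar> * norm z)"
    by (rule mult_left_mono) simp
  moreover have "norm (rhs \<kappa> x z - rhs \<mu> x z) = \<bar>q x * s x\<bar> * norm (a \<kappa> - a \<mu>)"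
    unfolding r right_diff_distrib[symmetric] norm_mult norm_of_real ..
  ultimately show ?thesis using sx by (simp add: abs_mult algebra_simps)
qed

lemma rhs_cont:
  "continuous_on {0..} A \<Longrightarrow> continuous_on {0..} (\<lambda>x. rhs \<kappa> x (A x))"
  unfolding rhs_def
  by (cases "\<kappa> = 0") (auto intro!: continuous_intros q_cont s_cont \<sigma>_cont)

text \<open>In terms of \<open>jost\<close>, the solution of \<open>v'' = (q - \<kappa>\<^sup>2) v\<close> with \<open>v(0) = 1\<close>, \<open>v'(0) = 0\<close> (derivatives with
  respect to \<open>\<sigma>\<close>) satisfies \<open>v' + \<i> \<kappa> v = exp (\<i> \<kappa> \<sigma>) jost\<close>.\<close>

definition jost :: "real \<Rightarrow> real \<Rightarrow> complex" where
  "jost \<kappa> = (SOME A. continuous_on {0..} A \<and> (\<forall>x\<ge>0. A x = \<i> * of_real \<kappa> + integral {0..x} (\<lambda>t. rhs \<kappa> t (A t))))"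

lemma jost:
  assumes "\<kappa> \<ge> 1"
  shows "continuous_on {0..} (jost \<kappa>)"
    and "x \<ge> 0 \<Longrightarrow> jost \<kappa> x = \<i> * of_real \<kappa> + integral {0..x} (\<lambda>t. rhs \<kappa> t (jost \<kappa> t))"
proof -
  have "\<exists>A. continuous_on {0..} A \<and> (\<forall>x\<ge>0. A x = \<i> * of_real \<kappa> + integral {0..x} (\<lambda>t. rhs \<kappa> t (A t)))"
  proof (rule linear_ode_exists[of "\<lambda>x. \<bar>q x\<bar> * s x"])
    show "continuous_on {0..} (\<lambda>x. \<bar>q x\<bar> * s x)" by (intro continuous_intros q_cont s_cont)
    show "0 \<le> \<bar>q x\<bar> * s x" if "x \<ge> 0" for x using s_pos[OF that] by simp
  qed (auto intro: norm_rhs_diff[OF assms] rhs_cont simp: rhs_def[of _ _ 0])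
  from someI_ex[OF this]
  show "continuous_on {0..} (jost \<kappa>)"
    and "x \<ge> 0 \<Longrightarrow> jost \<kappa> x = \<i> * of_real \<kappa> + integral {0..x} (\<lambda>t. rhs \<kappa> t (jost \<kappa> t))"
    unfolding jost_def by auto
qed

lemma jost_0: "\<kappa> \<ge> 1 \<Longrightarrow> jost \<kappa> 0 = \<i> * of_real \<kappa>"
  using jost(2)[of \<kappa> 0] by simp

lemma jost_deriv:
  assumes "\<kappa> \<ge> 1" "x \<ge> 0"
  shows "(jost \<kappa> has_vector_derivative rhs \<kappa> x (jost \<kappa> x)) (at x within {0..})"
proof -
  have "((\<lambda>x. \<i> * of_real \<kappa> + integral {0..x} (\<lambda>t. rhs \<kappa> t (jost \<kappa> t))) has_vector_derivative 0 + rhs \<kappa> x (jost \<kappa> x)) (at x within {0..})"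
    by (intro has_vector_derivative_add has_vector_derivative_const integral_has_vector_derivative_Ici rhs_cont jost assms)
  then show ?thesis
    using assms jost(2) by (intro has_vector_derivative_transform[where g = "jost \<kappa>"]) auto
qed

text \<open>Gronwall with initial size \<kappa>. The bound is uniform in x since the coefficient has
  total integral at most K.\<close>

lemma norm_jost_le:
  assumes k: "\<kappa> \<ge> 1" and x: "x \<ge> 0"
  shows "norm (jost \<kappa> x) \<le> \<kappa> * exp K"
proof -
  have "norm (jost \<kappa> x) \<le> \<kappa> * exp (integral {0..x} (\<lambda>t. \<bar>q t\<bar> * s t))"
  proof (rule gronwall[OF _ _ _ _ x])
    show "continuous_on {0..} (\<lambda>x. norm (jost \<kappa> x))" by (intro continuous_intros jost k)
    show "continuous_on {0..} (\<lambda>x. \<bar>q x\<bar> * s x)" by (intro continuous_intros q_cont s_cont)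
    show "0 \<le> \<bar>q x\<bar> * s x" if "x \<ge> 0" for x using s_pos[OF that] by simp
    fix x :: real assume x: "x \<ge> 0"
    have "norm (integral {0..x} (\<lambda>t. rhs \<kappa> t (jost \<kappa> t))) \<le> integral {0..x} (\<lambda>t. \<bar>q t\<bar> * s t * norm (jost \<kappa> t))"
    proof (rule integral_norm_bound_integral)
      fix t assume "t \<in> {0..x}"
      then show "norm (rhs \<kappa> t (jost \<kappa> t)) \<le> \<bar>q t\<bar> * s t * norm (jost \<kappa> t)"
        using norm_rhs_diff[OF k, of t "jost \<kappa> t" 0] by (simp add: rhs_def[of _ _ 0])
    qed (intro integrable_continuous_real continuous_on_Ici_Icc rhs_cont continuous_intros jost q_cont s_cont k)+
    then show "norm (jost \<kappa> x) \<le> \<kappa> + integral {0..x} (\<lambda>t. \<bar>q t\<bar> * s t * norm (jost \<kappa> t))"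
      unfolding jost(2)[OF k x] using k by (intro norm_triangle_mono) (auto simp: norm_mult)
  qed
  also have "\<dots> \<le> \<kappa> * exp K" using integral_qs_le[OF x] k by (intro mult_left_mono) auto
  finally show ?thesis .
qed

text \<open>Gronwall constant of the next lemma: 1 stems from the initial values \<i> \<kappa>, and
  2 K \<beta> exp K from the change of the equation acting on a solution of size at most \<beta> exp
  K.\<close>

definition jost_lip :: "real \<Rightarrow> real" where
  "jost_lip \<beta> = (1 + 2 * K * (\<beta> * exp K)) * exp K"

text \<open>The Lipschitz constant in the spectral parameter is independent of x. Through this
  uniformity the later oscillatory integrals decay in \<sigma>: all unbounded dependence on \<sigma>
  sits in the explicit phase.\<close>

lemma jost_lipschitz:
  assumes k: "\<kappa> \<ge> 1" "\<mu> \<ge> 1" "\<mu> \<le> \<beta>" and x: "x \<ge> 0"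
  shows "norm (jost \<kappa> x - jost \<mu> x) \<le> jost_lip \<beta> * \<bar>\<kappa> - \<mu>\<bar>"
proof -
  define C where "C = \<bar>\<kappa> - \<mu>\<bar> * (1 + 2 * K * (\<beta> * exp K))"
  have "norm (jost \<kappa> x - jost \<mu> x) \<le> C * exp (integral {0..x} (\<lambda>t. \<bar>q t\<bar> * s t))"
  proof (rule gronwall[OF _ _ _ _ x])
    show "continuous_on {0..} (\<lambda>x. norm (jost \<kappa> x - jost \<mu> x))" by (intro continuous_intros jost k)
    show "continuous_on {0..} (\<lambda>x. \<bar>q x\<bar> * s x)" by (intro continuous_intros q_cont s_cont)
    show "0 \<le> \<bar>q x\<bar> * s x" if "x \<ge> 0" for x using s_pos[OF that] by simp
    fix x :: real assume x: "x \<ge> 0"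
    have c1: "continuous_on {0..} (\<lambda>t. \<bar>q t\<bar> * s t * norm (jost \<kappa> t - jost \<mu> t))"
      by (intro continuous_intros jost q_cont s_cont k)
    have c2: "continuous_on {0..} (\<lambda>t. \<bar>q t\<bar> * s t * (1 + \<sigma> t) * (2 * \<bar>\<kappa> - \<mu>\<bar> * (\<beta> * exp K)))"
      by (intro continuous_intros jost q_cont s_cont \<sigma>_cont)
    note ii = integrable_continuous_real[OF continuous_on_Ici_Icc[OF c1]] integrable_continuous_real[OF continuous_on_Ici_Icc[OF c2]]
    have ir: "(\<lambda>t. rhs k t (jost k t)) integrable_on {0..x}" if "k \<ge> 1" for k
      by (intro integrable_continuous_real continuous_on_Ici_Icc rhs_cont jost that)
    have "norm (integral {0..x} (\<lambda>t. rhs \<kappa> t (jost \<kappa> t) - rhs \<mu> t (jost \<mu> t)))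
      \<le> integral {0..x} (\<lambda>t. \<bar>q t\<bar> * s t * norm (jost \<kappa> t - jost \<mu> t) + \<bar>q t\<bar> * s t * (1 + \<sigma> t) * (2 * \<bar>\<kappa> - \<mu>\<bar> * (\<beta> * exp K)))"
    proof (rule integral_norm_bound_integral[OF integrable_diff[OF ir ir] integrable_add[OF ii]])
      fix t assume "t \<in> {0..x}"
      then have t: "t \<ge> 0" by simp
      have "norm (rhs \<kappa> t (jost \<kappa> t) - rhs \<mu> t (jost \<mu> t)) \<le> \<bar>q t\<bar> * s t * norm (jost \<kappa> t - jost \<mu> t) + 2 * (\<bar>q t\<bar> * s t * (1 + \<sigma> t)) * \<bar>\<kappa> - \<mu>\<bar> * (\<beta> * exp K)"
      proof (rule norm_diff_triangle_le)
        have "norm (jost \<mu> t) \<le> \<mu> * exp K" by (rule norm_jost_le[OF k(2) t])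
        also have "\<dots> \<le> \<beta> * exp K" using k by (intro mult_right_mono) auto
        finally have "norm (jost \<mu> t) \<le> \<beta> * exp K" .
        then have "2 * (\<bar>q t\<bar> * s t * (1 + \<sigma> t)) * \<bar>\<kappa> - \<mu>\<bar> * norm (jost \<mu> t) \<le> 2 * (\<bar>q t\<bar> * s t * (1 + \<sigma> t)) * \<bar>\<kappa> - \<mu>\<bar> * (\<beta> * exp K)"
          by (rule mult_left_mono) (use \<sigma>_nonneg[OF t] s_pos[OF t] in auto)
        with norm_rhs_param_diff[OF k(1,2) t, of "jost \<mu> t"]
        show "norm (rhs \<kappa> t (jost \<mu> t) - rhs \<mu> t (jost \<mu> t)) \<le> 2 * (\<bar>q t\<bar> * s t * (1 + \<sigma> t)) * \<bar>\<kappa> - \<mu>\<bar> * (\<beta> * exp K)"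
          by (rule order_trans)
      qed (rule norm_rhs_diff[OF k(1) t])
      then show "norm (rhs \<kappa> t (jost \<kappa> t) - rhs \<mu> t (jost \<mu> t)) \<le>
          \<bar>q t\<bar> * s t * norm (jost \<kappa> t - jost \<mu> t) + \<bar>q t\<bar> * s t * (1 + \<sigma> t) * (2 * \<bar>\<kappa> - \<mu>\<bar> * (\<beta> * exp K))"
        by (simp add: algebra_simps)
    qed (use k in auto)
    also have "\<dots> = integral {0..x} (\<lambda>t. \<bar>q t\<bar> * s t * norm (jost \<kappa> t - jost \<mu> t)) +
        integral {0..x} (\<lambda>t. \<bar>q t\<bar> * s t * (1 + \<sigma> t)) * (2 * \<bar>\<kappa> - \<mu>\<bar> * (\<beta> * exp K))"
      using integral_add[OF ii] by simp
    also have "\<dots> \<le> integral {0..x} (\<lambda>t. \<bar>q t\<bar> * s t * norm (jost \<kappa> t - jost \<mu> t)) + K * (2 * \<bar>\<kappa> - \<mu>\<bar> * (\<beta> * exp K))"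
      using K[OF x] k by (intro add_left_mono mult_right_mono) auto
    finally have *: "norm (integral {0..x} (\<lambda>t. rhs \<kappa> t (jost \<kappa> t) - rhs \<mu> t (jost \<mu> t))) \<le> \<dots>" .
    have "jost \<kappa> x - jost \<mu> x = \<i> * of_real (\<kappa> - \<mu>) + integral {0..x} (\<lambda>t. rhs \<kappa> t (jost \<kappa> t) - rhs \<mu> t (jost \<mu> t))"
      unfolding jost(2)[OF k(1) x] jost(2)[OF k(2) x] integral_diff[OF ir[OF k(1)] ir[OF k(2)]]
      by (simp only: of_real_diff right_diff_distrib) simp
    then have "norm (jost \<kappa> x - jost \<mu> x) \<le> norm (\<i> * complex_of_real (\<kappa> - \<mu>)) + norm (integral {0..x} (\<lambda>t. rhs \<kappa> t (jost \<kappa> t) - rhs \<mu> t (jost \<mu> t)))"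
      by (simp only: norm_triangle_ineq)
    moreover have "norm (\<i> * complex_of_real (\<kappa> - \<mu>)) = \<bar>\<kappa> - \<mu>\<bar>" by (simp only: norm_mult norm_ii norm_of_real mult_1)
    ultimately have "norm (jost \<kappa> x - jost \<mu> x) \<le> \<bar>\<kappa> - \<mu>\<bar> + (integral {0..x} (\<lambda>t. \<bar>q t\<bar> * s t * norm (jost \<kappa> t - jost \<mu> t)) + K * (2 * \<bar>\<kappa> - \<mu>\<bar> * (\<beta> * exp K)))"
      using * by linarith
    then show "norm (jost \<kappa> x - jost \<mu> x) \<le> C + integral {0..x} (\<lambda>t. \<bar>q t\<bar> * s t * norm (jost \<kappa> t - jost \<mu> t))"
      by (simp add: C_def algebra_simps)
  qed
  also have "\<dots> \<le> C * exp K"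
    using integral_qs_le[OF x] k K_nonneg unfolding C_def by (intro mult_left_mono) auto
  finally show ?thesis by (simp add: C_def jost_lip_def algebra_simps)
qed

text \<open>Continuity in x at the fixed parameter combines with the Lipschitz estimate in the
  parameter, which is uniform in x.\<close>

lemma jost_joint_cont:
  assumes "1 \<le> a"
  shows "continuous_on ({0::real..} \<times> {a..b}) (\<lambda>(x::real, \<kappa>). jost \<kappa> x)"
  unfolding continuous_on_def
proof safe
  fix x0 k0 :: real assume 0: "x0 \<ge> 0" "k0 \<in> {a..b}"
  have k0: "k0 \<ge> 1" using 0 assms by auto
  let ?F = "at (x0, k0) within ({0::real..} \<times> {a..b})"
  have "((\<lambda>p. jost k0 (fst p)) \<longlongrightarrow> jost k0 (fst (x0, k0))) ?F"
  proof -
    have "continuous_on ({0::real..} \<times> {a..b}) (\<lambda>p. jost k0 (fst p))"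
      by (rule continuous_on_compose2[OF jost(1)[OF k0]]) (auto intro!: continuous_intros)
    then show ?thesis using 0 unfolding continuous_on_def by blast
  qed
  then have l1: "((\<lambda>p. norm (jost k0 (fst p) - jost k0 x0)) \<longlongrightarrow> 0) ?F" by (simp add: LIM_zero tendsto_norm_zero)
  have l2: "((\<lambda>p. jost_lip k0 * \<bar>snd p - k0\<bar>) \<longlongrightarrow> jost_lip k0 * \<bar>snd (x0, k0) - k0\<bar>) ?F"
    by (intro tendsto_intros)
  have "((\<lambda>p. (case p of (x::real, \<kappa>) \<Rightarrow> jost \<kappa> x) - jost k0 x0) \<longlongrightarrow> 0) ?F"
  proof (rule Lim_null_comparison)
    show "((\<lambda>p. jost_lip k0 * \<bar>snd p - k0\<bar> + norm (jost k0 (fst p) - jost k0 x0)) \<longlongrightarrow> 0) ?F"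
      using tendsto_add[OF l2 l1] by simp
    show "\<forall>\<^sub>F p in ?F. norm ((case p of (x::real, \<kappa>) \<Rightarrow> jost \<kappa> x) - jost k0 x0)
        \<le> jost_lip k0 * \<bar>snd p - k0\<bar> + norm (jost k0 (fst p) - jost k0 x0)"
      unfolding eventually_at_filter
    proof (intro always_eventually allI impI)
      fix p assume p: "p \<in> {0::real..} \<times> {a..b}"
      obtain x \<kappa> where [simp]: "p = (x, \<kappa>)" by (cases p)
      have "norm (jost \<kappa> x - jost k0 x0) \<le> jost_lip k0 * \<bar>\<kappa> - k0\<bar> + norm (jost k0 x - jost k0 x0)"
        by (rule norm_diff_triangle_le[OF jost_lipschitz order_refl]) (use p k0 assms in auto)
      then show "norm ((case p of (x::real, \<kappa>) \<Rightarrow> jost \<kappa> x) - jost k0 x0)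
        \<le> jost_lip k0 * \<bar>snd p - k0\<bar> + norm (jost k0 (fst p) - jost k0 x0)" by simp
    qed
  qed
  then show "((\<lambda>(x::real, \<kappa>). jost \<kappa> x) \<longlongrightarrow> jost k0 x0) ?F" by (simp add: LIM_zero_iff)
qed

end

section \<open>Wave packets: averages of the even solutions over the spectral parameter\<close>

context half_line
begin

definition even_sol :: "real \<Rightarrow> real \<Rightarrow> real" where
  "even_sol \<kappa> x = Im (cis (\<kappa> * \<sigma> x) * jost \<kappa> x) / \<kappa>"

definition even_sol' :: "real \<Rightarrow> real \<Rightarrow> real" where
  "even_sol' \<kappa> x = Re (cis (\<kappa> * \<sigma> x) * jost \<kappa> x)"

lemma even_sol_deriv:
  assumes k: "\<kappa> \<ge> 1" and x: "x \<ge> 0"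
  shows "(even_sol \<kappa> has_real_derivative s x * even_sol' \<kappa> x) (at x within {0..})"
    and "(even_sol' \<kappa> has_real_derivative s x * (q x - \<kappa>\<^sup>2) * even_sol \<kappa> x) (at x within {0..})"
proof -
  \<comment> \<open>\<open>Z\<close> is v' + \<i> \<kappa> v, with derivative \<i> \<kappa> s Z + s
    q v; its imaginary and real parts are the two equations claimed.\<close>
  define Z where "Z x = cis (\<kappa> * \<sigma> x) * jost \<kappa> x" for x
  define Z' where "Z' = of_real (\<kappa> * s x) * \<i> * Z x + of_real (q x * s x / \<kappa> * Im (Z x))"
  have "((\<lambda>x. \<kappa> * \<sigma> x) has_derivative (\<lambda>t. t * (\<kappa> * s x))) (at x within {0..})"
  proof -
    have "(\<lambda>t. t * (\<kappa> * s x)) = (*) (\<kappa> * s x)" by (simp add: fun_eq_iff)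
    then show ?thesis using DERIV_cmult[OF \<sigma>'[OF x], of \<kappa>] by (simp add: has_field_derivative_def)
  qed
  from has_derivative_cis[OF this]
  have c: "((\<lambda>x. cis (\<kappa> * \<sigma> x)) has_vector_derivative (\<kappa> * s x) *\<^sub>R (\<i> * cis (\<kappa> * \<sigma> x))) (at x within {0..})"
    unfolding has_vector_derivative_def by (simp add: mult.assoc scaleR_scaleR[symmetric] del: scaleR_scaleR)
  have "(Z has_vector_derivative (cis (\<kappa> * \<sigma> x) * rhs \<kappa> x (jost \<kappa> x) + (\<kappa> * s x) *\<^sub>R (\<i> * cis (\<kappa> * \<sigma> x)) * jost \<kappa> x)) (at x within {0..})"
    unfolding Z_def by (rule has_vector_derivative_mult[OF c jost_deriv[OF k x]])
  also have "cis (\<kappa> * \<sigma> x) * rhs \<kappa> x (jost \<kappa> x) + (\<kappa> * s x) *\<^sub>R (\<i> * cis (\<kappa> * \<sigma> x)) * jost \<kappa> x = Z'"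
  proof -
    have "cis (\<kappa> * \<sigma> x) * rhs \<kappa> x (jost \<kappa> x) = (cis (\<kappa> * \<sigma> x) * cis (- \<kappa> * \<sigma> x)) * of_real (q x * s x / \<kappa> * Im (Z x))"
      unfolding rhs_def Z_def of_real_mult by (simp only: mult_ac)
    also have "cis (\<kappa> * \<sigma> x) * cis (- \<kappa> * \<sigma> x) = 1" by (simp add: cis_mult)
    finally show ?thesis by (simp add: Z'_def Z_def scaleR_conv_of_real)
  qed
  finally have Z: "(Z has_vector_derivative Z') (at x within {0..})" .
  have "Im Z' / \<kappa> = s x * Re (Z x)" using k by (simp add: Z'_def)
  moreover have "((\<lambda>x. Im (Z x) / \<kappa>) has_real_derivative Im Z' / \<kappa>) (at x within {0..})"
    using bounded_linear.has_vector_derivative[OF bounded_linear_Im Z]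
    by (intro DERIV_cdivide) (simp add: has_real_derivative_iff_has_vector_derivative)
  ultimately show "(even_sol \<kappa> has_real_derivative s x * even_sol' \<kappa> x) (at x within {0..})"
    unfolding even_sol_def[abs_def] even_sol'_def Z_def by simp
  have "Re Z' = s x * (q x - \<kappa>\<^sup>2) * (Im (Z x) / \<kappa>)"
    using k by (simp add: Z'_def field_simps power2_eq_square)
  moreover have "((\<lambda>x. Re (Z x)) has_real_derivative Re Z') (at x within {0..})"
    using bounded_linear.has_vector_derivative[OF bounded_linear_Re Z]
    by (simp add: has_real_derivative_iff_has_vector_derivative)
  ultimately show "(even_sol' \<kappa> has_real_derivative s x * (q x - \<kappa>\<^sup>2) * even_sol \<kappa> x) (at x within {0..})"
    unfolding even_sol'_def[abs_def] even_sol_def Z_def by simp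
qed

lemma even_sol_0: "\<kappa> \<ge> 1 \<Longrightarrow> even_sol \<kappa> 0 = 1" "\<kappa> \<ge> 1 \<Longrightarrow> even_sol' \<kappa> 0 = 0"
  by (simp_all add: even_sol_def even_sol'_def jost_0 \<sigma>0)

lemma even_sol_joint_cont:
  assumes "1 \<le> a"
  shows "continuous_on ({0..} \<times> {a..b}) (\<lambda>(x, \<kappa>). even_sol \<kappa> x)"
    and "continuous_on ({0..} \<times> {a..b}) (\<lambda>(x, \<kappa>). even_sol' \<kappa> x)"
proof -
  have "continuous_on ({0..} \<times> {a..b}) (\<lambda>p. cis (snd p * \<sigma> (fst p)) * (\<lambda>(x, \<kappa>). jost \<kappa> x) p)"
    by (intro continuous_intros jost_joint_cont[OF assms] continuous_on_compose2[OF \<sigma>_cont]) auto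
  then have c: "continuous_on ({0..} \<times> {a..b}) (\<lambda>p. cis (snd p * \<sigma> (fst p)) * jost (snd p) (fst p))"
    by (simp add: case_prod_beta)
  show "continuous_on ({0..} \<times> {a..b}) (\<lambda>(x, \<kappa>). even_sol \<kappa> x)"
    unfolding even_sol_def case_prod_beta
    by (intro continuous_intros c) (use assms in auto)
  show "continuous_on ({0..} \<times> {a..b}) (\<lambda>(x, \<kappa>). even_sol' \<kappa> x)"
    unfolding even_sol'_def case_prod_beta by (intro continuous_intros c)
qed

text \<open>A single \<open>even_sol\<close> is bounded without any decay being available. The
  weight G is to vanish at both ends of the window, so that the oscillatory estimate
  applies.\<close>

definition packet :: "real \<Rightarrow> real \<Rightarrow> (real \<Rightarrow> real) \<Rightarrow> real \<Rightarrow> real" where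
  "packet a b G x = integral {a..b} (\<lambda>\<kappa>. even_sol \<kappa> x * G \<kappa>)"

definition packet' :: "real \<Rightarrow> real \<Rightarrow> (real \<Rightarrow> real) \<Rightarrow> real \<Rightarrow> real" where
  "packet' a b G x = integral {a..b} (\<lambda>\<kappa>. even_sol' \<kappa> x * G \<kappa>)"

lemma slice_cont:
  assumes "1 \<le> a" "x \<ge> 0"
  shows "continuous_on {a..b} (\<lambda>\<kappa>. even_sol \<kappa> x)" "continuous_on {a..b} (\<lambda>\<kappa>. even_sol' \<kappa> x)"
    "continuous_on {a..b} (\<lambda>\<kappa>. jost \<kappa> x)"
proof -
  have "continuous_on {a..b} (\<lambda>\<kappa>. f (x, \<kappa>))" if "continuous_on ({0..} \<times> {a..b}) f"
    for f :: "real \<times> real \<Rightarrow> 'a::topological_space"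
    by (rule continuous_on_compose2[OF that]) (use assms in \<open>auto intro!: continuous_intros\<close>)
  from this[OF even_sol_joint_cont(1)[OF assms(1)]] this[OF even_sol_joint_cont(2)[OF assms(1)]]
  show "continuous_on {a..b} (\<lambda>\<kappa>. even_sol \<kappa> x)" "continuous_on {a..b} (\<lambda>\<kappa>. even_sol' \<kappa> x)" by auto
  have "continuous_on {a..b} (\<lambda>\<kappa>. (\<lambda>(x, \<kappa>). jost \<kappa> x) (x, \<kappa>))"
    by (rule continuous_on_compose2[OF jost_joint_cont[OF assms(1)]]) (use assms in \<open>auto intro!: continuous_intros\<close>)
  then show "continuous_on {a..b} (\<lambda>\<kappa>. jost \<kappa> x)" by simp
qed

text \<open>Differentiation under the integral. The factor \<kappa>^2 cannot leave the average and
  is absorbed into the weight: on packets the operator acts by passing from G to \<kappa>^2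
  G.\<close>

lemma packet_deriv:
  assumes a: "1 \<le> a" and G: "continuous_on {a..b} G" and x: "x \<ge> 0"
  shows "(packet a b G has_real_derivative s x * packet' a b G x) (at x within {0..})"
    and "(packet' a b G has_real_derivative s x * (q x * packet a b G x - packet a b (\<lambda>\<kappa>. \<kappa>\<^sup>2 * G \<kappa>) x)) (at x within {0..})"
proof -
  have Gc: "continuous_on ({0..} \<times> {a..b}) (\<lambda>p. G (snd p))"
    by (rule continuous_on_compose2[OF G]) (auto intro!: continuous_intros)
  have sc: "continuous_on ({0..} \<times> {a..b}) (\<lambda>p. s (fst p))" "continuous_on ({0..} \<times> {a..b}) (\<lambda>p. q (fst p))"
    by (rule continuous_on_compose2[OF s_cont] continuous_on_compose2[OF q_cont]; auto intro!: continuous_intros)+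
  have ec: "continuous_on ({0..} \<times> {a..b}) (\<lambda>p. even_sol (snd p) (fst p))"
    "continuous_on ({0..} \<times> {a..b}) (\<lambda>p. even_sol' (snd p) (fst p))"
    using even_sol_joint_cont[OF a, of b] by (simp_all add: case_prod_beta)
  have i: "(\<lambda>\<kappa>. even_sol \<kappa> y * G \<kappa>) integrable_on {a..b}" "(\<lambda>\<kappa>. even_sol' \<kappa> y * G \<kappa>) integrable_on {a..b}"
     "(\<lambda>\<kappa>. even_sol \<kappa> y * (\<kappa>\<^sup>2 * G \<kappa>)) integrable_on {a..b}" if "y \<ge> 0" for y
    by (intro integrable_continuous_real continuous_intros slice_cont G a that)+
  have "((\<lambda>y. integral (cbox a b) (\<lambda>\<kappa>. even_sol \<kappa> y * G \<kappa>)) has_field_derivative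
      integral (cbox a b) (\<lambda>\<kappa>. s x * even_sol' \<kappa> x * G \<kappa>)) (at x within {0..})"
  proof (rule leibniz_rule_field_derivative[where U = "{0..}"])
    show "((\<lambda>y. even_sol \<kappa> y * G \<kappa>) has_field_derivative s y * even_sol' \<kappa> y * G \<kappa>) (at y within {0..})"
      if "y \<in> {0..}" "\<kappa> \<in> cbox a b" for y \<kappa>
      by (rule DERIV_cmult_right[OF even_sol_deriv(1)]) (use that a in auto)
    show "continuous_on ({0..} \<times> cbox a b) (\<lambda>(y, \<kappa>). s y * even_sol' \<kappa> y * G \<kappa>)"
      unfolding case_prod_beta box_real by (intro continuous_intros sc ec Gc)
  qed (use x i in auto)
  moreover have "integral (cbox a b) (\<lambda>\<kappa>. s x * even_sol' \<kappa> x * G \<kappa>) = s x * packet' a b G x"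
    unfolding packet'_def box_real by (simp add: mult.assoc)
  ultimately show "(packet a b G has_real_derivative s x * packet' a b G x) (at x within {0..})"
    unfolding packet_def[abs_def] by simp
  have "((\<lambda>y. integral (cbox a b) (\<lambda>\<kappa>. even_sol' \<kappa> y * G \<kappa>)) has_field_derivative
      integral (cbox a b) (\<lambda>\<kappa>. s x * (q x - \<kappa>\<^sup>2) * even_sol \<kappa> x * G \<kappa>)) (at x within {0..})"
  proof (rule leibniz_rule_field_derivative[where U = "{0..}"])
    show "((\<lambda>y. even_sol' \<kappa> y * G \<kappa>) has_field_derivative s y * (q y - \<kappa>\<^sup>2) * even_sol \<kappa> y * G \<kappa>) (at y within {0..})"
      if "y \<in> {0..}" "\<kappa> \<in> cbox a b" for y \<kappa>
      by (rule DERIV_cmult_right[OF even_sol_deriv(2)]) (use that a in auto)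
    show "continuous_on ({0..} \<times> cbox a b) (\<lambda>(y, \<kappa>). s y * (q y - \<kappa>\<^sup>2) * even_sol \<kappa> y * G \<kappa>)"
      unfolding case_prod_beta box_real by (intro continuous_intros sc ec Gc)
  qed (use x i in auto)
  moreover have "integral (cbox a b) (\<lambda>\<kappa>. s x * (q x - \<kappa>\<^sup>2) * even_sol \<kappa> x * G \<kappa>)
      = s x * (q x * packet a b G x - packet a b (\<lambda>\<kappa>. \<kappa>\<^sup>2 * G \<kappa>) x)"
  proof -
    have "(\<lambda>\<kappa>. s x * (q x - \<kappa>\<^sup>2) * even_sol \<kappa> x * G \<kappa>)
        = (\<lambda>\<kappa>. s x * (q x * (even_sol \<kappa> x * G \<kappa>) - even_sol \<kappa> x * (\<kappa>\<^sup>2 * G \<kappa>)))"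
      by (simp add: fun_eq_iff algebra_simps)
    then show ?thesis
      unfolding packet_def box_real
      using integral_diff[OF integrable_on_mult_right[OF i(1)[OF x], of "q x"] i(3)[OF x]] by simp
  qed
  ultimately show "(packet' a b G has_real_derivative s x * (q x * packet a b G x - packet a b (\<lambda>\<kappa>. \<kappa>\<^sup>2 * G \<kappa>) x)) (at x within {0..})"
    unfolding packet'_def[abs_def] by simp
qed

lemma packet_0:
  assumes "1 \<le> a"
  shows "packet a b G 0 = integral {a..b} G" "packet' a b G 0 = 0"
proof -
  show "packet a b G 0 = integral {a..b} G"
    unfolding packet_def by (rule integral_cong) (use assms in \<open>simp add: even_sol_0\<close>)
  have "packet' a b G 0 = integral {a..b} (\<lambda>\<kappa>. 0)"
    unfolding packet'_def by (rule integral_cong) (use assms in \<open>simp add: even_sol_0\<close>)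
  then show "packet' a b G 0 = 0" by simp
qed

text \<open>The factor 20 is that of \<open>oscillatory_integral_bound\<close>. The bound b exp K on
  \<open>jost\<close> is counted twice, once in the supremum and once in the Lipschitz constant of
  its product with G.\<close>

definition packet_const :: "real \<Rightarrow> real" where
  "packet_const b = 20 * (2 * b * exp K + jost_lip b)"

text \<open>The Lipschitz constant of the weight is taken as \<open>g0 + g1\<close> because the
  lemma is used for G itself and for G \<kappa> / \<kappa>, which carries the factor 1/\<kappa> of
  \<open>even_sol\<close>; for \<kappa> \<ge> 1 this quotient is Lipschitz with that
  constant.\<close>

lemma packet_bound_aux:
  assumes a: "1 \<le> a" "a < b" "b \<le> a + 1" and z: "G a = 0" "G b = 0" and x: "x \<ge> 0"
    and M: "\<And>t. t \<in> {a..b} \<Longrightarrow> \<bar>G t\<bar> \<le> g0"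
    and L: "\<And>t u. t \<in> {a..b} \<Longrightarrow> u \<in> {a..b} \<Longrightarrow> \<bar>G t - G u\<bar> \<le> (g0 + g1) * \<bar>t - u\<bar>" and g1: "g1 \<ge> 0"
  shows "norm (integral {a..b} (\<lambda>t. cis (t * \<sigma> x) * (jost t x * of_real (G t)))) \<le> packet_const b * (g0 + g1) / (1 + \<sigma> x)"
proof -
  have g0: "g0 \<ge> 0" using M[of a] a by auto
  have jl: "jost_lip b \<ge> 0" unfolding jost_lip_def using K_nonneg a by simp
  have jb: "norm (jost t x) \<le> b * exp K" if "t \<in> {a..b}" for t
    using norm_jost_le[of t x] that a x by (smt (verit) atLeastAtMost_iff exp_ge_zero mult_right_mono)
  have "norm (integral {a..b} (\<lambda>t. cis (t * \<sigma> x) * (jost t x * of_real (G t))))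
      \<le> 20 * (b * exp K * g0 + (jost_lip b * g0 + b * exp K * (g0 + g1))) / (1 + \<sigma> x)"
  proof (rule oscillatory_integral_bound[OF a(2,3)])
    fix t assume t: "t \<in> {a..b}"
    show "norm (jost t x * of_real (G t)) \<le> b * exp K * g0"
      unfolding norm_mult norm_of_real using jb[OF t] M[OF t] a by (intro mult_mono) auto
    fix u assume u: "u \<in> {a..b}"
    have eq: "jost t x * of_real (G t) - jost u x * of_real (G u) =
       (jost t x - jost u x) * of_real (G t) + jost u x * of_real (G t - G u)" by (simp add: algebra_simps)
    have "norm ((jost t x - jost u x) * complex_of_real (G t)) \<le> (jost_lip b * \<bar>t - u\<bar>) * g0"
      unfolding norm_mult norm_of_real
      by (intro mult_mono jost_lipschitz M t) (use t u a x jl in auto)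
    moreover have "norm (jost u x * complex_of_real (G t - G u)) \<le> (b * exp K) * ((g0 + g1) * \<bar>t - u\<bar>)"
      unfolding norm_mult norm_of_real
      by (intro mult_mono jb L t u) (use a in auto)
    ultimately have "norm (jost t x * of_real (G t) - jost u x * of_real (G u)) \<le>
       (jost_lip b * \<bar>t - u\<bar>) * g0 + (b * exp K) * ((g0 + g1) * \<bar>t - u\<bar>)"
      unfolding eq by (rule norm_triangle_mono)
    then show "norm (jost t x * of_real (G t) - jost u x * of_real (G u)) \<le>
       (jost_lip b * g0 + b * exp K * (g0 + g1)) * \<bar>t - u\<bar>" by (simp add: algebra_simps)
  qed (use z \<sigma>_nonneg[OF x] in auto)
  also have "\<dots> \<le> packet_const b * (g0 + g1) / (1 + \<sigma> x)"
  proof (rule divide_right_mono)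
    have "b * exp K * g0 \<le> b * exp K * (g0 + g1)" "jost_lip b * g0 \<le> jost_lip b * (g0 + g1)"
      using a g1 jl by (auto intro!: mult_left_mono)
    then show "20 * (b * exp K * g0 + (jost_lip b * g0 + b * exp K * (g0 + g1))) \<le> packet_const b * (g0 + g1)"
      unfolding packet_const_def by (simp add: algebra_simps)
  qed (use \<sigma>_nonneg[OF x] in auto)
  finally show ?thesis .
qed

lemma packet_bound:
  assumes a: "1 \<le> a" "a < b" "b \<le> a + 1" and z: "G a = 0" "G b = 0" and x: "x \<ge> 0"
    and M: "\<And>t. t \<in> {a..b} \<Longrightarrow> \<bar>G t\<bar> \<le> g0"
    and L: "\<And>t u. t \<in> {a..b} \<Longrightarrow> u \<in> {a..b} \<Longrightarrow> \<bar>G t - G u\<bar> \<le> g1 * \<bar>t - u\<bar>" and g1: "g1 \<ge> 0"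
  shows "\<bar>packet a b G x\<bar> \<le> packet_const b * (g0 + g1) / (1 + \<sigma> x)"
    and "\<bar>packet' a b G x\<bar> \<le> packet_const b * (g0 + g1) / (1 + \<sigma> x)"
proof -
  have g0: "g0 \<ge> 0" using M[of a] a by auto
  have L': "\<bar>G t - G u\<bar> \<le> (g0 + g1) * \<bar>t - u\<bar>" if "t \<in> {a..b}" "u \<in> {a..b}" for t u
    using order_trans[OF L[OF that], of "(g0 + g1) * \<bar>t - u\<bar>"] g0 by (simp add: mult_right_mono)
  have Gc: "continuous_on {a..b} G"
    by (rule lipschitz_on_continuous_on[of g1]) (use L g1 in \<open>auto intro!: lipschitz_onI simp: dist_real_def\<close>)
  have ic: "(\<lambda>t. cis (t * \<sigma> x) * (jost t x * of_real (G t))) integrable_on {a..b}"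
    "(\<lambda>t. cis (t * \<sigma> x) * (jost t x * of_real (G t / t))) integrable_on {a..b}"
    by (intro integrable_continuous_real continuous_intros slice_cont a x Gc; use a in auto)+
  have "packet' a b G x = integral {a..b} (\<lambda>t. Re (cis (t * \<sigma> x) * (jost t x * of_real (G t))))"
    unfolding packet'_def even_sol'_def
    by (rule integral_cong) (simp add: algebra_simps)
  also have "\<dots> = Re (integral {a..b} (\<lambda>t. cis (t * \<sigma> x) * (jost t x * of_real (G t))))"
    using integral_linear[OF ic(1) bounded_linear_Re] by (simp add: o_def)
  finally have eq': "packet' a b G x = \<dots>" .
  show "\<bar>packet' a b G x\<bar> \<le> packet_const b * (g0 + g1) / (1 + \<sigma> x)"
    unfolding eq' by (rule order_trans[OF abs_Re_le_cmod packet_bound_aux[OF a z x M L' g1]])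
  have "packet a b G x = integral {a..b} (\<lambda>t. Im (cis (t * \<sigma> x) * (jost t x * of_real (G t / t))))"
    unfolding packet_def even_sol_def
    by (rule integral_cong) (simp add: algebra_simps add_divide_distrib)
  also have "\<dots> = Im (integral {a..b} (\<lambda>t. cis (t * \<sigma> x) * (jost t x * of_real (G t / t))))"
    using integral_linear[OF ic(2) bounded_linear_Im] by (simp add: o_def)
  finally have eq: "packet a b G x = \<dots>" .
  have "norm (integral {a..b} (\<lambda>t. cis (t * \<sigma> x) * (jost t x * of_real (G t / t)))) \<le> packet_const b * (g0 + g1) / (1 + \<sigma> x)"
  proof (rule packet_bound_aux[OF a _ _ x _ _ g1])
    fix t assume t: "t \<in> {a..b}"
    have "\<bar>G t / t\<bar> \<le> \<bar>G t\<bar>" using t a by (simp add: divide_le_eq mult_le_cancel_left1)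
    then show "\<bar>G t / t\<bar> \<le> g0" using M[OF t] by linarith
    fix u assume u: "u \<in> {a..b}"
    have tu: "t \<ge> 1" "u \<ge> 1" using t u a by auto
    have "G t / t - G u / u = (G t - G u) / t + (u - t) * (G u / (t * u))"
      using tu by (simp add: field_simps)
    then have "\<bar>G t / t - G u / u\<bar> \<le> \<bar>(G t - G u) / t\<bar> + \<bar>(u - t) * (G u / (t * u))\<bar>"
      by (simp only: abs_triangle_ineq)
    moreover have "\<bar>(G t - G u) / t\<bar> \<le> \<bar>G t - G u\<bar>"
      using tu by (simp add: divide_le_eq mult_le_cancel_left1)
    moreover have "\<bar>(u - t) * (G u / (t * u))\<bar> \<le> \<bar>t - u\<bar> * g0"
    proof -
      have "\<bar>G u / (t * u)\<bar> = \<bar>G u\<bar> / (t * u)" using tu by (simp add: abs_mult)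
      also have "\<dots> \<le> g0 / 1" using tu M[OF u] g0 mult_mono[of 1 t 1 u] by (intro frac_le) auto
      finally show ?thesis unfolding abs_mult by (intro mult_mono) auto
    qed
    ultimately show "\<bar>G t / t - G u / u\<bar> \<le> (g0 + g1) * \<bar>t - u\<bar>"
      using L[OF t u] by (simp add: algebra_simps)
  qed (use z in auto)
  then show "\<bar>packet a b G x\<bar> \<le> packet_const b * (g0 + g1) / (1 + \<sigma> x)"
    unfolding eq using abs_Im_le_cmod order_trans by blast
qed

end

section \<open>The weighted spaces\<close>

lemma integrable_lebesgue_continuous_support:
  fixes h :: "real \<Rightarrow> real"
  assumes "continuous_on UNIV h" "\<And>x. x \<notin> {a..b} \<Longrightarrow> h x = 0"
  shows "integrable lebesgue h"
proof -
  have "integrable lebesgue (\<lambda>x. 1 * h x)"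
    by (rule integrable_mult_continuous_support[of a b]) (use assms in \<open>auto intro: continuous_on_subset absolutely_integrable_continuous_real\<close>)
  then show ?thesis by simp
qed

lemma borel_measurable_lebesgue_continuous:
  fixes h :: "real \<Rightarrow> real"
  assumes "continuous_on UNIV h"
  shows "h \<in> borel_measurable lebesgue"
  by (intro measurable_completion) (use assms in \<open>simp add: borel_measurable_continuous_onI\<close>)

text \<open>Continuous functions that agree almost everywhere agree everywhere, so the description
  operator in \<open>delta\<close> has a unique solution.\<close>

lemma delta_continuous:
  assumes "continuous_on UNIV g" "AE x in lebesgue. g x = \<phi> x"
  shows "delta \<phi> = g 0"
proof -
  have "(THE g. continuous_on UNIV g \<and> (AE x in lebesgue. g x = \<phi> x)) = g"
  proof (rule the_equality)
    fix f assume f: "continuous_on UNIV f \<and> (AE x in lebesgue. f x = \<phi> x)"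
    then have "AE x in lebesgue. f x = \<phi> x" by simp
    with assms(2) have "AE x in lebesgue. x \<in> {x. f x = g x}" by eventually_elim simp
    moreover have "closed {x. f x = g x}" using f assms(1) by (intro closed_Collect_eq) auto
    ultimately have "x \<in> {x. f x = g x}" for x by (intro mem_closed_if_AE_lebesgue)
    then show "f = g" by auto
  qed (use assms in simp)
  then show ?thesis by (simp add: delta_def)
qed

text \<open>m stands for the fourth root of \<rho> k. By \<open>\<rho>_eq\<close> multiplication by
  m is isometric from the weighted space into square integrable functions with respect to d\<sigma>,
  and by \<open>Q1_eq\<close> one has D \<phi> = (m \<phi>)' / (m s): up to this isometry D is
  d/d\<sigma>.\<close>

locale weights =
  fixes \<rho> k m m' :: "real \<Rightarrow> real"
  assumes \<rho>_pos: "\<rho> x > 0" and k_pos: "k x > 0"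
    and \<rho>_cont: "continuous_on UNIV \<rho>" and k_cont: "continuous_on UNIV k"
    and m_pos: "m x > 0" and m_deriv: "(m has_real_derivative m' x) (at x)" and m'_cont: "continuous_on UNIV m'"
    and \<rho>_eq: "\<rho> x = (m x)\<^sup>2 * sqrt (\<rho> x / k x)"
    and Q1_eq: "Q1 \<rho> k x = m' x / (m x * sqrt (\<rho> x / k x))"
begin

definition s :: "real \<Rightarrow> real" where "s x = sqrt (\<rho> x / k x)"

lemma s_pos: "s x > 0" using \<rho>_pos k_pos by (simp add: s_def)

lemma nz[simp]: "s x \<noteq> 0" "m x \<noteq> 0" "\<rho> x \<noteq> 0" "k x \<noteq> 0"
  using s_pos[of x] m_pos[of x] \<rho>_pos[of x] k_pos[of x] by auto

lemma s_cont: "continuous_on UNIV s"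
  unfolding s_def using k_pos by (intro continuous_intros \<rho>_cont k_cont) (simp add: less_imp_neq)

lemma m_cont: "continuous_on UNIV m" by (rule DERIV_imp_continuous_on[OF m_deriv])

lemma \<rho>_ms: "\<rho> x = (m x)\<^sup>2 * s x" using \<rho>_eq by (simp add: s_def)

lemma Q1_ms: "Q1 \<rho> k x = m' x / (m x * s x)" using Q1_eq by (simp add: s_def)

lemma Q1_cont: "continuous_on UNIV (Q1 \<rho> k)"
  unfolding Q1_ms by (intro continuous_intros m'_cont m_cont s_cont) simp

lemma sqrt_inv: "sqrt (k x / \<rho> x) = 1 / s x"
  by (simp add: s_def real_sqrt_divide)

definition \<mu> :: "real measure" where "\<mu> = density lebesgue (\<lambda>x. ennreal (\<rho> x))"

lemma \<rho>_meas: "\<rho> \<in> borel_measurable lebesgue" by (rule borel_measurable_lebesgue_continuous[OF \<rho>_cont])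

lemma meas_\<mu>[simp]: "borel_measurable \<mu> = borel_measurable lebesgue"
  unfolding \<mu>_def by (rule measurable_cong_sets) simp_all

lemma integrable_\<mu>: "f \<in> borel_measurable lebesgue \<Longrightarrow> integrable \<mu> f \<longleftrightarrow> integrable lebesgue (\<lambda>x. \<rho> x * f x)"
  unfolding \<mu>_def using \<rho>_pos by (subst integrable_density) (auto intro: \<rho>_meas less_imp_le)

lemma integral_\<mu>: "f \<in> borel_measurable lebesgue \<Longrightarrow> integral\<^sup>L \<mu> f = (LINT x|lebesgue. \<rho> x * f x)"
  unfolding \<mu>_def using \<rho>_pos by (subst integral_density) (auto intro: \<rho>_meas less_imp_le)

lemma AE_\<mu>: "(AE x in \<mu>. P x) \<longleftrightarrow> (AE x in lebesgue. P x)"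
  unfolding \<mu>_def using \<rho>_pos \<rho>_meas by (subst AE_density) auto

abbreviation ip :: "(real \<Rightarrow> real) \<Rightarrow> (real \<Rightarrow> real) \<Rightarrow> real" where
  "ip f g \<equiv> integral\<^sup>L \<mu> (\<lambda>x. f x * g x)"

abbreviation sq :: "(real \<Rightarrow> real) set" where "sq \<equiv> square_integrable \<mu>"

lemma sq_meas: "f \<in> sq \<Longrightarrow> f \<in> borel_measurable lebesgue" by (simp add: square_integrable_def)

lemma sq_cong_AE:
  assumes "f \<in> sq" "AE x in lebesgue. f x = g x"
  shows "g \<in> sq"
proof -
  have g: "g \<in> borel_measurable lebesgue" by (rule borel_measurable_AE[OF sq_meas[OF assms(1)] assms(2)])
  have "AE x in \<mu>. (f x)\<^sup>2 = (g x)\<^sup>2" unfolding AE_\<mu> using assms(2) by eventually_elim simp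
  then have "integrable \<mu> (\<lambda>x. (g x)\<^sup>2)"
    using integrable_cong_AE_imp[of \<mu> "\<lambda>x. (f x)\<^sup>2" "\<lambda>x. (g x)\<^sup>2"] assms(1) g
    by (auto simp: square_integrable_def)
  then show ?thesis using g by (simp add: square_integrable_def)
qed

lemma ip_cong_AE:
  assumes "f \<in> sq" "g \<in> sq" "AE x in lebesgue. f x = f' x" "AE x in lebesgue. g x = g' x"
  shows "ip f g = ip f' g'"
proof (rule integral_cong_AE)
  show "(\<lambda>x. f x * g x) \<in> borel_measurable \<mu>" "(\<lambda>x. f' x * g' x) \<in> borel_measurable \<mu>"
    using sq_meas[OF assms(1)] sq_meas[OF assms(2)] sq_meas[OF sq_cong_AE[OF assms(1,3)]]
      sq_meas[OF sq_cong_AE[OF assms(2,4)]] by auto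
  show "AE x in \<mu>. f x * g x = f' x * g' x"
    unfolding AE_\<mu> using assms(3,4) by eventually_elim simp
qed

lemma emb_eq: "f \<in> borel_measurable lebesgue \<Longrightarrow> g \<in> borel_measurable lebesgue \<Longrightarrow> emb \<rho> f g = ip f g"
  unfolding emb_def by (subst integral_\<mu>) (auto simp: mult_ac)

lemma continuous_support_sq:
  assumes "continuous_on UNIV h" "\<And>x. x \<notin> {a..b} \<Longrightarrow> h x = 0"
  shows "h \<in> sq"
proof -
  have "integrable lebesgue (\<lambda>x. \<rho> x * (h x)\<^sup>2)"
    by (rule integrable_lebesgue_continuous_support[of _ a b]) (use assms in \<open>auto intro!: continuous_intros \<rho>_cont\<close>)
  then show ?thesis
    using borel_measurable_lebesgue_continuous[OF assms(1)] by (auto simp: square_integrable_def integrable_\<mu>)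
qed

lemma integral_eq_ip:
  assumes "F \<in> borel_measurable lebesgue" "continuous_on UNIV h"
  shows "(LINT x|lebesgue. F x * h x) = ip F (\<lambda>x. h x / \<rho> x)"
  using assms borel_measurable_lebesgue_continuous[OF assms(2)] \<rho>_meas by (subst integral_\<mu>) auto

text \<open>Cauchy-Schwarz against the indicator of the interval divided by \<rho>, which is square
  integrable for the weighted measure because 1/\<rho> is continuous.\<close>

lemma sq_set_integrable:
  assumes "f \<in> sq"
  shows "set_integrable lebesgue {a..b} f"
proof -
  define h where "h x = indicator {a..b} x / \<rho> x" for x
  have "integrable lebesgue (\<lambda>x. \<rho> x * (h x)\<^sup>2)"
  proof -
    have "integrable lebesgue (\<lambda>x. indicator {a..b} x *\<^sub>R (1 / \<rho> x))"
    proof -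
      have "continuous_on {a..b} (\<lambda>x. 1 / \<rho> x)"
        by (intro continuous_intros continuous_on_subset[OF \<rho>_cont]) auto
      from absolutely_integrable_continuous_real[OF this] show ?thesis unfolding set_integrable_def .
    qed
    moreover have "indicator {a..b} x *\<^sub>R (1 / \<rho> x) = \<rho> x * (h x)\<^sup>2" for x
      by (simp add: h_def power2_eq_square indicator_def)
    ultimately show ?thesis by simp
  qed
  moreover have "h \<in> borel_measurable lebesgue"
    unfolding h_def by (intro borel_measurable_divide \<rho>_meas borel_measurable_indicator) simp
  ultimately have "h \<in> sq" by (auto simp: square_integrable_def integrable_\<mu>)
  from square_integrable_mult[OF assms this]
  have "integrable lebesgue (\<lambda>x. \<rho> x * (f x * h x))"
    using sq_meas[OF assms] \<open>h \<in> borel_measurable lebesgue\<close> by (subst (asm) integrable_\<mu>) auto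
  moreover have "\<rho> x * (f x * h x) = indicator {a..b} x *\<^sub>R f x" for x by (simp add: h_def)
  ultimately show ?thesis by (simp add: set_integrable_def)
qed

lemma sq_L1_loc: "f \<in> sq \<Longrightarrow> L1_loc UNIV f"
  by (intro L1_loc_Icc_I sq_set_integrable) auto

text \<open>The local condition in \<open>H0\<close> follows from the weighted one, since 1/\<rho>
  is bounded on compact sets.\<close>

lemma H0_iff: "f \<in> H0 \<rho> \<longleftrightarrow> f \<in> sq"
proof
  assume f: "f \<in> H0 \<rho>"
  have sm: "(\<lambda>x. sqrt (\<rho> x)) \<in> borel_measurable lebesgue"
    by (intro borel_measurable_lebesgue_continuous continuous_intros \<rho>_cont)
  have m: "(\<lambda>x. sqrt (\<rho> x) * f x) \<in> borel_measurable lebesgue"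
    and i: "integrable lebesgue (\<lambda>x. (sqrt (\<rho> x) * f x)\<^sup>2)"
    using f by (auto simp: H0_def L2_on_def set_borel_measurable_def set_integrable_def)
  have "(\<lambda>x. (sqrt (\<rho> x) * f x) / sqrt (\<rho> x)) \<in> borel_measurable lebesgue"
    by (intro borel_measurable_divide m sm)
  then have fm: "f \<in> borel_measurable lebesgue" by simp
  moreover have "(sqrt (\<rho> x) * f x)\<^sup>2 = \<rho> x * (f x)\<^sup>2" for x
    using \<rho>_pos[of x] by (simp add: power_mult_distrib)
  ultimately show "f \<in> sq" using i by (simp add: square_integrable_def integrable_\<mu>)
next
  assume f: "f \<in> sq"
  note fm = sq_meas[OF f]
  have f2: "integrable lebesgue (\<lambda>x. \<rho> x * (f x)\<^sup>2)" using f fm by (simp add: square_integrable_def integrable_\<mu>)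
  have e: "(sqrt (\<rho> x) * f x)\<^sup>2 = \<rho> x * (f x)\<^sup>2" for x
    using \<rho>_pos[of x] by (simp add: power_mult_distrib)
  have sm: "(\<lambda>x. sqrt (\<rho> x)) \<in> borel_measurable lebesgue"
    by (intro borel_measurable_lebesgue_continuous continuous_intros \<rho>_cont)
  have "L2_on K f" if K: "compact K" for K
  proof -
    have Ks: "K \<in> sets lebesgue" using K by (auto intro: lmeasurable_compact fmeasurableD)
    have sr: "set_integrable lebesgue K (\<lambda>x. \<rho> x * (f x)\<^sup>2)"
      using f2 Ks unfolding set_integrable_def by (intro integrable_mult_indicator)
    have "bounded ((\<lambda>x. 1 / \<rho> x) ` K)"
      by (intro compact_imp_bounded compact_continuous_image K continuous_intros continuous_on_subset[OF \<rho>_cont]) auto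
    moreover have "(\<lambda>x. 1 / \<rho> x) \<in> borel_measurable (lebesgue_on K)"
      by (intro continuous_imp_measurable_on_sets_lebesgue continuous_intros continuous_on_subset[OF \<rho>_cont] Ks) auto
    ultimately have "set_integrable lebesgue K (\<lambda>x. 1 / \<rho> x * (\<rho> x * (f x)\<^sup>2))"
      by (intro absolutely_integrable_bounded_measurable_product_real sr Ks)
    then show ?thesis using Ks fm by (auto simp: L2_on_def set_borel_measurable_def)
  qed
  then show "f \<in> H0 \<rho>"
    unfolding H0_def L2_loc_def using f2 fm sm
    by (auto simp: L2_on_def set_borel_measurable_def set_integrable_def e)
qed

lemma norm_H0_eq: "f \<in> sq \<Longrightarrow> norm_H0 \<rho> f = sqrt (ip f f)"
proof -
  assume f: "f \<in> sq"
  have "(sqrt (\<rho> x) * f x)\<^sup>2 = \<rho> x * (f x * f x)" for x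
    using \<rho>_pos[of x] by (simp add: power_mult_distrib power2_eq_square[of "f x"])
  then show ?thesis unfolding norm_H0_def using sq_meas[OF f] by (subst integral_\<mu>) auto
qed

abbreviation D :: "(real \<Rightarrow> real) \<Rightarrow> real \<Rightarrow> real" where "D \<equiv> DD \<rho> k"

text \<open>\<open>hasD \<phi> \<xi>\<close>: the function \<open>\<phi>\<close> belongs to \<open>H1\<close> and \<open>\<xi>\<close> represents \<open>D \<phi>\<close>.\<close>

definition hasD :: "(real \<Rightarrow> real) \<Rightarrow> (real \<Rightarrow> real) \<Rightarrow> bool" where
  "hasD \<phi> \<xi> \<longleftrightarrow> \<phi> \<in> sq \<and> \<xi> \<in> sq \<and> has_weak_deriv UNIV \<phi> (\<lambda>x. s x * (\<xi> x - Q1 \<rho> k x * \<phi> x))"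

lemma H1_hasD:
  assumes "\<phi> \<in> H1 \<rho> k" shows "hasD \<phi> (D \<phi>)"
proof -
  obtain g where "has_weak_deriv UNIV \<phi> g" and h: "\<phi> \<in> H0 \<rho>" "D \<phi> \<in> H0 \<rho>" using assms by (auto simp: H1_def)
  then have "has_weak_deriv UNIV \<phi> (weak_deriv \<phi>)" unfolding weak_deriv_def by (intro someI[of "has_weak_deriv UNIV \<phi>" g])
  moreover have "s x * (D \<phi> x - Q1 \<rho> k x * \<phi> x) = weak_deriv \<phi> x" for x by (simp add: DD_def sqrt_inv)
  ultimately show ?thesis using h by (simp add: hasD_def H0_iff)
qed

text \<open>Uniqueness of weak derivatives identifies the choice hidden in \<open>weak_deriv\<close>
  with any explicit candidate, up to a null set.\<close>

lemma hasD_imp: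
  assumes h: "hasD \<phi> \<xi>" shows "\<phi> \<in> H1 \<rho> k" "AE x in lebesgue. D \<phi> x = \<xi> x"
proof -
  have wd: "has_weak_deriv UNIV \<phi> (\<lambda>x. s x * (\<xi> x - Q1 \<rho> k x * \<phi> x))" using h by (simp add: hasD_def)
  then have "has_weak_deriv UNIV \<phi> (weak_deriv \<phi>)" unfolding weak_deriv_def by (rule someI[of "has_weak_deriv UNIV \<phi>"])
  from has_weak_deriv_unique[OF this wd]
  show ae: "AE x in lebesgue. D \<phi> x = \<xi> x" by eventually_elim (simp add: DD_def sqrt_inv)
  then have "AE x in lebesgue. \<xi> x = D \<phi> x" by eventually_elim simp
  then have "D \<phi> \<in> sq" using h sq_cong_AE by (auto simp: hasD_def)
  then show "\<phi> \<in> H1 \<rho> k" using h wd by (auto simp: H1_def H0_iff hasD_def)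
qed

lemma hasD_lin:
  assumes "hasD \<phi> \<xi>" "hasD \<psi> \<eta>"
  shows "hasD (\<lambda>x. a * \<phi> x + b * \<psi> x) (\<lambda>x. a * \<xi> x + b * \<eta> x)"
proof -
  have "has_weak_deriv UNIV (\<lambda>x. a * \<phi> x + b * \<psi> x)
     (\<lambda>x. a * (s x * (\<xi> x - Q1 \<rho> k x * \<phi> x)) + b * (s x * (\<eta> x - Q1 \<rho> k x * \<psi> x)))"
    using assms unfolding hasD_def by (intro has_weak_deriv_add has_weak_deriv_cmult) auto
  moreover have "a * (s x * (\<xi> x - Q1 \<rho> k x * \<phi> x)) + b * (s x * (\<eta> x - Q1 \<rho> k x * \<psi> x)) =
     s x * ((a * \<xi> x + b * \<eta> x) - Q1 \<rho> k x * (a * \<phi> x + b * \<psi> x))" for x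
    by (simp add: algebra_simps)
  ultimately show ?thesis using assms by (auto simp: hasD_def intro: square_integrable_lin)
qed

lemma H1_sq: "\<phi> \<in> H1 \<rho> k \<Longrightarrow> \<phi> \<in> sq" "\<phi> \<in> H1 \<rho> k \<Longrightarrow> D \<phi> \<in> sq"
  using H1_hasD[of \<phi>] by (auto simp: hasD_def)

text \<open>\<open>D\<close> contains a choice of weak derivative for each function separately, so
  its linearity is available almost everywhere only.\<close>

lemma H1_lin:
  assumes "\<phi> \<in> H1 \<rho> k" "\<psi> \<in> H1 \<rho> k"
  shows "(\<lambda>x. a * \<phi> x + b * \<psi> x) \<in> H1 \<rho> k"
    and "AE x in lebesgue. D (\<lambda>x. a * \<phi> x + b * \<psi> x) x = a * D \<phi> x + b * D \<psi> x"
  using hasD_imp[OF hasD_lin[OF H1_hasD[OF assms(1)] H1_hasD[OF assms(2)]]] by auto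

lemma norm_H1_sq: "\<phi> \<in> H1 \<rho> k \<Longrightarrow> (norm_H1 \<rho> k \<phi>)\<^sup>2 = ip \<phi> \<phi> + ip (D \<phi>) (D \<phi>)"
  using H1_sq[of \<phi>] L2.pos[of _ \<mu>] by (simp add: norm_H1_def norm_H0_eq)

lemma norm_H1_nonneg: "0 \<le> norm_H1 \<rho> k \<phi>" by (simp add: norm_H1_def)

lemma ip_tendsto:
  assumes F: "\<And>n::nat. F n \<in> sq" "f \<in> sq" "(\<lambda>n. integral\<^sup>L \<mu> (\<lambda>x. (F n x - f x)\<^sup>2)) \<longlonglongrightarrow> 0" and g: "g \<in> sq"
  shows "(\<lambda>n. ip (F n) g) \<longlonglongrightarrow> ip f g"
proof -
  have "(\<lambda>n. (ip (F n) g - ip f g)\<^sup>2) \<longlonglongrightarrow> 0"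
  proof (rule tendsto_sandwich[of "\<lambda>_. 0"])
    show "(\<lambda>n. integral\<^sup>L \<mu> (\<lambda>x. (F n x - f x)\<^sup>2) * ip g g) \<longlonglongrightarrow> 0"
      using tendsto_mult_right[OF F(3), of "ip g g"] by simp
    show "\<forall>\<^sub>F n in sequentially. (ip (F n) g - ip f g)\<^sup>2 \<le> integral\<^sup>L \<mu> (\<lambda>x. (F n x - f x)\<^sup>2) * ip g g"
      using L2.Cauchy_Schwarz_sq[OF L2.diff_in[OF F(1,2)] g] L2.B_diff[OF F(1,2) g]
      by (simp add: power2_eq_square)
  qed auto
  then have "(\<lambda>n. ip (F n) g - ip f g) \<longlonglongrightarrow> 0" by (rule tendsto_0_if_square_tendsto_0)
  then show ?thesis by (simp add: LIM_zero_iff)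
qed

text \<open>D is a closed operator: for a fixed C1 test function both sides of the defining identity
  are scalar products with fixed square integrable functions, and these pass to the limit.\<close>

lemma hasD_limit:
  assumes F: "\<And>n::nat. hasD (F n) (X n)" and f: "f \<in> sq" "(\<lambda>n. integral\<^sup>L \<mu> (\<lambda>x. (F n x - f x)\<^sup>2)) \<longlonglongrightarrow> 0"
    and \<xi>: "\<xi> \<in> sq" "(\<lambda>n. integral\<^sup>L \<mu> (\<lambda>x. (X n x - \<xi> x)\<^sup>2)) \<longlonglongrightarrow> 0"
  shows "hasD f \<xi>"
proof -
  have Fs: "F n \<in> sq" "X n \<in> sq" for n using F by (auto simp: hasD_def)
  have L1: "L1_loc UNIV (\<lambda>x. s x * (\<xi> x - Q1 \<rho> k x * f x))"
  proof -
    have "L1_loc UNIV (\<lambda>x. \<xi> x * s x + f x * (- s x * Q1 \<rho> k x))"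
      by (intro L1_loc_add L1_loc_mult_continuous sq_L1_loc f \<xi> continuous_intros s_cont Q1_cont) auto
    then show ?thesis by (simp add: algebra_simps)
  qed
  have "has_weak_deriv UNIV f (\<lambda>x. s x * (\<xi> x - Q1 \<rho> k x * f x))"
  proof (rule has_weak_deriv_I[OF sq_L1_loc[OF f(1)] L1])
    fix \<theta> \<theta>' :: "real \<Rightarrow> real" and a b
    assume \<theta>: "\<And>x. (\<theta> has_real_derivative \<theta>' x) (at x)" "continuous_on UNIV \<theta>'"
      "\<And>x. x \<notin> {a..b} \<Longrightarrow> \<theta> x = 0" "\<And>x. x \<notin> {a..b} \<Longrightarrow> \<theta>' x = 0"
    have \<theta>c: "continuous_on UNIV \<theta>" by (rule DERIV_imp_continuous_on[OF \<theta>(1)])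
    \<comment> \<open>Division by \<rho> turns Lebesgue integrals into scalar products for the
      weighted measure; compact support makes the quotients square integrable.\<close>
    define h1 where "h1 x = \<theta>' x / \<rho> x" for x
    define h2 where "h2 x = (s x * \<theta> x) / \<rho> x" for x
    define h3 where "h3 x = (- (s x * Q1 \<rho> k x * \<theta> x)) / \<rho> x" for x
    have h: "h1 \<in> sq" "h2 \<in> sq" "h3 \<in> sq"
      unfolding h1_def h2_def h3_def
      by (rule continuous_support_sq[of _ a b], intro continuous_intros \<theta>(2) \<theta>c s_cont Q1_cont \<rho>_cont; simp add: \<theta>(3,4))+
    have e1: "(LINT x|lebesgue. G x * \<theta>' x) = ip G h1" if "G \<in> sq" for G
      unfolding h1_def by (rule integral_eq_ip[OF sq_meas[OF that] \<theta>(2)])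
    have e2: "(LINT x|lebesgue. s x * (Y x - Q1 \<rho> k x * G x) * \<theta> x) = ip Y h2 + ip G h3" if "G \<in> sq" "Y \<in> sq" for G Y
    proof -
      have i: "integrable \<mu> (\<lambda>x. Y x * h2 x)" "integrable \<mu> (\<lambda>x. G x * h3 x)"
        by (intro square_integrable_mult that h)+
      have "(LINT x|lebesgue. s x * (Y x - Q1 \<rho> k x * G x) * \<theta> x) = (LINT x|lebesgue. \<rho> x * (Y x * h2 x + G x * h3 x))"
        by (rule Bochner_Integration.integral_cong) (simp_all add: h2_def h3_def field_simps)
      also have "\<dots> = integral\<^sup>L \<mu> (\<lambda>x. Y x * h2 x + G x * h3 x)"
        using sq_meas[OF that(1)] sq_meas[OF that(2)] sq_meas[OF h(2)] sq_meas[OF h(3)] by (subst integral_\<mu>) auto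
      also have "\<dots> = ip Y h2 + ip G h3" by (rule Bochner_Integration.integral_add[OF i])
      finally show ?thesis .
    qed
    have eq: "ip (F n) h1 = - (ip (X n) h2 + ip (F n) h3)" for n
      unfolding e1[OF Fs(1), symmetric] e2[OF Fs, symmetric]
      by (rule has_weak_deriv_C1_test[where S = UNIV and a = a and b = b, OF _ _ _ \<theta>(1-3)])
        (use F in \<open>auto simp: hasD_def\<close>)
    have "(\<lambda>n. ip (F n) h1) \<longlonglongrightarrow> - (ip \<xi> h2 + ip f h3)"
      unfolding eq by (intro tendsto_intros ip_tendsto Fs f \<xi> h)
    moreover have "(\<lambda>n. ip (F n) h1) \<longlonglongrightarrow> ip f h1" by (intro ip_tendsto Fs f h)
    ultimately have "ip f h1 = - (ip \<xi> h2 + ip f h3)" by (rule LIMSEQ_unique[symmetric])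
    then show "(LINT x|lebesgue. f x * \<theta>' x) = - (LINT x|lebesgue. s x * (\<xi> x - Q1 \<rho> k x * f x) * \<theta> x)"
      by (simp only: e1[OF f(1)] e2[OF f(1) \<xi>(1)])
  qed auto
  then show ?thesis using f \<xi> by (simp add: hasD_def)
qed

end

section \<open>The energy form with a bounded potential, completeness of \<open>H1\<close>, the
  resolvent\<close>

locale weights_pot = weights +
  fixes q :: "real \<Rightarrow> real" and Cq :: real
  assumes q_cont: "continuous_on UNIV q" and q_bd: "\<bar>q x\<bar> \<le> Cq"
begin

lemma Cq_nonneg: "Cq \<ge> 0" using q_bd[of 0] by linarith

lemma q_mult_sq: "f \<in> sq \<Longrightarrow> (\<lambda>x. q x * f x) \<in> sq"
  by (rule square_integrable_bounded_mult[OF _ _ q_bd]) (simp_all add: borel_measurable_lebesgue_continuous q_cont)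

text \<open>The form of minus the generator: the pairing of D^2 w - q w with v equals
  \<open>- Bq w v\<close>.\<close>

definition Bq :: "(real \<Rightarrow> real) \<Rightarrow> (real \<Rightarrow> real) \<Rightarrow> real" where
  "Bq w v = ip (D w) (D v) + ip (\<lambda>x. q x * w x) v"

text \<open>Chosen so that 1 \<le> q + c \<le> 2 c, which makes \<open>Bc\<close> equivalent to the
  squared norm of \<open>H1\<close>.\<close>

definition c :: real where "c = Cq + 1"

definition Bc :: "(real \<Rightarrow> real) \<Rightarrow> (real \<Rightarrow> real) \<Rightarrow> real" where
  "Bc w v = Bq w v + c * ip w v"

lemma Bq_potential: "w \<in> sq \<Longrightarrow> v \<in> sq \<Longrightarrow> ip (\<lambda>x. q x * w x) v + c * ip w v = integral\<^sup>L \<mu> (\<lambda>x. (q x + c) * (w x * v x))"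
proof -
  assume wv: "w \<in> sq" "v \<in> sq"
  have "integral\<^sup>L \<mu> (\<lambda>x. (q x + c) * (w x * v x)) = integral\<^sup>L \<mu> (\<lambda>x. (q x * w x) * v x + c * (w x * v x))"
    by (simp add: algebra_simps)
  then show ?thesis
    using square_integrable_mult[OF q_mult_sq[OF wv(1)] wv(2)] square_integrable_mult[OF wv] by simp
qed

lemma Bc_bounds:
  assumes "w \<in> sq" "D w \<in> sq"
  shows "ip w w + ip (D w) (D w) \<le> Bc w w" "Bc w w \<le> (2 * c) * (ip w w + ip (D w) (D w))"
proof -
  note e = Bq_potential[OF assms(1,1)]
  have B: "Bc w w = ip (D w) (D w) + integral\<^sup>L \<mu> (\<lambda>x. (q x + c) * (w x * w x))"
    using e by (simp add: Bc_def Bq_def)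
  have i: "integrable \<mu> (\<lambda>x. w x * w x)" by (rule square_integrable_mult[OF assms(1,1)])
  have i2: "integrable \<mu> (\<lambda>x. (q x + c) * (w x * w x))"
    using square_integrable_mult[OF q_mult_sq[OF assms(1)] assms(1)] i by (simp add: distrib_right mult.assoc)
  have qc: "1 \<le> q x + c" "q x + c \<le> 2 * c" for x using q_bd[of x] by (auto simp: c_def)
  have "ip w w \<le> integral\<^sup>L \<mu> (\<lambda>x. (q x + c) * (w x * w x))"
    by (rule integral_mono[OF i i2]) (use mult_right_mono[OF qc(1)] in force)
  then show "ip w w + ip (D w) (D w) \<le> Bc w w" using B by simp
  have "integral\<^sup>L \<mu> (\<lambda>x. (q x + c) * (w x * w x)) \<le> integral\<^sup>L \<mu> (\<lambda>x. (2 * c) * (w x * w x))"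
    by (rule integral_mono) (use i i2 mult_right_mono[OF qc(2)] in force)+
  then have "Bc w w \<le> ip (D w) (D w) + 2 * c * ip w w" using B by simp
  also have "\<dots> \<le> 2 * c * ip (D w) (D w) + 2 * c * ip w w"
    using L2.pos[OF assms(2)] Cq_nonneg mult_right_mono[of 1 "2 * c" "ip (D w) (D w)"] by (simp add: c_def)
  finally show "Bc w w \<le> (2 * c) * (ip w w + ip (D w) (D w))" by (simp add: algebra_simps)
qed

lemma ip_D_lin:
  assumes "u \<in> H1 \<rho> k" "v \<in> H1 \<rho> k" "g \<in> sq"
  shows "ip (D (\<lambda>x. a * u x + b * v x)) g = a * ip (D u) g + b * ip (D v) g"
proof -
  have "ip (D (\<lambda>x. a * u x + b * v x)) g = ip (\<lambda>x. a * D u x + b * D v x) g"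
    by (rule ip_cong_AE) (use H1_lin[OF assms(1,2)] H1_sq assms in auto)
  also have "\<dots> = a * ip (D u) g + b * ip (D v) g" by (intro L2.Blin H1_sq assms)
  finally show ?thesis .
qed

sublocale form: form_space "H1 \<rho> k" Bc
proof
  fix u v w :: "real \<Rightarrow> real" and a b :: real
  assume H: "u \<in> H1 \<rho> k" "v \<in> H1 \<rho> k" "w \<in> H1 \<rho> k"
  have "ip (\<lambda>x. q x * (a * u x + b * v x)) w = ip (\<lambda>x. a * (q x * u x) + b * (q x * v x)) w"
    by (simp add: algebra_simps)
  also have "\<dots> = a * ip (\<lambda>x. q x * u x) w + b * ip (\<lambda>x. q x * v x) w"
    by (intro L2.Blin q_mult_sq H1_sq H)
  finally show "Bc (\<lambda>x. a * u x + b * v x) w = a * Bc u w + b * Bc v w"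
    using ip_D_lin[OF H(1,2) H1_sq(2)[OF H(3)]] L2.Blin[OF H1_sq(1)[OF H(1)] H1_sq(1)[OF H(2)] H1_sq(1)[OF H(3)]]
    by (simp add: Bc_def Bq_def algebra_simps)
next
  fix v w assume "v \<in> H1 \<rho> k" "w \<in> H1 \<rho> k"
  show "Bc v w = Bc w v" by (simp add: Bc_def Bq_def mult_ac)
next
  fix v assume v: "v \<in> H1 \<rho> k"
  show "0 \<le> Bc v v"
    using Bc_bounds(1)[OF H1_sq[OF v]] L2.pos[OF H1_sq(1)[OF v]] L2.pos[OF H1_sq(2)[OF v]] by linarith
qed (rule H1_lin)

lemma norm_H1_le_Bc: "w \<in> H1 \<rho> k \<Longrightarrow> (norm_H1 \<rho> k w)\<^sup>2 \<le> Bc w w"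
  using Bc_bounds(1)[OF H1_sq(1,2)] by (simp add: norm_H1_sq)

text \<open>A Cauchy sequence for \<open>Bc\<close> is one for the functions and for their images
  under D. Both limits exist in the weighted space, and closedness of D identifies the second as the
  image of the first.\<close>

lemma H1_complete:
  assumes F: "\<And>n::nat. F n \<in> H1 \<rho> k"
    and C: "\<And>e. e > 0 \<Longrightarrow> \<exists>N. \<forall>m\<ge>N. \<forall>n\<ge>N. Bc (\<lambda>x. F m x - F n x) (\<lambda>x. F m x - F n x) < e"
  shows "\<exists>v\<in>H1 \<rho> k. (\<lambda>n. Bc (\<lambda>x. F n x - v x) (\<lambda>x. F n x - v x)) \<longlonglongrightarrow> 0"
proof -
  have Ddiff: "ip (D (\<lambda>x. u x - v x)) (D (\<lambda>x. u x - v x)) = integral\<^sup>L \<mu> (\<lambda>x. (D u x - D v x)\<^sup>2)"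
    if H: "u \<in> H1 \<rho> k" "v \<in> H1 \<rho> k" for u v
  proof -
    have ae: "AE x in lebesgue. D (\<lambda>x. u x - v x) x = D u x - D v x"
      using H1_lin(2)[OF H, of 1 "-1"] by simp
    have "ip (D (\<lambda>x. u x - v x)) (D (\<lambda>x. u x - v x)) = ip (\<lambda>x. D u x - D v x) (\<lambda>x. D u x - D v x)"
      by (rule ip_cong_AE[OF _ _ ae ae]; rule H1_sq(2)[OF form.diff_in[OF H]])
    then show ?thesis by (simp add: power2_eq_square)
  qed
  have low: "integral\<^sup>L \<mu> (\<lambda>x. (u x - v x)\<^sup>2) + integral\<^sup>L \<mu> (\<lambda>x. (D u x - D v x)\<^sup>2) \<le> Bc (\<lambda>x. u x - v x) (\<lambda>x. u x - v x)"
    and up: "Bc (\<lambda>x. u x - v x) (\<lambda>x. u x - v x) \<le> (2 * c) * (integral\<^sup>L \<mu> (\<lambda>x. (u x - v x)\<^sup>2) + integral\<^sup>L \<mu> (\<lambda>x. (D u x - D v x)\<^sup>2))"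
    if H: "u \<in> H1 \<rho> k" "v \<in> H1 \<rho> k" for u v
    using Bc_bounds[OF H1_sq(1)[OF form.diff_in[OF H]] H1_sq(2)[OF form.diff_in[OF H]]] Ddiff[OF H]
    by (simp_all add: power2_eq_square)
  have nn: "0 \<le> integral\<^sup>L \<mu> (\<lambda>x. (u x - v x)\<^sup>2)" for u v :: "real \<Rightarrow> real" by simp
  have "\<exists>f\<in>sq. (\<lambda>n. integral\<^sup>L \<mu> (\<lambda>x. (F n x - f x)\<^sup>2)) \<longlonglongrightarrow> 0"
  proof (rule square_integrable_complete[OF H1_sq(1)[OF F]])
    fix e :: real assume "e > 0"
    then obtain N where N: "\<forall>m\<ge>N. \<forall>n\<ge>N. Bc (\<lambda>x. F m x - F n x) (\<lambda>x. F m x - F n x) < e" using C by blast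
    have "integral\<^sup>L \<mu> (\<lambda>x. (F m x - F n x)\<^sup>2) < e" if "m \<ge> N" "n \<ge> N" for m n
    proof -
      have "Bc (\<lambda>x. F m x - F n x) (\<lambda>x. F m x - F n x) < e" using N that by blast
      with low[OF F[of m] F[of n]] nn[of "F m" "F n"] nn[of "D (F m)" "D (F n)"] show ?thesis by linarith
    qed
    then show "\<exists>N. \<forall>m\<ge>N. \<forall>n\<ge>N. integral\<^sup>L \<mu> (\<lambda>x. (F m x - F n x)\<^sup>2) < e" by blast
  qed
  then obtain f where f: "f \<in> sq" "(\<lambda>n. integral\<^sup>L \<mu> (\<lambda>x. (F n x - f x)\<^sup>2)) \<longlonglongrightarrow> 0" by blast
  have "\<exists>f\<in>sq. (\<lambda>n. integral\<^sup>L \<mu> (\<lambda>x. (D (F n) x - f x)\<^sup>2)) \<longlonglongrightarrow> 0"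
  proof (rule square_integrable_complete[OF H1_sq(2)[OF F]])
    fix e :: real assume "e > 0"
    then obtain N where N: "\<forall>m\<ge>N. \<forall>n\<ge>N. Bc (\<lambda>x. F m x - F n x) (\<lambda>x. F m x - F n x) < e" using C by blast
    have "integral\<^sup>L \<mu> (\<lambda>x. (D (F m) x - D (F n) x)\<^sup>2) < e" if "m \<ge> N" "n \<ge> N" for m n
    proof -
      have "Bc (\<lambda>x. F m x - F n x) (\<lambda>x. F m x - F n x) < e" using N that by blast
      with low[OF F[of m] F[of n]] nn[of "F m" "F n"] nn[of "D (F m)" "D (F n)"] show ?thesis by linarith
    qed
    then show "\<exists>N. \<forall>m\<ge>N. \<forall>n\<ge>N. integral\<^sup>L \<mu> (\<lambda>x. (D (F m) x - D (F n) x)\<^sup>2) < e" by blast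
  qed
  then obtain \<xi> where \<xi>: "\<xi> \<in> sq" "(\<lambda>n. integral\<^sup>L \<mu> (\<lambda>x. (D (F n) x - \<xi> x)\<^sup>2)) \<longlonglongrightarrow> 0" by blast
  have h: "hasD f \<xi>" by (rule hasD_limit[OF H1_hasD[OF F] f \<xi>])
  note fH = hasD_imp[OF h]
  have eq: "integral\<^sup>L \<mu> (\<lambda>x. (D (F n) x - \<xi> x)\<^sup>2) = integral\<^sup>L \<mu> (\<lambda>x. (D (F n) x - D f x)\<^sup>2)" for n
  proof (rule integral_cong_AE)
    show "(\<lambda>x. (D (F n) x - \<xi> x)\<^sup>2) \<in> borel_measurable \<mu>" "(\<lambda>x. (D (F n) x - D f x)\<^sup>2) \<in> borel_measurable \<mu>"
      using sq_meas[OF H1_sq(2)[OF F]] sq_meas[OF H1_sq(2)[OF fH(1)]] sq_meas[OF \<xi>(1)] by auto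
    show "AE x in \<mu>. (D (F n) x - \<xi> x)\<^sup>2 = (D (F n) x - D f x)\<^sup>2"
      unfolding AE_\<mu> using fH(2) by eventually_elim simp
  qed
  have "(\<lambda>n. Bc (\<lambda>x. F n x - f x) (\<lambda>x. F n x - f x)) \<longlonglongrightarrow> 0"
  proof (rule tendsto_sandwich[of "\<lambda>_. 0"])
    show "(\<lambda>n. (2 * c) * (integral\<^sup>L \<mu> (\<lambda>x. (F n x - f x)\<^sup>2) + integral\<^sup>L \<mu> (\<lambda>x. (D (F n) x - D f x)\<^sup>2))) \<longlonglongrightarrow> 0"
      using tendsto_mult_left[OF tendsto_add[OF f(2) \<xi>(2)[unfolded eq]], of "2 * c"] by simp
    show "\<forall>\<^sub>F n in sequentially. 0 \<le> Bc (\<lambda>x. F n x - f x) (\<lambda>x. F n x - f x)"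
      by (intro always_eventually allI form.pos form.diff_in F fH)
    show "\<forall>\<^sub>F n in sequentially. Bc (\<lambda>x. F n x - f x) (\<lambda>x. F n x - f x) \<le>
        (2 * c) * (integral\<^sup>L \<mu> (\<lambda>x. (F n x - f x)\<^sup>2) + integral\<^sup>L \<mu> (\<lambda>x. (D (F n) x - D f x)\<^sup>2))"
      by (intro always_eventually allI up F fH)
  qed simp
  then show ?thesis using fH(1) by blast
qed

lemma resolvent_exists:
  assumes f: "f \<in> sq"
  shows "\<exists>v\<in>H1 \<rho> k. \<forall>w\<in>H1 \<rho> k. Bc w v = ip w f"
proof (rule form.Riesz[OF _ _ _ H1_complete])
  have "(\<lambda>x. 0) \<in> sq" by (rule continuous_support_sq[of _ 0 0]) auto
  moreover have "has_weak_deriv UNIV (\<lambda>x::real. 0::real) (\<lambda>x. 0)" by (rule has_weak_deriv_C1) auto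
  ultimately have "hasD (\<lambda>x. 0) (\<lambda>x. 0)" by (simp add: hasD_def)
  from hasD_imp(1)[OF this] show "H1 \<rho> k \<noteq> {}" by blast
  show "ip (\<lambda>x. a * u x + b * v x) f = a * ip u f + b * ip v f" if "u \<in> H1 \<rho> k" "v \<in> H1 \<rho> k" for u v a b
    by (intro L2.Blin H1_sq that f)
  show "\<bar>ip u f\<bar> \<le> sqrt (ip f f) * sqrt (Bc u u)" if "u \<in> H1 \<rho> k" for u
  proof -
    have "\<bar>ip u f\<bar> \<le> sqrt (ip u u) * sqrt (ip f f)" by (intro L2.Cauchy_Schwarz H1_sq that f)
    also have "\<dots> \<le> sqrt (Bc u u) * sqrt (ip f f)"
    proof (intro mult_right_mono real_sqrt_le_mono)
      show "ip u u \<le> Bc u u" using Bc_bounds(1)[OF H1_sq[OF that]] L2.pos[OF H1_sq(2)[OF that]] by linarith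
    qed simp
    finally show ?thesis by (simp add: mult.commute)
  qed
qed auto

text \<open>The weak solution v of (q + c) v - D^2 v = f, that is, the resolvent applied to f. The
  choice is harmless, since coercivity determines v up to null sets.\<close>

definition res :: "(real \<Rightarrow> real) \<Rightarrow> real \<Rightarrow> real" where
  "res f = (SOME v. v \<in> H1 \<rho> k \<and> (\<forall>w\<in>H1 \<rho> k. Bc w v = ip w f))"

lemma res:
  assumes "f \<in> sq"
  shows "res f \<in> H1 \<rho> k" "w \<in> H1 \<rho> k \<Longrightarrow> Bc w (res f) = ip w f"
proof -
  have "\<exists>v. v \<in> H1 \<rho> k \<and> (\<forall>w\<in>H1 \<rho> k. Bc w v = ip w f)" using resolvent_exists[OF assms] by blast
  from someI_ex[OF this] show "res f \<in> H1 \<rho> k" "w \<in> H1 \<rho> k \<Longrightarrow> Bc w (res f) = ip w f"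
    unfolding res_def by auto
qed

lemma ip_commute: "ip f g = ip g f" by (simp add: mult.commute)

lemma res_sym:
  assumes "f \<in> sq" "g \<in> sq"
  shows "ip (res f) g = ip f (res g)"
proof -
  have "ip (res f) g = Bc (res f) (res g)" using res[OF assms(1)] res(2)[OF assms(2)] by simp
  also have "\<dots> = Bc (res g) (res f)" by (intro form.sym res assms)
  also have "\<dots> = ip (res g) f" using res[OF assms(2)] res(2)[OF assms(1)] by simp
  finally show ?thesis using ip_commute by simp
qed

text \<open>Testing the weak equation with \<open>res f\<close> itself. Only the dual norm of f
  enters, and this is all that a state known to be continuous in the dual norm can offer.\<close>

lemma norm_H1_res_le:
  assumes f: "f \<in> sq" and C: "\<And>\<phi>. \<phi> \<in> H1 \<rho> k \<Longrightarrow> \<bar>ip f \<phi>\<bar> \<le> C * norm_H1 \<rho> k \<phi>"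
  shows "norm_H1 \<rho> k (res f) \<le> max C 0"
proof -
  let ?n = "norm_H1 \<rho> k (res f)"
  have "?n\<^sup>2 \<le> Bc (res f) (res f)" by (rule norm_H1_le_Bc[OF res(1)[OF f]])
  also have "\<dots> = ip f (res f)" using res[OF f] ip_commute by simp
  also have "\<dots> \<le> C * ?n" using C[OF res(1)[OF f]] by linarith
  finally have "?n * ?n \<le> C * ?n" by (simp add: power2_eq_square)
  then show ?thesis using norm_H1_nonneg[of "res f"] by (cases "?n = 0") (auto simp: mult_le_cancel_right)
qed

text \<open>If \<open>res f\<close> vanishes, then so does its energy, which is
  \<open>ip (res f) f\<close>. As f lies in \<open>H1\<close>, it may itself be used as a test
  function, and \<open>Bc f (res f)\<close>, which equals \<open>ip f f\<close>, vanishes by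
  Cauchy-Schwarz.\<close>

lemma res_0_imp_0:
  assumes f: "f \<in> H1 \<rho> k" and z: "ip (res f) (res f) = 0"
  shows "AE x in lebesgue. f x = 0"
proof -
  note fs = H1_sq(1)[OF f]
  note r = res[OF fs]
  have "\<bar>ip (res f) f\<bar> \<le> sqrt (ip (res f) (res f)) * sqrt (ip f f)"
    by (intro L2.Cauchy_Schwarz H1_sq r fs)
  then have "Bc (res f) (res f) = 0" using z r by simp
  then have "Bc f (res f) = 0"
    using form.Cauchy_Schwarz[OF f r(1)] by simp
  then have "ip f f = 0" using r(2)[OF f] by simp
  from square_integral_0_AE[OF fs this] show ?thesis by (simp add: AE_\<mu>)
qed

end

section \<open>Backward uniqueness\<close>

context weights_pot
begin

lemma norm_le_norm_H1:
  assumes "\<phi> \<in> H1 \<rho> k" shows "sqrt (ip \<phi> \<phi>) \<le> norm_H1 \<rho> k \<phi>"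
proof -
  have "ip \<phi> \<phi> \<le> (norm_H1 \<rho> k \<phi>)\<^sup>2"
    unfolding norm_H1_sq[OF assms] using L2.pos[OF H1_sq(2)[OF assms]] by linarith
  then show ?thesis by (rule real_le_lsqrt[OF norm_H1_nonneg])
qed

lemma ip_le_norm_H1:
  assumes "w \<in> sq" "\<phi> \<in> H1 \<rho> k"
  shows "\<bar>ip w \<phi>\<bar> \<le> sqrt (ip w w) * norm_H1 \<rho> k \<phi>"
proof -
  have "\<bar>ip w \<phi>\<bar> \<le> sqrt (ip w w) * sqrt (ip \<phi> \<phi>)" by (intro L2.Cauchy_Schwarz H1_sq assms)
  also have "\<dots> \<le> sqrt (ip w w) * norm_H1 \<rho> k \<phi>"
    by (rule mult_left_mono[OF norm_le_norm_H1[OF assms(2)]]) simp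
  finally show ?thesis .
qed

text \<open>Continuity in the dual norm, spelled out as an estimate with the factor e so that no
  supremum has to be handled.\<close>

definition dual_cont :: "real \<Rightarrow> (real \<Rightarrow> real \<Rightarrow> real) \<Rightarrow> bool" where
  "dual_cont T W \<longleftrightarrow> (\<forall>t0\<in>{0..T}. \<forall>e>0. \<exists>d>0. \<forall>t\<in>{0..T}. \<bar>t - t0\<bar> < d \<longrightarrow>
     (\<forall>\<phi>\<in>H1 \<rho> k. \<bar>ip (W t) \<phi> - ip (W t0) \<phi>\<bar> \<le> e * norm_H1 \<rho> k \<phi>))"

lemma dual_contD:
  assumes "dual_cont T W" "t0 \<in> {0..T}" "e > 0"
  obtains d where "d > 0" "\<And>t \<phi>. t \<in> {0..T} \<Longrightarrow> \<bar>t - t0\<bar> < d \<Longrightarrow> \<phi> \<in> H1 \<rho> k \<Longrightarrow>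
     \<bar>ip (W t) \<phi> - ip (W t0) \<phi>\<bar> \<le> e * norm_H1 \<rho> k \<phi>"
  using assms unfolding dual_cont_def by blast

lemma dual_cont_continuous:
  assumes "dual_cont T W" "\<phi> \<in> H1 \<rho> k"
  shows "continuous_on {0..T} (\<lambda>t. ip (W t) \<phi>)"
  unfolding continuous_on_iff
proof (intro ballI allI impI)
  fix t0 e :: real assume t0: "t0 \<in> {0..T}" and e: "e > 0"
  let ?n = "norm_H1 \<rho> k \<phi>"
  have n: "?n \<ge> 0" by (rule norm_H1_nonneg)
  obtain d where d: "d > 0" "\<And>t \<phi>. t \<in> {0..T} \<Longrightarrow> \<bar>t - t0\<bar> < d \<Longrightarrow> \<phi> \<in> H1 \<rho> k \<Longrightarrow>
     \<bar>ip (W t) \<phi> - ip (W t0) \<phi>\<bar> \<le> e / (?n + 1) * norm_H1 \<rho> k \<phi>"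
    using dual_contD[OF assms(1) t0, of "e / (?n + 1)"] e n by auto
  have "e / (?n + 1) * ?n < e" using e n by (simp add: field_simps)
  then have "dist (ip (W t) \<phi>) (ip (W t0) \<phi>) < e" if "t \<in> {0..T}" "dist t t0 < d" for t
    using d(2)[OF that(1) _ assms(2)] that(2) by (simp add: dist_real_def)
  then show "\<exists>d>0. \<forall>t\<in>{0..T}. dist t t0 < d \<longrightarrow> dist (ip (W t) \<phi>) (ip (W t0) \<phi>) < e"
    using d(1) by blast
qed

text \<open>Continuity bounds the dual norm near each time, and bisection of [0,T] makes the bound
  global; bounds on adjacent intervals are simply added.\<close>

lemma dual_cont_bounded:
  assumes dc: "dual_cont T W" and W: "\<And>t. t \<in> {0..T} \<Longrightarrow> W t \<in> sq"
  obtains C where "C \<ge> 0" "\<And>t \<phi>. t \<in> {0..T} \<Longrightarrow> \<phi> \<in> H1 \<rho> k \<Longrightarrow> \<bar>ip (W t) \<phi>\<bar> \<le> C * norm_H1 \<rho> k \<phi>"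
proof (cases "0 \<le> T")
  case True
  define P where "P a b \<longleftrightarrow> (\<exists>C\<ge>0. \<forall>t\<in>{a..b} \<inter> {0..T}. \<forall>\<phi>\<in>H1 \<rho> k. \<bar>ip (W t) \<phi>\<bar> \<le> C * norm_H1 \<rho> k \<phi>)" for a b
  have "P 0 T"
  proof (induction rule: Bolzano[OF True])
    case (1 a b c)
    then obtain C1 C2 where C: "C1 \<ge> 0" "C2 \<ge> 0" "\<forall>t\<in>{a..b} \<inter> {0..T}. \<forall>\<phi>\<in>H1 \<rho> k. \<bar>ip (W t) \<phi>\<bar> \<le> C1 * norm_H1 \<rho> k \<phi>"
      "\<forall>t\<in>{b..c} \<inter> {0..T}. \<forall>\<phi>\<in>H1 \<rho> k. \<bar>ip (W t) \<phi>\<bar> \<le> C2 * norm_H1 \<rho> k \<phi>" unfolding P_def by blast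
    have "\<bar>ip (W t) \<phi>\<bar> \<le> (C1 + C2) * norm_H1 \<rho> k \<phi>" if "t \<in> {a..c} \<inter> {0..T}" "\<phi> \<in> H1 \<rho> k" for t \<phi>
    proof -
      have "C1 * norm_H1 \<rho> k \<phi> \<le> (C1 + C2) * norm_H1 \<rho> k \<phi>" "C2 * norm_H1 \<rho> k \<phi> \<le> (C1 + C2) * norm_H1 \<rho> k \<phi>"
        using C norm_H1_nonneg by (auto intro: mult_right_mono)
      moreover have "t \<in> {a..b} \<inter> {0..T} \<or> t \<in> {b..c} \<inter> {0..T}" using that by auto
      then have "\<bar>ip (W t) \<phi>\<bar> \<le> C1 * norm_H1 \<rho> k \<phi> \<or> \<bar>ip (W t) \<phi>\<bar> \<le> C2 * norm_H1 \<rho> k \<phi>"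
        using C(3,4) that(2) by blast
      ultimately show ?thesis by linarith
    qed
    then show ?case unfolding P_def using C(1,2) by (intro exI[of _ "C1 + C2"]) auto
  next
    case (2 x)
    then have x: "x \<in> {0..T}" by auto
    obtain d where d: "d > 0" "\<And>t \<phi>. t \<in> {0..T} \<Longrightarrow> \<bar>t - x\<bar> < d \<Longrightarrow> \<phi> \<in> H1 \<rho> k \<Longrightarrow>
      \<bar>ip (W t) \<phi> - ip (W x) \<phi>\<bar> \<le> 1 * norm_H1 \<rho> k \<phi>"
      using dual_contD[OF dc x, of 1] by auto
    define C where "C = sqrt (ip (W x) (W x)) + 1"
    have Cx: "\<bar>ip (W x) \<phi>\<bar> \<le> sqrt (ip (W x) (W x)) * norm_H1 \<rho> k \<phi>" if "\<phi> \<in> H1 \<rho> k" for \<phi>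
      by (intro ip_le_norm_H1 W x that)
    show ?case
    proof (intro exI[of _ d] conjI d(1) allI impI)
      fix a b assume ab: "a \<le> x \<and> x \<le> b \<and> b - a < d"
      have "\<bar>ip (W t) \<phi>\<bar> \<le> C * norm_H1 \<rho> k \<phi>" if t: "t \<in> {a..b} \<inter> {0..T}" and p: "\<phi> \<in> H1 \<rho> k" for t \<phi>
      proof -
        have "\<bar>t - x\<bar> < d" "t \<in> {0..T}" using t ab by auto
        from d(2)[OF this(2,1) p] Cx[OF p] show ?thesis unfolding C_def by (simp add: distrib_right)
      qed
      moreover have "C \<ge> 0" using L2.pos[OF W[OF x]] by (simp add: C_def)
      ultimately show "P a b" unfolding P_def by blast
    qed
  qed
  then obtain C where "C \<ge> 0" "\<forall>t\<in>{0..T} \<inter> {0..T}. \<forall>\<phi>\<in>H1 \<rho> k. \<bar>ip (W t) \<phi>\<bar> \<le> C * norm_H1 \<rho> k \<phi>"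
    unfolding P_def by blast
  then show ?thesis by (intro that[of C]) (simp_all only: Int_absorb)
next
  case False
  then show ?thesis by (intro that[of 0]) auto
qed

text \<open>The symmetry of the generator makes \<open>ip (res (W a)) (res (W b))\<close> a function of \<open>a + b\<close>.\<close>

lemma backward_half:
  assumes dc: "dual_cont T W" and W: "\<And>t. t \<in> {0..T} \<Longrightarrow> W t \<in> H1 \<rho> k"
    and wd: "\<And>\<phi>. \<phi> \<in> H1 \<rho> k \<Longrightarrow> has_weak_deriv {0<..<T} (\<lambda>t. ip (W t) \<phi>) (\<lambda>t. - Bq (W t) \<phi>)"
    and \<tau>: "0 < \<tau>" "\<tau> \<le> T" and z: "AE x in lebesgue. W \<tau> x = 0"
  shows "AE x in lebesgue. W (\<tau> / 2) x = 0"
proof -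
  have Ws: "W t \<in> sq" if "t \<in> {0..T}" for t using H1_sq(1)[OF W[OF that]] .
  obtain C where C: "C \<ge> 0" "\<And>t \<phi>. t \<in> {0..T} \<Longrightarrow> \<phi> \<in> H1 \<rho> k \<Longrightarrow> \<bar>ip (W t) \<phi>\<bar> \<le> C * norm_H1 \<rho> k \<phi>"
    using dual_cont_bounded[OF dc Ws] by blast
  define R where "R t = res (W t)" for t
  \<comment> \<open>One resolvent would lead to \<open>ip (W a) (W b)\<close>, whose joint
    continuity would need uniform \<open>H1\<close> bounds on the states. With two, the form
    \<open>Bc (W a) (RR b)\<close> becomes \<open>ip (W a) (R b)\<close>, and such bounds do hold
    for \<open>R\<close> and \<open>RR\<close>.\<close>
  define RR where "RR t = res (R t)" for t
  have RH: "R t \<in> H1 \<rho> k" if "t \<in> {0..T}" for t unfolding R_def by (rule res(1)[OF Ws[OF that]])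
  have Rs: "R t \<in> sq" if "t \<in> {0..T}" for t by (rule H1_sq(1)[OF RH[OF that]])
  have RRH: "RR t \<in> H1 \<rho> k" if "t \<in> {0..T}" for t unfolding RR_def by (rule res(1)[OF Rs[OF that]])
  have Rn: "norm_H1 \<rho> k (R t) \<le> C" if "t \<in> {0..T}" for t
    using norm_H1_res_le[OF Ws[OF that] C(2)[OF that]] C(1) by (simp add: R_def)
  have RRn: "norm_H1 \<rho> k (RR t) \<le> C" if t: "t \<in> {0..T}" for t
  proof -
    have "norm_H1 \<rho> k (RR t) \<le> max C 0"
      unfolding RR_def
    proof (rule norm_H1_res_le[OF Rs[OF t]])
      fix \<phi> assume p: "\<phi> \<in> H1 \<rho> k"
      have "\<bar>ip (R t) \<phi>\<bar> \<le> sqrt (ip (R t) (R t)) * norm_H1 \<rho> k \<phi>" by (rule ip_le_norm_H1[OF Rs[OF t] p])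
      also have "\<dots> \<le> C * norm_H1 \<rho> k \<phi>"
        by (rule mult_right_mono[OF order_trans[OF norm_le_norm_H1[OF RH[OF t]] Rn[OF t]] norm_H1_nonneg])
      finally show "\<bar>ip (R t) \<phi>\<bar> \<le> C * norm_H1 \<rho> k \<phi>" .
    qed
    then show ?thesis using C(1) by simp
  qed
  define p where "p a b = ip (W a) (R b)" for a b
  define P where "P a b = ip (W a) (RR b)" for a b
  have psym: "p a b = p b a" if "a \<in> {0..T}" "b \<in> {0..T}" for a b
    using res_sym[OF Ws[OF that(1)] Ws[OF that(2)]] ip_commute unfolding p_def R_def by simp
  have PR: "P a b = ip (R a) (R b)" if "a \<in> {0..T}" "b \<in> {0..T}" for a b
    using res_sym[OF Ws[OF that(1)] Rs[OF that(2)]] unfolding P_def RR_def R_def by simp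
  have Psym: "P a b = P b a" if "a \<in> {0..T}" "b \<in> {0..T}" for a b
    using PR[OF that] PR[OF that(2,1)] ip_commute by simp
  \<comment> \<open>\<Gamma> is the derivative of \<open>P\<close> in its first argument. Since
    \<Gamma> and \<open>P\<close> are symmetric, it is also the derivative in the second, and the
    two contributions along (r, \<tau> - r) cancel.\<close>
  define \<Gamma> where "\<Gamma> a b = c * P a b - p a b" for a b
  have \<Gamma>sym: "\<Gamma> a b = \<Gamma> b a" if "a \<in> {0..T}" "b \<in> {0..T}" for a b
    using psym[OF that] Psym[OF that] by (simp add: \<Gamma>_def)
  have c0: "c \<ge> 1" using Cq_nonneg by (simp add: c_def)
  have FTC: "P a' b - P a b = (LINT t:{a..a'}|lebesgue. \<Gamma> t b)"
    if "0 < a" "a \<le> a'" "a' < T" "b \<in> {0..T}" for a a' b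
  proof -
    have eq: "- Bq (W t) (RR b) = \<Gamma> t b" if t: "t \<in> {0..T}" for t
    proof -
      have "Bc (W t) (RR b) = p t b"
        unfolding RR_def p_def by (rule res(2)[OF Rs[OF \<open>b \<in> {0..T}\<close>] W[OF t]])
      then show ?thesis by (simp add: Bc_def \<Gamma>_def P_def)
    qed
    have "P a' b - P a b = (LINT t:{a..a'}|lebesgue. - Bq (W t) (RR b))"
      unfolding P_def
      by (rule has_weak_deriv_FTC[OF wd[OF RRH[OF that(4)]]])
        (use that in \<open>auto intro!: continuous_on_subset[OF dual_cont_continuous[OF dc RRH]]\<close>)
    also have "\<dots> = (LINT t:{a..a'}|lebesgue. \<Gamma> t b)"
      unfolding set_lebesgue_integral_def
      by (rule Bochner_Integration.integral_cong) (use eq that in \<open>auto simp: indicator_def\<close>)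
    finally show ?thesis .
  qed
  \<comment> \<open>One argument is moved at a time, the second one after exchanging the arguments
    by symmetry; the uniform \<open>H1\<close> bounds turn continuity in the dual norm into joint
    continuity.\<close>
  have local: "\<exists>d>0. \<forall>a'\<in>{0..T}. \<forall>b'\<in>{0..T}. \<bar>a' - a\<bar> < d \<longrightarrow> \<bar>b' - b\<bar> < d \<longrightarrow> 
      \<bar>p a' b' - p a b\<bar> \<le> e \<and> \<bar>P a' b' - P a b\<bar> \<le> e"
    if a: "a \<in> {0..T}" and b: "b \<in> {0..T}" and e: "e > 0" for a b e
  proof -
    define e' where "e' = e / (2 * (C + 1))"
    have e': "e' > 0" "2 * (e' * C) \<le> e" using e C(1) by (auto simp: e'_def field_simps)
    obtain d1 where d1: "d1 > 0" "\<And>t \<phi>. t \<in> {0..T} \<Longrightarrow> \<bar>t - a\<bar> < d1 \<Longrightarrow> \<phi> \<in> H1 \<rho> k \<Longrightarrow>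
      \<bar>ip (W t) \<phi> - ip (W a) \<phi>\<bar> \<le> e' * norm_H1 \<rho> k \<phi>" using dual_contD[OF dc a e'(1)] by blast
    obtain d2 where d2: "d2 > 0" "\<And>t \<phi>. t \<in> {0..T} \<Longrightarrow> \<bar>t - b\<bar> < d2 \<Longrightarrow> \<phi> \<in> H1 \<rho> k \<Longrightarrow>
      \<bar>ip (W t) \<phi> - ip (W b) \<phi>\<bar> \<le> e' * norm_H1 \<rho> k \<phi>" using dual_contD[OF dc b e'(1)] by blast
    have "\<bar>p a' b' - p a b\<bar> \<le> e \<and> \<bar>P a' b' - P a b\<bar> \<le> e"
      if ab': "a' \<in> {0..T}" "b' \<in> {0..T}" "\<bar>a' - a\<bar> < min d1 d2" "\<bar>b' - b\<bar> < min d1 d2" for a' b'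
    proof -
      have "\<bar>p a' b' - p a b'\<bar> \<le> e' * norm_H1 \<rho> k (R b')" "\<bar>P a' b' - P a b'\<bar> \<le> e' * norm_H1 \<rho> k (RR b')"
        unfolding p_def P_def using d1(2)[OF ab'(1) _ RH[OF ab'(2)]] d1(2)[OF ab'(1) _ RRH[OF ab'(2)]] ab'(3) by auto
      moreover have "\<bar>p b' a - p b a\<bar> \<le> e' * norm_H1 \<rho> k (R a)" "\<bar>P b' a - P b a\<bar> \<le> e' * norm_H1 \<rho> k (RR a)"
        unfolding p_def P_def using d2(2)[OF ab'(2) _ RH[OF a]] d2(2)[OF ab'(2) _ RRH[OF a]] ab'(4) by auto
      moreover have "e' * norm_H1 \<rho> k (R b') \<le> e' * C" "e' * norm_H1 \<rho> k (RR b') \<le> e' * C"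
        "e' * norm_H1 \<rho> k (R a) \<le> e' * C" "e' * norm_H1 \<rho> k (RR a) \<le> e' * C"
        using e'(1) by (intro mult_left_mono Rn RRn ab' a; simp)+
      moreover note psym[OF ab'(2) a] psym[OF b a] Psym[OF ab'(2) a] Psym[OF b a] e'(2)
      ultimately show ?thesis by linarith
    qed
    then show ?thesis using d1(1) d2(1) by (intro exI[of _ "min d1 d2"]) auto
  qed
  have \<Gamma>local: "\<exists>d>0. \<forall>a'\<in>{0..T}. \<forall>b'\<in>{0..T}. \<bar>a' - a\<bar> < d \<longrightarrow> \<bar>b' - b\<bar> < d \<longrightarrow> \<bar>\<Gamma> a' b' - \<Gamma> a b\<bar> \<le> e"
    if a: "a \<in> {0..T}" and b: "b \<in> {0..T}" and e: "e > 0" for a b e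
  proof -
    have e2: "e / (c + 1) > 0" using e c0 by simp
    obtain d where d: "d > 0" "\<And>a' b'. a' \<in> {0..T} \<Longrightarrow> b' \<in> {0..T} \<Longrightarrow> \<bar>a' - a\<bar> < d \<Longrightarrow> \<bar>b' - b\<bar> < d \<Longrightarrow>
      \<bar>p a' b' - p a b\<bar> \<le> e / (c + 1) \<and> \<bar>P a' b' - P a b\<bar> \<le> e / (c + 1)" using local[OF a b e2] by blast
    have "\<bar>\<Gamma> a' b' - \<Gamma> a b\<bar> \<le> e" if ab': "a' \<in> {0..T}" "b' \<in> {0..T}" "\<bar>a' - a\<bar> < d" "\<bar>b' - b\<bar> < d" for a' b'
    proof -
      have "\<Gamma> a' b' - \<Gamma> a b = c * (P a' b' - P a b) - (p a' b' - p a b)" by (simp add: \<Gamma>_def algebra_simps)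
      then have "\<bar>\<Gamma> a' b' - \<Gamma> a b\<bar> \<le> \<bar>c * (P a' b' - P a b)\<bar> + \<bar>p a' b' - p a b\<bar>" by (simp only: abs_triangle_ineq4)
      also have "\<bar>c * (P a' b' - P a b)\<bar> = c * \<bar>P a' b' - P a b\<bar>" using c0 by (simp add: abs_mult)
      finally have 1: "\<bar>\<Gamma> a' b' - \<Gamma> a b\<bar> \<le> c * \<bar>P a' b' - P a b\<bar> + \<bar>p a' b' - p a b\<bar>" .
      have "c * \<bar>P a' b' - P a b\<bar> \<le> c * (e / (c + 1))" using d(2)[OF ab'] c0 by (intro mult_left_mono) auto
      then have "\<bar>\<Gamma> a' b' - \<Gamma> a b\<bar> \<le> c * (e / (c + 1)) + e / (c + 1)" using 1 d(2)[OF ab'] by linarith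
      also have "\<dots> = (c + 1) * (e / (c + 1))" by (simp only: distrib_right mult_1)
      also have "\<dots> = e" using c0 by simp
      finally show ?thesis .
    qed
    then show ?thesis using d(1) by blast
  qed
  have \<Gamma>int: "set_integrable lebesgue {a..a'} (\<lambda>t. \<Gamma> t b)" if "0 \<le> a" "a' \<le> T" "b \<in> {0..T}" for a a' b
    unfolding \<Gamma>_def P_def p_def
    by (intro absolutely_integrable_continuous_real continuous_intros continuous_on_subset[OF dual_cont_continuous[OF dc RRH[OF that(3)]]]
        continuous_on_subset[OF dual_cont_continuous[OF dc RH[OF that(3)]]]) (use that in auto)
  have near: "\<bar>(LINT t:{a..a'}|lebesgue. \<Gamma> t b) - (a' - a) * g\<bar> \<le> (a' - a) * e"
    if "0 \<le> a" "a \<le> a'" "a' \<le> T" "b \<in> {0..T}" "\<And>t. t \<in> {a..a'} \<Longrightarrow> \<bar>\<Gamma> t b - g\<bar> \<le> e" for a a' b g e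
  proof -
    have ci: "set_integrable lebesgue {a..a'} (\<lambda>t. y)" for y :: real
      by (intro absolutely_integrable_continuous_real continuous_intros)
    have cv: "(LINT t:{a..a'}|lebesgue. y) = (a' - a) * y" for y :: real
      using that by (simp add: set_lebesgue_integral_eq_integral[OF ci])
    have "(LINT t:{a..a'}|lebesgue. \<Gamma> t b) \<le> (LINT t:{a..a'}|lebesgue. g + e)"
      by (rule set_integral_mono[OF \<Gamma>int[OF that(1,3,4)] ci]) (use that(5) in \<open>auto simp: abs_le_iff algebra_simps\<close>)
    moreover have "(LINT t:{a..a'}|lebesgue. g - e) \<le> (LINT t:{a..a'}|lebesgue. \<Gamma> t b)"
      by (rule set_integral_mono[OF ci \<Gamma>int[OF that(1,3,4)]]) (use that(5) in \<open>force simp: abs_le_iff algebra_simps\<close>)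
    ultimately show ?thesis unfolding cv by (simp add: abs_le_iff algebra_simps)
  qed
  \<comment> \<open>\<open>h\<close> starts at \<open>P 0 \<tau>\<close>, which is zero because the
    state at \<tau> vanishes, and ends at the squared norm of \<open>R (\<tau> / 2)\<close>.\<close>
  define h where "h r = P r (\<tau> - r)" for r
  have hc: "continuous_on {0..\<tau>/2} h"
    unfolding continuous_on_iff
  proof (intro ballI allI impI)
    fix r e :: real assume r: "r \<in> {0..\<tau>/2}" and e: "e > 0"
    have ab: "r \<in> {0..T}" "\<tau> - r \<in> {0..T}" using r \<tau> by auto
    have e2: "e / 2 > 0" using e by simp
    obtain d where d: "d > 0" "\<And>a' b'. a' \<in> {0..T} \<Longrightarrow> b' \<in> {0..T} \<Longrightarrow> \<bar>a' - r\<bar> < d \<Longrightarrow> \<bar>b' - (\<tau> - r)\<bar> < d \<Longrightarrow>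
      \<bar>P a' b' - P r (\<tau> - r)\<bar> \<le> e / 2" using local[OF ab e2] by blast
    have "dist (h r') (h r) < e" if r': "r' \<in> {0..\<tau>/2}" "dist r' r < d" for r'
    proof -
      have "\<bar>P r' (\<tau> - r') - P r (\<tau> - r)\<bar> \<le> e / 2"
        by (rule d(2)) (use r' \<tau> in \<open>auto simp: dist_real_def\<close>)
      then show ?thesis using e by (simp add: h_def dist_real_def)
    qed
    then show "\<exists>d>0. \<forall>r'\<in>{0..\<tau>/2}. dist r' r < d \<longrightarrow> dist (h r') (h r) < e" using d(1) by blast
  qed
  have h': "(h has_real_derivative 0) (at r)" if r: "0 < r" "r < \<tau>/2" for r
    unfolding DERIV_def LIM_eq
  proof (intro allI impI)
    fix e :: real assume e: "e > 0"
    have ab: "r \<in> {0..T}" "\<tau> - r \<in> {0..T}" using r \<tau> by auto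
    define g where "g = \<Gamma> r (\<tau> - r)"
    have e3: "e / 3 > 0" using e by simp
    obtain d where d: "d > 0" "\<And>a' b'. a' \<in> {0..T} \<Longrightarrow> b' \<in> {0..T} \<Longrightarrow> \<bar>a' - r\<bar> < d \<Longrightarrow> \<bar>b' - (\<tau> - r)\<bar> < d \<Longrightarrow>
      \<bar>\<Gamma> a' b' - g\<bar> \<le> e / 3" using \<Gamma>local[OF ab e3] unfolding g_def by blast
    have d': "\<bar>\<Gamma> b' a' - g\<bar> \<le> e / 3" if "a' \<in> {0..T}" "b' \<in> {0..T}" "\<bar>a' - r\<bar> < d" "\<bar>b' - (\<tau> - r)\<bar> < d" for a' b'
      using d(2)[OF that] \<Gamma>sym[OF that(1,2)] by simp
    \<comment> \<open>The increment is a difference of two integrals of \<Gamma> over intervals of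
      equal length v - u, and both integrands are within \<open>e / 3\<close> of the same number
      g.\<close>
    have inc: "\<bar>h v - h u\<bar> \<le> (v - u) * (2 * (e / 3))"
      if uv: "0 < u" "u \<le> v" "v < \<tau>/2" "\<bar>u - r\<bar> < d" "\<bar>v - r\<bar> < d" for u v
    proof -
      have m: "u \<in> {0..T}" "v \<in> {0..T}" "\<tau> - u \<in> {0..T}" "\<tau> - v \<in> {0..T}" using uv \<tau> by auto
      have A: "P v (\<tau> - v) - P u (\<tau> - v) = (LINT t:{u..v}|lebesgue. \<Gamma> t (\<tau> - v))"
        by (rule FTC) (use uv \<tau> m in auto)
      have B: "P (\<tau> - u) u - P (\<tau> - v) u = (LINT t:{\<tau> - v..\<tau> - u}|lebesgue. \<Gamma> t u)"
        by (rule FTC) (use uv \<tau> m in auto)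
      have "\<bar>(LINT t:{u..v}|lebesgue. \<Gamma> t (\<tau> - v)) - (v - u) * g\<bar> \<le> (v - u) * (e / 3)"
      proof (rule near)
        show "\<bar>\<Gamma> t (\<tau> - v) - g\<bar> \<le> e / 3" if "t \<in> {u..v}" for t
          by (rule d(2)) (use that uv m \<tau> in auto)
      qed (use uv m in auto)
      moreover have "\<bar>(LINT t:{\<tau> - v..\<tau> - u}|lebesgue. \<Gamma> t u) - (v - u) * g\<bar> \<le> (v - u) * (e / 3)"
      proof -
        have "\<bar>(LINT t:{\<tau> - v..\<tau> - u}|lebesgue. \<Gamma> t u) - ((\<tau> - u) - (\<tau> - v)) * g\<bar> \<le> ((\<tau> - u) - (\<tau> - v)) * (e / 3)"
      proof (rule near)
        show "\<bar>\<Gamma> t u - g\<bar> \<le> e / 3" if "t \<in> {\<tau> - v..\<tau> - u}" for t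
          by (rule d') (use that uv m \<tau> in auto)
      qed (use uv m in auto)
      then show ?thesis by simp
      qed
      moreover have "h v - h u = (P v (\<tau> - v) - P u (\<tau> - v)) - (P (\<tau> - u) u - P (\<tau> - v) u)"
        using Psym[OF m(1,4)] Psym[OF m(1,3)] by (simp add: h_def)
      moreover have "(v - u) * (2 * (e / 3)) = (v - u) * (e / 3) + (v - u) * (e / 3)" by simp
      ultimately show ?thesis unfolding A B by linarith
    qed
    define d0 where "d0 = min d (min r (\<tau>/2 - r))"
    have "norm ((h (r + x) - h r) / x - 0) < e" if x: "x \<noteq> 0" "norm (x - 0) < d0" for x
    proof -
      have xd: "\<bar>x\<bar> < d" "\<bar>x\<bar> < r" "\<bar>x\<bar> < \<tau>/2 - r" using x by (auto simp: d0_def)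
      have "\<bar>h (r + x) - h r\<bar> \<le> \<bar>x\<bar> * (2 * (e / 3))"
      proof (cases "x > 0")
        case True
        then show ?thesis using inc[of r "r + x"] r xd d(1) by auto
      next
        case False
        then show ?thesis using inc[of "r + x" r] r xd d(1) by (auto simp: abs_minus_commute)
      qed
      then have "\<bar>h (r + x) - h r\<bar> / \<bar>x\<bar> \<le> 2 * (e / 3)" using x(1) by (simp add: divide_le_eq mult.commute)
      moreover have "2 * (e / 3) < e" using e by simp
      ultimately have "\<bar>h (r + x) - h r\<bar> / \<bar>x\<bar> < e" by (rule le_less_trans)
      then show ?thesis by (simp only: abs_divide real_norm_def diff_0_right)
    qed
    moreover have "d0 > 0" using d(1) r by (simp add: d0_def)
    ultimately show "\<exists>d0>0. \<forall>x. x \<noteq> 0 \<and> norm (x - 0) < d0 \<longrightarrow> norm ((h (r + x) - h r) / x - 0) < e" by blast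
  qed
  have "h (\<tau>/2) = h 0"
    by (rule DERIV_isconst_end[of 0 "\<tau>/2" h]) (use \<tau> hc h' in auto)
  moreover have "h 0 = 0"
  proof -
    have m: "0 \<in> {0..T}" "\<tau> \<in> {0..T}" using \<tau> by auto
    have "h 0 = P \<tau> 0" using Psym[OF m] by (simp add: h_def)
    also have "\<dots> = ip (\<lambda>x. 0) (RR 0)"
      unfolding P_def by (rule ip_cong_AE) (use z Ws m H1_sq(1)[OF RRH] in auto)
    finally show ?thesis by simp
  qed
  moreover have m2: "\<tau> / 2 \<in> {0..T}" using \<tau> by auto
  ultimately have "ip (R (\<tau>/2)) (R (\<tau>/2)) = 0"
    using PR[OF m2 m2] by (simp add: h_def)
  then show ?thesis using res_0_imp_0[OF W[OF m2]] unfolding R_def by simp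
qed

text \<open>Halving repeatedly, the state vanishes at times T / 2^n, which tend to 0. Continuity at
  0 is available in the dual norm only, so the limit is tested with the initial state itself, an
  element of \<open>H1\<close>.\<close>

lemma backward_uniqueness:
  assumes T: "T > 0" and dc: "dual_cont T W" and W: "\<And>t. t \<in> {0..T} \<Longrightarrow> W t \<in> H1 \<rho> k"
    and wd: "\<And>\<phi>. \<phi> \<in> H1 \<rho> k \<Longrightarrow> has_weak_deriv {0<..<T} (\<lambda>t. ip (W t) \<phi>) (\<lambda>t. - Bq (W t) \<phi>)"
    and z: "AE x in lebesgue. W T x = 0"
  shows "AE x in lebesgue. W 0 x = 0"
proof -
  have zn: "AE x in lebesgue. W (T / 2 ^ n) x = 0" for n
  proof (induction n)
    case (Suc n)
    have "T / 2 ^ n \<le> T" using T by (simp add: divide_le_eq mult_le_cancel_left1)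
    then have "AE x in lebesgue. W (T / 2 ^ n / 2) x = 0"
      using T by (intro backward_half[OF dc W wd _ _ Suc]) auto
    then show ?case by (simp add: mult.commute)
  qed (use z in simp)
  have 0: "0 \<in> {0..T}" using T by simp
  let ?n = "norm_H1 \<rho> k (W 0)"
  have small: "\<bar>ip (W 0) (W 0)\<bar> \<le> e * ?n" if e: "e > 0" for e
  proof -
    obtain d where d: "d > 0" "\<And>t \<phi>. t \<in> {0..T} \<Longrightarrow> \<bar>t - 0\<bar> < d \<Longrightarrow> \<phi> \<in> H1 \<rho> k \<Longrightarrow>
      \<bar>ip (W t) \<phi> - ip (W 0) \<phi>\<bar> \<le> e * norm_H1 \<rho> k \<phi>" using dual_contD[OF dc 0 e] by blast
    obtain n where n: "(1/2) ^ n < d / T" using real_arch_pow_inv[of "d / T" "1/2"] d T by auto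
    define t where "t = T / 2 ^ n"
    have t: "t \<in> {0..T}" "\<bar>t - 0\<bar> < d"
      using T n by (auto simp: t_def divide_le_eq mult_le_cancel_left1 field_simps)
    have "ip (W t) (W 0) = ip (\<lambda>x. 0) (W 0)"
      unfolding t_def by (rule ip_cong_AE) (use zn H1_sq(1)[OF W] t 0 in \<open>auto simp: t_def\<close>)
    then show ?thesis using d(2)[OF t W[OF 0]] by simp
  qed
  have n: "?n \<ge> 0" by (rule norm_H1_nonneg)
  have "\<bar>ip (W 0) (W 0)\<bar> \<le> 0 + e" if e: "e > 0" for e
  proof -
    have "\<bar>ip (W 0) (W 0)\<bar> \<le> e / (?n + 1) * ?n" using n e by (intro small) simp
    also have "\<dots> \<le> e" using e n by (simp add: field_simps)
    finally show ?thesis by simp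
  qed
  then have "\<bar>ip (W 0) (W 0)\<bar> \<le> 0" by (rule field_le_epsilon)
  then have "ip (W 0) (W 0) = 0" by linarith
  from square_integral_0_AE[OF H1_sq(1)[OF W[OF 0]] this] show ?thesis by (simp add: AE_\<mu>)
qed

end

section \<open>Even and odd extensions, and Green's formula\<close>

lemma at_within_Ici_at: "x > 0 \<Longrightarrow> at x within {0..} = at (x::real)"
  by (rule at_within_interior) auto

text \<open>The one-sided derivatives at 0 are opposite, hence they agree exactly because
  \<open>f' 0\<close> is 0; the factor \<open>sgn x\<close> gives the value 0 there.\<close>

lemma DERIV_even_extension:
  fixes f f' :: "real \<Rightarrow> real"
  assumes d: "\<And>x. x \<ge> 0 \<Longrightarrow> (f has_real_derivative f' x) (at x within {0..})" and z: "f' 0 = 0"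
  shows "((\<lambda>x. f \<bar>x\<bar>) has_real_derivative sgn x * f' \<bar>x\<bar>) (at x)"
proof -
  consider "x > 0" | "x < 0" | "x = 0" by linarith
  then show ?thesis
  proof cases
    case 1
    then have "(f has_real_derivative f' x) (at x)" using d[of x] at_within_Ici_at[of x] by simp
    then have "((\<lambda>x. f \<bar>x\<bar>) has_real_derivative f' x) (at x)"
      by (rule has_field_derivative_transform_within_open[of _ _ _ "{0<..}"]) (use 1 in auto)
    then show ?thesis using 1 by simp
  next
    case 2
    then have "(f has_real_derivative f' (- x)) (at (- x))" using d[of "- x"] at_within_Ici_at[of "- x"] by simp
    then have "((\<lambda>x. f (- x)) has_real_derivative f' (- x) * - 1) (at x)"
      by (rule DERIV_chain2) (auto intro!: derivative_eq_intros)
    then have "((\<lambda>x. f \<bar>x\<bar>) has_real_derivative f' (- x) * - 1) (at x)"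
      by (rule has_field_derivative_transform_within_open[of _ _ _ "{..<0}"]) (use 2 in auto)
    then show ?thesis using 2 by simp
  next
    case 3
    have "(f has_real_derivative 0) (at 0 within {0..})" using d[of 0] z by simp
    then have r: "((\<lambda>y. (f y - f 0) / y) \<longlongrightarrow> 0) (at_right 0)"
      by (simp add: has_field_derivative_iff at_within_Ici_at_right)
    have "((\<lambda>y. (f \<bar>y\<bar> - f 0) / y) \<longlongrightarrow> 0) (at_right 0)"
      by (rule Lim_transform_eventually[OF r]) (auto simp: eventually_at_filter)
    moreover have "((\<lambda>y. (f \<bar>y\<bar> - f 0) / y) \<longlongrightarrow> 0) (at_left 0)"
    proof -
      have l: "((\<lambda>y. - ((f y - f 0) / y)) \<longlongrightarrow> 0) (at_right 0)" using tendsto_minus[OF r] by (simp only: minus_zero)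
      have "((\<lambda>y. (f \<bar>- y\<bar> - f 0) / (- y)) \<longlongrightarrow> 0) (at_right 0)"
        by (rule Lim_transform_eventually[OF l]) (auto simp: eventually_at_filter)
      then show ?thesis by (simp add: filterlim_at_left_to_right)
    qed
    ultimately have "((\<lambda>y. (f \<bar>y\<bar> - f 0) / y) \<longlongrightarrow> 0) (at 0)" by (simp add: filterlim_split_at)
    then show ?thesis using 3 by (simp add: has_field_derivative_iff)
  qed
qed

text \<open>The value 0 at the origin makes the odd extension continuous, and the difference
  quotients on both sides of 0 are then the same.\<close>

lemma DERIV_odd_extension:
  fixes f f' :: "real \<Rightarrow> real"
  assumes d: "\<And>x. x \<ge> 0 \<Longrightarrow> (f has_real_derivative f' x) (at x within {0..})" and z: "f 0 = 0"
  shows "((\<lambda>x. sgn x * f \<bar>x\<bar>) has_real_derivative f' \<bar>x\<bar>) (at x)"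
proof -
  consider "x > 0" | "x < 0" | "x = 0" by linarith
  then show ?thesis
  proof cases
    case 1
    then have "(f has_real_derivative f' x) (at x)" using d[of x] at_within_Ici_at[of x] by simp
    then have "((\<lambda>x. sgn x * f \<bar>x\<bar>) has_real_derivative f' x) (at x)"
      by (rule has_field_derivative_transform_within_open[of _ _ _ "{0<..}"]) (use 1 in auto)
    then show ?thesis using 1 by simp
  next
    case 2
    then have "(f has_real_derivative f' (- x)) (at (- x))" using d[of "- x"] at_within_Ici_at[of "- x"] by simp
    then have "((\<lambda>x. f (- x)) has_real_derivative f' (- x) * - 1) (at x)"
      by (rule DERIV_chain2) (auto intro!: derivative_eq_intros)
    from DERIV_minus[OF this]
    have "((\<lambda>x. sgn x * f \<bar>x\<bar>) has_real_derivative - (f' (- x) * - 1)) (at x)"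
      by (rule has_field_derivative_transform_within_open[of _ _ _ "{..<0}"]) (use 2 in auto)
    then show ?thesis using 2 by simp
  next
    case 3
    have "(f has_real_derivative f' 0) (at 0 within {0..})" using d[of 0] by simp
    then have r: "((\<lambda>y. f y / y) \<longlongrightarrow> f' 0) (at_right 0)"
      by (simp add: has_field_derivative_iff at_within_Ici_at_right z)
    have "((\<lambda>y. sgn y * f \<bar>y\<bar> / y) \<longlongrightarrow> f' 0) (at_right 0)"
      by (rule Lim_transform_eventually[OF r]) (auto simp: eventually_at_filter)
    moreover have "((\<lambda>y. sgn y * f \<bar>y\<bar> / y) \<longlongrightarrow> f' 0) (at_left 0)"
    proof -
      have "((\<lambda>y. sgn (- y) * f \<bar>- y\<bar> / (- y)) \<longlongrightarrow> f' 0) (at_right 0)"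
        by (rule Lim_transform_eventually[OF r]) (auto simp: eventually_at_filter)
      then show ?thesis by (simp add: filterlim_at_left_to_right)
    qed
    ultimately have "((\<lambda>y. sgn y * f \<bar>y\<bar> / y) \<longlongrightarrow> f' 0) (at 0)" by (simp add: filterlim_split_at)
    then show ?thesis using 3 by (simp add: has_field_derivative_iff)
  qed
qed

context weights
begin

text \<open>The quotient rule in the form D (v / m) = (dv/d\<sigma>) / m.\<close>

lemma hasD_C1:
  assumes v: "\<And>x. (v has_real_derivative s x * p x) (at x)" and p: "continuous_on UNIV p"
    and sq: "(\<lambda>x. v x / m x) \<in> sq" "(\<lambda>x. p x / m x) \<in> sq"
  shows "hasD (\<lambda>x. v x / m x) (\<lambda>x. p x / m x)"
proof -
  have eq: "s x * (p x / m x - Q1 \<rho> k x * (v x / m x)) = (s x * p x * m x - v x * m' x) / (m x * m x)" for x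
    unfolding Q1_ms using nz[of x] by (simp add: field_simps)
  have vc: "continuous_on UNIV v" by (rule DERIV_imp_continuous_on[OF v])
  have "has_weak_deriv UNIV (\<lambda>x. v x / m x) (\<lambda>x. (s x * p x * m x - v x * m' x) / (m x * m x))"
  proof (rule has_weak_deriv_C1)
    show "((\<lambda>x. v x / m x) has_real_derivative (s x * p x * m x - v x * m' x) / (m x * m x)) (at x)" for x
      by (rule DERIV_divide[OF v m_deriv]) simp
    show "continuous_on UNIV (\<lambda>x. (s x * p x * m x - v x * m' x) / (m x * m x))"
      by (intro continuous_intros s_cont p m_cont vc m'_cont) simp
  qed simp
  then show ?thesis using sq unfolding hasD_def eq by simp
qed

text \<open>Green's formula; the boundary terms at infinity are removed by cutoffs that are functions of \<open>\<sigma>\<close>.\<close>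

lemma green:
  assumes W: "hasD w \<xi>" and p: "\<And>x. (p has_real_derivative s x * h x) (at x)" and h: "continuous_on UNIV h"
    and sq: "(\<lambda>x. p x / m x) \<in> sq" "(\<lambda>x. h x / m x) \<in> sq"
    and \<sigma>: "\<And>x. (\<sigma> has_real_derivative s x) (at x)" "filterlim \<sigma> at_top at_top" "filterlim \<sigma> at_bot at_bot"
  shows "ip \<xi> (\<lambda>x. p x / m x) = - ip w (\<lambda>x. h x / m x)"
proof -
  obtain X where X: "X \<in> smooth_class" "\<And>x::real. x \<in> {-1..1} \<Longrightarrow> X x = 1" "\<And>x. x \<notin> {-1-1..1+1} \<Longrightarrow> X x = 0"
    using smooth_cutoff[of 1 "-1" 1] by auto
  obtain X' where X': "X' \<in> smooth_class" "\<And>x. (X has_real_derivative X' x) (at x)"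
    using smooth_class_deriv[OF X(1)] by blast
  have Xz: "X x = 0" "X' x = 0" if "x \<notin> {-2..2}" for x
  proof -
    show "X x = 0" using X(3)[of x] that by simp
    show "X' x = 0"
    proof (rule DERIV_unique[OF X'(2)])
      show "(X has_real_derivative 0) (at x)"
        by (rule has_field_derivative_transform_within_open[of "\<lambda>x. 0" _ _ "- {-2..2}"])
          (use that X(3) in \<open>auto simp: open_Compl\<close>)
    qed
  qed
  have "bounded (X ` {-2..2})" "bounded (X' ` {-2..2})"
    by (intro compact_imp_bounded compact_continuous_image smooth_class_continuous X X' compact_Icc)+
  then obtain M1 M2 where M: "\<forall>x\<in>{-2..2}. \<bar>X x\<bar> \<le> M1" "\<forall>x\<in>{-2..2}. \<bar>X' x\<bar> \<le> M2"
    unfolding bounded_iff by auto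
  have Mb: "\<bar>X x\<bar> \<le> M1" "\<bar>X' x\<bar> \<le> M2" for x
  proof -
    have "0 \<le> M1" "0 \<le> M2" using order_trans[OF abs_ge_zero bspec[OF M(1), of 0]] order_trans[OF abs_ge_zero bspec[OF M(2), of 0]] by auto
    then show "\<bar>X x\<bar> \<le> M1" "\<bar>X' x\<bar> \<le> M2" using M Xz[of x] by (cases "x \<in> {-2..2}"; auto)+
  qed
  have \<sigma>c: "continuous_on A \<sigma>" for A by (rule DERIV_imp_continuous_on[OF \<sigma>(1)])
  have wS: "w \<in> sq" "\<xi> \<in> sq" using W by (auto simp: hasD_def)
  have pc: "continuous_on A p" for A by (rule DERIV_imp_continuous_on[OF p])
  define N where "N n = real (Suc n)" for n
  have Np: "N n > 0" for n by (simp add: N_def)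
  \<comment> \<open>The factor m matches D \<phi> = (m \<phi>)' / (m s). The cutoff is compactly
    supported in x because \<sigma> is unbounded in both directions.\<close>
  define \<theta> where "\<theta> n x = X (\<sigma> x / N n) * (p x * m x)" for n x
  define \<theta>' where "\<theta>' n x = X' (\<sigma> x / N n) * (s x / N n) * (p x * m x) + X (\<sigma> x / N n) * (s x * h x * m x + p x * m' x)" for n x
  have XNd: "((\<lambda>x. X (\<sigma> x / N n)) has_real_derivative X' (\<sigma> x / N n) * (s x / N n)) (at x)" for n x
    by (rule DERIV_chain2[OF X'(2)]) (auto intro!: DERIV_cdivide \<sigma>)
  have \<theta>d: "(\<theta> n has_real_derivative \<theta>' n x) (at x)" for n x
    unfolding \<theta>_def \<theta>'_def
    by (rule DERIV_mult[OF XNd DERIV_mult[OF p m_deriv], THEN DERIV_cong]) (simp add: algebra_simps)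
  have Xc: "continuous_on UNIV (\<lambda>x. X (\<sigma> x / N n))" "continuous_on UNIV (\<lambda>x. X' (\<sigma> x / N n))" for n
    using Np[of n] by (auto intro!: continuous_on_compose2[OF smooth_class_continuous[OF X(1), of UNIV]]
      continuous_on_compose2[OF smooth_class_continuous[OF X'(1), of UNIV]] continuous_intros \<sigma>c)
  have \<theta>'c: "continuous_on UNIV (\<theta>' n)" for n
    unfolding \<theta>'_def using Np[of n] by (intro continuous_intros Xc s_cont pc m_cont h m'_cont) auto
  have eq: "integral\<^sup>L \<mu> (\<lambda>x. X (\<sigma> x / N n) * (\<xi> x * (p x / m x))) =
      - integral\<^sup>L \<mu> (\<lambda>x. X (\<sigma> x / N n) * (w x * (h x / m x))) - integral\<^sup>L \<mu> (\<lambda>x. X' (\<sigma> x / N n) * (w x * (p x / m x))) / N n" for n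
  proof -
    have "\<forall>\<^sub>F x in at_top. 2 * N n < \<sigma> x" "\<forall>\<^sub>F x in at_bot. \<sigma> x < - 2 * N n"
      using \<sigma>(2,3) by (auto simp: filterlim_at_top_dense filterlim_at_bot_dense)
    then obtain a b where ab: "\<And>x. x \<ge> b \<Longrightarrow> 2 * N n < \<sigma> x" "\<And>x. x \<le> a \<Longrightarrow> \<sigma> x < - 2 * N n"
      unfolding eventually_at_top_linorder eventually_at_bot_linorder by blast
    have out: "\<sigma> x / N n \<notin> {-2..2}" if "x \<notin> {a..b}" for x
      using that ab[of x] Np[of n] by (auto simp: field_simps not_le)
    have \<theta>z: "\<theta> n x = 0" if "x \<notin> {a..b}" for x using Xz(1)[OF out[OF that]] by (simp add: \<theta>_def)
    have wd: "has_weak_deriv UNIV w (\<lambda>x. s x * (\<xi> x - Q1 \<rho> k x * w x))" using W by (simp add: hasD_def)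
    have ibp: "(LINT x|lebesgue. w x * \<theta>' n x) = - (LINT x|lebesgue. s x * (\<xi> x - Q1 \<rho> k x * w x) * \<theta> n x)"
      by (rule has_weak_deriv_C1_test[OF wd open_UNIV subset_UNIV \<theta>d \<theta>'c \<theta>z])
    have bm: "(\<lambda>x. X (\<sigma> x / N n)) \<in> borel_measurable lebesgue" "(\<lambda>x. X' (\<sigma> x / N n)) \<in> borel_measurable lebesgue"
      by (intro borel_measurable_lebesgue_continuous Xc)+
    have I: "integrable \<mu> (\<lambda>x. X (\<sigma> x / N n) * (f x * g x))" "integrable \<mu> (\<lambda>x. X' (\<sigma> x / N n) * (f x * g x))"
      if fg: "f \<in> sq" "g \<in> sq" for f g
    proof -
      have "integrable \<mu> (\<lambda>x. (X (\<sigma> x / N n) * f x) * g x)" "integrable \<mu> (\<lambda>x. (X' (\<sigma> x / N n) * f x) * g x)"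
        by (intro square_integrable_mult square_integrable_bounded_mult[OF fg(1) _ Mb(1)]
            square_integrable_bounded_mult[OF fg(1) _ Mb(2)] fg; simp add: bm)+
      then show "integrable \<mu> (\<lambda>x. X (\<sigma> x / N n) * (f x * g x))" "integrable \<mu> (\<lambda>x. X' (\<sigma> x / N n) * (f x * g x))"
        by (simp_all add: mult.assoc)
    qed
    define A where "A x = X (\<sigma> x / N n) * (\<xi> x * (p x / m x))" for x
    define B where "B x = X (\<sigma> x / N n) * (w x * (h x / m x))" for x
    define C where "C x = X' (\<sigma> x / N n) * (w x * (p x / m x))" for x
    have int: "integrable \<mu> A" "integrable \<mu> B" "integrable \<mu> C"
      unfolding A_def B_def C_def by (intro I wS sq)+
    have meas: "A \<in> borel_measurable lebesgue" "B \<in> borel_measurable lebesgue" "C \<in> borel_measurable lebesgue"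
      using borel_measurable_integrable[OF int(1)] borel_measurable_integrable[OF int(2)] borel_measurable_integrable[OF int(3)] by simp_all
    \<comment> \<open>The term with \<open>m'\<close> occurs on both sides and cancels. It is
      isolated because its integrability is seen only in the presence of the cutoff, over a bounded
      interval.\<close>
    define F where "F x = X (\<sigma> x / N n) * (w x * (p x * m' x))" for x
    have Fi: "integrable lebesgue F"
    proof -
      have "integrable lebesgue (\<lambda>x. w x * (X (\<sigma> x / N n) * (p x * m' x)))"
        by (rule integrable_mult_continuous_support[OF sq_set_integrable[OF wS(1), of a b]])
          (use Xz(1)[OF out] in \<open>auto intro!: continuous_on_subset[of UNIV] continuous_intros Xc pc m'_cont\<close>)
      then show ?thesis unfolding F_def by (simp add: mult_ac)
    qed
    have e1: "w x * \<theta>' n x = \<rho> x * (C x / N n + B x) + F x" for x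
      using nz[of x] Np[of n] by (simp add: \<theta>'_def B_def C_def F_def \<rho>_ms field_simps power2_eq_square)
    have e2: "s x * (\<xi> x - Q1 \<rho> k x * w x) * \<theta> n x = \<rho> x * A x - F x" for x
      using nz[of x] by (simp add: \<theta>_def A_def F_def \<rho>_ms Q1_ms field_simps power2_eq_square)
    have ir: "integrable lebesgue (\<lambda>x. \<rho> x * (C x / N n + B x))" "integrable lebesgue (\<lambda>x. \<rho> x * A x)"
      using int meas by (auto simp flip: integrable_\<mu>)
    have "integral\<^sup>L \<mu> (\<lambda>x. C x / N n + B x) + (LINT x|lebesgue. F x) = - (integral\<^sup>L \<mu> A - (LINT x|lebesgue. F x))"
      using ibp meas unfolding e1 e2 Bochner_Integration.integral_add[OF ir(1) Fi] Bochner_Integration.integral_diff[OF ir(2) Fi]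
      by (simp add: integral_\<mu>)
    moreover have "integral\<^sup>L \<mu> (\<lambda>x. C x / N n + B x) = integral\<^sup>L \<mu> C / N n + integral\<^sup>L \<mu> B" using int by simp
    ultimately show ?thesis unfolding A_def B_def C_def by linarith
  qed
  have lim: "(\<lambda>n. integral\<^sup>L \<mu> (\<lambda>x. X (\<sigma> x / N n) * (f x * g x))) \<longlonglongrightarrow> ip f g" if fg: "f \<in> sq" "g \<in> sq" for f g
  proof (rule integral_dominated_convergence[where w = "\<lambda>x. M1 * \<bar>f x * g x\<bar>"])
    have fgi: "integrable \<mu> (\<lambda>x. f x * g x)" by (rule square_integrable_mult[OF fg])
    show "integrable \<mu> (\<lambda>x. M1 * \<bar>f x * g x\<bar>)" using fgi by (intro integrable_mult_right integrable_abs)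
    show fm: "(\<lambda>x. f x * g x) \<in> borel_measurable \<mu>" using fgi by (rule borel_measurable_integrable)
    show "(\<lambda>x. X (\<sigma> x / N n) * (f x * g x)) \<in> borel_measurable \<mu>" for n
      using fm borel_measurable_lebesgue_continuous[OF Xc(1)] by simp
    show "AE x in \<mu>. norm (X (\<sigma> x / N n) * (f x * g x)) \<le> M1 * \<bar>f x * g x\<bar>" for n
      by (rule AE_I2) (unfold real_norm_def abs_mult[of "X _"], intro mult_right_mono Mb abs_ge_zero)
    show "AE x in \<mu>. (\<lambda>n. X (\<sigma> x / N n) * (f x * g x)) \<longlonglongrightarrow> f x * g x"
    proof (rule AE_I2)
      fix x
      obtain n0 where n0: "\<bar>\<sigma> x\<bar> \<le> real n0" using real_arch_simple by blast
      have "X (\<sigma> x / N n) = 1" if "n \<ge> n0" for n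
      proof (rule X(2))
        have "\<bar>\<sigma> x\<bar> \<le> N n" using n0 that by (simp add: N_def)
        then show "\<sigma> x / N n \<in> {-1..1}" using Np[of n] by (auto simp: field_simps abs_le_iff)
      qed
      then show "(\<lambda>n. X (\<sigma> x / N n) * (f x * g x)) \<longlonglongrightarrow> f x * g x"
        by (intro tendsto_eventually eventually_sequentiallyI[of n0]) simp
    qed
  qed
  \<comment> \<open>The derivative of the cutoff brings the factor 1 / N, while the product it
    multiplies is integrable.\<close>
  have lim0: "(\<lambda>n. integral\<^sup>L \<mu> (\<lambda>x. X' (\<sigma> x / N n) * (w x * (p x / m x))) / N n) \<longlonglongrightarrow> 0"
  proof (rule tendsto_0_le[where K = 1])
    define I where "I = integral\<^sup>L \<mu> (\<lambda>x. M2 * \<bar>w x * (p x / m x)\<bar>)"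
    show "(\<lambda>n. I * inverse (real (Suc n))) \<longlonglongrightarrow> 0"
      using tendsto_mult_left[OF LIMSEQ_inverse_real_of_nat, of I] by simp
    have fgi: "integrable \<mu> (\<lambda>x. w x * (p x / m x))" by (rule square_integrable_mult[OF wS(1) sq(1)])
    have "\<bar>integral\<^sup>L \<mu> (\<lambda>x. X' (\<sigma> x / N n) * (w x * (p x / m x)))\<bar> \<le> I" for n
      unfolding I_def
    proof (rule order_trans[OF integral_abs_bound], rule Bochner_Integration.integral_mono')
      show "integrable \<mu> (\<lambda>x. M2 * \<bar>w x * (p x / m x)\<bar>)" using fgi by (intro integrable_mult_right integrable_abs)
      show "\<bar>X' (\<sigma> x / N n) * (w x * (p x / m x))\<bar> \<le> M2 * \<bar>w x * (p x / m x)\<bar>" for x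
        unfolding abs_mult[of "X' _"] by (intro mult_right_mono Mb abs_ge_zero)
    qed (intro mult_nonneg_nonneg abs_ge_zero order_trans[OF abs_ge_zero Mb(2)])
    then show "\<forall>\<^sub>F n in sequentially. norm (integral\<^sup>L \<mu> (\<lambda>x. X' (\<sigma> x / N n) * (w x * (p x / m x))) / N n) \<le> norm (I * inverse (real (Suc n))) * 1"
      by (intro always_eventually allI) (auto simp: N_def abs_divide divide_inverse abs_mult intro!: mult_right_mono intro: order_trans[OF _ abs_ge_self])
  qed
  have "(\<lambda>n. integral\<^sup>L \<mu> (\<lambda>x. X (\<sigma> x / N n) * (\<xi> x * (p x / m x)))) \<longlonglongrightarrow> - ip w (\<lambda>x. h x / m x) - 0"
    unfolding eq by (intro tendsto_diff tendsto_minus lim wS sq lim0)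
  from LIMSEQ_unique[OF lim[OF wS(2) sq(1)] this] show ?thesis by simp
qed

end

section \<open>Decaying test functions on the whole line\<close>

locale heat = weights_pot +
  fixes \<sigma> :: "real \<Rightarrow> real" and K :: real
  assumes \<sigma>_0: "\<sigma> 0 = 0" and \<sigma>_deriv: "(\<sigma> has_real_derivative s x) (at x)"
    and \<sigma>_top: "filterlim \<sigma> at_top at_top"
    and s_even: "s (- x) = s x" and q_even: "q (- x) = q x"
    and K_bound: "x \<ge> 0 \<Longrightarrow> integral {0..x} (\<lambda>t. \<bar>q t\<bar> * s t * (1 + \<sigma> t)) \<le> K"
begin

sublocale hl: half_line s \<sigma> q K
  by unfold_locales
    (auto intro: continuous_on_subset[OF s_cont] continuous_on_subset[OF q_cont] s_pos has_field_derivative_at_within \<sigma>_deriv K_bound simp: \<sigma>_0)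

lemma \<sigma>_odd: "\<sigma> (- x) = - \<sigma> x"
proof -
  have "((\<lambda>x. \<sigma> (- x) + \<sigma> x) has_real_derivative 0) (at y)" for y
  proof -
    have "((\<lambda>x. \<sigma> (- x)) has_real_derivative s (- y) * - 1) (at y)"
      by (rule DERIV_chain2[OF \<sigma>_deriv]) (auto intro!: derivative_eq_intros)
    from DERIV_add[OF this \<sigma>_deriv[of y]] show ?thesis by (simp add: s_even)
  qed
  then have "\<sigma> (- x) + \<sigma> x = \<sigma> (- 0) + \<sigma> 0" by (intro DERIV_isconst_all) auto
  then show ?thesis by (simp add: \<sigma>_0)
qed

lemma \<sigma>_bot: "filterlim \<sigma> at_bot at_bot"
  unfolding filterlim_at_bot_mirror using \<sigma>_top by (simp add: \<sigma>_odd filterlim_uminus_at_bot)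

lemma \<sigma>_cont: "continuous_on A \<sigma>" by (rule DERIV_imp_continuous_on[OF \<sigma>_deriv])

lemma abs_even: "s \<bar>x\<bar> = s x" "q \<bar>x\<bar> = q x"
  using s_even[of x] q_even[of x] by (auto simp: abs_if)

lemma \<sigma>_abs_nonneg: "\<sigma> \<bar>x\<bar> \<ge> 0" by (rule hl.\<sigma>_nonneg) simp

definition decay :: "real \<Rightarrow> real" where "decay x = s x / (1 + \<sigma> \<bar>x\<bar>)\<^sup>2"

text \<open>On the half-line \<open>decay\<close> is the derivative of - 1 / (1 + \<sigma>), which
  has finite limits; evenness supplies the other half.\<close>

lemma decay_integrable: "integrable lebesgue decay"
proof -
  have pos: "1 + \<sigma> \<bar>x\<bar> > 0" for x using \<sigma>_abs_nonneg[of x] by linarith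
  have \<sigma>ac: "continuous_on UNIV (\<lambda>x. \<sigma> \<bar>x\<bar>)" by (intro continuous_on_compose2[OF \<sigma>_cont[of UNIV]] continuous_intros) auto
  have dc: "continuous_on UNIV decay"
    unfolding decay_def using pos by (intro continuous_intros s_cont \<sigma>ac) (auto simp: less_imp_neq[symmetric])
  have dm: "decay \<in> borel_measurable lborel" using dc by (simp add: borel_measurable_continuous_onI)
  have d0: "decay x \<ge> 0" for x unfolding decay_def using s_pos[of x] by (simp add: less_imp_le)
  have nn: "(\<integral>\<^sup>+x. ennreal (decay x) * indicator {0..} x \<partial>lborel) = ennreal (0 - (- inverse (1 + \<sigma> 0)))"
  proof (rule nn_integral_FTC_atLeast)
    show "decay \<in> borel_measurable borel" using dm by simp
    show "((\<lambda>x. - inverse (1 + \<sigma> x)) has_real_derivative decay x) (at x)" if "0 \<le> x" for x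
    proof -
      have "1 + \<sigma> x \<noteq> 0" using hl.\<sigma>_nonneg[OF that] by linarith
      then show ?thesis using that unfolding decay_def
        by (auto intro!: derivative_eq_intros \<sigma>_deriv simp: power2_eq_square field_simps)
    qed
    have "filterlim (\<lambda>x. 1 + \<sigma> x) at_top at_top"
      by (rule filterlim_tendsto_add_at_top[OF tendsto_const \<sigma>_top])
    then have "((\<lambda>x. inverse (1 + \<sigma> x)) \<longlongrightarrow> 0) at_top"
      by (rule tendsto_inverse_0_at_top)
    then show "((\<lambda>x. - inverse (1 + \<sigma> x)) \<longlongrightarrow> 0) at_top" using tendsto_minus by fastforce
  qed (use d0 in auto)
  have i1: "integrable lborel (\<lambda>x. indicator {0..} x * decay x)"
  proof (rule integrableI_bounded)
    show "(\<lambda>x. indicator {0..} x * decay x) \<in> borel_measurable lborel"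
      using dm by (intro borel_measurable_times borel_measurable_indicator) auto
    have "(\<integral>\<^sup>+x. ennreal (norm (indicator {0..} x * decay x)) \<partial>lborel) = (\<integral>\<^sup>+x. ennreal (decay x) * indicator {0..} x \<partial>lborel)"
      using d0 by (intro nn_integral_cong) (auto simp: indicator_def abs_mult)
    also have "\<dots> < \<infinity>" unfolding nn by simp
    finally show "(\<integral>\<^sup>+x. ennreal (norm (indicator {0..} x * decay x)) \<partial>lborel) < \<infinity>" .
  qed
  have "decay (0 + (-1) * x) = decay x" for x by (simp add: decay_def s_even)
  then have i2: "integrable lborel (\<lambda>x. indicator {0..} (0 + (-1) * x) * decay x)"
    using lborel_integrable_real_affine[OF i1, of "-1" 0] by simp
  have "integrable lborel decay"
  proof (rule Bochner_Integration.integrable_bound)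
    show "integrable lborel (\<lambda>x. indicator {0..} x * decay x + indicator {0..} (0 + (-1) * x) * decay x)"
      using i1 i2 by (rule Bochner_Integration.integrable_add)
    show "AE x in lborel. norm (decay x) \<le> norm (indicator {0..} x * decay x + indicator {0..} (0 + (-1) * x) * decay x)"
      using d0 by (intro AE_I2) (auto simp: indicator_def)
  qed (rule dm)
  then show ?thesis using integrable_completion[of decay lborel] dm by simp
qed

definition J :: real where "J = (LINT x|lebesgue. decay x)"

lemma decay_nonneg: "decay x \<ge> 0" unfolding decay_def using s_pos[of x] by (simp add: less_imp_le)

lemma J_nonneg: "J \<ge> 0" unfolding J_def using decay_nonneg by simp

text \<open>Since \<rho> (v / m)^2 = s v^2, decay of v like 1 / (1 + \<sigma>) is exactly what makes
  the square comparable with \<open>decay\<close>.\<close>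

lemma decaying_sq:
  assumes v: "continuous_on UNIV v" "\<And>x. \<bar>v x\<bar> \<le> C / (1 + \<sigma> \<bar>x\<bar>)"
  shows "(\<lambda>x. v x / m x) \<in> sq" "ip (\<lambda>x. v x / m x) (\<lambda>x. v x / m x) \<le> C\<^sup>2 * J"
proof -
  have vm: "(\<lambda>x. v x / m x) \<in> borel_measurable lebesgue"
    by (intro borel_measurable_lebesgue_continuous continuous_intros v m_cont) simp
  have e: "\<rho> x * (v x / m x)\<^sup>2 = s x * (v x)\<^sup>2" for x by (simp add: \<rho>_ms power_divide)
  have le: "s x * (v x)\<^sup>2 \<le> C\<^sup>2 * decay x" for x
  proof -
    have "(v x)\<^sup>2 \<le> (C / (1 + \<sigma> \<bar>x\<bar>))\<^sup>2" using power_mono[OF v(2)[of x], of 2] by simp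
    then have "s x * (v x)\<^sup>2 \<le> s x * (C / (1 + \<sigma> \<bar>x\<bar>))\<^sup>2" using s_pos[of x] by (intro mult_left_mono) auto
    then show ?thesis by (simp add: decay_def power_divide mult.commute)
  qed
  have i: "integrable lebesgue (\<lambda>x. s x * (v x)\<^sup>2)"
  proof (rule Bochner_Integration.integrable_bound)
    show "integrable lebesgue (\<lambda>x. C\<^sup>2 * decay x)" by (intro integrable_mult_right decay_integrable)
    show "(\<lambda>x. s x * (v x)\<^sup>2) \<in> borel_measurable lebesgue"
      by (intro borel_measurable_lebesgue_continuous continuous_intros v s_cont)
    show "AE x in lebesgue. norm (s x * (v x)\<^sup>2) \<le> norm (C\<^sup>2 * decay x)"
      using le s_pos by (intro AE_I2) (auto simp: abs_mult less_imp_le decay_nonneg)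
  qed
  then show "(\<lambda>x. v x / m x) \<in> sq" using vm by (auto simp: square_integrable_def integrable_\<mu> e)
  have "ip (\<lambda>x. v x / m x) (\<lambda>x. v x / m x) = (LINT x|lebesgue. s x * (v x)\<^sup>2)"
    using vm by (subst integral_\<mu>) (auto simp: e simp flip: power2_eq_square)
  also have "\<dots> \<le> (LINT x|lebesgue. C\<^sup>2 * decay x)"
    by (rule integral_mono[OF i]) (use decay_integrable le in auto)
  finally show "ip (\<lambda>x. v x / m x) (\<lambda>x. v x / m x) \<le> C\<^sup>2 * J" by (simp add: J_def)
qed

text \<open>Division by m undoes the passage from W to m W, and the absolute value extends the
  packet from the half-line; the result is smooth enough at 0 because \<open>packet'\<close>
  vanishes there.\<close>

definition wave :: "real \<Rightarrow> real \<Rightarrow> (real \<Rightarrow> real) \<Rightarrow> real \<Rightarrow> real" where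
  "wave a b G x = hl.packet a b G \<bar>x\<bar> / m x"

definition admissible :: "real \<Rightarrow> real \<Rightarrow> real \<Rightarrow> real \<Rightarrow> (real \<Rightarrow> real) \<Rightarrow> bool" where
  "admissible a b g0 g1 G \<longleftrightarrow> 1 \<le> a \<and> a < b \<and> b \<le> a + 1 \<and> G a = 0 \<and> G b = 0 \<and> 0 \<le> g1 \<and>
     (\<forall>t\<in>{a..b}. \<bar>G t\<bar> \<le> g0) \<and> (\<forall>t\<in>{a..b}. \<forall>u\<in>{a..b}. \<bar>G t - G u\<bar> \<le> g1 * \<bar>t - u\<bar>)"

lemma admissible_cont:
  assumes "admissible a b g0 g1 G" shows "continuous_on {a..b} G"
  by (rule lipschitz_on_continuous_on[of g1]) (use assms in \<open>auto intro!: lipschitz_onI simp: dist_real_def admissible_def\<close>)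

text \<open>The last item is the spectral property of packets, obtained from Green's formula: the
  form against a wave is the scalar product with the wave whose weight is multiplied by \<kappa>^2.
  The norm bound combines the packet estimates for v and dv/d\<sigma>, each contributing J times the
  squared constant.\<close>

lemma wave_properties:
  assumes ad: "admissible a b g0 g1 G"
  shows "wave a b G \<in> H1 \<rho> k"
    and "norm_H1 \<rho> k (wave a b G) \<le> sqrt (2 * J) * (hl.packet_const b * (g0 + g1))"
    and "continuous_on UNIV (wave a b G)"
    and "wave a b G 0 = integral {a..b} G / m 0"
    and "admissible a b g0' g1' (\<lambda>\<kappa>. \<kappa>\<^sup>2 * G \<kappa>) \<Longrightarrow> w \<in> H1 \<rho> k \<Longrightarrow> Bq w (wave a b G) = ip w (wave a b (\<lambda>\<kappa>. \<kappa>\<^sup>2 * G \<kappa>))"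
proof -
  have a: "1 \<le> a" using ad by (simp add: admissible_def)
  note Gc = admissible_cont[OF ad]
  define v where "v x = hl.packet a b G \<bar>x\<bar>" for x
  define p where "p x = sgn x * hl.packet' a b G \<bar>x\<bar>" for x
  define C where "C = hl.packet_const b * (g0 + g1)"
  note b = hl.packet_bound[of a b G _ g0 g1]
  have bnd: "\<bar>hl.packet a b G \<bar>x\<bar>\<bar> \<le> C / (1 + \<sigma> \<bar>x\<bar>)" "\<bar>hl.packet' a b G \<bar>x\<bar>\<bar> \<le> C / (1 + \<sigma> \<bar>x\<bar>)" for x
    using ad unfolding admissible_def C_def by (auto intro!: b)
  have vb: "\<bar>v x\<bar> \<le> C / (1 + \<sigma> \<bar>x\<bar>)" for x using bnd by (simp add: v_def)
  have C0: "0 \<le> C / (1 + \<sigma> \<bar>x\<bar>)" for x using order_trans[OF abs_ge_zero bnd(1)] .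
  have pb: "\<bar>p x\<bar> \<le> C / (1 + \<sigma> \<bar>x\<bar>)" for x
    using bnd(2)[of x] C0[of x] by (auto simp: p_def abs_mult sgn_if)
  have vd: "(v has_real_derivative s x * p x) (at x)" for x
  proof -
    have "((\<lambda>x. hl.packet a b G \<bar>x\<bar>) has_real_derivative sgn x * (s \<bar>x\<bar> * hl.packet' a b G \<bar>x\<bar>)) (at x)"
      by (rule DERIV_even_extension[OF hl.packet_deriv(1)[OF a Gc]]) (simp_all add: hl.packet_0[OF a])
    then show ?thesis unfolding v_def[abs_def] p_def by (simp add: abs_even mult_ac)
  qed
  define h where "h x = q x * v x - hl.packet a b (\<lambda>\<kappa>. \<kappa>\<^sup>2 * G \<kappa>) \<bar>x\<bar>" for x
  have pd: "(p has_real_derivative s x * h x) (at x)" for x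
  proof -
    have "((\<lambda>x. sgn x * hl.packet' a b G \<bar>x\<bar>) has_real_derivative s \<bar>x\<bar> * (q \<bar>x\<bar> * hl.packet a b G \<bar>x\<bar> - hl.packet a b (\<lambda>\<kappa>. \<kappa>\<^sup>2 * G \<kappa>) \<bar>x\<bar>)) (at x)"
      by (rule DERIV_odd_extension[OF hl.packet_deriv(2)[OF a Gc]]) (simp_all add: hl.packet_0[OF a])
    then show ?thesis unfolding p_def[abs_def] h_def v_def by (simp add: abs_even)
  qed
  have vc: "continuous_on UNIV v" by (rule DERIV_imp_continuous_on[OF vd])
  have pc: "continuous_on UNIV p" by (rule DERIV_imp_continuous_on[OF pd])
  note vs = decaying_sq[OF vc vb] and ps = decaying_sq[OF pc pb]
  have hD: "hasD (\<lambda>x. v x / m x) (\<lambda>x. p x / m x)" by (rule hasD_C1[OF vd pc vs(1) ps(1)])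
  have wv: "wave a b G = (\<lambda>x. v x / m x)" by (simp add: wave_def[abs_def] v_def)
  note H = hasD_imp[OF hD]
  show H1: "wave a b G \<in> H1 \<rho> k" unfolding wv by (rule H(1))
  show "continuous_on UNIV (wave a b G)" unfolding wv by (intro continuous_intros vc m_cont) simp
  show "wave a b G 0 = integral {a..b} G / m 0" by (simp add: wave_def hl.packet_0[OF a])
  have Dp: "ip (D (wave a b G)) g = ip (\<lambda>x. p x / m x) g" if "g \<in> sq" for g
    unfolding wv by (rule ip_cong_AE) (use H that H1_sq in auto)
  have "ip (D (wave a b G)) (D (wave a b G)) = ip (\<lambda>x. p x / m x) (\<lambda>x. p x / m x)"
    unfolding wv by (rule ip_cong_AE) (use H H1_sq in auto)
  then have "ip (D (wave a b G)) (D (wave a b G)) \<le> C\<^sup>2 * J" using ps(2) by (simp only:)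
  moreover have "ip (wave a b G) (wave a b G) \<le> C\<^sup>2 * J" using vs(2) by (simp only: wv)
  ultimately have "(norm_H1 \<rho> k (wave a b G))\<^sup>2 \<le> C\<^sup>2 * J + C\<^sup>2 * J"
    unfolding norm_H1_sq[OF H1] by linarith
  also have "\<dots> = (sqrt (2 * J) * C)\<^sup>2" using J_nonneg by (simp add: power_mult_distrib)
  finally have sq: "(norm_H1 \<rho> k (wave a b G))\<^sup>2 \<le> (sqrt (2 * J) * C)\<^sup>2" .
  have "C \<ge> 0" using C0[of 0] by (simp add: \<sigma>_0)
  then show "norm_H1 \<rho> k (wave a b G) \<le> sqrt (2 * J) * (hl.packet_const b * (g0 + g1))"
    unfolding C_def[symmetric] by (intro power2_le_imp_le[OF sq]) (use J_nonneg in simp)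
  assume ad': "admissible a b g0' g1' (\<lambda>\<kappa>. \<kappa>\<^sup>2 * G \<kappa>)" and w: "w \<in> H1 \<rho> k"
  define v2 where "v2 x = hl.packet a b (\<lambda>\<kappa>. \<kappa>\<^sup>2 * G \<kappa>) \<bar>x\<bar>" for x
  have v2c: "continuous_on UNIV v2"
    unfolding v2_def
    by (rule continuous_on_compose2[OF DERIV_continuous_on[of "{0..}" "hl.packet a b (\<lambda>\<kappa>. \<kappa>\<^sup>2 * G \<kappa>)"]])
      (auto intro!: hl.packet_deriv(1)[OF a admissible_cont[OF ad']] continuous_intros)
  have v2b: "\<bar>v2 x\<bar> \<le> hl.packet_const b * (g0' + g1') / (1 + \<sigma> \<bar>x\<bar>)" for x
    unfolding v2_def using ad' by (intro hl.packet_bound(1)) (auto simp: admissible_def)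
  note v2s = decaying_sq(1)[OF v2c v2b]
  have hc: "continuous_on UNIV h" unfolding h_def v2_def[symmetric] by (intro continuous_intros q_cont vc v2c)
  have h2: "h x / m x = 1 * (q x * (v x / m x)) + (-1) * (v2 x / m x)" for x by (simp add: h_def v2_def field_simps)
  have hs: "(\<lambda>x. h x / m x) \<in> sq" unfolding h2 by (intro square_integrable_lin q_mult_sq vs v2s)
  have ws: "w \<in> sq" "D w \<in> sq" using H1_sq[OF w] by auto
  have "ip (D w) (D (wave a b G)) = ip (D (wave a b G)) (D w)" by (rule ip_commute)
  also have "\<dots> = ip (\<lambda>x. p x / m x) (D w)" by (rule Dp[OF ws(2)])
  also have "\<dots> = ip (D w) (\<lambda>x. p x / m x)" by (rule ip_commute)
  also have "\<dots> = - ip w (\<lambda>x. h x / m x)"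
    by (rule green[OF H1_hasD[OF w] pd hc ps(1) hs \<sigma>_deriv \<sigma>_top \<sigma>_bot])
  also have "ip w (\<lambda>x. h x / m x) = 1 * ip w (\<lambda>x. q x * (v x / m x)) + (-1) * ip w (\<lambda>x. v2 x / m x)"
    unfolding h2 by (intro L2.Blin2 q_mult_sq vs v2s ws)
  also have "ip w (\<lambda>x. q x * (v x / m x)) = ip (\<lambda>x. q x * w x) (wave a b G)"
    by (simp add: wv mult_ac)
  finally have "ip (D w) (D (wave a b G)) + ip (\<lambda>x. q x * w x) (wave a b G) = ip w (\<lambda>x. v2 x / m x)" by linarith
  then show "Bq w (wave a b G) = ip w (wave a b (\<lambda>\<kappa>. \<kappa>\<^sup>2 * G \<kappa>))"
    by (simp only: Bq_def wave_def[abs_def] v2_def)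
qed

end

section \<open>The control vanishes\<close>

text \<open>The weak equation is known on the open interval only; closed subintervals exhaust it,
  and continuity of f up to the end points together with integrability of g gives the limit.\<close>

lemma has_weak_deriv_FTC_closed:
  fixes f g :: "real \<Rightarrow> real"
  assumes T: "T > 0" and wd: "has_weak_deriv {0<..<T} f g" and f: "continuous_on {0..T} f"
    and g: "set_integrable lebesgue {0..T} g"
  shows "f T - f 0 = (LINT t:{0..T}|lebesgue. g t)"
proof -
  \<comment> \<open>Starting at T / 2 instead of T keeps all intervals from \<open>e n\<close> to
    \<open>T - e n\<close> nonempty.\<close>
  define e where "e n = T * inverse (real (Suc (Suc n)))" for n
  have e2: "e n \<le> T / 2" "0 < e n" for n using T by (auto simp: e_def field_simps)
  have el: "e \<longlonglongrightarrow> 0"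
    unfolding e_def using tendsto_mult_left[OF LIMSEQ_Suc[OF LIMSEQ_inverse_real_of_nat], of T] by simp
  define A where "A n = {e n..T - e n}" for n
  have AU: "(\<Union>n. A n) = {0<..<T}"
  proof
    show "(\<Union>n. A n) \<subseteq> {0<..<T}"
    proof
      fix t assume "t \<in> (\<Union>n. A n)"
      then obtain n where "t \<in> A n" by blast
      then show "t \<in> {0<..<T}" using e2[of n] by (auto simp: A_def)
    qed
    show "{0<..<T} \<subseteq> (\<Union>n. A n)"
    proof
      fix t assume t: "t \<in> {0<..<T}"
      then have "\<forall>\<^sub>F n in sequentially. e n < min t (T - t)" by (intro order_tendstoD(2)[OF el]) auto
      then obtain n where "e n < min t (T - t)" unfolding eventually_sequentially by blast
      then show "t \<in> (\<Union>n. A n)" by (auto simp: A_def intro!: exI[of _ n])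
    qed
  qed
  have lim1: "(\<lambda>n. LINT t:A n|lebesgue. g t) \<longlonglongrightarrow> (LINT t:(\<Union>n. A n)|lebesgue. g t)"
  proof (rule set_integral_cont_up)
    show "set_integrable lebesgue (\<Union>n. A n) g" unfolding AU by (rule set_integrable_subset[OF g]) auto
    show "incseq A"
    proof (rule incseq_SucI)
      fix n
      have "e (Suc n) \<le> e n" using T by (simp add: e_def field_simps)
      then show "A n \<subseteq> A (Suc n)" by (auto simp: A_def)
    qed
  qed (simp add: A_def)
  have eq: "(LINT t:A n|lebesgue. g t) = f (T - e n) - f (e n)" for n
    unfolding A_def
    by (rule has_weak_deriv_FTC[OF wd, symmetric])
      (use e2[of n] T in \<open>auto intro!: continuous_on_subset[OF f]\<close>)
  have lim2: "(\<lambda>n. f (T - e n) - f (e n)) \<longlonglongrightarrow> f T - f 0"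
  proof (rule tendsto_diff)
    have "(\<lambda>n. T - e n) \<longlonglongrightarrow> T - 0" by (intro tendsto_diff tendsto_const el)
    then show "(\<lambda>n. f (T - e n)) \<longlonglongrightarrow> f T"
    proof (intro continuous_on_tendsto_compose[OF f])
      have "T - e n \<in> {0..T}" for n using e2[of n] T by auto
      then show "\<forall>\<^sub>F n in sequentially. T - e n \<in> {0..T}" by simp
    qed (use T in auto)
    show "(\<lambda>n. f (e n)) \<longlonglongrightarrow> f 0"
    proof (rule continuous_on_tendsto_compose[OF f el])
      have "e n \<in> {0..T}" for n using e2[of n] T by auto
      then show "\<forall>\<^sub>F n in sequentially. e n \<in> {0..T}" by simp
    qed (use T in auto)
  qed
  have "f T - f 0 = (LINT t:{0<..<T}|lebesgue. g t)"
    using LIMSEQ_unique[OF lim2 lim1[unfolded eq AU]] .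
  also have "\<dots> = (LINT t:{0..T}|lebesgue. g t)"
    unfolding set_lebesgue_integral_def
  proof (rule integrable_lebesgue_cong_AE(2))
    have "AE t in lebesgue. t \<noteq> 0" "AE t in lebesgue. t \<noteq> T" by (rule AE_completion[OF AE_lborel_singleton])+
    then show "AE t in lebesgue. indicat_real {0<..<T} t *\<^sub>R g t = indicat_real {0..T} t *\<^sub>R g t"
      by eventually_elim (auto simp: indicator_def)
  qed
  finally show ?thesis .
qed

text \<open>With r = \<kappa>^2 - l this is r (1 - r) times 2 \<kappa>, the Jacobian of the
  substitution; the factor r (1 - r) vanishes at both ends of the window.\<close>

definition bump :: "real \<Rightarrow> real \<Rightarrow> real" where
  "bump l \<kappa> = 2 * \<kappa> * ((\<kappa>\<^sup>2 - l) * (l + 1 - \<kappa>\<^sup>2))"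

definition bump_moment :: "real \<Rightarrow> real" where
  "bump_moment t = integral {0..1} (\<lambda>r. exp (r * t) * (r * (1 - r)))"

lemma bump_moment_pos: "bump_moment t > 0"
proof -
  have "integral {0..1} (\<lambda>r::real. 0) < bump_moment t"
    unfolding bump_moment_def by (rule integral_less_real) (auto intro!: continuous_intros)
  then show ?thesis by simp
qed

lemma bump_moment_cont: "continuous_on UNIV bump_moment"
proof -
  have "continuous_on UNIV (\<lambda>t::real. integral (cbox 0 1) (\<lambda>r. exp (r * t) * (r * (1 - r))))"
    by (rule integral_continuous_on_param) (unfold case_prod_beta, intro continuous_intros)
  then show ?thesis unfolding bump_moment_def[abs_def] by simp
qed

text \<open>Substituting r = \<kappa>^2 - l separates exp (l t) from a factor independent of l; this
  is the reason for a window of constant length in \<kappa>^2 instead of \<kappa>.\<close>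

lemma integral_exp_bump:
  assumes l: "l \<ge> 1"
  shows "integral {sqrt l..sqrt (l + 1)} (\<lambda>\<kappa>. exp (\<kappa>\<^sup>2 * t) * bump l \<kappa>) = exp (l * t) * bump_moment t"
proof -
  define f where "f r = exp ((l + r) * t) * (r * (1 - r))" for r
  have "((\<lambda>\<kappa>. (2 * \<kappa>) *\<^sub>R f (\<kappa>\<^sup>2 - l)) has_integral (integral {(sqrt l)\<^sup>2 - l..(sqrt (l + 1))\<^sup>2 - l} f)) {sqrt l..sqrt (l + 1)}"
  proof (rule has_integral_substitution[where c = 0 and d = 1])
    show "(\<lambda>\<kappa>. \<kappa>\<^sup>2 - l) ` {sqrt l..sqrt (l + 1)} \<subseteq> {0..1}"
    proof safe
      fix x assume x: "x \<in> {sqrt l..sqrt (l + 1)}"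
      have "0 \<le> sqrt l" using l by simp
      moreover have "0 \<le> x" using order_trans[OF \<open>0 \<le> sqrt l\<close>, of x] x by simp
      ultimately have "(sqrt l)\<^sup>2 \<le> x\<^sup>2" "x\<^sup>2 \<le> (sqrt (l + 1))\<^sup>2"
        using x power_mono[of "sqrt l" x 2] power_mono[of x "sqrt (l + 1)" 2] by simp_all
      then show "x\<^sup>2 - l \<in> {0..1}" using l by simp
    qed
    show "continuous_on {0..1} f" unfolding f_def by (intro continuous_intros)
    show "((\<lambda>\<kappa>. \<kappa>\<^sup>2 - l) has_real_derivative 2 * x) (at x within {sqrt l..sqrt (l + 1)})" for x
      by (auto intro!: derivative_eq_intros)
  qed (use l in auto)
  moreover have "(2 * \<kappa>) *\<^sub>R f (\<kappa>\<^sup>2 - l) = exp (\<kappa>\<^sup>2 * t) * bump l \<kappa>" for \<kappa>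
    by (simp add: f_def bump_def)
  moreover have "integral {(sqrt l)\<^sup>2 - l..(sqrt (l + 1))\<^sup>2 - l} f = exp (l * t) * bump_moment t"
  proof -
    have "f = (\<lambda>r. exp (l * t) * (exp (r * t) * (r * (1 - r))))" by (simp add: f_def fun_eq_iff distrib_right exp_add)
    then show ?thesis using l by (simp add: bump_moment_def)
  qed
  ultimately show ?thesis by (simp add: integral_unique)
qed

context heat
begin

text \<open>On the window both factors r and 1 - r lie in [0,1], whence 2 b for the bump and 2 + 8
  b^2 for its derivative. Powers of \<kappa>^2 are included because the equation multiplies the
  weight by \<kappa>^2 at every step of the later chain.\<close>

lemma admissible_bump:
  assumes l: "l \<ge> 1"
  defines "b \<equiv> sqrt (l + 1)"
  shows "admissible (sqrt l) b ((b\<^sup>2) ^ j * (2 * b)) ((b\<^sup>2) ^ j * (4 * real j * b + (2 + 8 * b\<^sup>2))) (\<lambda>\<kappa>. (\<kappa>\<^sup>2) ^ j * bump l \<kappa>)"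
proof -
  define a where "a = sqrt l"
  have a1: "a \<ge> 1" using l by (simp add: a_def)
  have ab: "a < b" using l by (simp add: a_def b_def)
  have sq: "a\<^sup>2 = l" "b\<^sup>2 = l + 1" using l by (simp_all add: a_def b_def)
  have b1: "b \<ge> 1" using a1 ab by simp
  \<comment> \<open>Windows get shorter in \<kappa>: b^2 = a^2 + 1 is at most (a + 1)^2.\<close>
  have ba: "b \<le> a + 1"
    by (rule power2_le_imp_le) (use sq a1 in \<open>auto simp: power2_sum\<close>)
  have r: "0 \<le> t\<^sup>2 - l" "t\<^sup>2 - l \<le> 1" "t \<ge> 1" "t\<^sup>2 \<le> b\<^sup>2" if "t \<in> {a..b}" for t
  proof -
    have "a\<^sup>2 \<le> t\<^sup>2" "t\<^sup>2 \<le> b\<^sup>2" using that a1 by (auto intro!: power_mono)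
    then show "0 \<le> t\<^sup>2 - l" "t\<^sup>2 - l \<le> 1" "t\<^sup>2 \<le> b\<^sup>2" using sq by auto
    show "t \<ge> 1" using that a1 by simp
  qed
  have g0: "\<bar>bump l t\<bar> \<le> 2 * b" if t: "t \<in> {a..b}" for t
  proof -
    have "\<bar>(t\<^sup>2 - l) * (l + 1 - t\<^sup>2)\<bar> \<le> 1 * 1" unfolding abs_mult using r[OF t] by (intro mult_mono) auto
    moreover have "\<bar>2 * t\<bar> \<le> 2 * b" using t r(3)[OF t] by simp
    ultimately have "\<bar>2 * t\<bar> * \<bar>(t\<^sup>2 - l) * (l + 1 - t\<^sup>2)\<bar> \<le> (2 * b) * (1 * 1)" by (intro mult_mono) auto
    then show ?thesis unfolding bump_def abs_mult[of "2 * t" "(t\<^sup>2 - l) * (l + 1 - t\<^sup>2)"] by (simp only: mult_1_right)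
  qed
  define g' where "g' t = 2 * ((t\<^sup>2 - l) * (l + 1 - t\<^sup>2)) + 4 * t\<^sup>2 * (l + 1 - t\<^sup>2) - 4 * t\<^sup>2 * (t\<^sup>2 - l)" for t
  have gd: "(bump l has_real_derivative g' t) (at t within S)" for t S
    unfolding bump_def[abs_def] g'_def by (auto intro!: derivative_eq_intros simp: power2_eq_square algebra_simps)
  have g1: "\<bar>g' t\<bar> \<le> 2 + 8 * b\<^sup>2" if t: "t \<in> {a..b}" for t
  proof -
    have "\<bar>(t\<^sup>2 - l) * (l + 1 - t\<^sup>2)\<bar> \<le> 1 * 1" unfolding abs_mult using r[OF t] by (intro mult_mono) auto
    moreover have "\<bar>t\<^sup>2 * (l + 1 - t\<^sup>2)\<bar> \<le> b\<^sup>2 * 1" "\<bar>t\<^sup>2 * (t\<^sup>2 - l)\<bar> \<le> b\<^sup>2 * 1"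
      unfolding abs_mult using r[OF t] t by (intro mult_mono; auto)+
    moreover have "g' t = 2 * ((t\<^sup>2 - l) * (l + 1 - t\<^sup>2)) + 4 * (t\<^sup>2 * (l + 1 - t\<^sup>2)) - 4 * (t\<^sup>2 * (t\<^sup>2 - l))"
      by (simp add: g'_def)
    ultimately show ?thesis by linarith
  qed
  define G where "G t = (t\<^sup>2) ^ j * bump l t" for t
  define G' where "G' t = (t\<^sup>2) ^ j * g' t + real j * (t\<^sup>2) ^ (j - 1) * (2 * t) * bump l t" for t
  have Gd: "(G has_real_derivative G' t) (at t within S)" for t S
  proof -
    have "((\<lambda>t. (t\<^sup>2) ^ j) has_real_derivative real j * (t\<^sup>2) ^ (j - 1) * (2 * t)) (at t within S)"
      by (auto intro!: derivative_eq_intros)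
    from DERIV_mult[OF this gd] show ?thesis unfolding G_def[abs_def] G'_def by (simp add: algebra_simps)
  qed
  have pw: "(t\<^sup>2) ^ j \<le> (b\<^sup>2) ^ j" if "t \<in> {a..b}" for t
    by (rule power_mono[OF r(4)[OF that]]) simp
  have G'b: "\<bar>G' t\<bar> \<le> (b\<^sup>2) ^ j * (4 * real j * b + (2 + 8 * b\<^sup>2))" if t: "t \<in> {a..b}" for t
  proof -
    have 1: "\<bar>(t\<^sup>2) ^ j * g' t\<bar> \<le> (b\<^sup>2) ^ j * (2 + 8 * b\<^sup>2)"
      unfolding abs_mult using pw[OF t] g1[OF t] by (intro mult_mono) auto
    \<comment> \<open>As t \<ge> 1, the odd power t^(2j-1) is bounded by t^(2j), which keeps a
      common factor for both terms.\<close>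
    have 2: "\<bar>real j * (t\<^sup>2) ^ (j - 1) * (2 * t) * bump l t\<bar> \<le> (b\<^sup>2) ^ j * (4 * real j * b)"
    proof (cases j)
      case (Suc i)
      have "(t\<^sup>2) ^ i * t \<le> (t\<^sup>2) ^ i * t\<^sup>2"
        using r(3)[OF t] by (intro mult_left_mono) (auto simp: power2_eq_square)
      also have "\<dots> = (t\<^sup>2) ^ j" by (simp add: Suc)
      finally have tt: "(t\<^sup>2) ^ i * t \<le> (b\<^sup>2) ^ j" using pw[OF t] by linarith
      have "\<bar>((t\<^sup>2) ^ i * t) * bump l t\<bar> \<le> (b\<^sup>2) ^ j * (2 * b)"
        unfolding abs_mult[of "(t\<^sup>2) ^ i * t"] using tt g0[OF t] r(3)[OF t] by (intro mult_mono) auto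
      then have "real j * 2 * \<bar>((t\<^sup>2) ^ i * t) * bump l t\<bar> \<le> real j * 2 * ((b\<^sup>2) ^ j * (2 * b))"
        by (rule mult_left_mono) simp
      moreover have "\<bar>real j * (t\<^sup>2) ^ (j - 1) * (2 * t) * bump l t\<bar> = real j * 2 * \<bar>((t\<^sup>2) ^ i * t) * bump l t\<bar>"
        by (simp add: Suc abs_mult mult_ac)
      ultimately show ?thesis by (simp add: mult_ac)
    qed simp
    show ?thesis
      unfolding G'_def distrib_left[of "(b\<^sup>2) ^ j" "4 * real j * b" "2 + 8 * b\<^sup>2"] using 1 2 by linarith
  qed
  have lip: "\<bar>G t - G u\<bar> \<le> (b\<^sup>2) ^ j * (4 * real j * b + (2 + 8 * b\<^sup>2)) * \<bar>t - u\<bar>" if "t \<in> {a..b}" "u \<in> {a..b}" for t u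
    using field_differentiable_bound[of "{a..b}" G G' _ t u] Gd G'b that by simp
  have sup: "\<bar>G t\<bar> \<le> (b\<^sup>2) ^ j * (2 * b)" if "t \<in> {a..b}" for t
    unfolding G_def abs_mult using pw[OF that] g0[OF that] by (intro mult_mono) auto
  have "G a = 0" "G b = 0" using sq by (auto simp: G_def bump_def)
  moreover have "0 \<le> (b\<^sup>2) ^ j * (4 * real j * b + (2 + 8 * b\<^sup>2))" using b1 by simp
  ultimately show ?thesis
    unfolding admissible_def a_def[symmetric] G_def[abs_def, symmetric] using a1 ab ba lip sup by auto
qed

text \<open>The functions \<open>t \<mapsto> ip (W t) (wave \<dots> (\<kappa>\<^sup>2\<^sup>j g))\<close> satisfy a chain of equations; combining them with
  weights \<open>t\<^sup>j / j!\<close> telescopes and amounts to testing with \<open>exp (\<kappa>\<^sup>2 t) g\<close>.\<close>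

lemma control_moment_identity:
  assumes T: "T > 0" and dc: "dual_cont T W" and W: "\<And>t. t \<in> {0..T} \<Longrightarrow> W t \<in> H1 \<rho> k"
    and wd: "\<And>\<phi>. \<phi> \<in> H1 \<rho> k \<Longrightarrow> has_weak_deriv {0<..<T} (\<lambda>t. ip (W t) \<phi>) (\<lambda>t. - Bq (W t) \<phi> - \<alpha> * u t * delta \<phi>)"
    and u: "set_integrable lebesgue {0..T} u" and z: "AE x in lebesgue. W T x = 0" and l: "l \<ge> 1"
  shows "ip (W 0) (wave (sqrt l) (sqrt (l + 1)) (bump l)) = \<alpha> / m 0 * (LINT t:{0..T}|lebesgue. exp (l * t) * (bump_moment t * u t))"
proof -
  define a b where "a = sqrt l" and "b = sqrt (l + 1)"
  define G where "G j \<kappa> = (\<kappa>\<^sup>2) ^ j * bump l \<kappa>" for j \<kappa>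
  have adm: "admissible a b ((b\<^sup>2) ^ j * (2 * b)) ((b\<^sup>2) ^ j * (4 * real j * b + (2 + 8 * b\<^sup>2))) (G j)" for j
    using admissible_bump[OF l, of j] unfolding a_def b_def G_def[abs_def] .
  have a1: "a \<ge> 1" "a < b" using l by (auto simp: a_def b_def)
  have GS: "(\<lambda>\<kappa>. \<kappa>\<^sup>2 * G j \<kappa>) = G (Suc j)" for j by (simp add: G_def fun_eq_iff)
  define \<phi> where "\<phi> j = wave a b (G j)" for j
  note wp = wave_properties[OF adm]
  have \<phi>H: "\<phi> j \<in> H1 \<rho> k" for j unfolding \<phi>_def by (rule wp(1))
  define I where "I j = integral {a..b} (G j)" for j
  have d\<phi>: "delta (\<phi> j) = I j / m 0" for j
    using delta_continuous[OF wp(3)[of j]] wp(4)[of j] by (simp add: \<phi>_def I_def)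
  define M where "M j t = ip (W t) (\<phi> j)" for j t
  have Bq\<phi>: "Bq (W t) (\<phi> j) = M (Suc j) t" if "t \<in> {0..T}" for j t
  proof -
    have "admissible a b ((b\<^sup>2) ^ Suc j * (2 * b)) ((b\<^sup>2) ^ Suc j * (4 * real (Suc j) * b + (2 + 8 * b\<^sup>2))) (\<lambda>\<kappa>. \<kappa>\<^sup>2 * G j \<kappa>)"
      unfolding GS by (rule adm)
    from wp(5)[OF this W[OF that]] show ?thesis unfolding \<phi>_def M_def GS .
  qed
  define \<beta> where "\<beta> = \<alpha> / m 0"
  have wdM: "has_weak_deriv {0<..<T} (M j) (\<lambda>t. - M (Suc j) t - \<beta> * u t * I j)" for j
  proof -
    have eq: "(\<lambda>t. ip (W t) (\<phi> j)) = M j" by (simp add: M_def fun_eq_iff)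
    show ?thesis
      by (rule has_weak_deriv_AE[OF wd[OF \<phi>H[of j], unfolded eq]])
        (auto intro!: AE_I2 simp: Bq\<phi> d\<phi> \<beta>_def)
  qed
  have Mc: "continuous_on {0..T} (M j)" for j unfolding M_def[abs_def] by (rule dual_cont_continuous[OF dc \<phi>H])
  \<comment> \<open>The equation is available for test functions fixed in time, so exp (\<kappa>^2
    t) is replaced by its Taylor polynomials: each coefficient is a fixed wave multiplied by a
    function of t.\<close>
  define S where "S n t = (\<Sum>j\<le>n. t ^ j / fact j * M j t)" for n t
  define E where "E n t = (\<Sum>j\<le>n. t ^ j / fact j * I j)" for n t
  have pd: "((\<lambda>t. t ^ j / fact j) has_real_derivative real j * t ^ (j - 1) / fact j) (at t)" for j and t :: real
    by (auto intro!: derivative_eq_intros)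
  \<comment> \<open>The derivative of t^(n+1) / (n+1)! is t^n / n!, so each new term cancels the
    remainder left by the previous one and leaves a remainder of the next order.\<close>
  have wdS: "has_weak_deriv {0<..<T} (S n) (\<lambda>t. - (t ^ n / fact n * M (Suc n) t) - \<beta> * u t * E n t)" for n
  proof (induction n)
    case 0
    show ?case using wdM[of 0] by (simp add: S_def[abs_def] E_def)
  next
    case (Suc n)
    have "has_weak_deriv {0<..<T} (\<lambda>t. t ^ Suc n / fact (Suc n) * M (Suc n) t)
       (\<lambda>t. t ^ Suc n / fact (Suc n) * (- M (Suc (Suc n)) t - \<beta> * u t * I (Suc n)) + real (Suc n) * t ^ (Suc n - 1) / fact (Suc n) * M (Suc n) t)"
      by (rule has_weak_deriv_mult_C1[OF _ _ wdM pd]) (auto intro!: continuous_intros simp: is_interval_convex_1)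
    from has_weak_deriv_add[OF _ _ Suc this]
    have "has_weak_deriv {0<..<T} (\<lambda>t. S n t + t ^ Suc n / fact (Suc n) * M (Suc n) t)
      (\<lambda>t. (- (t ^ n / fact n * M (Suc n) t) - \<beta> * u t * E n t) +
        (t ^ Suc n / fact (Suc n) * (- M (Suc (Suc n)) t - \<beta> * u t * I (Suc n)) + real (Suc n) * t ^ (Suc n - 1) / fact (Suc n) * M (Suc n) t))"
      by (simp add: is_interval_convex_1)
    moreover have "(- (t ^ n / fact n * M (Suc n) t) - \<beta> * u t * E n t) +
        (t ^ Suc n / fact (Suc n) * (- M (Suc (Suc n)) t - \<beta> * u t * I (Suc n)) + real (Suc n) * t ^ (Suc n - 1) / fact (Suc n) * M (Suc n) t)
        = - (t ^ Suc n / fact (Suc n) * M (Suc (Suc n)) t) - \<beta> * u t * E (Suc n) t" for t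
    proof -
      have "real (Suc n) * t ^ (Suc n - 1) / fact (Suc n) = t ^ n / fact n" by (simp add: fact_Suc del: of_nat_Suc)
      then show ?thesis by (simp only: E_def sum.atMost_Suc) (simp only: algebra_simps)
    qed
    moreover have "(\<lambda>t. S n t + t ^ Suc n / fact (Suc n) * M (Suc n) t) = S (Suc n)" by (simp add: S_def fun_eq_iff)
    ultimately show ?case by (simp only:)
  qed
  have ec: "continuous_on A (E n)" for n A unfolding E_def by (intro continuous_intros) auto
  have ui: "set_integrable lebesgue {0..T} (\<lambda>t. u t * E n t)" for n by (rule set_integrable_mult_continuous[OF u ec])
  have mi: "set_integrable lebesgue {0..T} (\<lambda>t. t ^ n / fact n * M (Suc n) t)" for n
    by (intro absolutely_integrable_continuous_real continuous_intros Mc) auto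
  have MT: "M j T = 0" for j
  proof -
    have "M j T = ip (\<lambda>x. 0) (\<phi> j)"
      unfolding M_def by (rule ip_cong_AE) (use z H1_sq(1)[OF W] H1_sq(1)[OF \<phi>H] T in auto)
    then show ?thesis by simp
  qed
  \<comment> \<open>The final state is zero, so the value at T disappears; at 0 only the term j = 0
    survives, because 0^0 = 1.\<close>
  have id: "M 0 0 = (LINT t:{0..T}|lebesgue. t ^ n / fact n * M (Suc n) t) + \<beta> * (LINT t:{0..T}|lebesgue. u t * E n t)" for n
  proof -
    have "S n T - S n 0 = (LINT t:{0..T}|lebesgue. - (t ^ n / fact n * M (Suc n) t) - \<beta> * u t * E n t)"
    proof (rule has_weak_deriv_FTC_closed[OF T wdS])
      show "continuous_on {0..T} (S n)" unfolding S_def by (intro continuous_intros Mc) auto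
      show "set_integrable lebesgue {0..T} (\<lambda>t. - (t ^ n / fact n * M (Suc n) t) - \<beta> * u t * E n t)"
        using set_integral_diff(1)[OF set_integrable_mult_right[of "-1", OF mi] set_integrable_mult_right[of \<beta>, OF ui]] by (simp add: mult.assoc)
    qed
    also have "\<dots> = (LINT t:{0..T}|lebesgue. (-1) * (t ^ n / fact n * M (Suc n) t) - \<beta> * (u t * E n t))" by (simp add: mult.assoc)
    also have "\<dots> = (-1) * (LINT t:{0..T}|lebesgue. t ^ n / fact n * M (Suc n) t) - \<beta> * (LINT t:{0..T}|lebesgue. u t * E n t)"
      by (subst set_integral_diff(2)) (simp_all only: set_integrable_mult_right mi ui set_integral_mult_right)
    finally have "S n T - S n 0 = \<dots>" .
    moreover have "S n T = 0" by (simp add: S_def MT)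
    moreover have "S n 0 = M 0 0" by (simp add: S_def power_0_left if_distrib if_distribR cong: if_cong)
    ultimately show ?thesis by simp
  qed
  obtain C0 where C0: "C0 \<ge> 0" "\<And>t \<phi>. t \<in> {0..T} \<Longrightarrow> \<phi> \<in> H1 \<rho> k \<Longrightarrow> \<bar>ip (W t) \<phi>\<bar> \<le> C0 * norm_H1 \<rho> k \<phi>"
    using dual_cont_bounded[OF dc H1_sq(1)[OF W]] by blast
  define P where "P = C0 * (sqrt (2 * J) * (hl.packet_const b * (6 * b + (2 + 8 * b\<^sup>2))))"
  \<comment> \<open>The Lipschitz constants of the weights grow linearly in j apart from the power
    of b^2; \<open>2 ^ j\<close> absorbs this, so the moments grow geometrically and lose against
    the factorial. The 6 in \<open>P\<close> is 2 + 4.\<close>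
  have Mb: "\<bar>M j t\<bar> \<le> P * (b\<^sup>2) ^ j * 2 ^ j" if t: "t \<in> {0..T}" for j t
  proof -
    have pc: "hl.packet_const b \<ge> 0"
      unfolding hl.packet_const_def hl.jost_lip_def using hl.K_nonneg a1 by simp
    have j2: "real j \<le> 2 ^ j" using of_nat_less_two_power[of j, where 'a = real] by simp
    have o2: "(1::real) \<le> 2 ^ j" by simp
    have jb: "real j * b \<le> 2 ^ j * b" using j2 a1 by (intro mult_right_mono) auto
    have bb: "b \<le> 2 ^ j * b" "(2 + 8 * b\<^sup>2) \<le> 2 ^ j * (2 + 8 * b\<^sup>2)"
      using mult_right_mono[OF o2, of b] mult_right_mono[OF o2, of "2 + 8 * b\<^sup>2"] a1 by simp_all
    have "2 * b + (4 * real j * b + (2 + 8 * b\<^sup>2)) \<le> 2 ^ j * (6 * b + (2 + 8 * b\<^sup>2))"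
      using jb bb by (simp add: algebra_simps)
    then have "(b\<^sup>2) ^ j * (2 * b) + (b\<^sup>2) ^ j * (4 * real j * b + (2 + 8 * b\<^sup>2)) \<le> (b\<^sup>2) ^ j * (2 ^ j * (6 * b + (2 + 8 * b\<^sup>2)))"
      unfolding distrib_left[symmetric, of "(b\<^sup>2) ^ j"] by (rule mult_left_mono) simp
    then have "hl.packet_const b * ((b\<^sup>2) ^ j * (2 * b) + (b\<^sup>2) ^ j * (4 * real j * b + (2 + 8 * b\<^sup>2)))
       \<le> hl.packet_const b * ((b\<^sup>2) ^ j * (2 ^ j * (6 * b + (2 + 8 * b\<^sup>2))))" using pc by (rule mult_left_mono)
    then have "norm_H1 \<rho> k (\<phi> j) \<le> sqrt (2 * J) * (hl.packet_const b * ((b\<^sup>2) ^ j * (2 ^ j * (6 * b + (2 + 8 * b\<^sup>2)))))"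
      using wp(2)[of j] J_nonneg unfolding \<phi>_def by (meson mult_left_mono order_trans real_sqrt_ge_zero mult_nonneg_nonneg zero_le_numeral)
    then have "C0 * norm_H1 \<rho> k (\<phi> j) \<le> C0 * (sqrt (2 * J) * (hl.packet_const b * ((b\<^sup>2) ^ j * (2 ^ j * (6 * b + (2 + 8 * b\<^sup>2))))))"
      using C0(1) by (rule mult_left_mono)
    also have "\<dots> = P * (b\<^sup>2) ^ j * 2 ^ j" by (simp only: P_def mult_ac)
    finally show ?thesis using C0(2)[OF t \<phi>H[of j]] unfolding M_def by linarith
  qed
  have lim1: "(\<lambda>n. LINT t:{0..T}|lebesgue. t ^ n / fact n * M (Suc n) t) \<longlonglongrightarrow> 0"
  proof (rule tendsto_0_le[where K = 1])
    define y where "y = T * (b\<^sup>2 * 2)"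
    have "(\<lambda>n. y ^ n /\<^sub>R fact n) \<longlonglongrightarrow> 0" by (rule summable_LIMSEQ_zero[OF summable_exp_generic])
    from tendsto_mult_left[OF this, of "T * P * (b\<^sup>2 * 2)"]
    show "(\<lambda>n. T * P * (b\<^sup>2 * 2) * (y ^ n /\<^sub>R fact n)) \<longlonglongrightarrow> 0" by simp
    have "\<bar>LINT t:{0..T}|lebesgue. t ^ n / fact n * M (Suc n) t\<bar> \<le> T * P * (b\<^sup>2 * 2) * (y ^ n /\<^sub>R fact n)" for n
    proof -
      have ci: "set_integrable lebesgue {0..T} (\<lambda>t. x)" for x :: real
        by (intro absolutely_integrable_continuous_real continuous_intros)
      have "\<bar>t ^ n / fact n * M (Suc n) t\<bar> \<le> T ^ n / fact n * (P * (b\<^sup>2) ^ Suc n * 2 ^ Suc n)" if t: "t \<in> {0..T}" for t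
        unfolding abs_mult using t Mb[OF t, of "Suc n"]
        by (intro mult_mono) (auto simp: power_abs intro!: divide_right_mono power_mono)
      then have "(LINT t:{0..T}|lebesgue. \<bar>t ^ n / fact n * M (Suc n) t\<bar>) \<le> (LINT t:{0..T}|lebesgue. T ^ n / fact n * (P * (b\<^sup>2) ^ Suc n * 2 ^ Suc n))"
        by (rule set_integral_mono[OF set_integrable_abs[OF mi] ci])
      with set_integral_norm_bound[OF mi[of n]]
      have "\<bar>LINT t:{0..T}|lebesgue. t ^ n / fact n * M (Suc n) t\<bar> \<le> (LINT t:{0..T}|lebesgue. T ^ n / fact n * (P * (b\<^sup>2) ^ Suc n * 2 ^ Suc n))"
        unfolding real_norm_def by (rule order_trans)
      also have "\<dots> = T * (T ^ n / fact n * (P * (b\<^sup>2) ^ Suc n * 2 ^ Suc n))"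
        using T by (simp add: set_lebesgue_integral_eq_integral[OF ci])
      also have "\<dots> = T * P * (b\<^sup>2 * 2) * (y ^ n /\<^sub>R fact n)"
        by (simp add: y_def power_mult_distrib divide_inverse mult_ac)
      finally show ?thesis .
    qed
    then show "\<forall>\<^sub>F n in sequentially. norm (LINT t:{0..T}|lebesgue. t ^ n / fact n * M (Suc n) t) \<le> norm (T * P * (b\<^sup>2 * 2) * (y ^ n /\<^sub>R fact n)) * 1"
      unfolding real_norm_def mult_1_right by (intro always_eventually allI) (rule order_trans[OF _ abs_ge_self])
  qed
  have Gc: "continuous_on {a..b} (G j)" for j by (rule admissible_cont[OF adm])
  have gc: "continuous_on {a..b} (bump l)" using Gc[of 0] by (simp add: G_def[abs_def])
  have gb: "\<bar>bump l \<kappa>\<bar> \<le> 2 * b" if "\<kappa> \<in> {a..b}" for \<kappa>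
    using adm[of 0] that by (simp add: admissible_def G_def)
  define EE where "EE t = exp (l * t) * bump_moment t" for t
  have EE: "EE t = integral {a..b} (\<lambda>\<kappa>. exp (\<kappa>\<^sup>2 * t) * bump l \<kappa>)" for t
    unfolding EE_def a_def b_def by (rule integral_exp_bump[OF l, symmetric])
  \<comment> \<open>\<open>E n\<close> averages the Taylor polynomials of exp (\<kappa>^2 t), so its
    limit is the average of the exponential, which \<open>integral_exp_bump\<close> has
    computed.\<close>
  have Eint: "E n t = integral {a..b} (\<lambda>\<kappa>. (\<Sum>j\<le>n. (\<kappa>\<^sup>2 * t) ^ j / fact j) * bump l \<kappa>)" for n t
  proof -
    have "E n t = (\<Sum>j\<le>n. integral {a..b} (\<lambda>\<kappa>. t ^ j / fact j * G j \<kappa>))" unfolding E_def I_def by simp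
    also have "\<dots> = integral {a..b} (\<lambda>\<kappa>. \<Sum>j\<le>n. t ^ j / fact j * G j \<kappa>)"
      by (rule integral_sum[symmetric]) (auto intro!: integrable_continuous_real continuous_intros Gc)
    also have "(\<lambda>\<kappa>. \<Sum>j\<le>n. t ^ j / fact j * G j \<kappa>) = (\<lambda>\<kappa>. (\<Sum>j\<le>n. (\<kappa>\<^sup>2 * t) ^ j / fact j) * bump l \<kappa>)"
      unfolding sum_distrib_right by (simp add: G_def power_mult_distrib mult_ac)
    finally show ?thesis .
  qed
  have part: "\<bar>(\<Sum>j\<le>n. (\<kappa>\<^sup>2 * t) ^ j / fact j) * bump l \<kappa>\<bar> \<le> exp (b\<^sup>2 * T) * (2 * b)"
    if k: "\<kappa> \<in> {a..b}" and t: "t \<in> {0..T}" for n \<kappa> t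
  proof -
    have x0: "0 \<le> \<kappa>\<^sup>2 * t" using t by simp
    have "(\<Sum>j\<le>n. (\<kappa>\<^sup>2 * t) ^ j / fact j) \<le> exp (\<kappa>\<^sup>2 * t)"
      unfolding lessThan_Suc_atMost[symmetric]
      by (rule sum_le_sums_nonneg[where f = "\<lambda>j. (\<kappa>\<^sup>2 * t) ^ j / fact j"])
        (use exp_converges[of "\<kappa>\<^sup>2 * t"] x0 in \<open>auto simp: divide_inverse mult.commute\<close>)
    also have "\<dots> \<le> exp (b\<^sup>2 * T)" using k t a1 by (auto intro!: mult_mono power_mono)
    finally have "\<bar>\<Sum>j\<le>n. (\<kappa>\<^sup>2 * t) ^ j / fact j\<bar> \<le> exp (b\<^sup>2 * T)" using x0 by (simp add: sum_nonneg)
    then show ?thesis unfolding abs_mult using gb[OF k] by (intro mult_mono) auto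
  qed
  have ic: "(\<lambda>\<kappa>. (\<Sum>j\<le>n. (\<kappa>\<^sup>2 * t) ^ j / fact j) * bump l \<kappa>) integrable_on {a..b}" for n t
    by (intro integrable_continuous_real continuous_intros gc) auto
  have Elim: "(\<lambda>n. E n t) \<longlonglongrightarrow> EE t" if t: "t \<in> {0..T}" for t
    unfolding Eint EE
  proof (rule dominated_convergence(2)[where h = "\<lambda>_. exp (b\<^sup>2 * T) * (2 * b)"])
    show "(\<lambda>n. (\<Sum>j\<le>n. (\<kappa>\<^sup>2 * t) ^ j / fact j) * bump l \<kappa>) \<longlonglongrightarrow> exp (\<kappa>\<^sup>2 * t) * bump l \<kappa>" if "\<kappa> \<in> {a..b}" for \<kappa>
    proof (rule tendsto_mult_right)
      have "(\<lambda>j. (\<kappa>\<^sup>2 * t) ^ j / fact j) sums exp (\<kappa>\<^sup>2 * t)"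
        using exp_converges[of "\<kappa>\<^sup>2 * t"] by (simp add: divide_inverse mult.commute)
      then show "(\<lambda>n. \<Sum>j\<le>n. (\<kappa>\<^sup>2 * t) ^ j / fact j) \<longlonglongrightarrow> exp (\<kappa>\<^sup>2 * t)" by (simp add: sums_def_le)
    qed
  qed (use ic part t in auto)
  have Eb: "\<bar>E n t\<bar> \<le> exp (b\<^sup>2 * T) * (2 * b) * (b - a)" if t: "t \<in> {0..T}" for n t
  proof -
    have "norm (integral {a..b} (\<lambda>\<kappa>. (\<Sum>j\<le>n. (\<kappa>\<^sup>2 * t) ^ j / fact j) * bump l \<kappa>)) \<le> exp (b\<^sup>2 * T) * (2 * b) * (b - a)"
      by (rule integral_bound) (use a1 part[OF _ t] in \<open>auto intro!: continuous_intros gc\<close>)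
    then show ?thesis unfolding Eint by simp
  qed
  have EEc: "continuous_on UNIV EE" unfolding EE_def by (intro continuous_intros bump_moment_cont)
  have lim2: "(\<lambda>n. LINT t:{0..T}|lebesgue. u t * E n t) \<longlonglongrightarrow> (LINT t:{0..T}|lebesgue. u t * EE t)"
    unfolding set_lebesgue_integral_def
  proof (rule integral_dominated_convergence[where w = "\<lambda>t. norm (indicator {0..T} t *\<^sub>R u t) * (exp (b\<^sup>2 * T) * (2 * b) * (b - a))"])
    show "(\<lambda>t. indicat_real {0..T} t *\<^sub>R (u t * E n t)) \<in> borel_measurable lebesgue" for n
      using ui[of n] unfolding set_integrable_def by (rule borel_measurable_integrable)
    show "(\<lambda>t. indicat_real {0..T} t *\<^sub>R (u t * EE t)) \<in> borel_measurable lebesgue"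
      using set_integrable_mult_continuous[OF u continuous_on_subset[OF EEc subset_UNIV]]
      unfolding set_integrable_def by (rule borel_measurable_integrable)
    show "integrable lebesgue (\<lambda>t. norm (indicator {0..T} t *\<^sub>R u t) * (exp (b\<^sup>2 * T) * (2 * b) * (b - a)))"
      using u unfolding set_integrable_def by (intro integrable_mult_left integrable_norm)
    show "AE t in lebesgue. (\<lambda>n. indicat_real {0..T} t *\<^sub>R (u t * E n t)) \<longlonglongrightarrow> indicat_real {0..T} t *\<^sub>R (u t * EE t)"
    proof (rule AE_I2)
      fix t show "(\<lambda>n. indicat_real {0..T} t *\<^sub>R (u t * E n t)) \<longlonglongrightarrow> indicat_real {0..T} t *\<^sub>R (u t * EE t)"
        by (cases "t \<in> {0..T}") (auto intro!: tendsto_mult_left Elim)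
    qed
    show "AE t in lebesgue. norm (indicat_real {0..T} t *\<^sub>R (u t * E n t)) \<le> norm (indicator {0..T} t *\<^sub>R u t) * (exp (b\<^sup>2 * T) * (2 * b) * (b - a))" for n
    proof (rule AE_I2)
      fix t show "norm (indicat_real {0..T} t *\<^sub>R (u t * E n t)) \<le> norm (indicator {0..T} t *\<^sub>R u t) * (exp (b\<^sup>2 * T) * (2 * b) * (b - a))"
        using Eb[of t n] by (cases "t \<in> {0..T}") (auto simp: abs_mult intro!: mult_left_mono)
    qed
  qed
  have "(\<lambda>n. (LINT t:{0..T}|lebesgue. t ^ n / fact n * M (Suc n) t) + \<beta> * (LINT t:{0..T}|lebesgue. u t * E n t)) \<longlonglongrightarrow> 0 + \<beta> * (LINT t:{0..T}|lebesgue. u t * EE t)"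
    by (intro tendsto_add lim1 tendsto_mult_left lim2)
  then have "(\<lambda>n. M 0 0) \<longlonglongrightarrow> \<beta> * (LINT t:{0..T}|lebesgue. u t * EE t)" unfolding id[symmetric] by simp
  then have "M 0 0 = \<beta> * (LINT t:{0..T}|lebesgue. u t * EE t)" by (simp add: LIMSEQ_const_iff)
  moreover have "u t * EE t = exp (l * t) * (bump_moment t * u t)" for t by (simp add: EE_def)
  moreover have "G 0 = bump l" by (simp add: G_def fun_eq_iff)
  ultimately show ?thesis by (simp add: M_def \<phi>_def \<beta>_def a_def b_def)
qed

text \<open>The moment identity expresses the exponential moments of
  \<open>bump_moment t * u t\<close> by the initial state alone. Its pairing with the wave is
  bounded polynomially in l, hence subexponentially, and positivity of \<open>bump_moment\<close>
  allows division at the end.\<close>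

lemma control_zero:
  assumes T: "T > 0" and dc: "dual_cont T W" and W: "\<And>t. t \<in> {0..T} \<Longrightarrow> W t \<in> H1 \<rho> k"
    and wd: "\<And>\<phi>. \<phi> \<in> H1 \<rho> k \<Longrightarrow> has_weak_deriv {0<..<T} (\<lambda>t. ip (W t) \<phi>) (\<lambda>t. - Bq (W t) \<phi> - \<alpha> * u t * delta \<phi>)"
    and u: "set_integrable lebesgue {0..T} u" and z: "AE x in lebesgue. W T x = 0" and \<alpha>: "\<alpha> \<noteq> 0"
  shows "AE t in lebesgue. t \<in> {0<..T} \<longrightarrow> u t = 0"
proof -
  have "AE t in lebesgue. t \<in> {0<..T} \<longrightarrow> u t * bump_moment t = 0"
  proof (rule exponential_moments_subexponential_imp_0)
    show "set_integrable lebesgue {0..T} (\<lambda>t. u t * bump_moment t)"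
      by (rule set_integrable_mult_continuous[OF u continuous_on_subset[OF bump_moment_cont]]) simp
    obtain C0 where C0: "C0 \<ge> 0" "\<And>t \<phi>. t \<in> {0..T} \<Longrightarrow> \<phi> \<in> H1 \<rho> k \<Longrightarrow> \<bar>ip (W t) \<phi>\<bar> \<le> C0 * norm_H1 \<rho> k \<phi>"
      using dual_cont_bounded[OF dc H1_sq(1)[OF W]] by blast
    \<comment> \<open>For b \<ge> 1 the lone 1 in \<open>jost_lip\<close> is at most b, so
      \<open>packet_const b\<close> is at most \<open>P * b\<close>. Similarly 12 = 2 + 2 + 8 bounds
      the constants of the weight by 12 b^2; the product is cubic in b and is enlarged to b^4 = (l +
      1)^2.\<close>
    define P where "P = 20 * (2 * exp K + (1 + 2 * K * exp K) * exp K)"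
    have P0: "P \<ge> 0" unfolding P_def using hl.K_nonneg by simp
    define C1 where "C1 = \<bar>m 0 / \<alpha>\<bar> * (C0 * (sqrt (2 * J) * (P * 12)))"
    have C10: "C1 \<ge> 0" unfolding C1_def using C0(1) P0 J_nonneg by simp
    have main: "\<bar>LINT t:{0..T}|lebesgue. exp (l * t) * (u t * bump_moment t)\<bar> \<le> C1 * (l + 1)\<^sup>2" if l: "l \<ge> 1" for l
    proof -
      define b where "b = sqrt (l + 1)"
      have b1: "b \<ge> 1" using l by (simp add: b_def)
      note adm = admissible_bump[OF l, of 0, folded b_def, simplified]
      note wp = wave_properties[OF adm]
      have "(LINT t:{0..T}|lebesgue. exp (l * t) * (u t * bump_moment t)) = m 0 / \<alpha> * ip (W 0) (wave (sqrt l) b (bump l))"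
      proof -
        define L where "L = (LINT t:{0..T}|lebesgue. exp (l * t) * (bump_moment t * u t))"
        have "ip (W 0) (wave (sqrt l) b (bump l)) = \<alpha> / m 0 * L"
          unfolding b_def L_def by (rule control_moment_identity[OF T dc W wd u z l])
        then have "m 0 / \<alpha> * ip (W 0) (wave (sqrt l) b (bump l)) = m 0 / \<alpha> * (\<alpha> / m 0 * L)" by (rule arg_cong)
        also have "\<dots> = L" using \<alpha> by simp
        also have "L = (LINT t:{0..T}|lebesgue. exp (l * t) * (u t * bump_moment t))" unfolding L_def by (simp only: mult.commute)
        finally show ?thesis by (rule sym)
      qed
      then have "\<bar>LINT t:{0..T}|lebesgue. exp (l * t) * (u t * bump_moment t)\<bar> = \<bar>m 0 / \<alpha>\<bar> * \<bar>ip (W 0) (wave (sqrt l) b (bump l))\<bar>"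
        by (simp only: abs_mult)
      also have "\<dots> \<le> \<bar>m 0 / \<alpha>\<bar> * (C0 * (sqrt (2 * J) * (P * 12))) * (l + 1)\<^sup>2"
      proof -
        have pcb: "hl.packet_const b \<le> P * b"
        proof -
          have "(1 + 2 * K * (b * exp K)) * exp K \<le> (b + 2 * K * (b * exp K)) * exp K"
            using b1 by (intro mult_right_mono) auto
          then show ?thesis unfolding hl.packet_const_def hl.jost_lip_def P_def by (simp add: algebra_simps)
        qed
        have pc0: "0 \<le> hl.packet_const b"
          unfolding hl.packet_const_def hl.jost_lip_def using hl.K_nonneg b1 by simp
        have bsq: "b \<le> b\<^sup>2" "1 \<le> b\<^sup>2" using b1 by (simp_all add: power2_eq_square mult_le_cancel_left1 mult_ge1_I)
        have gg: "2 * b + (2 + 8 * b\<^sup>2) \<le> 12 * b\<^sup>2" using bsq by linarith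
        have "hl.packet_const b * (2 * b + (2 + 8 * b\<^sup>2)) \<le> (P * b) * (12 * b\<^sup>2)"
          using pcb pc0 gg b1 P0 by (intro mult_mono) auto
        also have "\<dots> = P * 12 * (b * b\<^sup>2)" by (simp only: mult_ac)
        also have "\<dots> \<le> P * 12 * (b\<^sup>2 * b\<^sup>2)" using bsq P0 by (intro mult_left_mono mult_right_mono) auto
        also have "b\<^sup>2 * b\<^sup>2 = (l + 1)\<^sup>2" using l by (simp add: b_def power2_eq_square)
        finally have "sqrt (2 * J) * (hl.packet_const b * (2 * b + (2 + 8 * b\<^sup>2))) \<le> sqrt (2 * J) * (P * 12 * (l + 1)\<^sup>2)"
          using J_nonneg by (intro mult_left_mono) auto
        with wp(2) have "norm_H1 \<rho> k (wave (sqrt l) b (bump l)) \<le> sqrt (2 * J) * (P * 12 * (l + 1)\<^sup>2)" by linarith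
        then have "C0 * norm_H1 \<rho> k (wave (sqrt l) b (bump l)) \<le> C0 * (sqrt (2 * J) * (P * 12 * (l + 1)\<^sup>2))"
          using C0(1) by (rule mult_left_mono)
        moreover have "\<bar>ip (W 0) (wave (sqrt l) b (bump l))\<bar> \<le> C0 * norm_H1 \<rho> k (wave (sqrt l) b (bump l))"
          using T by (intro C0(2) wp(1)) auto
        ultimately have "\<bar>ip (W 0) (wave (sqrt l) b (bump l))\<bar> \<le> C0 * (sqrt (2 * J) * (P * 12 * (l + 1)\<^sup>2))" by linarith
        then have "\<bar>m 0 / \<alpha>\<bar> * \<bar>ip (W 0) (wave (sqrt l) b (bump l))\<bar> \<le> \<bar>m 0 / \<alpha>\<bar> * (C0 * (sqrt (2 * J) * (P * 12 * (l + 1)\<^sup>2)))"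
          by (rule mult_left_mono) simp
        then show ?thesis by (simp only: mult_ac)
      qed
      finally show ?thesis unfolding C1_def .
    qed
    fix e :: real assume e: "e > 0"
    \<comment> \<open>Makes l + 1 \<le> r (1 + e l / 2) \<le> r exp (e l / 2); squaring gives the
      required rate e.\<close>
    define r where "r = max 1 (2 / e)"
    have "\<bar>LINT t:{0..T}|lebesgue. exp (l * t) * (u t * bump_moment t)\<bar> \<le> C1 * r\<^sup>2 * exp (e * l)" if l: "l \<ge> 1" for l
    proof -
      have "l \<le> r * (e / 2 * l)"
      proof -
        have "1 \<le> r * (e / 2)" using e by (auto simp: r_def max_def field_simps)
        then have "1 * l \<le> r * (e / 2) * l" using l by (intro mult_right_mono) auto
        then show ?thesis by (simp only: mult_1 mult.assoc)
      qed
      moreover have "1 \<le> r" by (simp add: r_def)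
      ultimately have "l + 1 \<le> r * (1 + e / 2 * l)" by (simp add: distrib_left)
      also have "\<dots> \<le> r * exp (e / 2 * l)" using \<open>1 \<le> r\<close> by (intro mult_left_mono exp_ge_add_one_self) auto
      finally have "(l + 1)\<^sup>2 \<le> (r * exp (e / 2 * l))\<^sup>2" using l by (intro power_mono) auto
      also have "\<dots> = r\<^sup>2 * exp (e * l)" by (simp add: power_mult_distrib flip: exp_double)
      finally have "C1 * (l + 1)\<^sup>2 \<le> C1 * (r\<^sup>2 * exp (e * l))" using C10 by (rule mult_left_mono)
      then show ?thesis using main[OF l] by (simp only: mult.assoc)
    qed
    then show "\<exists>C. \<forall>l\<ge>1. \<bar>LINT t:{0..T}|lebesgue. exp (l * t) * (u t * bump_moment t)\<bar> \<le> C * exp (e * l)" by blast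
  qed
  then show ?thesis by eventually_elim (use bump_moment_pos in \<open>auto simp: less_imp_neq[symmetric]\<close>)
qed

end

section \<open>From the hypotheses to the weighted setting\<close>

context weights_pot
begin

lemma norm_H1_scale:
  assumes "\<phi> \<in> H1 \<rho> k"
  shows "norm_H1 \<rho> k (\<lambda>x. a * \<phi> x) = \<bar>a\<bar> * norm_H1 \<rho> k \<phi>"
proof -
  have H: "(\<lambda>x. a * \<phi> x) \<in> H1 \<rho> k" and ae: "AE x in lebesgue. D (\<lambda>x. a * \<phi> x) x = a * D \<phi> x"
    using H1_lin[OF assms assms, of a 0] by simp_all
  have "ip (D (\<lambda>x. a * \<phi> x)) (D (\<lambda>x. a * \<phi> x)) = ip (\<lambda>x. a * D \<phi> x) (\<lambda>x. a * D \<phi> x)"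
    by (rule ip_cong_AE[OF H1_sq(2)[OF H] H1_sq(2)[OF H] ae ae])
  then have "(norm_H1 \<rho> k (\<lambda>x. a * \<phi> x))\<^sup>2 = a\<^sup>2 * (norm_H1 \<rho> k \<phi>)\<^sup>2"
    unfolding norm_H1_sq[OF H] norm_H1_sq[OF assms] by (simp add: power2_eq_square distrib_left mult_ac)
  then have "(norm_H1 \<rho> k (\<lambda>x. a * \<phi> x))\<^sup>2 = (\<bar>a\<bar> * norm_H1 \<rho> k \<phi>)\<^sup>2" by (simp add: power_mult_distrib)
  then show ?thesis by (rule power2_eq_imp_eq) (simp_all add: norm_H1_nonneg)
qed

text \<open>Normalising \<phi> brings the pairing under the supremum, which is finite by
  Cauchy-Schwarz. Functions of norm zero are treated separately, because they cannot be
  normalised.\<close>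

lemma norm_Hm1_bound:
  assumes w: "w \<in> sq" and \<phi>: "\<phi> \<in> H1 \<rho> k"
  shows "\<bar>ip w \<phi>\<bar> \<le> norm_Hm1 \<rho> k (ip w) * norm_H1 \<rho> k \<phi>"
proof -
  let ?n = "norm_H1 \<rho> k \<phi>"
  have n: "?n \<ge> 0" by (rule norm_H1_nonneg)
  show ?thesis
  proof (cases "?n = 0")
    case True
    then show ?thesis using ip_le_norm_H1[OF w \<phi>] by simp
  next
    case False
    then have n0: "?n > 0" using n by simp
    define \<psi> where "\<psi> x = 1 / ?n * \<phi> x" for x
    have \<psi>: "\<psi> \<in> H1 \<rho> k" using H1_lin(1)[OF \<phi> \<phi>, of "1 / ?n" 0] by (simp add: \<psi>_def[abs_def])
    have "norm_H1 \<rho> k \<psi> = 1" unfolding \<psi>_def[abs_def] norm_H1_scale[OF \<phi>] using n0 by simp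
    then have mem: "\<bar>ip w \<psi>\<bar> \<in> (\<lambda>\<phi>. \<bar>ip w \<phi>\<bar>) ` {\<phi> \<in> H1 \<rho> k. norm_H1 \<rho> k \<phi> \<le> 1}" using \<psi> by auto
    have "\<bar>ip w \<psi>\<bar> \<le> norm_Hm1 \<rho> k (ip w)"
      unfolding norm_Hm1_def
    proof (rule cSup_upper[OF mem], rule bdd_aboveI)
      fix y assume "y \<in> (\<lambda>\<phi>. \<bar>ip w \<phi>\<bar>) ` {\<phi> \<in> H1 \<rho> k. norm_H1 \<rho> k \<phi> \<le> 1}"
      then obtain \<eta> where \<eta>: "y = \<bar>ip w \<eta>\<bar>" "\<eta> \<in> H1 \<rho> k" "norm_H1 \<rho> k \<eta> \<le> 1" by auto
      have "y \<le> sqrt (ip w w) * norm_H1 \<rho> k \<eta>" unfolding \<eta>(1) by (rule ip_le_norm_H1[OF w \<eta>(2)])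
      also have "\<dots> \<le> sqrt (ip w w) * 1" using L2.pos[OF w] by (intro mult_left_mono \<eta>(3)) simp
      finally show "y \<le> sqrt (ip w w)" by simp
    qed
    moreover have "ip w \<psi> = 1 / ?n * ip w \<phi>" unfolding \<psi>_def by (subst integral_mult_right_zero[symmetric]) (simp add: mult_ac)
    ultimately have "1 / ?n * \<bar>ip w \<phi>\<bar> \<le> norm_Hm1 \<rho> k (ip w)" using n0 by (simp add: abs_mult)
    then show ?thesis using n0 by (simp add: field_simps)
  qed
qed

text \<open>On \<open>H1\<close> the difference of two embedded states is the pairing with the
  difference of the states, so \<open>norm_Hm1_bound\<close> extracts a pointwise estimate from the
  supremum.\<close>

lemma dual_cont_if_norm_tendsto:
  assumes W: "\<And>t. t \<in> {0..T} \<Longrightarrow> W t \<in> sq"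
    and lim: "\<And>t0. t0 \<in> {0..T} \<Longrightarrow> ((\<lambda>t. norm_Hm1 \<rho> k (\<lambda>\<phi>. emb \<rho> (W t) \<phi> - emb \<rho> (W t0) \<phi>)) \<longlongrightarrow> 0) (at t0 within {0..T})"
  shows "dual_cont T W"
  unfolding dual_cont_def
proof (intro ballI allI impI)
  fix t0 e :: real assume t0: "t0 \<in> {0..T}" and e: "e > 0"
  have "\<forall>\<^sub>F t in at t0 within {0..T}. norm_Hm1 \<rho> k (\<lambda>\<phi>. emb \<rho> (W t) \<phi> - emb \<rho> (W t0) \<phi>) < e"
    by (rule order_tendstoD(2)[OF lim[OF t0] e])
  then obtain d where d: "d > 0" "\<And>t. t \<in> {0..T} \<Longrightarrow> t \<noteq> t0 \<Longrightarrow> dist t t0 < d \<Longrightarrow>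
      norm_Hm1 \<rho> k (\<lambda>\<phi>. emb \<rho> (W t) \<phi> - emb \<rho> (W t0) \<phi>) < e" unfolding eventually_at by blast
  have "\<bar>ip (W t) \<phi> - ip (W t0) \<phi>\<bar> \<le> e * norm_H1 \<rho> k \<phi>"
    if t: "t \<in> {0..T}" "\<bar>t - t0\<bar> < d" and \<phi>: "\<phi> \<in> H1 \<rho> k" for t \<phi>
  proof (cases "t = t0")
    case True
    then show ?thesis using e norm_H1_nonneg[of \<phi>] by simp
  next
    case False
    define w where "w x = W t x - W t0 x" for x
    have w: "w \<in> sq" unfolding w_def[abs_def] by (intro L2.diff_in W t t0)
    have ipw: "ip w \<psi> = ip (W t) \<psi> - ip (W t0) \<psi>" if "\<psi> \<in> sq" for \<psi>
      unfolding w_def by (intro L2.B_diff W t t0 that)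
    have "norm_Hm1 \<rho> k (\<lambda>\<phi>. emb \<rho> (W t) \<phi> - emb \<rho> (W t0) \<phi>) = norm_Hm1 \<rho> k (ip w)"
      unfolding norm_Hm1_def
    proof (rule SUP_cong[OF refl])
      fix \<psi> assume "\<psi> \<in> {\<phi> \<in> H1 \<rho> k. norm_H1 \<rho> k \<phi> \<le> 1}"
      then have \<psi>: "\<psi> \<in> sq" using H1_sq by blast
      show "\<bar>emb \<rho> (W t) \<psi> - emb \<rho> (W t0) \<psi>\<bar> = \<bar>ip w \<psi>\<bar>"
        unfolding ipw[OF \<psi>] emb_eq[OF sq_meas[OF W[OF t(1)]] sq_meas[OF \<psi>]] emb_eq[OF sq_meas[OF W[OF t0]] sq_meas[OF \<psi>]] ..
    qed
    then have "norm_Hm1 \<rho> k (ip w) < e" using d(2)[OF t(1) False] t(2) by (simp add: dist_real_def)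
    then have "norm_Hm1 \<rho> k (ip w) * norm_H1 \<rho> k \<phi> \<le> e * norm_H1 \<rho> k \<phi>"
      using norm_H1_nonneg by (intro mult_right_mono) auto
    then show ?thesis using norm_Hm1_bound[OF w \<phi>] ipw[OF H1_sq(1)[OF \<phi>]] by linarith
  qed
  then show "\<exists>d>0. \<forall>t\<in>{0..T}. \<bar>t - t0\<bar> < d \<longrightarrow> (\<forall>\<phi>\<in>H1 \<rho> k. \<bar>ip (W t) \<phi> - ip (W t0) \<phi>\<bar> \<le> e * norm_H1 \<rho> k \<phi>)"
    using d(1) by blast
qed

end

text \<open>Control of u is given on the open interval; the two end points form a null set, and
  completeness of the measure makes u measurable on the closed one.\<close>

lemma Linf_on_integrable:
  fixes u :: "real \<Rightarrow> real"
  assumes "Linf_on {0<..<T} u"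
  shows "set_integrable lebesgue {0..T} u"
proof -
  have m: "(\<lambda>t. indicator {0<..<T} t *\<^sub>R u t) \<in> borel_measurable lebesgue"
    using assms by (simp add: Linf_on_def set_borel_measurable_def)
  obtain C where C: "AE t in lebesgue. t \<in> {0<..<T} \<longrightarrow> \<bar>u t\<bar> \<le> C" using assms by (auto simp: Linf_on_def)
  have i: "integrable lebesgue (\<lambda>t. indicator {0<..<T} t *\<^sub>R u t)"
  proof (rule Bochner_Integration.integrable_bound[OF _ m])
    show "integrable lebesgue (\<lambda>t. indicator {0..T} t *\<^sub>R C)"
      using absolutely_integrable_continuous_real[of 0 T "\<lambda>t. C"] by (simp add: set_integrable_def)
    show "AE t in lebesgue. norm (indicator {0<..<T} t *\<^sub>R u t) \<le> norm (indicat_real {0..T} t *\<^sub>R C)"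
      using C by eventually_elim (auto simp: indicator_def)
  qed
  have "AE t in lebesgue. indicat_real {0<..<T} t *\<^sub>R u t = indicat_real {0..T} t *\<^sub>R u t"
  proof -
    have "AE t in lebesgue. t \<noteq> 0" "AE t in lebesgue. t \<noteq> T" by (rule AE_completion[OF AE_lborel_singleton])+
    then show ?thesis by eventually_elim (auto simp: indicator_def)
  qed
  from integrable_lebesgue_cong_AE(1)[OF this] i show ?thesis by (simp add: set_integrable_def)
qed

context heat
begin

text \<open>Tested with \<phi>, the equation says that \<open>ip (W t) \<phi>\<close> has weak
  derivative \<open>- Bq (W t) \<phi> - \<alpha> * u t * delta \<phi>\<close>. As \<alpha> is
  nonzero, the control vanishes, and what remains is the homogeneous equation of
  \<open>backward_uniqueness\<close>.\<close>

lemma no_null_control: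
  assumes T: "T > 0" and sol: "is_solution \<rho> k \<gamma> T W0 u W" and q: "\<And>x. qpot \<rho> k \<gamma> x = q x"
    and u: "Linf_on {0<..<T} u" and z: "AE x in lebesgue. W T x = 0"
  shows "AE x in lebesgue. W0 x = 0"
proof -
  obtain Wt where WH: "\<And>t. t \<in> {0..T} \<Longrightarrow> W t \<in> H1 \<rho> k"
    and td: "has_time_deriv \<rho> k T (\<lambda>t. emb \<rho> (W t)) Wt"
    and eq: "AE t in lebesgue. t \<in> {0<..<T} \<longrightarrow> (\<forall>\<phi>\<in>H1 \<rho> k. Wt t \<phi> =
             DD_dual \<rho> k (DD \<rho> k (W t)) \<phi> - emb \<rho> (\<lambda>x. qpot \<rho> k \<gamma> x * W t x) \<phi>
             - 2 * sqrt (\<rho> 0 * k 0) * u t * delta \<phi>)"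
    and W0: "AE x in lebesgue. W 0 x = W0 x"
    using sol unfolding is_solution_def even_H1_def by blast
  have Ws: "W t \<in> sq" if "t \<in> {0..T}" for t using H1_sq(1)[OF WH[OF that]] .
  have dc: "dual_cont T W"
    using td unfolding has_time_deriv_def by (intro dual_cont_if_norm_tendsto Ws) auto
  define \<alpha> where "\<alpha> = 2 * sqrt (\<rho> 0 * k 0)"
  have \<alpha>: "\<alpha> \<noteq> 0" by (simp add: \<alpha>_def)
  have wd: "has_weak_deriv {0<..<T} (\<lambda>t. ip (W t) \<phi>) (\<lambda>t. - Bq (W t) \<phi> - \<alpha> * u t * delta \<phi>)"
    if \<phi>: "\<phi> \<in> H1 \<rho> k" for \<phi>
  proof (rule has_weak_deriv_AE)
    show "has_weak_deriv {0<..<T} (\<lambda>t. emb \<rho> (W t) \<phi>) (\<lambda>t. Wt t \<phi>)"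
      using td \<phi> unfolding has_time_deriv_def by blast
    show "AE t in lebesgue. t \<in> {0<..<T} \<longrightarrow> emb \<rho> (W t) \<phi> = ip (W t) \<phi>"
      using emb_eq[OF sq_meas[OF Ws] sq_meas[OF H1_sq(1)[OF \<phi>]]] by (intro AE_I2) auto
    show "AE t in lebesgue. t \<in> {0<..<T} \<longrightarrow> Wt t \<phi> = - Bq (W t) \<phi> - \<alpha> * u t * delta \<phi>"
      using eq
    proof eventually_elim
      fix t
      assume *: "t \<in> {0<..<T} \<longrightarrow> (\<forall>\<phi>\<in>H1 \<rho> k. Wt t \<phi> =
             DD_dual \<rho> k (DD \<rho> k (W t)) \<phi> - emb \<rho> (\<lambda>x. qpot \<rho> k \<gamma> x * W t x) \<phi>
             - 2 * sqrt (\<rho> 0 * k 0) * u t * delta \<phi>)"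
      show "t \<in> {0<..<T} \<longrightarrow> Wt t \<phi> = - Bq (W t) \<phi> - \<alpha> * u t * delta \<phi>"
      proof
        assume t: "t \<in> {0<..<T}"
        then have tT: "t \<in> {0..T}" by auto
        have "emb \<rho> (D (W t)) (D \<phi>) = ip (D (W t)) (D \<phi>)"
          by (rule emb_eq; rule sq_meas; rule H1_sq(2)) (use WH tT \<phi> in auto)
        moreover have "emb \<rho> (\<lambda>x. q x * W t x) \<phi> = ip (\<lambda>x. q x * W t x) \<phi>"
          by (rule emb_eq) (use sq_meas[OF q_mult_sq[OF Ws[OF tT]]] sq_meas[OF H1_sq(1)[OF \<phi>]] in auto)
        ultimately show "Wt t \<phi> = - Bq (W t) \<phi> - \<alpha> * u t * delta \<phi>"
          using * t \<phi> by (simp add: DD_dual_def q Bq_def \<alpha>_def)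
      qed
    qed
  qed
  have u0: "AE t in lebesgue. t \<in> {0<..T} \<longrightarrow> u t = 0"
    by (rule control_zero[OF T dc WH wd Linf_on_integrable[OF u] z \<alpha>])
  have wd0: "has_weak_deriv {0<..<T} (\<lambda>t. ip (W t) \<phi>) (\<lambda>t. - Bq (W t) \<phi>)" if \<phi>: "\<phi> \<in> H1 \<rho> k" for \<phi>
    by (rule has_weak_deriv_AE[OF wd[OF \<phi>]]) (use u0 in \<open>auto elim: eventually_mono\<close>)
  have "AE x in lebesgue. W 0 x = 0" by (rule backward_uniqueness[OF T dc WH wd0 z])
  with W0 show ?thesis by eventually_elim simp
qed

end

text \<open>The same numbers are derivatives at x and at -x, so the equality also covers points
  where f is not differentiable and \<open>deriv\<close> is an arbitrary choice.\<close>

lemma deriv_odd: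
  fixes f :: "real \<Rightarrow> real"
  assumes "\<And>x. f (- x) = - f x"
  shows "deriv f (- x) = deriv f x"
proof -
  have imp: "(f has_real_derivative d) (at (- y))" if d: "(f has_real_derivative d) (at y)" for d y
  proof -
    have "((\<lambda>x. f (- x)) has_real_derivative d * - 1) (at (- y))"
      by (rule DERIV_chain2[where f = f and g = uminus]) (use d in \<open>auto intro!: derivative_eq_intros\<close>)
    from DERIV_minus[OF this] show ?thesis by (simp add: assms)
  qed
  have "(f has_real_derivative d) (at (- x)) \<longleftrightarrow> (f has_real_derivative d) (at x)" for d
    using imp[of d x] imp[of d "- x"] by auto
  then show ?thesis by (simp add: deriv_def)
qed

lemma continuous_on_even_ext:
  assumes "continuous_on {0..} f"
  shows "continuous_on UNIV (even_ext f)"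
  unfolding even_ext_def[abs_def]
  by (rule continuous_on_compose2[OF assms]) (auto intro!: continuous_intros)

lemma Ck_on_1_continuous:
  assumes "Ck_on 1 S f" shows "continuous_on S f"
proof -
  obtain f' where "\<forall>x\<in>S. (f has_real_derivative f' x) (at x within S)" using assms by auto
  then show ?thesis by (intro DERIV_continuous_on) auto
qed

theorem theorem2p6:
  fixes \<rho> k \<gamma> W0 :: "real \<Rightarrow> real" and T :: real
  assumes "T > 0"
    and "\<And>x. x \<ge> 0 \<Longrightarrow> \<rho> x > 0" and "\<And>x. x \<ge> 0 \<Longrightarrow> k x > 0"
    and "Ck_on 1 {0..} \<rho>" and "Ck_on 1 {0..} k"
    and "Ck_on 2 {0..} (\<lambda>x. \<rho> x * k x)"
    and "((\<lambda>x. \<rho> x * k x) has_real_derivative 0) (at 0 within {0..})"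
    and "filterlim (sigma (even_ext \<rho>) (even_ext k)) at_top at_top"
    and "Linf_on {0<..} (qpot (even_ext \<rho>) (even_ext k) (even_ext \<gamma>))"
    and "Ck_on 1 {0..} (qpot (even_ext \<rho>) (even_ext k) (even_ext \<gamma>))"
    and "set_integrable lebesgue {0<..} (\<lambda>x. sqrt (even_ext \<rho> x / even_ext k x) *
           qpot (even_ext \<rho>) (even_ext k) (even_ext \<gamma>) x * sigma (even_ext \<rho>) (even_ext k) x)"
    and "W0 \<in> even_H1 (even_ext \<rho>) (even_ext k)"
    and "controllable (even_ext \<rho>) (even_ext k) (even_ext \<gamma>) T W0 (\<lambda>x. 0)"
  shows "AE x in lebesgue. W0 x = 0"
proof -
  note T = assms(1) and pos = assms(2,3) and C1 = assms(4,5) and C2 = assms(6) and d0 = assms(7)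
    and \<sigma>top = assms(8) and qinf = assms(9) and qC1 = assms(10) and qint = assms(11) and ctrl = assms(13)
  define r where "r = even_ext \<rho>"
  define \<kappa> where "\<kappa> = even_ext k"
  have rk: "r x > 0" "\<kappa> x > 0" "r (- x) = r x" "\<kappa> (- x) = \<kappa> x" for x
    using pos[of "\<bar>x\<bar>"] by (auto simp: r_def \<kappa>_def even_ext_def)
  have nz: "r x \<noteq> 0" "\<kappa> x \<noteq> 0" for x using rk[of x] by auto
  have rkc: "continuous_on UNIV r" "continuous_on UNIV \<kappa>"
    unfolding r_def \<kappa>_def by (intro continuous_on_even_ext Ck_on_1_continuous C1)+
  obtain p' p'' where p': "\<And>x. x \<ge> 0 \<Longrightarrow> ((\<lambda>x. \<rho> x * k x) has_real_derivative p' x) (at x within {0..})"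
    and p'': "\<And>x. x \<ge> 0 \<Longrightarrow> (p' has_real_derivative p'' x) (at x within {0..})"
    using C2 unfolding numeral_2_eq_2 Ck_on.simps by (metis atLeast_iff)
  have p'0: "p' 0 = 0"
    by (rule tendsto_unique[OF _ p'[of 0, unfolded has_field_derivative_iff] d0[unfolded has_field_derivative_iff]])
      (auto simp: at_within_Ici_at_right)
  define p where "p x = r x * \<kappa> x" for x
  have p_pos: "p x > 0" for x using rk by (simp add: p_def)
  define dp where "dp x = sgn x * p' \<bar>x\<bar>" for x
  have dp: "(p has_real_derivative dp x) (at x)" for x
    using DERIV_even_extension[OF p' p'0, of x] by (simp add: p_def[abs_def] r_def \<kappa>_def even_ext_def dp_def)
  have dpc: "continuous_on UNIV dp"
    unfolding dp_def[abs_def] by (rule DERIV_imp_continuous_on[OF DERIV_odd_extension[OF p'' p'0]])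
  define m where "m x = sqrt (sqrt (p x))" for x
  define m' where "m' x = dp x / (4 * (sqrt (p x) * m x))" for x
  have m_pos: "m x > 0" for x using p_pos by (simp add: m_def)
  have md: "(m has_real_derivative m' x) (at x)" for x
    unfolding m_def[abs_def] m'_def using p_pos[of x]
    by (auto intro!: derivative_eq_intros dp simp: m_def field_simps)
  have pc: "continuous_on UNIV p" unfolding p_def by (intro continuous_intros rkc)
  have m'c: "continuous_on UNIV m'"
    unfolding m'_def m_def using p_pos by (intro continuous_intros dpc pc) (auto simp: less_imp_neq[symmetric])
  have mm: "(m x)\<^sup>2 = sqrt (p x)" for x using p_pos[of x] by (simp add: m_def)
  have Q1: "Q1 r \<kappa> x = m' x / (m x * sqrt (r x / \<kappa> x))" for x
  proof -
    have "deriv (\<lambda>y. \<kappa> y * r y) x = dp x"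
      using dp[of x] by (intro DERIV_imp_deriv) (simp add: p_def[abs_def] mult.commute)
    then have "Q1 r \<kappa> x = dp x / (4 * p x) * sqrt (\<kappa> x / r x)" by (simp add: Q1_def p_def mult_ac)
    also have "sqrt (\<kappa> x / r x) = 1 / sqrt (r x / \<kappa> x)" by (simp add: real_sqrt_divide)
    also have "p x = sqrt (p x) * (m x)\<^sup>2" using p_pos[of x] by (simp add: mm)
    finally show ?thesis using m_pos[of x] by (simp add: m'_def power2_eq_square mult_ac)
  qed
  interpret w: weights r \<kappa> m m'
  proof
    show "r x = (m x)\<^sup>2 * sqrt (r x / \<kappa> x)" for x
    proof -
      have "(m x)\<^sup>2 * sqrt (r x / \<kappa> x) = sqrt (p x * (r x / \<kappa> x))" by (simp only: mm real_sqrt_mult)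
      also have "p x * (r x / \<kappa> x) = (r x)\<^sup>2" using nz[of x] by (simp add: p_def power2_eq_square)
      finally show ?thesis using rk[of x] by simp
    qed
  qed (use rk rkc m_pos md m'c Q1 in auto)
  define q where "q = qpot r \<kappa> (even_ext \<gamma>)"
  have Q1odd: "Q1 r \<kappa> (- x) = - Q1 r \<kappa> x" for x
    unfolding Q1 using rk by (simp add: m'_def m_def p_def dp_def)
  have qeven: "q (- x) = q x" for x
    using deriv_odd[of "Q1 r \<kappa>", OF Q1odd] rk Q1odd by (simp add: q_def qpot_def Q2_def even_ext_def)
  have qc0: "continuous_on {0..} q" using Ck_on_1_continuous[OF qC1] by (simp add: q_def r_def \<kappa>_def)
  have qabs: "q = (\<lambda>x. q \<bar>x\<bar>)" using qeven by (auto simp: fun_eq_iff abs_if)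
  have qc: "continuous_on UNIV q"
    by (subst qabs, rule continuous_on_compose2[OF qc0]) (auto intro!: continuous_intros)
  obtain Cq where Cq: "AE x in lebesgue. x \<in> {0<..} \<longrightarrow> \<bar>q x\<bar> \<le> Cq"
    using qinf by (auto simp: Linf_on_def q_def r_def \<kappa>_def)
  \<comment> \<open>The essential bound becomes pointwise by continuity: first on the positive
    half-line, then at 0 by closure, then everywhere by evenness.\<close>
  have qb: "\<bar>q x\<bar> \<le> Cq" for x
  proof -
    have cl: "closed {x. \<bar>q x\<bar> \<le> Cq}" by (intro closed_Collect_le continuous_intros qc)
    have "{0<..} \<subseteq> {x. \<bar>q x\<bar> \<le> Cq}"
    proof
      fix x :: real assume "x \<in> {0<..}"
      then show "x \<in> {x. \<bar>q x\<bar> \<le> Cq}"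
        by (intro mem_closed_if_AE_lebesgue_open[OF open_greaterThan[of 0] cl]) (use Cq in auto)
    qed
    then have "closure {0<..} \<subseteq> {x. \<bar>q x\<bar> \<le> Cq}" using cl by (rule closure_minimal)
    then have "{0..} \<subseteq> {x. \<bar>q x\<bar> \<le> Cq}" by simp
    then have "\<bar>x\<bar> \<in> {x. \<bar>q x\<bar> \<le> Cq}" by (rule subsetD) simp
    then show ?thesis using fun_cong[OF qabs, of x] by simp
  qed
  define \<sigma> where "\<sigma> = sigma r \<kappa>"
  have \<sigma>': "(\<sigma> has_real_derivative w.s x) (at x)" for x
    using has_real_derivative_primitive[OF w.s_cont, of 0 x] by (simp add: \<sigma>_def sigma_def[abs_def] w.s_def zero_ereal_def)
  have \<sigma>_0: "\<sigma> 0 = 0" by (simp add: \<sigma>_def sigma_def)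
  have \<sigma>c: "continuous_on A \<sigma>" for A by (rule DERIV_imp_continuous_on[OF \<sigma>'])
  have \<sigma>mono: "\<sigma> x \<le> \<sigma> y" if "x \<le> y" for x y
    by (rule DERIV_nonneg_imp_nondecreasing[OF that]) (use \<sigma>' w.s_pos less_imp_le in blast)
  have \<sigma>top': "filterlim \<sigma> at_top at_top" using \<sigma>top by (simp add: \<sigma>_def r_def \<kappa>_def)
  define f where "f t = \<bar>q t\<bar> * w.s t * (1 + \<sigma> t)" for t
  have fc: "continuous_on UNIV f" unfolding f_def by (intro continuous_intros qc w.s_cont \<sigma>c)
  have f0: "f t \<ge> 0" if "t \<ge> 0" for t
    unfolding f_def using \<sigma>mono[OF that] \<sigma>_0 w.s_pos[of t] by simp
  obtain x1 where x1: "\<And>x. x \<ge> x1 \<Longrightarrow> \<sigma> x \<ge> 1"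
    using \<sigma>top' unfolding filterlim_at_top eventually_at_top_linorder by blast
  define h where "h t = indicator {0<..} t *\<^sub>R (w.s t * q t * \<sigma> t)" for t
  have hi: "integrable lebesgue h"
    using qint[folded r_def \<kappa>_def] by (simp add: h_def[abs_def] set_integrable_def w.s_def q_def \<sigma>_def)
  \<comment> \<open>The hypothesis controls the weight \<sigma>, whereas 1 + \<sigma> is required.
    Beyond \<open>x1\<close> one has \<sigma> \<ge> 1 and thus 1 + \<sigma> \<le> 2 \<sigma>; up to
    \<open>max 0 x1\<close> continuity suffices. The integral of this majorant serves as the
    constant K.\<close>
  define g where "g t = indicator {0..max 0 x1} t *\<^sub>R f t + 2 * \<bar>h t\<bar>" for t
  have fi: "set_integrable lebesgue {a..b} f" for a b
    by (intro absolutely_integrable_continuous_real continuous_on_subset[OF fc]) simp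
  have gi: "integrable lebesgue g"
    using fi[of 0 "max 0 x1"] hi unfolding g_def[abs_def] set_integrable_def by auto
  have "integral {0..x} f \<le> integral\<^sup>L lebesgue g" if x: "x \<ge> 0" for x
  proof -
    have "integral {0..x} f = (LINT t:{0..x}|lebesgue. f t)" by (rule set_lebesgue_integral_eq_integral(2)[OF fi, symmetric])
    also have "\<dots> \<le> integral\<^sup>L lebesgue g"
      unfolding set_lebesgue_integral_def
    proof (rule integral_mono)
      show "integrable lebesgue (\<lambda>t. indicat_real {0..x} t *\<^sub>R f t)" using fi by (simp add: set_integrable_def)
      show "integrable lebesgue g" by (rule gi)
      fix t
      show "indicat_real {0..x} t *\<^sub>R f t \<le> g t"
      proof (cases "t \<in> {0..x} \<and> t > max 0 x1")
        case True
        then have s1: "1 \<le> \<sigma> t" "t > 0" using x1[of t] by auto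
        have "f t \<le> \<bar>q t\<bar> * w.s t * (2 * \<sigma> t)"
          unfolding f_def using s1 w.s_pos[of t] by (intro mult_left_mono) auto
        also have "\<dots> = 2 * \<bar>h t\<bar>" using s1 w.s_pos[of t] by (simp add: h_def abs_mult)
        finally have "f t \<le> 2 * \<bar>h t\<bar>" .
        moreover have "0 \<le> indicator {0..max 0 x1} t *\<^sub>R f t" using f0[of t] s1 by simp
        moreover have "indicat_real {0..x} t *\<^sub>R f t = f t" using True by simp
        ultimately show ?thesis unfolding g_def by linarith
      next
        case False
        then show ?thesis using f0[of t] by (auto simp: g_def indicator_def)
      qed
    qed
    finally show ?thesis .
  qed
  then have Kb: "integral {0..x} (\<lambda>t. \<bar>q t\<bar> * w.s t * (1 + \<sigma> t)) \<le> integral\<^sup>L lebesgue g" if "x \<ge> 0" for x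
    using that unfolding f_def by simp
  interpret h: heat r \<kappa> m m' q Cq \<sigma> "integral\<^sup>L lebesgue g"
    by unfold_locales (use qc qb \<sigma>_0 \<sigma>' \<sigma>top' qeven Kb rk in \<open>auto simp: w.s_def\<close>)
  obtain u W where u: "Linf_on {0<..<T} u" and sol: "is_solution r \<kappa> (even_ext \<gamma>) T W0 u W"
    and WT: "AE x in lebesgue. W T x = 0"
    using ctrl unfolding controllable_def reachable_def r_def \<kappa>_def by blast
  show ?thesis by (rule h.no_null_control[OF T sol _ u WT]) (simp add: q_def)
qed

end
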